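(* Suppose that $0<1/n\ll\varepsilon_0\ll\varepsilon\ll\lambda,1/K\ll 1$, that $D\ge n/3$, that $0\le\phi\ll 1$ and that $D,n,K,m,\lambda n/K^2,(D-\phi n)/(2K^2)\in\mathbb{N}$. Suppose that the following conditions hold: (i) $G$ is a $D$-regular graph on $n$ vertices. (ii) $\mathcal{P}$ is a $(K,m,\varepsilon_0)$-partition of $V(G)$ such that $D\le e_G(A',B')\le\varepsilon_0 n^2$ and $\Delta(G[A',B'])\le D/2$. Furthermore, $G$ is not critical (with respect to $A',B'$ and $D$). (iii) $G_0$ is a subgraph of $G$ such that $G[A_0]+G[B_0]\subseteq G_0$, $e_{G_0}(A',B')\le\phi n$ and $d_{G_0}(v)=\phi n$ for all $v\in V_0$. (iv) Let $G^{\diamond}:=G-G[A]-G[B]-G_0$. Then $e_{G^{\diamond}}(A',B')$ is even and $(G^{\diamond},\mathcal{P})$ is a $(K,m,\varepsilon_0,\varepsilon)$-exceptional scheme. Then there exists a set $\mathcal{J}$ consisting of $(D-\phi n)/2$ edge-disjoint Hamilton exceptional systems with parameter $\varepsilon_0$ in $G^{\diamond}$ which satisfies the following properties: (a) Together all the Hamilton exceptional systems in $\mathcal{J}$ cover all edges of $G^{\diamond}$. (b) For all $1\le i,i'\le K$, the set $\mathcal{J}$ contains $(D-(\phi+2\lambda)n)/(2K^2)$ $(i,i')$-HES. Moreover, $\lambda n/K^2$ of these $(i,i')$-HES $J$ are such that $e_J(A',B')=2$.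
   Context: Constants. The hierarchy $0<1/n\ll\varepsilon_0\ll\varepsilon\ll\lambda,1/K\ll1$ means that constants are chosen from right to left: there are non-decreasing functions $(0,1]\to(0,1]$ such that the result holds whenever each constant is at most the corresponding function of the constant(s) to its right ($\varepsilon$ must be small with respect to both $\lambda$ and $1/K$, while $\lambda$ and $1/K$ are each at most some absolute constant, with no relation between them). $0\le\phi\ll1$ means that $\phi$ is non-negative and at most a sufficiently small absolute constant. $a=b\pm c$ means $b-c\le a\le b+c$. Graph notation. Graphs are finite and simple. $e(G)$ is the number of edges, $\Delta(G)$ the maximum degree; $d_G(v)$ is the degree of $v$ and $d_G(v,X)$ the number of neighbours of $v$ in $X$; $e_G(X)$ is the number of edges with both endvertices in $X$; $e_G(X,Y)$ is the number of edges with one endvertex in $X$ and the other in $Y$ (subscripts are omitted if clear). $G[X]$ is the induced subgraph on $X$; for disjoint $X,Y$, $G[X,Y]$ is the bipartite subgraph with classes $X,Y$ and all edges of $G$ between $X$ and $Y$. For edge-disjoint $G,H$, $G+H$ has vertex set $V(G)\cup V(H)$ and edge set $E(G)\cup E(H)$. $G-H$ is obtained from $G$ by deleting the edges in $E(G)\cap E(H)$. A path system is a graph which is a union of vertex-disjoint paths (some possibly trivial, i.e. single vertices). Partitions. A $(K,m,\varepsilon_0)$-partition $\mathcal{P}$ of a vertex set $V$ is a partition of $V$ into sets $A_0,A_1,\dots,A_K$ and $B_0,B_1,\dots,B_K$ such that $|A_i|=|B_i|=m$ for all $i\ge1$ and $|A_0\cup B_0|\le\varepsilon_0|V|$. Write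 $V_0:=A_0\cup B_0$, $A:=A_1\cup\dots\cup A_K$, $B:=B_1\cup\dots\cup B_K$, $A':=A_0\cup A$, $B':=B_0\cup B$. Critical. A $D$-regular graph $G$ with a partition $A',B'$ of $V(G)$ is critical (with respect to $A',B'$ and $D$) if both $\Delta(G[A',B'])\ge 11D/40$ and $e(H)\le 41D/40$ for all subgraphs $H$ of $G[A',B']$ with $\Delta(H)\le 11D/40$. Exceptional schemes. For a graph $G$ on $n$ vertices and a partition $\mathcal{P}$ of $V(G)$, $(G,\mathcal{P})$ is a $(K,m,\varepsilon_0,\varepsilon)$-exceptional scheme if: (ESch1) $\mathcal{P}$ is a $(K,m,\varepsilon_0)$-partition of $V(G)$; (ESch2) $e(A)=e(B)=0$; (ESch3) if $v\in A$ then $d(v,B')<\varepsilon_0n$ and if $v\in B$ then $d(v,A')<\varepsilon_0n$; (ESch4) for all $v\in V(G)$ and all $1\le i\le K$, $d(v,A_i)=(d(v,A)\pm\varepsilon n)/K$ and $d(v,B_i)=(d(v,B)\pm\varepsilon n)/K$; (ESch5) for all $1\le i,i'\le K$: $e(A_0,A_i)=(e(A_0,A)\pm\varepsilon\max\{e(A_0,A),n\})/K$, $e(B_0,A_i)=(e(B_0,A)\pm\varepsilon\max\{e(B_0,A),n\})/K$, $e(A_0,B_i)=(e(A_0,B)\pm\varepsilon\max\{e(A_0,B),n\})/K$, $e(B_0,B_i)=(e(B_0,B)\pm\varepsilon\max\{e(B_0,B),n\})/K$, and $e(A_i,B_{i'})=(e(A,B)\pm\varepsilon\max\{e(A,B),n\})/K^2$.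 Hamilton exceptional systems. Let $A,A_0,B,B_0$ partition a set $V$ of $n$ vertices with $|A|=|B|$. An exceptional cover $J$ is a path system with $V_0\subseteq V(J)\subseteq V$, such that $d_J(v)=2$ for every $v\in V_0$, $d_J(v)\le1$ for every $v\in V(J)\setminus V_0$, and $e_J(A)=e_J(B)=0$. A Hamilton exceptional system (HES) with parameter $\varepsilon_0$ is an exceptional cover $J$ such that the number of $AB$-paths in $J$ (paths with one endvertex in $A$ and the other in $B$; these are automatically components of $J$) is even, positive and at most $\sqrt{\varepsilon_0}\,n$. For $1\le i,i'\le K$, an $(i,i')$-HES is a Hamilton exceptional system $J$ with $V(J)\subseteq V_0\cup A_i\cup B_{i'}$. *)

theory Defs
  imports Complex_Main "HOL-Library.Disjoint_Sets"
begin

section \<open>Graphs\<close>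

record 'a ugraph =
  verts :: "'a set"
  edges :: "'a set set"

definition simple_graph :: "'a ugraph \<Rightarrow> bool" where
  "simple_graph G \<longleftrightarrow> finite (verts G) \<and> (\<forall>e\<in>edges G. e \<subseteq> verts G \<and> card e = 2)"

definition subgraph :: "'a ugraph \<Rightarrow> 'a ugraph \<Rightarrow> bool" where
  "subgraph H G \<longleftrightarrow> simple_graph H \<and> verts H \<subseteq> verts G \<and> edges H \<subseteq> edges G"

definition nbrs :: "'a ugraph \<Rightarrow> 'a \<Rightarrow> 'a set" where
  "nbrs G v = {u. {v, u} \<in> edges G}"

definition deg :: "'a ugraph \<Rightarrow> 'a \<Rightarrow> nat" where
  "deg G v = card (nbrs G v)"

definition deg_in :: "'a ugraph \<Rightarrow> 'a \<Rightarrow> 'a set \<Rightarrow> nat" where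
  "deg_in G v X = card (nbrs G v \<inter> X)"

text \<open>The inserted 0 only matters for the graph without vertices.\<close>

definition max_deg :: "'a ugraph \<Rightarrow> nat" where
  "max_deg G = Max (insert 0 (deg G ` verts G))"

definition regular :: "nat \<Rightarrow> 'a ugraph \<Rightarrow> bool" where
  "regular D G \<longleftrightarrow> (\<forall>v\<in>verts G. deg G v = D)"

definition num_edges :: "'a ugraph \<Rightarrow> nat" where
  "num_edges G = card (edges G)"

definition edges_within :: "'a ugraph \<Rightarrow> 'a set \<Rightarrow> 'a set set" where
  "edges_within G X = {e \<in> edges G. e \<subseteq> X}"

definition edges_between :: "'a ugraph \<Rightarrow> 'a set \<Rightarrow> 'a set \<Rightarrow> 'a set set" where
  "edges_between G X Y = {e \<in> edges G. \<exists>x\<in>X. \<exists>y\<in>Y. e = {x, y}}"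

definition e_within :: "'a ugraph \<Rightarrow> 'a set \<Rightarrow> nat" where
  "e_within G X = card (edges_within G X)"

definition e_between :: "'a ugraph \<Rightarrow> 'a set \<Rightarrow> 'a set \<Rightarrow> nat" where
  "e_between G X Y = card (edges_between G X Y)"

definition induced :: "'a ugraph \<Rightarrow> 'a set \<Rightarrow> 'a ugraph" where
  "induced G X = \<lparr>verts = verts G \<inter> X, edges = edges_within G X\<rparr>"

definition bip_subgraph :: "'a ugraph \<Rightarrow> 'a set \<Rightarrow> 'a set \<Rightarrow> 'a ugraph" where
  "bip_subgraph G X Y = \<lparr>verts = verts G \<inter> (X \<union> Y), edges = edges_between G X Y\<rparr>"

definition graph_sum :: "'a ugraph \<Rightarrow> 'a ugraph \<Rightarrow> 'a ugraph" where
  "graph_sum G H = \<lparr>verts = verts G \<union> verts H, edges = edges G \<union> edges H\<rparr>"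

definition graph_minus :: "'a ugraph \<Rightarrow> 'a ugraph \<Rightarrow> 'a ugraph" where
  "graph_minus G H = \<lparr>verts = verts G, edges = edges G - edges H\<rparr>"

definition path_graph :: "'a list \<Rightarrow> 'a ugraph" where
  "path_graph xs = \<lparr>verts = set xs, edges = {{xs ! i, xs ! Suc i} | i. Suc i < length xs}\<rparr>"

definition is_path :: "'a ugraph \<Rightarrow> bool" where
  "is_path P \<longleftrightarrow> (\<exists>xs. xs \<noteq> [] \<and> distinct xs \<and> P = path_graph xs)"

definition path_system :: "'a ugraph \<Rightarrow> bool" where
  "path_system J \<longleftrightarrow> (\<exists>Ps. finite Ps \<and> (\<forall>P\<in>Ps. is_path P) \<and> disjoint_family_on verts Ps \<and>
     verts J = (\<Union>P\<in>Ps. verts P) \<and> edges J = (\<Union>P\<in>Ps. edges P))"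

section \<open>Partitions and exceptional schemes\<close>

text \<open>A partition is given by two families \<open>A\<close>, \<open>B\<close>, of which only the sets with indices
  \<open>0, \<dots>, K\<close> are relevant.\<close>

definition core :: "nat \<Rightarrow> (nat \<Rightarrow> 'a set) \<Rightarrow> 'a set" where
  "core K A = (\<Union>i\<in>{1..K}. A i)"

definition side :: "nat \<Rightarrow> (nat \<Rightarrow> 'a set) \<Rightarrow> 'a set" where
  "side K A = A 0 \<union> core K A"

definition Km_partition ::
  "nat \<Rightarrow> nat \<Rightarrow> real \<Rightarrow> (nat \<Rightarrow> 'a set) \<Rightarrow> (nat \<Rightarrow> 'a set) \<Rightarrow> 'a set \<Rightarrow> bool" where
  "Km_partition K m \<epsilon>0 A B V \<longleftrightarrow>
     disjoint_family_on A {0..K} \<and> disjoint_family_on B {0..K} \<and>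
     side K A \<inter> side K B = {} \<and> side K A \<union> side K B = V \<and>
     (\<forall>i\<in>{1..K}. card (A i) = m \<and> card (B i) = m) \<and>
     real (card (A 0 \<union> B 0)) \<le> \<epsilon>0 * real (card V)"

definition critical :: "nat \<Rightarrow> 'a set \<Rightarrow> 'a set \<Rightarrow> 'a ugraph \<Rightarrow> bool" where
  "critical D A' B' G \<longleftrightarrow>
     real (max_deg (bip_subgraph G A' B')) \<ge> 11 * real D / 40 \<and>
     (\<forall>H. subgraph H (bip_subgraph G A' B') \<and> real (max_deg H) \<le> 11 * real D / 40
        \<longrightarrow> real (num_edges H) \<le> 41 * real D / 40)"

text \<open>The statement \<open>a = (b \<plusminus> c) / k\<close>.\<close>

definition eq_pm_div :: "real \<Rightarrow> real \<Rightarrow> real \<Rightarrow> real \<Rightarrow> bool" where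
  "eq_pm_div a b c k \<longleftrightarrow> (b - c) / k \<le> a \<and> a \<le> (b + c) / k"

definition ESch3 ::
  "real \<Rightarrow> nat \<Rightarrow> (nat \<Rightarrow> 'a set) \<Rightarrow> (nat \<Rightarrow> 'a set) \<Rightarrow> 'a ugraph \<Rightarrow> bool" where
  "ESch3 \<epsilon>0 K A B G \<longleftrightarrow>
     (\<forall>v\<in>core K A. real (deg_in G v (side K B)) < \<epsilon>0 * real (card (verts G))) \<and>
     (\<forall>v\<in>core K B. real (deg_in G v (side K A)) < \<epsilon>0 * real (card (verts G)))"

definition ESch4 ::
  "real \<Rightarrow> nat \<Rightarrow> (nat \<Rightarrow> 'a set) \<Rightarrow> (nat \<Rightarrow> 'a set) \<Rightarrow> 'a ugraph \<Rightarrow> bool" where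
  "ESch4 \<epsilon> K A B G \<longleftrightarrow> (\<forall>v\<in>verts G. \<forall>i\<in>{1..K}.
     eq_pm_div (deg_in G v (A i)) (deg_in G v (core K A)) (\<epsilon> * card (verts G)) K \<and>
     eq_pm_div (deg_in G v (B i)) (deg_in G v (core K B)) (\<epsilon> * card (verts G)) K)"

definition ESch5 ::
  "real \<Rightarrow> nat \<Rightarrow> (nat \<Rightarrow> 'a set) \<Rightarrow> (nat \<Rightarrow> 'a set) \<Rightarrow> 'a ugraph \<Rightarrow> bool" where
  "ESch5 \<epsilon> K A B G \<longleftrightarrow>
     (let balanced = (\<lambda>X Xi Y Yi k.
        eq_pm_div (e_between G Xi Yi) (e_between G X Y)
          (\<epsilon> * max (real (e_between G X Y)) (real (card (verts G)))) k)
      in \<forall>i\<in>{1..K}. \<forall>i'\<in>{1..K}.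
        balanced (A 0) (A 0) (core K A) (A i) (real K) \<and>
        balanced (B 0) (B 0) (core K A) (A i) (real K) \<and>
        balanced (A 0) (A 0) (core K B) (B i) (real K) \<and>
        balanced (B 0) (B 0) (core K B) (B i) (real K) \<and>
        balanced (core K A) (A i) (core K B) (B i') (real K ^ 2))"

definition exceptional_scheme ::
  "nat \<Rightarrow> nat \<Rightarrow> real \<Rightarrow> real \<Rightarrow> (nat \<Rightarrow> 'a set) \<Rightarrow> (nat \<Rightarrow> 'a set) \<Rightarrow> 'a ugraph \<Rightarrow> bool" where
  "exceptional_scheme K m \<epsilon>0 \<epsilon> A B G \<longleftrightarrow>
     Km_partition K m \<epsilon>0 A B (verts G) \<and>
     e_within G (core K A) = 0 \<and> e_within G (core K B) = 0 \<and>
     ESch3 \<epsilon>0 K A B G \<and> ESch4 \<epsilon> K A B G \<and> ESch5 \<epsilon> K A B G"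

section \<open>Hamilton exceptional systems\<close>

text \<open>Here \<open>A\<close>, \<open>A0\<close>, \<open>B\<close>, \<open>B0\<close> are sets that partition the underlying vertex set.\<close>

definition exceptional_cover ::
  "'a set \<Rightarrow> 'a set \<Rightarrow> 'a set \<Rightarrow> 'a set \<Rightarrow> 'a ugraph \<Rightarrow> bool" where
  "exceptional_cover A A0 B B0 J \<longleftrightarrow>
     path_system J \<and> A0 \<union> B0 \<subseteq> verts J \<and> verts J \<subseteq> A \<union> A0 \<union> B \<union> B0 \<and>
     (\<forall>v\<in>A0 \<union> B0. deg J v = 2) \<and>
     (\<forall>v\<in>verts J - (A0 \<union> B0). deg J v \<le> 1) \<and>
     e_within J A = 0 \<and> e_within J B = 0"

text \<open>Paths are collected as subgraphs, so that a path and its reversal are counted once.\<close>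

definition AB_paths :: "'a set \<Rightarrow> 'a set \<Rightarrow> 'a ugraph \<Rightarrow> 'a ugraph set" where
  "AB_paths A B J = {P. subgraph P J \<and>
     (\<exists>xs. xs \<noteq> [] \<and> distinct xs \<and> P = path_graph xs \<and> hd xs \<in> A \<and> last xs \<in> B)}"

definition HES ::
  "real \<Rightarrow> 'a set \<Rightarrow> 'a set \<Rightarrow> 'a set \<Rightarrow> 'a set \<Rightarrow> 'a ugraph \<Rightarrow> bool" where
  "HES \<epsilon>0 A A0 B B0 J \<longleftrightarrow>
     exceptional_cover A A0 B B0 J \<and>
     even (card (AB_paths A B J)) \<and> 0 < card (AB_paths A B J) \<and>
     real (card (AB_paths A B J)) \<le> sqrt \<epsilon>0 * real (card (A \<union> A0 \<union> B \<union> B0))"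

definition local_HES ::
  "real \<Rightarrow> nat \<Rightarrow> (nat \<Rightarrow> 'a set) \<Rightarrow> (nat \<Rightarrow> 'a set) \<Rightarrow> nat \<Rightarrow> nat \<Rightarrow> 'a ugraph \<Rightarrow> bool" where
  "local_HES \<epsilon>0 K A B i i' J \<longleftrightarrow>
     HES \<epsilon>0 (core K A) (A 0) (core K B) (B 0) J \<and>
     verts J \<subseteq> A 0 \<union> B 0 \<union> A i \<union> B i'"

section \<open>Constant hierarchies\<close>

text \<open>The functions implicit in \<open>a \<lless> b\<close>, which stands for \<open>a \<le> f b\<close>.\<close>

definition hierarchy_fun :: "(real \<Rightarrow> real) \<Rightarrow> bool" where
  "hierarchy_fun f \<longleftrightarrow> mono_on {0<..1} f \<and> f ` {0<..1} \<subseteq> {0<..1}"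

end

theory Submission
  imports Defs
begin

text \<open>
  Call an edge between \<open>A'\<close> and \<open>B'\<close> crossing. Every other edge of \<open>G\<^sup>\<diamond>\<close> joins a vertex of
  \<open>V\<^sub>0\<close> to the core of its own side. A Hamilton exceptional system is a union of disjoint paths that
  has degree 2 at each vertex of \<open>V\<^sub>0\<close> and degree at most 1 elsewhere, and in which the number of
  \<open>AB\<close>-paths is even, positive and small. If crossing edges inside \<open>V\<^sub>0\<close> meet no other crossing
  edge of the system, then its components have at most four vertices, and its \<open>AB\<close>-paths
  correspond to its isolated crossing edges, those that meet no other crossing edge of the
  system (\<open>HES_of_colour_class\<close>). So the theorem asks for a colouring of \<open>E(G\<^sup>\<diamond>)\<close> with
  \<open>N = (D - \<phi>n)/2\<close> colours, and each vertex of \<open>V\<^sub>0\<close> has degree exactly \<open>2N\<close>.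

  A type is a pair \<open>(i, i')\<close> of cluster indices, and each of the \<open>K\<^sup>2\<close> types has \<open>t = N/K\<^sup>2\<close> colours
  \<open>((i, i'), k)\<close> with \<open>k < t\<close>. With \<open>l = \<lambda>n/K\<^sup>2\<close>, the colours with \<open>k < t - l\<close> are local, confined to
  \<open>V\<^sub>0 \<union> A\<^sub>i \<union> B\<^sub>i\<^sub>'\<close>; those with \<open>k < l\<close> must have exactly two crossing edges; the remaining \<open>l\<close> of
  each type are nonlocal and absorb all irregularities. The crossing edges are coloured first.

  Slicing: each crossing edge gets a type that permits it, with the edges at every vertex of
  \<open>V\<^sub>0\<close> shared out evenly. By the scheme conditions the degrees and the totals per type are a \<open>1/K\<^sup>2\<close>
  proportion, up to small errors (\<open>slicing\<close>).

  Seeds: each colour should receive a seed, a pair of disjoint crossing edges. By an exchange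
  argument, \<open>2k\<close> edges of a bipartite graph with maximum degree at most \<open>k\<close> split into \<open>k\<close> such
  pairs (\<open>bipartite_pairing\<close>). Vertices of larger degree are trimmed first, by setting aside star
  pairs, two edges \<open>vx\<close>, \<open>vy\<close> of equal type with \<open>v \<in> V\<^sub>0\<close> and \<open>x, y \<notin> V\<^sub>0\<close>. A star pair in a colour
  class creates no isolated crossing edge, so it does not affect the parity of the number of
  \<open>AB\<close>-paths. After trimming, about \<open>2t\<close> edges per type and \<open>2N\<close> in total have to remain
  (\<open>admissible_exists\<close>). If no crossing degree exceeds about \<open>11D/40\<close>, nothing is trimmed and
  \<open>D\<close> crossing edges in \<open>G\<close> suffice. Otherwise \<open>G\<close> not being critical yields more than
  \<open>41D/40\<close> crossing edges of maximum degree at most \<open>11D/40\<close>, and trimming to degrees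
  somewhat above \<open>11D/40\<close> keeps nearly as many (\<open>heavy_vertex_count\<close>).

  Colouring: \<open>N\<close> pairs become seeds, one for each colour (\<open>seed_choice\<close>). The other pairs and
  the star pairs are placed greedily into local colours of their type with \<open>k \<ge> l\<close>, vertex-disjoint
  from what is there (\<open>crossing_colouring\<close>). Then each colour has an even positive number of
  isolated crossing edges. Finally the vertices of \<open>V\<^sub>0\<close> are treated one at a time: the
  remaining edges at \<open>v\<close> fill up the degree of \<open>v\<close> in each colour to 2, first in local colours,
  which need ends in a prescribed cluster, and then in nonlocal ones. Few colours are forbidden
  for each edge, so matchings with slack exist (\<open>star_allocation\<close>, \<open>extend_colouring\<close>). The
  nonlocal colours are what makes the demand in each cluster strictly smaller than the supply.
\<close>

section \<open>Pairings, balanced maps and matchings with slack\<close>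

text \<open>Elements of \<open>X\<close> are inserted one at a time. If all good targets of a new \<open>x\<close> are taken, then more
  than \<open>q\<close> earlier elements sit on one of them, while an unused \<open>y\<^sub>0\<close> is bad for at most \<open>q\<close>
  elements; so some earlier element can move to \<open>y\<^sub>0\<close> and free its target for \<open>x\<close>.\<close>
lemma matching_with_slack:
  fixes bad :: "'x \<Rightarrow> 'y \<Rightarrow> bool"
  assumes "finite X" "finite Y" "card X \<le> card Y"
    and "\<And>x. x \<in> X \<Longrightarrow> card {y \<in> Y. bad x y} \<le> p"
    and "\<And>y. y \<in> Y \<Longrightarrow> card {x \<in> X. bad x y} \<le> q"
    and "2 * p + q < card Y"
  shows "\<exists>f. inj_on f X \<and> f ` X \<subseteq> Y \<and> (\<forall>x\<in>X. \<not> bad x (f x))"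
  using assms(1,3,4,5)
proof (induction X rule: finite_induct)
  case empty
  then show ?case by simp
next
  case (insert x X)
  have c1: "card {x' \<in> X. bad x' y} \<le> q" if "y \<in> Y" for y
  proof -
    have "card {x' \<in> X. bad x' y} \<le> card {x' \<in> insert x X. bad x' y}"
      using insert.hyps by (intro card_mono) auto
    then show ?thesis using insert.prems(3)[OF that] by linarith
  qed
  have cX: "card X < card Y" using insert.prems(1) insert.hyps by simp
  obtain f where f: "inj_on f X" "f ` X \<subseteq> Y" "\<forall>x\<in>X. \<not> bad x (f x)"
    using insert.IH cX insert.prems(2) c1 by force
  have badx: "card {y \<in> Y. bad x y} \<le> p" using insert.prems(2) by simp
  show ?case
  proof (cases "\<exists>y\<in>Y - f ` X. \<not> bad x y")
    case True
    then obtain y where y: "y \<in> Y" "y \<notin> f ` X" "\<not> bad x y" by blast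
    let ?g = "f(x := y)"
    have "inj_on ?g (insert x X)" using f(1) y insert.hyps(2) by (auto simp: inj_on_def)
    moreover have "?g ` insert x X \<subseteq> Y" using f(2) y by auto
    moreover have "\<forall>z\<in>insert x X. \<not> bad z (?g z)" using f(3) y by auto
    ultimately show ?thesis by blast
  next
    case False
    have cf: "card (f ` X) = card X" using f(1) by (rule card_image)
    obtain y0 where y0: "y0 \<in> Y" "y0 \<notin> f ` X"
      using cX cf card_mono[of "f ` X" Y] insert.hyps(1) by (metis finite_imageI leD subsetI)
    let ?Z = "{x' \<in> X. \<not> bad x (f x')}"
    have "Y \<subseteq> {y \<in> Y. bad x y} \<union> f ` ?Z" using False by blast
    then have "card Y \<le> card ({y \<in> Y. bad x y} \<union> f ` ?Z)"
      using insert.hyps(1) assms(2) by (intro card_mono) auto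
    also have "\<dots> \<le> card {y \<in> Y. bad x y} + card (f ` ?Z)" by (rule card_Un_le)
    also have "\<dots> \<le> p + card ?Z"
      using badx card_image_le[of ?Z f] insert.hyps(1) by auto
    finally have "q < card ?Z" using assms(6) by linarith
    then have "\<not> ?Z \<subseteq> {x' \<in> X. bad x' y0}"
      using c1[OF y0(1)] card_mono[of "{x' \<in> X. bad x' y0}" ?Z] insert.hyps(1) by auto
    then obtain x' where x': "x' \<in> X" "\<not> bad x (f x')" "\<not> bad x' y0" by blast
    let ?g = "f(x := f x', x' := y0)"
    have xx: "x' \<noteq> x" using x' insert.hyps(2) by auto
    have "inj_on ?g (insert x X)"
      using f(1) y0 x' xx insert.hyps(2) by (auto simp: inj_on_def)
    moreover have "?g ` insert x X \<subseteq> Y" using f(2) y0 x' by auto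
    moreover have "\<forall>z\<in>insert x X. \<not> bad z (?g z)" using f(3) x' xx by auto
    ultimately show ?thesis by blast
  qed
qed

text \<open>Adding an element to a least loaded fibre keeps all fibre sizes in \<open>{q, q + 1}\<close> for some \<open>q\<close>.\<close>
lemma equitable_map:
  assumes "finite S" "finite T" "T \<noteq> {}"
  shows "\<exists>f. f ` S \<subseteq> T \<and> (\<forall>\<tau>\<in>T. real (card S) / real (card T) - 1 \<le> real (card {s \<in> S. f s = \<tau>})
     \<and> real (card {s \<in> S. f s = \<tau>}) \<le> real (card S) / real (card T) + 1)"
proof -
  have "\<exists>f q. f ` S \<subseteq> T \<and> (\<forall>\<tau>\<in>T. card {s \<in> S. f s = \<tau>} \<in> {q, Suc q})"
    using assms(1)
  proof (induction S rule: finite_induct)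
    case empty
    then show ?case by (auto intro!: exI[of _ 0])
  next
    case (insert x S)
    then obtain f q where f: "f ` S \<subseteq> T" "\<forall>\<tau>\<in>T. card {s \<in> S. f s = \<tau>} \<in> {q, Suc q}" by blast
    obtain \<sigma> q' where s: "\<sigma> \<in> T" "card {s \<in> S. f s = \<sigma>} = q'"
        "\<forall>\<tau>\<in>T. card {s \<in> S. f s = \<tau>} \<in> {q', Suc q'}"
    proof (cases "\<exists>\<sigma>\<in>T. card {s \<in> S. f s = \<sigma>} = q")
      case True
      then show ?thesis using that f by blast
    next
      case False
      then have "\<forall>\<tau>\<in>T. card {s \<in> S. f s = \<tau>} = Suc q" using f(2) by blast
      then show ?thesis using that assms(3) by blast
    qed
    let ?g = "f(x := \<sigma>)"
    have "{s \<in> insert x S. ?g s = \<tau>} = (if \<tau> = \<sigma> then insert x {s \<in> S. f s = \<tau>} else {s \<in> S. f s = \<tau>})" for \<tau>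
      using insert.hyps by auto
    then have "card {s \<in> insert x S. ?g s = \<tau>} = (if \<tau> = \<sigma> then Suc (card {s \<in> S. f s = \<tau>}) else card {s \<in> S. f s = \<tau>})" for \<tau>
      using insert.hyps by simp
    then have "?g ` insert x S \<subseteq> T \<and> (\<forall>\<tau>\<in>T. card {s \<in> insert x S. ?g s = \<tau>} \<in> {q', Suc q'})"
      using s f(1) by auto
    then show ?case by blast
  qed
  then obtain f q where f: "f ` S \<subseteq> T" "\<forall>\<tau>\<in>T. card {s \<in> S. f s = \<tau>} \<in> {q, Suc q}" by blast
  have S: "card S = (\<Sum>\<tau>\<in>T. card {s \<in> S. f s = \<tau>})"
  proof -
    have "card (\<Union>\<tau>\<in>T. {s \<in> S. f s = \<tau>}) = (\<Sum>\<tau>\<in>T. card {s \<in> S. f s = \<tau>})"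
      using assms by (intro card_UN_disjoint) auto
    moreover have "(\<Union>\<tau>\<in>T. {s \<in> S. f s = \<tau>}) = S" using f(1) by auto
    ultimately show ?thesis by simp
  qed
  have "q * card T \<le> card S"
    using sum_mono[of T "\<lambda>_. q" "\<lambda>\<tau>. card {s \<in> S. f s = \<tau>}"] f(2) S
    by (force simp: mult.commute)
  moreover have "card S \<le> Suc q * card T"
    using sum_mono[of T "\<lambda>\<tau>. card {s \<in> S. f s = \<tau>}" "\<lambda>_. Suc q"] f(2) S
    by (force simp: mult.commute)
  ultimately have b: "real q * real (card T) \<le> real (card S)" "real (card S) \<le> (real q + 1) * real (card T)"
    by (metis of_nat_mult of_nat_mono, metis of_nat_mult of_nat_mono of_nat_Suc add.commute)
  have T: "real (card T) > 0" using assms by (simp add: card_gt_0_iff)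
  have "real q \<le> real (card S) / real (card T)" "real (card S) / real (card T) \<le> real q + 1"
    using b T by (simp_all add: field_simps)
  then have "\<forall>\<tau>\<in>T. real (card S) / real (card T) - 1 \<le> real (card {s \<in> S. f s = \<tau>})
     \<and> real (card {s \<in> S. f s = \<tau>}) \<le> real (card S) / real (card T) + 1"
    using f(2) by force
  then show ?thesis using f(1) by blast
qed

text \<open>The version with lists of allowed values: elements are grouped into kinds by \<open>\<kappa>\<close>, each kind has
  its own list \<open>Perm\<close>, and each kind is distributed evenly by itself.\<close>
lemma equitable_list_map:
  assumes "finite E" "\<And>e. e \<in> E \<Longrightarrow> finite (Perm (\<kappa> e)) \<and> Perm (\<kappa> e) \<noteq> {}"
  shows "\<exists>ty. (\<forall>e\<in>E. ty e \<in> Perm (\<kappa> e)) \<and>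
    (\<forall>k\<in>\<kappa> ` E. \<forall>\<tau>\<in>Perm k.
       real (card {e \<in> E. \<kappa> e = k}) / real (card (Perm k)) - 1 \<le> real (card {e \<in> E. \<kappa> e = k \<and> ty e = \<tau>})
     \<and> real (card {e \<in> E. \<kappa> e = k \<and> ty e = \<tau>}) \<le> real (card {e \<in> E. \<kappa> e = k}) / real (card (Perm k)) + 1)"
proof -
  have "\<forall>k\<in>\<kappa> ` E. \<exists>f. f ` {e \<in> E. \<kappa> e = k} \<subseteq> Perm k \<and> (\<forall>\<tau>\<in>Perm k.
      real (card {e \<in> E. \<kappa> e = k}) / real (card (Perm k)) - 1 \<le> real (card {s \<in> {e \<in> E. \<kappa> e = k}. f s = \<tau>})
     \<and> real (card {s \<in> {e \<in> E. \<kappa> e = k}. f s = \<tau>}) \<le> real (card {e \<in> E. \<kappa> e = k}) / real (card (Perm k)) + 1)"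
    using assms by (intro ballI equitable_map) auto
  then obtain g where g: "\<forall>k\<in>\<kappa> ` E. g k ` {e \<in> E. \<kappa> e = k} \<subseteq> Perm k \<and> (\<forall>\<tau>\<in>Perm k.
      real (card {e \<in> E. \<kappa> e = k}) / real (card (Perm k)) - 1 \<le> real (card {s \<in> {e \<in> E. \<kappa> e = k}. g k s = \<tau>})
     \<and> real (card {s \<in> {e \<in> E. \<kappa> e = k}. g k s = \<tau>}) \<le> real (card {e \<in> E. \<kappa> e = k}) / real (card (Perm k)) + 1)"
    unfolding bchoice_iff by blast
  have "{s \<in> {e \<in> E. \<kappa> e = k}. g k s = \<tau>} = {e \<in> E. \<kappa> e = k \<and> g (\<kappa> e) e = \<tau>}" for k \<tau> by auto
  note eq = this
  have "g (\<kappa> e) e \<in> Perm (\<kappa> e)" if "e \<in> E" for e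
    using g that by blast
  then show ?thesis using g[unfolded eq] by (intro exI[of _ "\<lambda>e. g (\<kappa> e) e"]) auto
qed

definition pair_partition :: "'a set set \<Rightarrow> 'a set set set \<Rightarrow> bool" where
  "pair_partition E P \<longleftrightarrow> \<Union> P = E \<and> disjoint P \<and> (\<forall>p\<in>P. card p = 2)"

definition matching_pair :: "'a set set \<Rightarrow> bool" where
  "matching_pair p \<longleftrightarrow> (\<exists>e f. p = {e, f} \<and> e \<noteq> f \<and> e \<inter> f = {})"

lemma pair_partition_card:
  assumes "pair_partition E P" "finite E"
  shows "finite P" "card E = 2 * card P"
proof -
  show fP: "finite P" using assms finite_UnionD unfolding pair_partition_def by blast
  have "card (\<Union>P) = sum card P"
    using assms unfolding pair_partition_def disjoint_def
    by (intro card_Union_disjoint) (auto simp: pairwise_def disjnt_def intro: card_ge_0_finite)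
  then show "card E = 2 * card P" using assms(1) unfolding pair_partition_def by simp
qed

lemma pair_partition_exists:
  assumes "finite E" "even (card E)"
  shows "\<exists>P. pair_partition E P"
  using assms
proof (induction "card E" arbitrary: E rule: less_induct)
  case less
  show ?case
  proof (cases "E = {}")
    case True
    then show ?thesis by (auto simp: pair_partition_def intro!: exI[of _ "{}"])
  next
    case False
    then have "card E \<ge> 2" using less.prems
      by (metis One_nat_def Suc_1 card_0_eq less_2_cases not_less_eq_eq odd_one not_le One_nat_def)
    then obtain p where p: "p \<subseteq> E" "card p = 2" by (metis obtain_subset_with_card_n)
    have fp: "finite p" using p less.prems finite_subset by blast
    then have "card (E - p) = card E - 2" using p by (simp add: card_Diff_subset)
    then have "\<exists>P. pair_partition (E - p) P"
      using less.prems less.hyps[of "E - p"] \<open>card E \<ge> 2\<close> by auto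
    then obtain P where P: "pair_partition (E - p) P" by blast
    have "pair_partition E (insert p P)"
    proof -
      have "disjoint (insert p P)"
        using P unfolding pair_partition_def by (auto simp: disjoint_def)
      moreover have "\<Union> (insert p P) = E" using P p unfolding pair_partition_def by blast
      ultimately show ?thesis using P p unfolding pair_partition_def by simp
    qed
    then show ?thesis by blast
  qed
qed

text \<open>The two pairs \<open>ef\<close>, \<open>gh\<close> are replaced by \<open>eg\<close>, \<open>fh\<close>.\<close>
lemma pair_partition_swap:
  assumes P: "pair_partition E P" and pq: "p \<in> P" "q \<in> P" "p \<noteq> q"
    and p: "p = {e, f}" "e \<noteq> f" and q: "q = {g, h}" "g \<noteq> h"
  shows "pair_partition E (P - {p, q} \<union> {{e, g}, {f, h}})"
    and "e \<noteq> g" "f \<noteq> h" "{e, g} \<notin> P" "{f, h} \<notin> P"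
proof -
  have dd: "x \<inter> y = {}" if "x \<in> P" "y \<in> P" "x \<noteq> y" for x y
    using P that unfolding pair_partition_def disjoint_def by simp
  have d: "p \<inter> q = {}" using dd pq by simp
  have ne: "e \<noteq> g" "f \<noteq> h" "e \<noteq> h" "f \<noteq> g" using d p q by auto
  show n: "e \<noteq> g" "f \<noteq> h" by (fact ne)+
  have U: "\<Union> P = E" and c2: "\<forall>p\<in>P. card p = 2" using P unfolding pair_partition_def by auto
  have "{e,g} \<noteq> p" using ne p(2) unfolding p(1) doubleton_eq_iff by simp
  then show "{e, g} \<notin> P" using dd[of "{e,g}" p] pq(1) p(1) by blast
  have "{f,h} \<noteq> p" using ne p(2) unfolding p(1) doubleton_eq_iff by simp
  then show "{f, h} \<notin> P" using dd[of "{f,h}" p] pq(1) p(1) by blast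
  have U1: "\<Union> (P - {p, q} \<union> {{e, g}, {f, h}}) = E"
  proof -
    have "\<Union> P = \<Union> (P - {p,q}) \<union> p \<union> q" using pq by auto
    then show ?thesis using U p q by auto
  qed
  have "disjoint (P - {p, q} \<union> {{e, g}, {f, h}})"
    unfolding disjoint_def
  proof (intro ballI impI)
    fix x y assume x: "x \<in> P - {p, q} \<union> {{e, g}, {f, h}}" and y: "y \<in> P - {p, q} \<union> {{e, g}, {f, h}}" and xy: "x \<noteq> y"
    have out: "z \<inter> (p \<union> q) = {}" if "z \<in> P - {p,q}" for z
      using dd[of z p] dd[of z q] that pq by blast
    have new: "{e,g} \<inter> {f,h} = {}" "{e,g} \<subseteq> p \<union> q" "{f,h} \<subseteq> p \<union> q" using ne p q by simp_all
    show "x \<inter> y = {}"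
    proof (cases "x \<in> P - {p,q}")
      case True
      have "x \<inter> y = {}" if "y \<in> P - {p,q}" using dd[of x y] True that xy by simp
      moreover have "x \<inter> y = {}" if "y \<subseteq> p \<union> q" using out[OF True] that by auto
      ultimately show ?thesis using y new(2,3) by auto
    next
      case False
      then have xn: "x = {e,g} \<or> x = {f,h}" using x by blast
      have "x \<inter> y = {}" if "y \<in> P - {p,q}" using out[OF that] xn new(2,3) by auto
      moreover have "x \<inter> y = {}" if "y = {e,g} \<or> y = {f,h}"
        using xn that xy new(1) by (elim disjE) (simp_all add: Int_commute)
      ultimately show ?thesis using y by auto
    qed
  qed
  then show "pair_partition E (P - {p, q} \<union> {{e, g}, {f, h}})"
    using U1 c2 n unfolding pair_partition_def by (simp add: ball_Un)
qed

text \<open>Let the edges \<open>vx\<close>, \<open>vy\<close> form a bad pair. Since the degree of \<open>v\<close> is at most the number of pairs, and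
  this pair contributes two edges at \<open>v\<close>, some other pair \<open>q\<close> avoids \<open>v\<close>. No edge contains both \<open>x\<close>
  and \<open>y\<close>, as they lie on the same side. Hence one of the two ways of recombining the four edges
  reduces the number of bad pairs.\<close>
lemma bad_pair_improve:
  fixes E :: "'a set set"
  assumes fE: "finite E" and bip: "\<And>e. e \<in> E \<Longrightarrow> \<exists>x y. e = {x, y} \<and> x \<in> S \<and> y \<notin> S"
    and P: "pair_partition E P" and deg: "\<And>v. card {e \<in> E. v \<in> e} \<le> card P"
    and bad: "p \<in> P" "\<not> matching_pair p"
  shows "\<exists>P'. pair_partition E P' \<and> card {p \<in> P'. \<not> matching_pair p} < card {p \<in> P. \<not> matching_pair p}"
proof -
  have fP: "finite P" using pair_partition_card P fE by blast
  have c2: "card r = 2" if "r \<in> P" for r using P that unfolding pair_partition_def by auto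
  have sub: "r \<subseteq> E" if "r \<in> P" for r using P that unfolding pair_partition_def by auto
  have dd: "x \<inter> y = {}" if "x \<in> P" "y \<in> P" "x \<noteq> y" for x y
    using P that unfolding pair_partition_def disjoint_def by simp
  obtain e f where ef: "p = {e, f}" "e \<noteq> f" using c2[OF bad(1)] by (metis card_2_iff)
  then have "e \<inter> f \<noteq> {}" using bad(2) unfolding matching_pair_def by auto
  then obtain v where v: "v \<in> e" "v \<in> f" by blast
  have efE: "e \<in> E" "f \<in> E" using sub[OF bad(1)] ef by auto
  obtain x where x: "e = {v, x}" "(v \<in> S) \<noteq> (x \<in> S)" using bip[OF efE(1)] v(1) by blast
  obtain y where y: "f = {v, y}" "(v \<in> S) \<noteq> (y \<in> S)" using bip[OF efE(2)] v(2) by blast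
  have oneside: "\<not> (x \<in> g \<and> y \<in> g)" if "g \<in> E" for g
    using bip[OF that] x y ef(2) by auto
  have "\<exists>q\<in>P - {p}. v \<notin> \<Union> q"
  proof (rule ccontr)
    assume "\<not> ?thesis"
    then have "\<forall>q\<in>P - {p}. \<exists>g. g \<in> q \<and> v \<in> g" by blast
    then obtain c where c: "\<forall>q\<in>P - {p}. c q \<in> q \<and> v \<in> c q" by metis
    have "inj_on c (P - {p})"
    proof (rule inj_onI)
      fix r s assume "r \<in> P - {p}" "s \<in> P - {p}" "c r = c s"
      then show "r = s" using c dd[of r s] by (metis DiffD1 IntI empty_iff)
    qed
    then have "card (c ` (P - {p})) = card P - 1" using bad(1) by (simp add: card_image)
    moreover have "c ` (P - {p}) \<inter> {e, f} = {}"
      using c dd[OF _ bad(1)] ef by blast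
    moreover have "finite (c ` (P - {p}))" using fP by simp
    ultimately have "card (c ` (P - {p}) \<union> {e, f}) = card P - 1 + 2"
      using ef by (subst card_Un_disjoint) auto
    moreover have "c ` (P - {p}) \<union> {e, f} \<subseteq> {e \<in> E. v \<in> e}"
      using c sub v efE by auto
    then have "card (c ` (P - {p}) \<union> {e, f}) \<le> card {e \<in> E. v \<in> e}"
      using fE by (intro card_mono) auto
    moreover have "card P > 0" using bad(1) fP card_gt_0_iff by blast
    ultimately show False using deg[of v] by linarith
  qed
  then obtain q where q: "q \<in> P" "q \<noteq> p" "v \<notin> \<Union> q" by blast
  obtain g0 h0 where gh0: "q = {g0, h0}" "g0 \<noteq> h0" using c2[OF q(1)] by (metis card_2_iff)
  have g0E: "g0 \<in> E" "h0 \<in> E" using sub[OF q(1)] gh0 by auto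
  have disj: "e \<inter> g = {} \<longleftrightarrow> x \<notin> g" "f \<inter> g = {} \<longleftrightarrow> y \<notin> g" if "g \<in> q" for g
    using that q(3) x y by auto
  obtain g h where gh: "q = {g, h}" "g \<noteq> h"
    and good: "(e \<inter> g = {} \<and> f \<inter> h = {}) \<or> (\<not> matching_pair q \<and> (e \<inter> g = {} \<or> f \<inter> h = {}))"
  proof (cases "matching_pair q")
    case True
    then have gd: "g0 \<inter> h0 = {}" using gh0 unfolding matching_pair_def
      by (metis Int_commute doubleton_eq_iff)
    show ?thesis
    proof (cases "x \<notin> g0 \<and> y \<notin> h0")
      case True
      then show ?thesis using that[of g0 h0] gh0 disj by auto
    next
      case False
      then have "x \<notin> h0 \<and> y \<notin> g0" using gd oneside g0E by blast
      then show ?thesis using that[of h0 g0] gh0 disj by auto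
    qed
  next
    case False
    show ?thesis
    proof (cases "x \<in> g0")
      case True
      then have "y \<notin> g0" using oneside g0E by blast
      then have "f \<inter> g0 = {}" using disj gh0(1) by simp
      moreover have "q = {h0, g0}" "h0 \<noteq> g0" using gh0 by auto
      ultimately show ?thesis using that[of h0 g0] False by simp
    next
      case f: False
      then have "e \<inter> g0 = {}" using disj gh0(1) by simp
      then show ?thesis using that[of g0 h0] gh0 False by simp
    qed
  qed
  let ?P' = "P - {p, q} \<union> {{e, g}, {f, h}}"
  note sw = pair_partition_swap[OF P bad(1) q(1) q(2)[symmetric] ef gh]
  let ?b = "\<lambda>P. {p \<in> P. \<not> matching_pair p}"
  have m: "matching_pair {e, g}" if "e \<inter> g = {}" using that sw(2) unfolding matching_pair_def by blast
  have m': "matching_pair {f, h}" if "f \<inter> h = {}" using that sw(3) unfolding matching_pair_def by blast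
  have "card (?b ?P') < card (?b P)"
  proof -
    have fb: "finite (?b P)" using fP by simp
    from good consider "e \<inter> g = {}" "f \<inter> h = {}" | "\<not> matching_pair q" "e \<inter> g = {} \<or> f \<inter> h = {}" by blast
    then show ?thesis
    proof cases
      case 1
      then have "?b ?P' \<subseteq> ?b P - {p}" using m m' by auto
      then have "card (?b ?P') \<le> card (?b P - {p})" using fb by (intro card_mono) auto
      also have "\<dots> < card (?b P)" using fb bad by (intro psubset_card_mono) auto
      finally show ?thesis .
    next
      case 2
      have nb: "r \<in> P - {p, q} \<and> \<not> matching_pair r \<or> r = {e, g} \<and> e \<inter> g \<noteq> {} \<or> r = {f, h} \<and> f \<inter> h \<noteq> {}"
        if "r \<in> ?b ?P'" for r using that m m' by auto
      define r where "r = (if e \<inter> g = {} then {f, h} else {e, g})"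
      have "?b ?P' \<subseteq> insert r (?b P - {p, q})"
      proof
        fix s assume "s \<in> ?b ?P'"
        then show "s \<in> insert r (?b P - {p, q})" using nb[of s] 2(2) unfolding r_def
          by (cases "e \<inter> g = {}") auto
      qed
      then have "card (?b ?P') \<le> card (insert r (?b P - {p, q}))" using fb by (intro card_mono) auto
      also have "\<dots> \<le> Suc (card (?b P - {p, q}))" using fb by (simp add: card_insert_if)
      also have "card (?b P - {p, q}) = card (?b P) - 2"
        using bad q 2(1) by (subst card_Diff_subset) auto
      also have "Suc (card (?b P) - 2) < card (?b P)"
      proof -
        have "card {p, q} \<le> card (?b P)" using bad q 2(1) fb by (intro card_mono) auto
        then show ?thesis using q(2) by auto
      qed
      finally show ?thesis .
    qed
  qed
  then show ?thesis using sw(1) by blast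
qed

text \<open>A pairing with the fewest intersecting pairs has none, by the exchange above.\<close>
lemma bipartite_pairing:
  fixes E :: "'a set set"
  assumes fE: "finite E" and bip: "\<And>e. e \<in> E \<Longrightarrow> \<exists>x y. e = {x, y} \<and> x \<in> S \<and> y \<notin> S"
    and ev: "even (card E)" and deg: "\<And>v. 2 * card {e \<in> E. v \<in> e} \<le> card E"
  shows "\<exists>P. pair_partition E P \<and> (\<forall>p\<in>P. matching_pair p)"
proof -
  obtain P0 where "pair_partition E P0" using pair_partition_exists[OF fE ev] by blast
  then obtain P where P: "pair_partition E P"
    and min: "\<And>P'. pair_partition E P' \<Longrightarrow> card {p \<in> P. \<not> matching_pair p} \<le> card {p \<in> P'. \<not> matching_pair p}"
    using ex_has_least_nat[of "pair_partition E" P0 "\<lambda>P. card {p \<in> P. \<not> matching_pair p}"] by blast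
  have "card {e \<in> E. v \<in> e} \<le> card P" for v
    using deg[of v] pair_partition_card(2)[OF P fE] by linarith
  then have "matching_pair p" if "p \<in> P" for p
    using bad_pair_improve[OF fE bip P _ that] min by (meson not_le)
  then show ?thesis using P by blast
qed

section \<open>Greedy placement and pairings across types\<close>

text \<open>The ends are outside \<open>V\<^sub>0\<close>, where degrees in a Hamilton exceptional system are at most 1. So a system
  that contains a star pair of crossing edges has the path \<open>xvy\<close> as a component, both of whose ends lie
  on the side opposite to \<open>v\<close>.\<close>
definition star_pair :: "'a set \<Rightarrow> 'a set set \<Rightarrow> bool" where
  "star_pair V0 p \<longleftrightarrow> (\<exists>v\<in>V0. \<exists>x y. x \<notin> V0 \<and> y \<notin> V0 \<and> x \<noteq> y \<and> p = {{v, x}, {v, y}})"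

definition isolated :: "'a set set \<Rightarrow> 'a set set" where
  "isolated F = {e \<in> F. \<forall>g\<in>F. g \<noteq> e \<longrightarrow> g \<inter> e = {}}"

lemma star_pair_card: "star_pair V0 p \<Longrightarrow> card p = 2"
  unfolding star_pair_def by (auto simp: doubleton_eq_iff)

lemma matching_pair_card: "matching_pair p \<Longrightarrow> card p = 2"
  unfolding matching_pair_def using card_2_iff by blast

text \<open>When \<open>p\<close> is placed, each conflicting item blocks at most one colour of \<open>Al p\<close>. A colour is full
  when it has \<open>M\<close> items, and by the total count at most \<open>fl\<close> colours are full.\<close>
lemma greedy_extend:
  fixes f0 :: "'p \<Rightarrow> 'c" and Al :: "'p \<Rightarrow> 'c set" and conf :: "'p \<Rightarrow> 'p \<Rightarrow> bool"
  assumes fin: "finite P0" "finite New" "\<And>p. p \<in> New \<Longrightarrow> finite (Al p)" and dj: "P0 \<inter> New = {}"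
    and sym: "\<And>p q. conf p q \<Longrightarrow> conf q p"
    and ok: "\<And>p q. p \<in> P0 \<Longrightarrow> q \<in> P0 \<Longrightarrow> p \<noteq> q \<Longrightarrow> conf p q \<Longrightarrow> f0 p \<noteq> f0 q"
    and size: "\<And>c. card {p \<in> P0. f0 p = c} \<le> M"
    and full: "card P0 + card New < M * Suc fl"
    and room: "\<And>p. p \<in> New \<Longrightarrow>
      card ({q \<in> P0. conf q p \<and> f0 q \<in> Al p} \<union> {q \<in> New. conf q p \<and> Al q \<inter> Al p \<noteq> {}}) + fl < card (Al p)"
  shows "\<exists>f. (\<forall>p\<in>P0. f p = f0 p) \<and> (\<forall>p\<in>New. f p \<in> Al p) \<and>
     (\<forall>p\<in>P0 \<union> New. \<forall>q\<in>P0 \<union> New. p \<noteq> q \<longrightarrow> conf p q \<longrightarrow> f p \<noteq> f q) \<and>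
     (\<forall>c. card {p \<in> P0 \<union> New. f p = c} \<le> M)"
proof -
  have "\<exists>f. (\<forall>p\<in>P0. f p = f0 p) \<and> (\<forall>p\<in>W. f p \<in> Al p) \<and>
     (\<forall>p\<in>P0 \<union> W. \<forall>q\<in>P0 \<union> W. p \<noteq> q \<longrightarrow> conf p q \<longrightarrow> f p \<noteq> f q) \<and>
     (\<forall>c. card {p \<in> P0 \<union> W. f p = c} \<le> M)" if "W \<subseteq> New" for W
    using finite_subset[OF that fin(2)] that
  proof (induction W rule: finite_induct)
    case empty
    then show ?case using ok size by (intro exI[of _ f0]) auto
  next
    case (insert p W)
    then obtain f where f1: "\<forall>p\<in>P0. f p = f0 p" and f2: "\<forall>p\<in>W. f p \<in> Al p"
      and f3: "\<forall>p\<in>P0 \<union> W. \<forall>q\<in>P0 \<union> W. p \<noteq> q \<longrightarrow> conf p q \<longrightarrow> f p \<noteq> f q"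
      and f4: "\<forall>c. card {p \<in> P0 \<union> W. f p = c} \<le> M" by blast
    have p: "p \<in> New" "p \<notin> P0 \<union> W" and WN: "W \<subseteq> New" using insert.prems insert.hyps dj by auto
    let ?B1 = "f ` {q \<in> P0 \<union> W. conf q p \<and> f q \<in> Al p}"
    let ?B2 = "{c \<in> Al p. M \<le> card {q \<in> P0 \<union> W. f q = c}}"
    have finU: "finite (P0 \<union> W)" using fin insert.hyps by auto
    have "card ?B1 \<le> card {q \<in> P0 \<union> W. conf q p \<and> f q \<in> Al p}"
      using finU by (intro card_image_le) auto
    also have "\<dots> \<le> card ({q \<in> P0. conf q p \<and> f0 q \<in> Al p} \<union> {q \<in> New. conf q p \<and> Al q \<inter> Al p \<noteq> {}})"
      using f1 f2 WN fin by (intro card_mono) auto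
    finally have b1: "card ?B1 + fl < card (Al p)" using room[OF p(1)] by linarith
    have b2: "card ?B2 \<le> fl"
    proof -
      have fB2: "finite ?B2" using fin(3)[OF p(1)] by simp
      have "M * card ?B2 = (\<Sum>c\<in>?B2. M)" by simp
      also have "\<dots> \<le> (\<Sum>c\<in>?B2. card {q \<in> P0 \<union> W. f q = c})" by (intro sum_mono) auto
      also have "\<dots> = card (\<Union>c\<in>?B2. {q \<in> P0 \<union> W. f q = c})"
        using fB2 finU by (intro card_UN_disjoint[symmetric]) auto
      also have "\<dots> \<le> card (P0 \<union> W)" using finU by (intro card_mono) auto
      also have "\<dots> \<le> card P0 + card New"
        using card_Un_le[of P0 W] card_mono[OF fin(2) WN] by linarith
      finally have "M * card ?B2 < M * Suc fl" using full by linarith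
      then show ?thesis by (auto simp only: mult_less_cancel1 less_Suc_eq_le)
    qed
    have "\<not> Al p \<subseteq> ?B1 \<union> ?B2"
    proof
      assume a: "Al p \<subseteq> ?B1 \<union> ?B2"
      have "card (Al p) \<le> card (?B1 \<union> ?B2)" using a finU fin(3)[OF p(1)] by (intro card_mono) auto
      then show False using b1 b2 card_Un_le[of ?B1 ?B2] by linarith
    qed
    then obtain c where c: "c \<in> Al p" "c \<notin> ?B1" "c \<notin> ?B2" by blast
    have nc: "\<forall>q\<in>P0 \<union> W. conf q p \<longrightarrow> f q \<noteq> c" using c(1,2) by blast
    let ?g = "f(p := c)"
    have "\<forall>p\<in>P0. ?g p = f0 p" using f1 p(2) by auto
    moreover have "\<forall>q\<in>insert p W. ?g q \<in> Al q" using f2 c(1) by auto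
    moreover have "\<forall>q\<in>P0 \<union> insert p W. \<forall>r\<in>P0 \<union> insert p W. q \<noteq> r \<longrightarrow> conf q r \<longrightarrow> ?g q \<noteq> ?g r"
    proof (intro ballI impI)
      fix q r assume qr: "q \<in> P0 \<union> insert p W" "r \<in> P0 \<union> insert p W" "q \<noteq> r" "conf q r"
      show "?g q \<noteq> ?g r"
      proof (cases "q = p")
        case True
        then have "r \<in> P0 \<union> W" using qr by auto
        then show ?thesis using nc sym[OF qr(4)] True qr(3) by auto
      next
        case qp: False
        then have q: "q \<in> P0 \<union> W" using qr by auto
        show ?thesis
        proof (cases "r = p")
          case True
          then show ?thesis using nc q qr(3,4) by auto
        next
          case False
          then have "r \<in> P0 \<union> W" using qr by auto
          then show ?thesis using f3 q qr(3,4) qp False by simp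
        qed
      qed
    qed
    moreover have "\<forall>d. card {q \<in> P0 \<union> insert p W. ?g q = d} \<le> M"
    proof
      fix d
      have eq: "{q \<in> P0 \<union> insert p W. ?g q = d} = {q \<in> P0 \<union> W. f q = d} \<union> (if d = c then {p} else {})"
        using p(2) by auto
      show "card {q \<in> P0 \<union> insert p W. ?g q = d} \<le> M"
      proof (cases "d = c")
        case True
        have "card {q \<in> P0 \<union> W. f q = c} < M" using c(1,3) by auto
        then show ?thesis unfolding eq using True finU p(2) by (simp add: card_insert_if)
      next
        case False
        then show ?thesis unfolding eq using f4 by simp
      qed
    qed
    ultimately show ?case by blast
  qed
  then show ?thesis by blast
qed

text \<open>Types with an odd number of edges are paired up, and each contributes one edge to a pair that
  crosses the two types, after which all types are even.\<close>
lemma odd_pairs: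
  assumes "finite Od" "even (card Od)"
    and "\<And>\<tau>. \<tau> \<in> Od \<Longrightarrow> H \<tau> \<noteq> {}"
    and "\<And>\<tau> \<sigma> e. \<tau> \<in> Od \<Longrightarrow> \<sigma> \<in> Od \<Longrightarrow> e \<in> H \<sigma> \<Longrightarrow> \<exists>f\<in>H \<tau>. e \<inter> f = {}"
    and "\<And>\<sigma> \<tau>. \<sigma> \<in> Od \<Longrightarrow> \<tau> \<in> Od \<Longrightarrow> \<sigma> \<noteq> \<tau> \<Longrightarrow> H \<sigma> \<inter> H \<tau> = {}"
  shows "\<exists>NP. disjoint NP \<and> (\<forall>p\<in>NP. matching_pair p) \<and> \<Union>NP \<subseteq> (\<Union>\<tau>\<in>Od. H \<tau>) \<and> finite NP \<and>
     (\<forall>\<tau>\<in>Od. \<exists>e. H \<tau> \<inter> \<Union>NP = {e}) \<and> 2 * card NP = card Od"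
  using assms
proof (induction "card Od" arbitrary: Od rule: less_induct)
  case less
  show ?case
  proof (cases "Od = {}")
    case True
    then show ?thesis by (intro exI[of _ "{}"]) auto
  next
    case False
    then obtain \<sigma> where s: "\<sigma> \<in> Od" by blast
    have "Od \<noteq> {\<sigma>}" using less.prems(2) by auto
    then obtain \<tau> where t: "\<tau> \<in> Od" "\<tau> \<noteq> \<sigma>" using s by blast
    let ?O = "Od - {\<sigma>, \<tau>}"
    have cO: "card Od = card ?O + 2"
    proof -
      have "card {\<sigma>, \<tau>} \<le> card Od" using s t less.prems(1) by (intro card_mono) auto
      then show ?thesis using s t less.prems(1) by (subst card_Diff_subset) auto
    qed
    have "\<exists>NP. disjoint NP \<and> (\<forall>p\<in>NP. matching_pair p) \<and> \<Union>NP \<subseteq> (\<Union>\<tau>\<in>?O. H \<tau>) \<and> finite NP \<and>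
     (\<forall>\<tau>\<in>?O. \<exists>e. H \<tau> \<inter> \<Union>NP = {e}) \<and> 2 * card NP = card ?O"
      using less.prems cO by (intro less.hyps) auto
    then obtain NP where NP: "disjoint NP" "\<forall>p\<in>NP. matching_pair p" "\<Union>NP \<subseteq> (\<Union>\<tau>\<in>?O. H \<tau>)" "finite NP"
      "\<forall>\<tau>\<in>?O. \<exists>e. H \<tau> \<inter> \<Union>NP = {e}" "2 * card NP = card ?O" by (elim exE conjE) (rule that)
    obtain e where e: "e \<in> H \<sigma>" using less.prems(3) s by blast
    obtain f where f: "f \<in> H \<tau>" "e \<inter> f = {}" using less.prems(4)[OF t(1) s e] by blast
    have dH: "H \<rho> \<inter> H \<upsilon> = {}" if "\<rho> \<in> Od" "\<upsilon> \<in> Od" "\<rho> \<noteq> \<upsilon>" for \<rho> \<upsilon> using less.prems(5) that by blast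
    have ef: "e \<noteq> f" using dH[OF s t(1)] t(2) e f by blast
    have out: "e \<notin> \<Union>NP" "f \<notin> \<Union>NP" "H \<sigma> \<inter> \<Union>NP = {}" "H \<tau> \<inter> \<Union>NP = {}"
    proof -
      have "H \<rho> \<inter> \<Union>NP = {}" if r: "\<rho> \<in> {\<sigma>, \<tau>}" for \<rho>
      proof -
        have "H \<rho> \<inter> H \<upsilon> = {}" if "\<upsilon> \<in> ?O" for \<upsilon> using dH[of \<rho> \<upsilon>] that r s t by blast
        then show ?thesis using NP(3) by blast
      qed
      then show "e \<notin> \<Union>NP" "f \<notin> \<Union>NP" "H \<sigma> \<inter> \<Union>NP = {}" "H \<tau> \<inter> \<Union>NP = {}" using e f by auto
    qed
    let ?P = "insert {e, f} NP"
    have d: "disjoint ?P"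
      using NP(1) out(1,2) by (auto simp: disjoint_def)
    have m: "\<forall>p\<in>?P. matching_pair p" using NP(2) ef f(2) unfolding matching_pair_def by blast
    have U: "\<Union>?P = {e, f} \<union> \<Union>NP" by auto
    have sub: "\<Union>?P \<subseteq> (\<Union>\<tau>\<in>Od. H \<tau>)" unfolding U using NP(3) s t e f by auto
    have one: "\<forall>\<rho>\<in>Od. \<exists>g. H \<rho> \<inter> \<Union>?P = {g}"
    proof
      fix \<rho> assume r: "\<rho> \<in> Od"
      consider "\<rho> = \<sigma>" | "\<rho> = \<tau>" | "\<rho> \<in> ?O" using r by blast
      then show "\<exists>g. H \<rho> \<inter> \<Union>?P = {g}"
      proof cases
        case 1
        have "f \<notin> H \<sigma>" using dH[OF s t(1)] t(2) f by blast
        then have "H \<rho> \<inter> \<Union>?P = {e}" unfolding U 1 using out(3) e by blast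
        then show ?thesis ..
      next
        case 2
        have "e \<notin> H \<tau>" using dH[OF s t(1)] t(2) e by blast
        then have "H \<rho> \<inter> \<Union>?P = {f}" unfolding U 2 using out(4) f by blast
        then show ?thesis ..
      next
        case 3
        have "e \<notin> H \<rho>" "f \<notin> H \<rho>" using dH[of \<rho> \<sigma>] dH[of \<rho> \<tau>] 3 s t e f by blast+
        then have "H \<rho> \<inter> \<Union>?P = H \<rho> \<inter> \<Union>NP" unfolding U by blast
        then show ?thesis using NP(5) 3 by metis
      qed
    qed
    have "{e, f} \<notin> NP" using out(1) by blast
    then have "2 * card ?P = card Od" using NP(4,6) cO by simp
    then show ?thesis using d m sub one NP(4) by (intro exI[of _ ?P]) simp
  qed
qed

lemma disjoint_choice_card_le:
  assumes "disjoint P" "finite E" "\<And>p. p \<in> P \<Longrightarrow> \<exists>e\<in>p. e \<in> E"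
  shows "card P \<le> card E"
proof -
  obtain c where c: "\<And>p. p \<in> P \<Longrightarrow> c p \<in> p \<and> c p \<in> E" using assms(3) by metis
  have "inj_on c P"
  proof (rule inj_onI)
    fix p q assume pq: "p \<in> P" "q \<in> P" "c p = c q"
    then have "p \<inter> q \<noteq> {}" using c[of p] c[of q] by auto
    then show "p = q" using assms(1) pq unfolding disjoint_def by blast
  qed
  then show ?thesis using c assms(2) by (intro card_inj_on_le[of c]) auto
qed

text \<open>The degree condition has one unit of slack, so it survives the removal of at most one edge per type;
  it also gives the disjoint partners that \<open>odd_pairs\<close> asks for, as an edge \<open>xy\<close> meets fewer than
  \<open>card (H \<tau>)\<close> edges of another type.\<close>
lemma family_pairing:
  fixes H :: "'t \<Rightarrow> 'a set set"
  assumes finT: "finite Ty" and finH: "\<And>\<tau>. \<tau> \<in> Ty \<Longrightarrow> finite (H \<tau>)"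
    and bip: "\<And>\<tau> e. \<tau> \<in> Ty \<Longrightarrow> e \<in> H \<tau> \<Longrightarrow> \<exists>x y. e = {x, y} \<and> x \<in> S \<and> y \<notin> S"
    and dH: "\<And>\<sigma> \<tau>. \<sigma> \<in> Ty \<Longrightarrow> \<tau> \<in> Ty \<Longrightarrow> \<sigma> \<noteq> \<tau> \<Longrightarrow> H \<sigma> \<inter> H \<tau> = {}"
    and deg: "\<And>\<tau> v. \<tau> \<in> Ty \<Longrightarrow> 2 * card {e \<in> H \<tau>. v \<in> e} + 1 \<le> card (H \<tau>)"
    and ev: "even (\<Sum>\<tau>\<in>Ty. card (H \<tau>))"
  shows "\<exists>LP NP. disjoint NP \<and> (\<forall>p\<in>NP. matching_pair p) \<and> \<Union>NP \<subseteq> (\<Union>\<tau>\<in>Ty. H \<tau>) \<and> finite NP \<and>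
     2 * card NP \<le> card Ty \<and> (\<forall>\<tau>\<in>Ty. card (H \<tau> \<inter> \<Union>NP) \<le> 1) \<and>
     (\<forall>\<tau>\<in>Ty. pair_partition (H \<tau> - \<Union>NP) (LP \<tau>) \<and> (\<forall>p\<in>LP \<tau>. matching_pair p))"
proof -
  define Od where "Od = {\<tau> \<in> Ty. odd (card (H \<tau>))}"
  have evO: "even (card Od)" unfolding Od_def using ev finT by (subst (asm) even_sum_iff) auto
  have finOd: "finite Od" and OT: "Od \<subseteq> Ty" unfolding Od_def using finT by auto
  have dj: "\<exists>f\<in>H \<tau>. e \<inter> f = {}" if \<tau>: "\<tau> \<in> Ty" and \<sigma>: "\<sigma> \<in> Ty" and e: "e \<in> H \<sigma>" for \<tau> \<sigma> e
  proof (rule ccontr)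
    assume neg: "\<not> ?thesis"
    obtain x y where xy: "e = {x, y}" using bip[OF \<sigma> e] by blast
    have "H \<tau> \<subseteq> {e \<in> H \<tau>. x \<in> e} \<union> {e \<in> H \<tau>. y \<in> e}" using neg xy by auto
    then have "card (H \<tau>) \<le> card ({e \<in> H \<tau>. x \<in> e} \<union> {e \<in> H \<tau>. y \<in> e})"
      using finH[OF \<tau>] by (intro card_mono) auto
    also have "\<dots> \<le> card {e \<in> H \<tau>. x \<in> e} + card {e \<in> H \<tau>. y \<in> e}" by (rule card_Un_le)
    finally show False using deg[OF \<tau>, of x] deg[OF \<tau>, of y] by linarith
  qed
  obtain NP where NP: "disjoint NP" "\<forall>p\<in>NP. matching_pair p" "\<Union>NP \<subseteq> (\<Union>\<tau>\<in>Od. H \<tau>)" "finite NP"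
     "\<forall>\<tau>\<in>Od. \<exists>e. H \<tau> \<inter> \<Union>NP = {e}" "2 * card NP = card Od"
  proof -
    have "H \<tau> \<noteq> {}" if "\<tau> \<in> Od" for \<tau> using that unfolding Od_def by auto
    note ne = this
    have "\<exists>NP. disjoint NP \<and> (\<forall>p\<in>NP. matching_pair p) \<and> \<Union>NP \<subseteq> (\<Union>\<tau>\<in>Od. H \<tau>) \<and> finite NP \<and>
     (\<forall>\<tau>\<in>Od. \<exists>e. H \<tau> \<inter> \<Union>NP = {e}) \<and> 2 * card NP = card Od"
    proof (rule odd_pairs[OF finOd evO ne])
      show "\<exists>f\<in>H \<tau>. e \<inter> f = {}" if "\<tau> \<in> Od" "\<sigma> \<in> Od" "e \<in> H \<sigma>" for \<tau> \<sigma> e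
        using dj that OT by (meson subsetD)
      show "H \<sigma> \<inter> H \<tau> = {}" if "\<sigma> \<in> Od" "\<tau> \<in> Od" "\<sigma> \<noteq> \<tau>" for \<sigma> \<tau>
        using dH that OT by (meson subsetD)
    qed
    then show thesis by (elim exE conjE) (rule that)
  qed
  have par: "card (H \<tau> \<inter> \<Union>NP) \<le> 1 \<and> even (card (H \<tau> - \<Union>NP)) \<and> card (H \<tau>) \<le> card (H \<tau> - \<Union>NP) + 1"
    if \<tau>: "\<tau> \<in> Ty" for \<tau>
  proof (cases "\<tau> \<in> Od")
    case True
    obtain e where e: "H \<tau> \<inter> \<Union>NP = {e}" using bspec[OF NP(5) True] by (elim exE) (rule that)
    have eH: "e \<in> H \<tau>" using e by (metis IntD1 singletonI)
    have "H \<tau> - \<Union>NP = H \<tau> - (H \<tau> \<inter> \<Union>NP)" by (simp add: Diff_Int)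
    then have "H \<tau> - \<Union>NP = H \<tau> - {e}" unfolding e .
    with eH have "card (H \<tau> - \<Union>NP) = card (H \<tau>) - 1" by simp
    moreover have "odd (card (H \<tau>))" using True unfolding Od_def by simp
    ultimately show ?thesis unfolding e by (auto elim: oddE)
  next
    case False
    then have "H \<tau> \<inter> H \<sigma> = {}" if "\<sigma> \<in> Od" for \<sigma> using dH[OF \<tau>, of \<sigma>] that OT by blast
    then have e: "H \<tau> \<inter> \<Union>NP = {}" using NP(3) by blast
    then have "H \<tau> - \<Union>NP = H \<tau>" by blast
    then show ?thesis unfolding e using False \<tau> unfolding Od_def by simp
  qed
  have "\<forall>\<tau>\<in>Ty. \<exists>L. pair_partition (H \<tau> - \<Union>NP) L \<and> (\<forall>p\<in>L. matching_pair p)"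
  proof
    fix \<tau> assume \<tau>: "\<tau> \<in> Ty"
    show "\<exists>L. pair_partition (H \<tau> - \<Union>NP) L \<and> (\<forall>p\<in>L. matching_pair p)"
    proof (rule bipartite_pairing[where S = S])
      show "2 * card {e \<in> H \<tau> - \<Union>NP. v \<in> e} \<le> card (H \<tau> - \<Union>NP)" for v
      proof -
        have "card {e \<in> H \<tau> - \<Union>NP. v \<in> e} \<le> card {e \<in> H \<tau>. v \<in> e}"
          using finH[OF \<tau>] by (intro card_mono) auto
        then show ?thesis using deg[OF \<tau>, of v] par[OF \<tau>] by linarith
      qed
    qed (use finH[OF \<tau>] bip[OF \<tau>] par[OF \<tau>] in auto)
  qed
  then obtain LP where "\<forall>\<tau>\<in>Ty. pair_partition (H \<tau> - \<Union>NP) (LP \<tau>) \<and> (\<forall>p\<in>LP \<tau>. matching_pair p)"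
    unfolding bchoice_iff by blast
  moreover have "2 * card NP \<le> card Ty" using NP(6) card_mono[OF finT OT] by simp
  moreover have "\<Union>NP \<subseteq> (\<Union>\<tau>\<in>Ty. H \<tau>)" using NP(3) OT by blast
  ultimately show ?thesis using NP(1,2,4) par by blast
qed

section \<open>Packings of star pairs\<close>

text \<open>Here \<open>cr\<close> is the set of crossing edges, which is bipartite with respect to \<open>S\<close>, and \<open>ty\<close> is a
  fixed assignment of types to them. Typing is needed because a local colour only uses edges of one type.\<close>
locale typed_bipartite =
  fixes cr :: "'a set set" and S V0 :: "'a set" and Ty :: "'t set" and ty :: "'a set \<Rightarrow> 't"
  assumes fin_cr: "finite cr" and fin_Ty: "finite Ty"
    and bip: "\<And>e. e \<in> cr \<Longrightarrow> \<exists>x y. e = {x, y} \<and> x \<in> S \<and> y \<notin> S"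
    and ty_in: "\<And>e. e \<in> cr \<Longrightarrow> ty e \<in> Ty"
begin

definition star_packing :: "'a set set set \<Rightarrow> bool" where
  "star_packing Q \<longleftrightarrow> disjoint Q \<and> (\<forall>p\<in>Q. star_pair V0 p \<and> (\<exists>\<tau>. p \<subseteq> {e \<in> cr. ty e = \<tau>}))"

text \<open>The edges of type \<open>\<tau>\<close> that are left for seeds and other matching pairs.\<close>
definition rest :: "'a set set set \<Rightarrow> 't \<Rightarrow> 'a set set" where
  "rest Q \<tau> = {e \<in> cr - \<Union>Q. ty e = \<tau>}"

text \<open>The parameters are the degree bound \<open>r\<close> in each type, the least number \<open>lo\<close> of edges in each type and
  the least total \<open>tot\<close>. In the application \<open>tot\<close> is twice the number of colours, since each colour
  needs two edges for its seed.\<close>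
definition admissible :: "nat \<Rightarrow> nat \<Rightarrow> nat \<Rightarrow> 'a set set set \<Rightarrow> bool" where
  "admissible r lo tot Q \<longleftrightarrow> star_packing Q \<and> (\<forall>\<tau>\<in>Ty. \<forall>v. card {e \<in> rest Q \<tau>. v \<in> e} \<le> r) \<and>
     (\<forall>\<tau>\<in>Ty. lo \<le> card (rest Q \<tau>)) \<and> tot \<le> card (cr - \<Union>Q)"

lemma packing_sub: "star_packing Q \<Longrightarrow> \<Union>Q \<subseteq> cr"
  unfolding star_packing_def by blast

lemma packing_finite: assumes "star_packing Q" shows "finite Q"
  using packing_sub[OF assms] fin_cr by (metis finite_UnionD finite_subset)

lemma packing_card: assumes "star_packing Q" shows "card (\<Union>Q) = 2 * card Q"
proof -
  have "pair_partition (\<Union>Q) Q"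
    using assms star_pair_card unfolding star_packing_def pair_partition_def by blast
  then show ?thesis using pair_partition_card(2) packing_sub[OF assms] fin_cr finite_subset by blast
qed

lemma rest_finite: "finite (rest Q \<tau>)"
  unfolding rest_def using fin_cr by simp

lemma rest_sub: "rest Q \<tau> \<subseteq> cr"
  unfolding rest_def by auto

lemma rest_Union: "(\<Union>\<tau>\<in>Ty. rest Q \<tau>) = cr - \<Union>Q"
  unfolding rest_def using ty_in by auto

lemma rest_sum: "(\<Sum>\<tau>\<in>Ty. card (rest Q \<tau>)) = card (cr - \<Union>Q)"
proof -
  have "card (\<Union>\<tau>\<in>Ty. rest Q \<tau>) = (\<Sum>\<tau>\<in>Ty. card (rest Q \<tau>))"
    using fin_Ty rest_finite by (intro card_UN_disjoint) (auto simp: rest_def)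
  then show ?thesis unfolding rest_Union by simp
qed

text \<open>Pairs that are not seeds are hard to place at vertices of large degree, so as many star pairs as
  possible are taken out. In a largest admissible packing, a further star pair would violate the
  total or the bound on its type. It would lower both counts by 2, and the total is even; so the total
  is exactly \<open>tot\<close>, or the type has at most \<open>lo + 1\<close> edges.\<close>
lemma maximal_admissible:
  assumes Q0: "admissible r lo tot Q0" and ev: "even (card cr)" "even tot"
  shows "\<exists>Q. admissible r lo tot Q \<and> (card (cr - \<Union>Q) = tot \<or>
    (\<forall>\<tau>\<in>Ty. card (rest Q \<tau>) \<le> lo + 1 \<or> (\<forall>p. star_pair V0 p \<longrightarrow> \<not> p \<subseteq> rest Q \<tau>)))"
proof -
  have bd: "card Q \<le> card cr" if "admissible r lo tot Q" for Q
    using packing_card[of Q] card_mono[OF fin_cr packing_sub[of Q]] that unfolding admissible_def by auto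
  obtain Q where Q: "admissible r lo tot Q" and max: "\<And>Q'. admissible r lo tot Q' \<Longrightarrow> card Q' \<le> card Q"
  proof -
    have "\<exists>x. admissible r lo tot x \<and> (\<forall>y. admissible r lo tot y \<longrightarrow> card y \<le> card x)"
      using Q0 bd by (intro ex_has_greatest_nat[of _ Q0 _ "Suc (card cr)"]) (auto simp: less_Suc_eq_le)
    then show thesis using that by blast
  qed
  have pk: "star_packing Q" using Q unfolding admissible_def by simp
  have "card (rest Q \<tau>) \<le> lo + 1 \<or> (\<forall>p. star_pair V0 p \<longrightarrow> \<not> p \<subseteq> rest Q \<tau>)"
    if ne: "card (cr - \<Union>Q) \<noteq> tot" and \<tau>: "\<tau> \<in> Ty" for \<tau>
  proof (rule ccontr)
    assume "\<not> ?thesis"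
    then obtain p where big: "lo + 2 \<le> card (rest Q \<tau>)" and p: "star_pair V0 p" "p \<subseteq> rest Q \<tau>" by auto
    have c2: "card p = 2" using star_pair_card p by blast
    have fp: "finite p" using c2 by (simp add: card_ge_0_finite)
    let ?Q = "insert p Q"
    have pQ: "p \<inter> \<Union>Q = {}" using p(2) unfolding rest_def by auto
    have pcr: "p \<subseteq> cr - \<Union>Q" "\<And>e. e \<in> p \<Longrightarrow> ty e = \<tau>" using p(2) unfolding rest_def by auto
    have pk': "star_packing ?Q"
    proof -
      have "disjoint ?Q" using pk pQ unfolding star_packing_def by (auto simp: disjoint_def)
      moreover have "p \<subseteq> {e \<in> cr. ty e = \<tau>}" using pcr by auto
      ultimately show ?thesis using pk p(1) unfolding star_packing_def by blast
    qed
    have cU: "cr - \<Union>?Q = cr - \<Union>Q - p" by auto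
    have card1: "card (cr - \<Union>?Q) = card (cr - \<Union>Q) - 2"
      unfolding cU using pcr(1) fp c2 by (simp add: card_Diff_subset)
    have evr: "even (card (cr - \<Union>Q))"
    proof -
      have fU: "finite (\<Union>Q)" using packing_sub[OF pk] fin_cr finite_subset by blast
      have "card (cr - \<Union>Q) + 2 * card Q = card cr"
        using packing_card[OF pk] card_Diff_subset[OF fU packing_sub[OF pk]] card_mono[OF fin_cr packing_sub[OF pk]] by simp
      then show ?thesis using ev by (metis dvd_add_left_iff dvd_triv_left)
    qed
    have "tot \<le> card (cr - \<Union>Q)" using Q unfolding admissible_def by simp
    then have "tot + 2 \<le> card (cr - \<Union>Q)" using ne evr ev(2) by presburger
    then have tot': "tot \<le> card (cr - \<Union>?Q)" using card1 by simp
    have restp: "rest ?Q \<sigma> = (if \<sigma> = \<tau> then rest Q \<sigma> - p else rest Q \<sigma>)" for \<sigma>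
      using pcr unfolding rest_def by auto
    have lo': "lo \<le> card (rest ?Q \<sigma>)" if "\<sigma> \<in> Ty" for \<sigma>
    proof (cases "\<sigma> = \<tau>")
      case True
      have "card (rest Q \<tau> - p) = card (rest Q \<tau>) - 2" using p(2) fp c2 by (simp add: card_Diff_subset)
      then show ?thesis using True big unfolding restp by simp
    next
      case False
      then show ?thesis using Q that unfolding restp admissible_def by simp
    qed
    have "card {e \<in> rest ?Q \<sigma>. v \<in> e} \<le> r" if "\<sigma> \<in> Ty" for \<sigma> v
    proof -
      have "card {e \<in> rest ?Q \<sigma>. v \<in> e} \<le> card {e \<in> rest Q \<sigma>. v \<in> e}"
        using rest_finite[of Q] unfolding restp by (intro card_mono) auto
      moreover have "card {e \<in> rest Q \<sigma>. v \<in> e} \<le> r" using Q that unfolding admissible_def by blast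
      ultimately show ?thesis by linarith
    qed
    then have "admissible r lo tot ?Q" using pk' lo' tot' unfolding admissible_def by blast
    then have "card ?Q \<le> card Q" by (rule max)
    moreover have "p \<noteq> {}" using c2 by auto
    then have "p \<notin> Q" using pQ by blast
    ultimately show False using packing_finite[OF pk] by simp
  qed
  then show ?thesis using Q by blast
qed

end

section \<open>Choosing the seeds\<close>

lemma subset_between:
  assumes "finite Y" "X \<subseteq> Y" "card X \<le> k" "k \<le> card Y"
  shows "\<exists>Z. X \<subseteq> Z \<and> Z \<subseteq> Y \<and> card Z = k"
proof -
  have fX: "finite X" using assms finite_subset by blast
  have "k - card X \<le> card (Y - X)" using assms fX by (simp add: card_Diff_subset)
  then obtain W where W: "W \<subseteq> Y - X" "card W = k - card X" by (meson obtain_subset_with_card_n)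
  have "card (X \<union> W) = card X + card W"
    using W fX assms(1) finite_subset by (intro card_Un_disjoint) blast+
  then show ?thesis using W assms by (intro exI[of _ "X \<union> W"]) auto
qed

lemma matching_pair_incident: "matching_pair p \<Longrightarrow> card {e \<in> p. v \<in> e} \<le> 1"
proof -
  assume "matching_pair p"
  then obtain e f where "p = {e, f}" "e \<inter> f = {}" unfolding matching_pair_def by blast
  then have "{e \<in> p. v \<in> e} \<subseteq> {if v \<in> e then e else f}" by auto
  then show ?thesis using card_mono[of "{if v \<in> e then e else f}"] by simp
qed

lemma matching_pairs_incident:
  assumes "finite P" "\<And>p. p \<in> P \<Longrightarrow> matching_pair p"
  shows "card {e \<in> \<Union>P. v \<in> e} \<le> card P"
proof -
  have "{e \<in> \<Union>P. v \<in> e} = (\<Union>p\<in>P. {e \<in> p. v \<in> e})" by auto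
  then have "card {e \<in> \<Union>P. v \<in> e} \<le> (\<Sum>p\<in>P. card {e \<in> p. v \<in> e})"
    by (simp only: card_UN_le[OF assms(1)])
  also have "\<dots> \<le> (\<Sum>p\<in>P. 1)" by (intro sum_mono matching_pair_incident assms(2))
  finally show ?thesis by simp
qed

context typed_bipartite
begin

text \<open>In a type without star pairs, each \<open>v\<close> in \<open>V\<^sub>0\<close> has at most one edge leaving \<open>V\<^sub>0\<close>; so \<open>v\<close> has low degree
  there, and leftover pairs of this type can be placed greedily.\<close>
lemma rest_without_stars:
  assumes free: "\<And>p. star_pair V0 p \<Longrightarrow> \<not> p \<subseteq> rest Q \<tau>"
    and lowA: "\<And>v. v \<notin> V0 \<Longrightarrow> card {e \<in> cr. v \<in> e} \<le> b"
    and lowV: "\<And>v. v \<in> V0 \<Longrightarrow> card {e \<in> cr. v \<in> e \<and> e \<subseteq> V0} \<le> b"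
  shows "card {e \<in> rest Q \<tau>. v \<in> e} \<le> b + 1"
proof (cases "v \<in> V0")
  case False
  have "card {e \<in> rest Q \<tau>. v \<in> e} \<le> card {e \<in> cr. v \<in> e}"
    using fin_cr rest_sub by (intro card_mono) auto
  then show ?thesis using lowA[OF False] by linarith
next
  case True
  let ?E = "{e \<in> rest Q \<tau>. v \<in> e \<and> \<not> e \<subseteq> V0}"
  have "e = f" if ef: "e \<in> ?E" "f \<in> ?E" for e f
  proof (rule ccontr)
    assume ne: "e \<noteq> f"
    have form: "\<exists>x. x \<notin> V0 \<and> g = {v, x}" if g: "g \<in> ?E" for g
    proof -
      obtain x y where "g = {x, y}" using bip[of g] g rest_sub by blast
      then show ?thesis using g True by auto
    qed
    obtain x where x: "x \<notin> V0" "e = {v, x}" using form[OF ef(1)] by blast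
    obtain y where y: "y \<notin> V0" "f = {v, y}" using form[OF ef(2)] by blast
    have "star_pair V0 {e, f}" unfolding star_pair_def
      using True x y ne by blast
    moreover have "{e, f} \<subseteq> rest Q \<tau>" using ef by auto
    ultimately show False using free by blast
  qed
  moreover have "finite ?E" using rest_finite[of Q \<tau>] by simp
  ultimately have c1: "card ?E \<le> 1" by (simp add: card_le_Suc0_iff_eq)
  have "{e \<in> rest Q \<tau>. v \<in> e} \<subseteq> ?E \<union> {e \<in> cr. v \<in> e \<and> e \<subseteq> V0}" using rest_sub by auto
  then have "card {e \<in> rest Q \<tau>. v \<in> e} \<le> card (?E \<union> {e \<in> cr. v \<in> e \<and> e \<subseteq> V0})"
    using fin_cr rest_finite[of Q \<tau>] by (intro card_mono) auto
  also have "\<dots> \<le> card ?E + card {e \<in> cr. v \<in> e \<and> e \<subseteq> V0}" by (rule card_Un_le)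
  finally show ?thesis using c1 lowV[OF True] by linarith
qed

text \<open>\<open>LP \<tau>\<close> are the pairs whose edges both have type \<open>\<tau>\<close>, \<open>SS \<tau>\<close> the seeds of the \<open>t'\<close> local colours of type
  \<open>\<tau>\<close>, and \<open>NS\<close> the seeds of the nonlocal colours, which may mix types. The clause about
  \<open>LP \<tau> - SS \<tau> - NS\<close> says that leftover pairs occur only in types of low degree. The last clause keeps
  the nonlocal seeds from using up too many edges of one type at one vertex: the bound \<open>3l/2 + 1\<close>
  is below \<open>2l\<close>, the amount by which having \<open>t - l\<close> instead of \<open>t\<close> local colours reduces the demand
  of \<open>v\<close> in each type.\<close>
definition seed_system ::
  "nat \<Rightarrow> nat \<Rightarrow> nat \<Rightarrow> 'a set set set \<Rightarrow> ('t \<Rightarrow> 'a set set set) \<Rightarrow> ('t \<Rightarrow> 'a set set set) \<Rightarrow> 'a set set set \<Rightarrow> bool"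
where
  "seed_system l t' b Q LP SS NS \<longleftrightarrow>
    pair_partition (cr - \<Union>Q) ((\<Union>\<tau>\<in>Ty. LP \<tau>) \<union> NS) \<and>
    (\<forall>p\<in>(\<Union>\<tau>\<in>Ty. LP \<tau>) \<union> NS. matching_pair p) \<and>
    (\<forall>\<tau>\<in>Ty. SS \<tau> \<subseteq> LP \<tau> \<and> card (SS \<tau>) = t' \<and> \<Union>(LP \<tau>) \<subseteq> rest Q \<tau> \<and> SS \<tau> \<inter> NS = {}) \<and>
    card NS = card Ty * l \<and>
    (\<forall>\<tau>\<in>Ty. \<forall>p\<in>LP \<tau> - SS \<tau> - NS. \<forall>v. card {e \<in> rest Q \<tau>. v \<in> e} \<le> b + 1) \<and>
    (\<forall>\<tau>\<in>Ty. \<forall>v. 2 * card {e \<in> rest Q \<tau>. v \<in> e \<and> e \<in> \<Union>NS} \<le> 3 * l + 2)"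

text \<open>The pairs that have to be nonlocal seeds are those across types and the leftover pairs in types that
  contain star pairs. By the dichotomy for maximal packings, either there are exactly \<open>card Ty * l\<close>
  pairs beyond the local seeds, or each such type has at most \<open>lo + 1 < 2t\<close> edges and hence fewer than
  \<open>l\<close> leftover pairs. In both cases \<open>card Ty * l\<close> nonlocal seeds can include all of them.\<close>
lemma seed_choice:
  assumes adm: "admissible r lo (2 * (card Ty * t)) Q"
    and dich: "card (cr - \<Union>Q) = 2 * (card Ty * t) \<or>
      (\<forall>\<tau>\<in>Ty. card (rest Q \<tau>) \<le> lo + 1 \<or> (\<forall>p. star_pair V0 p \<longrightarrow> \<not> p \<subseteq> rest Q \<tau>))"
    and evcr: "even (card cr)"
    and num: "2 * r + 1 \<le> lo" "lo + s = 2 * t" "2 \<le> s" "card Ty * s \<le> l" "t' + l = t" "b + 1 \<le> l"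
    and lowA: "\<And>v. v \<notin> V0 \<Longrightarrow> card {e \<in> cr. v \<in> e} \<le> b"
    and lowV: "\<And>v. v \<in> V0 \<Longrightarrow> card {e \<in> cr. v \<in> e \<and> e \<subseteq> V0} \<le> b"
    and Ty0: "Ty \<noteq> {}"
  shows "\<exists>LP SS NS. seed_system l t' b Q LP SS NS"
proof -
  have pk: "star_packing Q" and degr: "\<And>\<tau> v. \<tau> \<in> Ty \<Longrightarrow> card {e \<in> rest Q \<tau>. v \<in> e} \<le> r"
    and hlo: "\<And>\<tau>. \<tau> \<in> Ty \<Longrightarrow> lo \<le> card (rest Q \<tau>)" and tot: "2 * (card Ty * t) \<le> card (cr - \<Union>Q)"
    using adm unfolding admissible_def by auto
  have evH: "even (card (cr - \<Union>Q))"
  proof -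
    have fU: "finite (\<Union>Q)" using packing_sub[OF pk] fin_cr finite_subset by blast
    have "card (cr - \<Union>Q) + 2 * card Q = card cr"
      using packing_card[OF pk] card_Diff_subset[OF fU packing_sub[OF pk]] card_mono[OF fin_cr packing_sub[OF pk]] by simp
    then show ?thesis using evcr by (metis dvd_add_left_iff dvd_triv_left)
  qed
  have dR: "rest Q \<sigma> \<inter> rest Q \<tau> = {}" if "\<sigma> \<noteq> \<tau>" for \<sigma> \<tau> using that unfolding rest_def by auto
  have fp: "\<exists>LP NP. disjoint NP \<and> (\<forall>p\<in>NP. matching_pair p) \<and> \<Union>NP \<subseteq> (\<Union>\<tau>\<in>Ty. rest Q \<tau>) \<and> finite NP \<and>
     2 * card NP \<le> card Ty \<and> (\<forall>\<tau>\<in>Ty. card (rest Q \<tau> \<inter> \<Union>NP) \<le> 1) \<and>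
     (\<forall>\<tau>\<in>Ty. pair_partition (rest Q \<tau> - \<Union>NP) (LP \<tau>) \<and> (\<forall>p\<in>LP \<tau>. matching_pair p))"
  proof (rule family_pairing[where S = S])
    show "2 * card {e \<in> rest Q \<tau>. v \<in> e} + 1 \<le> card (rest Q \<tau>)" if "\<tau> \<in> Ty" for \<tau> v
      using degr[OF that, of v] hlo[OF that] num(1) by linarith
    show "even (\<Sum>\<tau>\<in>Ty. card (rest Q \<tau>))" using rest_sum evH by simp
    show "\<exists>x y. e = {x, y} \<and> x \<in> S \<and> y \<notin> S" if "e \<in> rest Q \<tau>" for \<tau> e
      using bip that rest_sub by blast
  qed (use fin_Ty rest_finite dR in auto)
  obtain LP NP where NP1: "disjoint NP" and NP2: "\<forall>p\<in>NP. matching_pair p"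
    and NP3: "\<Union>NP \<subseteq> (\<Union>\<tau>\<in>Ty. rest Q \<tau>)" and NP4: "finite NP" and NP5: "2 * card NP \<le> card Ty"
    and NP6: "\<forall>\<tau>\<in>Ty. card (rest Q \<tau> \<inter> \<Union>NP) \<le> 1"
    and LP0: "\<forall>\<tau>\<in>Ty. pair_partition (rest Q \<tau> - \<Union>NP) (LP \<tau>) \<and> (\<forall>p\<in>LP \<tau>. matching_pair p)"
    using fp by (elim exE conjE) (rule that)
  have LPp: "pair_partition (rest Q \<tau> - \<Union>NP) (LP \<tau>)" and LPm: "\<And>p. p \<in> LP \<tau> \<Longrightarrow> matching_pair p"
    if "\<tau> \<in> Ty" for \<tau> using LP0 that by blast+
  have LPU: "\<Union>(LP \<tau>) = rest Q \<tau> - \<Union>NP" and LPd: "disjoint (LP \<tau>)" and LPf: "finite (LP \<tau>)"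
    and LPc: "2 * card (LP \<tau>) \<le> card (rest Q \<tau>)" "card (rest Q \<tau>) \<le> 2 * card (LP \<tau>) + 1"
    if \<tau>: "\<tau> \<in> Ty" for \<tau>
  proof -
    show "\<Union>(LP \<tau>) = rest Q \<tau> - \<Union>NP" "disjoint (LP \<tau>)" using LPp[OF \<tau>] unfolding pair_partition_def by auto
    have f: "finite (rest Q \<tau> - \<Union>NP)" using rest_finite by simp
    show "finite (LP \<tau>)" using pair_partition_card(1)[OF LPp[OF \<tau>] f] .
    have c: "card (rest Q \<tau> - \<Union>NP) = 2 * card (LP \<tau>)" using pair_partition_card(2)[OF LPp[OF \<tau>] f] .
    have "card (rest Q \<tau>) = card (rest Q \<tau> \<inter> \<Union>NP) + card (rest Q \<tau> - \<Union>NP)"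
      using rest_finite[of Q \<tau>] by (metis card_Int_Diff)
    then show "2 * card (LP \<tau>) \<le> card (rest Q \<tau>)" "card (rest Q \<tau>) \<le> 2 * card (LP \<tau>) + 1"
      using c NP6 \<tau> by force+
  qed
  have ne: "p \<noteq> {}" if "matching_pair p" for p using that unfolding matching_pair_def by auto
  have LPdisj: "LP \<sigma> \<inter> LP \<tau> = {}" if "\<sigma> \<in> Ty" "\<tau> \<in> Ty" "\<sigma> \<noteq> \<tau>" for \<sigma> \<tau>
  proof (rule ccontr)
    assume "LP \<sigma> \<inter> LP \<tau> \<noteq> {}"
    then obtain p where p: "p \<in> LP \<sigma>" "p \<in> LP \<tau>" by blast
    then have "p \<subseteq> rest Q \<sigma>" "p \<subseteq> rest Q \<tau>" using LPU[OF that(1)] LPU[OF that(2)] by blast+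
    then show False using dR[OF that(3)] ne[OF LPm[OF that(1) p(1)]] by blast
  qed
  define LA where "LA = (\<Union>\<tau>\<in>Ty. LP \<tau>)"
  have LAU: "\<Union>LA = (cr - \<Union>Q) - \<Union>NP"
  proof -
    have "\<Union>LA = (\<Union>\<tau>\<in>Ty. \<Union>(LP \<tau>))" unfolding LA_def by blast
    also have "\<dots> = (\<Union>\<tau>\<in>Ty. rest Q \<tau> - \<Union>NP)" using LPU by simp
    also have "\<dots> = (\<Union>\<tau>\<in>Ty. rest Q \<tau>) - \<Union>NP" by blast
    finally show ?thesis unfolding rest_Union .
  qed
  have LAm: "matching_pair p" if "p \<in> LA" for p using that LPm unfolding LA_def by blast
  have LAf: "finite LA" unfolding LA_def using fin_Ty LPf by blast
  have LANP: "LA \<inter> NP = {}"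
  proof (rule ccontr)
    assume "LA \<inter> NP \<noteq> {}"
    then obtain p where p: "p \<in> LA" "p \<in> NP" by blast
    then have "p \<subseteq> \<Union>NP" "p \<inter> \<Union>NP = {}" using LAU by blast+
    then show False using ne[OF LAm[OF p(1)]] by blast
  qed
  have PP: "pair_partition (cr - \<Union>Q) (LA \<union> NP)"
    unfolding pair_partition_def
  proof (intro conjI ballI)
    show "\<Union>(LA \<union> NP) = cr - \<Union>Q" using LAU NP3 rest_Union by auto
    show "card p = 2" if "p \<in> LA \<union> NP" for p using that LAm NP2 matching_pair_card by blast
    show "disjoint (LA \<union> NP)"
      unfolding disjoint_def
    proof (intro ballI impI)
      fix p q assume pq: "p \<in> LA \<union> NP" "q \<in> LA \<union> NP" "p \<noteq> q"
      have cross: "p \<inter> q = {}" if "p \<in> LA" "q \<in> NP" for p q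
        using that LAU by blast
      have LL: "p \<inter> q = {}" if L: "p \<in> LA" "q \<in> LA" "p \<noteq> q" for p q
      proof -
        obtain \<sigma> \<tau> where st: "\<sigma> \<in> Ty" "\<tau> \<in> Ty" "p \<in> LP \<sigma>" "q \<in> LP \<tau>" using L unfolding LA_def by blast
        show ?thesis
        proof (cases "\<sigma> = \<tau>")
          case True
          then show ?thesis using LPd[OF st(2)] st L(3) unfolding disjoint_def by blast
        next
          case False
          have "p \<subseteq> rest Q \<sigma>" "q \<subseteq> rest Q \<tau>" using LPU[OF st(1)] LPU[OF st(2)] st by blast+
          then show ?thesis using dR[OF False] by blast
        qed
      qed
      have NN: "p \<inter> q = {}" if "p \<in> NP" "q \<in> NP" "p \<noteq> q" for p q
        using NP1 that unfolding disjoint_def by blast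
      show "p \<inter> q = {}" using pq cross[of p q] cross[of q p] LL[of p q] NN[of p q]
        by (simp add: Int_commute) blast
    qed
  qed
  have cH: "card (cr - \<Union>Q) = 2 * card (LA \<union> NP)"
    using pair_partition_card(2)[OF PP] fin_cr by simp
  have t'LP: "t' \<le> card (LP \<tau>)" if "\<tau> \<in> Ty" for \<tau>
  proof -
    have "card Ty \<ge> 1" using Ty0 fin_Ty by (simp add: Suc_leI card_gt_0_iff)
    then have "1 * s \<le> card Ty * s" by (intro mult_right_mono) auto
    then have "s \<le> l" using num(4) by linarith
    then show ?thesis using LPc[OF that] hlo[OF that] num(2,3,5) by linarith
  qed
  have "\<forall>\<tau>\<in>Ty. \<exists>X. X \<subseteq> LP \<tau> \<and> card X = t'" using t'LP by (meson obtain_subset_with_card_n)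
  then obtain SS where SS: "\<And>\<tau>. \<tau> \<in> Ty \<Longrightarrow> SS \<tau> \<subseteq> LP \<tau>" "\<And>\<tau>. \<tau> \<in> Ty \<Longrightarrow> card (SS \<tau>) = t'"
    unfolding bchoice_iff by blast
  have SSf: "finite (SS \<tau>)" if "\<tau> \<in> Ty" for \<tau> using SS(1)[OF that] LPf[OF that] finite_subset by blast
  define SA where "SA = (\<Union>\<tau>\<in>Ty. SS \<tau>)"
  have SALA: "SA \<subseteq> LA" unfolding SA_def LA_def using SS(1) by blast
  have cSA: "card SA = card Ty * t'"
  proof -
    have "SS \<sigma> \<inter> SS \<tau> = {}" if "\<sigma> \<in> Ty" "\<tau> \<in> Ty" "\<sigma> \<noteq> \<tau>" for \<sigma> \<tau>
      using LPdisj[OF that] SS(1)[OF that(1)] SS(1)[OF that(2)] by blast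
    then have "card SA = (\<Sum>\<tau>\<in>Ty. card (SS \<tau>))"
      unfolding SA_def using fin_Ty SSf by (intro card_UN_disjoint) auto
    then show ?thesis using SS(2) by simp
  qed
  define free where "free \<tau> \<longleftrightarrow> (\<forall>p. star_pair V0 p \<longrightarrow> \<not> p \<subseteq> rest Q \<tau>)" for \<tau>
  define Y where "Y = (LA \<union> NP) - SA"
  \<comment> \<open>\<open>X\<close> must be contained in the set of nonlocal seeds, \<open>Y\<close> must contain it.\<close>
  define X where "X = NP \<union> (\<Union>\<tau>\<in>{\<tau>\<in>Ty. \<not> free \<tau>}. LP \<tau> - SS \<tau>)"
  have fY: "finite Y" unfolding Y_def using LAf NP4 by simp
  have SLP: "p \<in> SS \<tau>" if "p \<in> SA" "p \<in> LP \<tau>" "\<tau> \<in> Ty" for p \<tau>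
  proof -
    obtain \<sigma> where s: "\<sigma> \<in> Ty" "p \<in> SS \<sigma>" using \<open>p \<in> SA\<close> unfolding SA_def by blast
    then have "p \<in> LP \<sigma>" using SS(1) by blast
    then have "\<sigma> = \<tau>" using LPdisj[OF s(1) that(3)] that(2) by blast
    then show ?thesis using s by simp
  qed
  have XY: "X \<subseteq> Y"
    unfolding X_def Y_def using SLP SALA LANP unfolding LA_def by blast
  have cY: "2 * card Y + 2 * (card Ty * t') = card (cr - \<Union>Q)"
  proof -
    have "SA \<subseteq> LA \<union> NP" using SALA by blast
    moreover have "finite SA" using SALA LAf finite_subset by blast
    ultimately have "card Y = card (LA \<union> NP) - card SA" "card SA \<le> card (LA \<union> NP)"
      unfolding Y_def using LAf NP4 by (auto simp: card_Diff_subset intro: card_mono)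
    then show ?thesis using cH cSA by simp
  qed
  have tt: "card Ty * t = card Ty * t' + card Ty * l" using num(5) by (metis distrib_left)
  have cY': "card Ty * l \<le> card Y" using cY tot tt by linarith
  have cX: "card X \<le> card Ty * l"
  proof (cases "card (cr - \<Union>Q) = 2 * (card Ty * t)")
    case True
    then have "card Y = card Ty * l" using cY tt by linarith
    then show ?thesis using card_mono[OF fY XY] by simp
  next
    case False
    then have small: "card (rest Q \<tau>) \<le> lo + 1" if "\<tau> \<in> Ty" "\<not> free \<tau>" for \<tau>
      using dich that unfolding free_def by blast
    let ?N = "{\<tau>\<in>Ty. \<not> free \<tau>}"
    have fN: "finite ?N" using fin_Ty by simp
    have "card X \<le> card NP + card (\<Union>\<tau>\<in>?N. LP \<tau> - SS \<tau>)" unfolding X_def by (rule card_Un_le)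
    moreover have "card (\<Union>\<tau>\<in>?N. LP \<tau> - SS \<tau>) \<le> (\<Sum>\<tau>\<in>?N. card (LP \<tau> - SS \<tau>))" by (rule card_UN_le[OF fN])
    moreover have "(\<Sum>\<tau>\<in>?N. 2 * card (LP \<tau> - SS \<tau>)) \<le> (\<Sum>\<tau>\<in>?N. 2 * l - 1)"
    proof (rule sum_mono)
      fix \<tau> assume "\<tau> \<in> ?N"
      then have \<tau>: "\<tau> \<in> Ty" "\<not> free \<tau>" by auto
      have "card (LP \<tau> - SS \<tau>) = card (LP \<tau>) - t'" using SS[OF \<tau>(1)] SSf[OF \<tau>(1)] by (simp add: card_Diff_subset)
      then show "2 * card (LP \<tau> - SS \<tau>) \<le> 2 * l - 1"
        using small[OF \<tau>] LPc(1)[OF \<tau>(1)] num(2,3,5,6) by linarith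
    qed
    moreover have "(\<Sum>\<tau>\<in>?N. 2 * l - 1) \<le> card Ty * (2 * l - 1)"
      using card_mono[OF fin_Ty, of ?N] by (auto intro!: mult_right_mono)
    moreover have "(\<Sum>\<tau>\<in>?N. 2 * card (LP \<tau> - SS \<tau>)) = 2 * (\<Sum>\<tau>\<in>?N. card (LP \<tau> - SS \<tau>))"
      by (simp add: sum_distrib_left)
    \<comment> \<open>The pairs across types number at most half of \<open>card Ty\<close>; this uses up the \<open>- 1\<close> gained in each type.\<close>
    moreover have "card Ty * (2 * l - 1) + card Ty = 2 * (card Ty * l)"
    proof -
      have "2 * l - 1 + 1 = 2 * l" using num(6) by simp
      then have "card Ty * (2 * l - 1 + 1) = card Ty * (2 * l)" by simp
      then show ?thesis by (simp add: distrib_left)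
    qed
    ultimately show ?thesis using NP5 by linarith
  qed
  obtain NS where NS: "X \<subseteq> NS" "NS \<subseteq> Y" "card NS = card Ty * l"
    using subset_between[OF fY XY cX cY'] by blast
  have LNS: "LA \<union> NS = LA \<union> NP" using NS(1,2) unfolding X_def Y_def by blast
  show ?thesis
    unfolding seed_system_def
  proof (rule exI[of _ LP], rule exI[of _ SS], rule exI[of _ NS], intro conjI ballI allI)
    show "pair_partition (cr - \<Union>Q) (\<Union> (LP ` Ty) \<union> NS)" using PP LNS unfolding LA_def by simp
    show "matching_pair p" if "p \<in> \<Union> (LP ` Ty) \<union> NS" for p
    proof -
      have "p \<in> LA \<union> NP" using that LNS unfolding LA_def by blast
      then show ?thesis using LAm NP2 by blast
    qed
    show "card NS = card Ty * l" by (rule NS(3))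
    fix \<tau> assume \<tau>: "\<tau> \<in> Ty"
    show "SS \<tau> \<subseteq> LP \<tau>" "card (SS \<tau>) = t'" using SS[OF \<tau>] by auto
    show "\<Union>(LP \<tau>) \<subseteq> rest Q \<tau>" using LPU[OF \<tau>] by blast
    show "SS \<tau> \<inter> NS = {}" using NS(2) \<tau> unfolding Y_def SA_def by blast
    show "card {e \<in> rest Q \<tau>. v \<in> e} \<le> b + 1" if "p \<in> LP \<tau> - SS \<tau> - NS" for p v
    proof -
      have "free \<tau>"
      proof (rule ccontr)
        assume "\<not> free \<tau>"
        then have "LP \<tau> - SS \<tau> \<subseteq> X" unfolding X_def using \<tau> by blast
        then show False using that NS(1) by blast
      qed
      then show ?thesis using rest_without_stars[OF _ lowA lowV] unfolding free_def by blast
    qed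
    show "2 * card {e \<in> rest Q \<tau>. v \<in> e \<and> e \<in> \<Union>NS} \<le> 3 * l + 2" for v
    proof (cases "free \<tau>")
      case True
      have "card {e \<in> rest Q \<tau>. v \<in> e \<and> e \<in> \<Union>NS} \<le> card {e \<in> rest Q \<tau>. v \<in> e}"
        using rest_finite[of Q \<tau>] by (intro card_mono) auto
      also have "\<dots> \<le> b + 1" using rest_without_stars[OF _ lowA lowV] True unfolding free_def by blast
      finally show ?thesis using num(6) by linarith
    next
      case False
      have sub: "{e \<in> rest Q \<tau>. v \<in> e \<and> e \<in> \<Union>NS} \<subseteq> {e \<in> \<Union>(LP \<tau> - SS \<tau>). v \<in> e} \<union> (rest Q \<tau> \<inter> \<Union>NP)"
      proof
        fix e assume "e \<in> {e \<in> rest Q \<tau>. v \<in> e \<and> e \<in> \<Union>NS}"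
        then obtain p where e: "e \<in> rest Q \<tau>" "v \<in> e" "e \<in> p" "p \<in> NS" by blast
        then have "p \<in> LA \<union> NP" "p \<notin> SA" using NS(2) unfolding Y_def by auto
        then consider "p \<in> NP" | \<sigma> where "\<sigma> \<in> Ty" "p \<in> LP \<sigma>" unfolding LA_def by blast
        then show "e \<in> {e \<in> \<Union>(LP \<tau> - SS \<tau>). v \<in> e} \<union> (rest Q \<tau> \<inter> \<Union>NP)"
        proof cases
          case 1
          then show ?thesis using e by blast
        next
          case 2
          then have "e \<in> rest Q \<sigma>" using LPU[OF 2(1)] e by blast
          then have "\<sigma> = \<tau>" using e(1) dR[of \<sigma> \<tau>] by blast
          then have "p \<in> LP \<tau> - SS \<tau>" using 2 \<open>p \<notin> SA\<close> unfolding SA_def by blast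
          then show ?thesis using e by blast
        qed
      qed
      have fD: "finite (LP \<tau> - SS \<tau>)" using LPf[OF \<tau>] by simp
      have fUD: "finite {e \<in> \<Union>(LP \<tau> - SS \<tau>). v \<in> e}"
      proof (rule finite_subset[OF _ rest_finite[of Q \<tau>]])
        show "{e \<in> \<Union>(LP \<tau> - SS \<tau>). v \<in> e} \<subseteq> rest Q \<tau>" using LPU[OF \<tau>] by auto
      qed
      have "card {e \<in> rest Q \<tau>. v \<in> e \<and> e \<in> \<Union>NS}
         \<le> card ({e \<in> \<Union>(LP \<tau> - SS \<tau>). v \<in> e} \<union> (rest Q \<tau> \<inter> \<Union>NP))"
        using sub fUD rest_finite[of Q \<tau>] by (intro card_mono) auto
      also have "\<dots> \<le> card {e \<in> \<Union>(LP \<tau> - SS \<tau>). v \<in> e} + card (rest Q \<tau> \<inter> \<Union>NP)" by (rule card_Un_le)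
      also have "\<dots> \<le> card (LP \<tau> - SS \<tau>) + 1"
        using matching_pairs_incident[OF fD, of v] LPm[OF \<tau>] NP6 \<tau> by (intro add_mono) blast+
      also have "card (LP \<tau> - SS \<tau>) = card (LP \<tau>) - t'" using SS[OF \<tau>] SSf[OF \<tau>] by (simp add: card_Diff_subset)
      finally have c1: "card {e \<in> rest Q \<tau>. v \<in> e \<and> e \<in> \<Union>NS} \<le> card (LP \<tau>) - t' + 1" .
      \<comment> \<open>When the total is \<open>2 * card Ty * t\<close>, a type can exceed its share \<open>2t\<close> only by what the others
        lack, and each of them lacks at most \<open>s\<close>.\<close>
      have "card (rest Q \<tau>) \<le> 2 * t + l"
      proof (cases "card (cr - \<Union>Q) = 2 * (card Ty * t)")
        case True
        obtain k where k: "card Ty = Suc k" using \<tau> fin_Ty by (metis card_Suc_Diff1)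
        have "card (rest Q \<tau>) + (\<Sum>\<sigma>\<in>Ty - {\<tau>}. card (rest Q \<sigma>)) = 2 * (card Ty * t)"
          using rest_sum[of Q] True sum.remove[OF fin_Ty \<tau>, of "\<lambda>\<sigma>. card (rest Q \<sigma>)"] by simp
        moreover have "(\<Sum>\<sigma>\<in>Ty - {\<tau>}. lo) \<le> (\<Sum>\<sigma>\<in>Ty - {\<tau>}. card (rest Q \<sigma>))" using hlo by (intro sum_mono) auto
        moreover have "card (Ty - {\<tau>}) = k" using k \<tau> fin_Ty by simp
        ultimately have "card (rest Q \<tau>) + k * lo \<le> 2 * (Suc k * t)" using k by simp
        moreover have "k * lo + k * s = 2 * (k * t)" using num(2) by (metis distrib_left mult.left_commute)
        moreover have "k * s \<le> l" using num(4) k by simp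
        ultimately show ?thesis by simp
      next
        case f: False
        then have "card (rest Q \<tau>) \<le> lo + 1" using dich \<tau> False unfolding free_def by blast
        then show ?thesis using num(2,3) by linarith
      qed
      then show ?thesis using c1 LPc(1)[OF \<tau>] num(5) t'LP[OF \<tau>] by linarith
    qed
  qed
qed

end

section \<open>Colouring the crossing edges\<close>

lemma pairs_card:
  fixes P :: "'a set set set"
  assumes "finite P" "disjoint P" "\<And>p. p \<in> P \<Longrightarrow> card p = 2"
  shows "card (\<Union>P) = 2 * card P"
proof -
  have "pair_partition (\<Union>P) P" using assms unfolding pair_partition_def by simp
  moreover have "finite (\<Union>P)" using assms(1,3) by (intro finite_Union) (auto simp: card_ge_0_finite)
  ultimately show ?thesis by (rule pair_partition_card(2))
qed

text \<open>The items are matching pairs and star pairs, and items of equal colour are vertex-disjoint. So the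
  isolated edges of a colour class are exactly the edges of its matching pairs, two for each.\<close>
lemma item_classes:
  fixes Items :: "'a set set set" and f :: "'a set set \<Rightarrow> 'c"
  assumes fin: "finite Items" and dj: "disjoint Items"
    and kinds: "\<And>p. p \<in> Items \<Longrightarrow> matching_pair p \<or> star_pair V0 p"
    and sep: "\<And>p q. p \<in> Items \<Longrightarrow> q \<in> Items \<Longrightarrow> p \<noteq> q \<Longrightarrow> f p = f q \<Longrightarrow> \<Union>p \<inter> \<Union>q = {}"
  shows "\<exists>col. (\<forall>p\<in>Items. \<forall>e\<in>p. col e = f p) \<and>
    (\<forall>v c. card {e \<in> \<Union>Items. v \<in> e \<and> col e = c} \<le> 2) \<and>
    (\<forall>v c. v \<notin> V0 \<longrightarrow> card {e \<in> \<Union>Items. v \<in> e \<and> col e = c} \<le> 1) \<and>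
    (\<forall>c. card {e \<in> \<Union>Items. col e = c} = 2 * card {p \<in> Items. f p = c}) \<and>
    (\<forall>c v. (\<forall>p\<in>Items. f p = c \<longrightarrow> matching_pair p) \<longrightarrow> card {e \<in> \<Union>Items. v \<in> e \<and> col e = c} \<le> 1) \<and>
    (\<forall>c. \<forall>e\<in>{e \<in> \<Union>Items. col e = c}. \<forall>g\<in>{e \<in> \<Union>Items. col e = c}. e \<subseteq> V0 \<longrightarrow> g \<noteq> e \<longrightarrow> g \<inter> e = {}) \<and>
    (\<forall>c. card (isolated {e \<in> \<Union>Items. col e = c})
       = 2 * card {p \<in> Items. f p = c \<and> matching_pair p})"
proof -
  define col where "col e = f (THE p. p \<in> Items \<and> e \<in> p)" for e
  have col: "col e = f p" if "p \<in> Items" "e \<in> p" for e p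
  proof -
    have "(THE p. p \<in> Items \<and> e \<in> p) = p"
      using that dj unfolding disjoint_def by (intro the_equality) blast+
    then show ?thesis unfolding col_def by simp
  qed
  have c2: "card p = 2" if "p \<in> Items" for p using kinds[OF that] star_pair_card matching_pair_card by blast
  have finp: "finite p" if "p \<in> Items" for p using c2[OF that] by (simp add: card_ge_0_finite)
  have cls: "{e \<in> \<Union>Items. col e = c} = \<Union>{p \<in> Items. f p = c}" for c using col by auto
  have same: "p = q" if "p \<in> Items" "q \<in> Items" "f p = f q" "e \<in> p" "g \<in> q" "v \<in> e" "v \<in> g" for p q e g v
    using sep[of p q] that by blast
  have deg: "{e \<in> \<Union>Items. v \<in> e \<and> col e = c} = {} \<or>
     (\<exists>p\<in>Items. f p = c \<and> {e \<in> \<Union>Items. v \<in> e \<and> col e = c} = {e \<in> p. v \<in> e})" for v c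
  proof (cases "{e \<in> \<Union>Items. v \<in> e \<and> col e = c} = {}")
    case False
    then obtain e p where e: "p \<in> Items" "e \<in> p" "v \<in> e" "col e = c" by blast
    then have fp: "f p = c" using col by simp
    have "{e \<in> \<Union>Items. v \<in> e \<and> col e = c} = {e \<in> p. v \<in> e}"
    proof
      show "{e \<in> \<Union>Items. v \<in> e \<and> col e = c} \<subseteq> {e \<in> p. v \<in> e}"
      proof
        fix g assume "g \<in> {e \<in> \<Union>Items. v \<in> e \<and> col e = c}"
        then obtain q where q: "q \<in> Items" "g \<in> q" "v \<in> g" "col g = c" by blast
        then have "f q = c" using col by simp
        then have "p = q" using same[OF e(1) q(1) _ e(2) q(2) e(3) q(3)] fp by simp
        then show "g \<in> {e \<in> p. v \<in> e}" using q by simp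
      qed
      show "{e \<in> p. v \<in> e} \<subseteq> {e \<in> \<Union>Items. v \<in> e \<and> col e = c}" using col[OF e(1)] e(1) fp by auto
    qed
    then show ?thesis using e(1) fp by blast
  qed simp
  have degk: "card {e \<in> \<Union>Items. v \<in> e \<and> col e = c} \<le> k"
    if k: "\<And>p. p \<in> Items \<Longrightarrow> f p = c \<Longrightarrow> card {e \<in> p. v \<in> e} \<le> k" for v c k
    using deg[of v c]
  proof (elim disjE bexE conjE)
    assume e: "{e \<in> \<Union>Items. v \<in> e \<and> col e = c} = {}"
    show ?thesis unfolding e by simp
  next
    fix p assume p: "p \<in> Items" "f p = c" and e: "{e \<in> \<Union>Items. v \<in> e \<and> col e = c} = {e \<in> p. v \<in> e}"
    show ?thesis unfolding e using k[OF p] .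
  qed
  have star1: "card {e \<in> p. v \<in> e} \<le> 1" if st: "star_pair V0 p" and v: "v \<notin> V0" for p v
  proof -
    obtain w x y where w: "w \<in> V0" "x \<noteq> y" "p = {{w, x}, {w, y}}" using st unfolding star_pair_def by blast
    then have "{e \<in> p. v \<in> e} \<subseteq> {if v = x then {w, x} else {w, y}}" using v by auto
    then show ?thesis using card_mono[of "{if v = x then {w, x} else {w, y}}"] by simp
  qed
  have starV: "\<not> e \<subseteq> V0" if "star_pair V0 p" "e \<in> p" for e p using that unfolding star_pair_def by auto
  have starm: "\<exists>g\<in>p. g \<noteq> e \<and> g \<inter> e \<noteq> {}" if st: "star_pair V0 p" and e: "e \<in> p" for e p
  proof -
    obtain w x y where w: "x \<noteq> y" "p = {{w, x}, {w, y}}" using st unfolding star_pair_def by blast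
    then have "{w, x} \<noteq> {w, y}" by (simp add: doubleton_eq_iff)
    then show ?thesis using w e by auto
  qed
  have matm: "g \<inter> e = {}" if m: "matching_pair p" and "e \<in> p" "g \<in> p" "g \<noteq> e" for e g p
    using that unfolding matching_pair_def by blast
  have a1: "card {e \<in> \<Union>Items. v \<in> e \<and> col e = c} \<le> 2" for v c
  proof -
    have "card {e \<in> p. v \<in> e} \<le> 2" if "p \<in> Items" for p
      using card_mono[of p "{e \<in> p. v \<in> e}"] finp[OF that] c2[OF that] by simp
    then show ?thesis by (intro degk)
  qed
  have a2: "card {e \<in> \<Union>Items. v \<in> e \<and> col e = c} \<le> 1" if "v \<notin> V0" for v c
  proof -
    have "card {e \<in> p. v \<in> e} \<le> 1" if "p \<in> Items" for p
      using kinds[OF that] star1[of p v] matching_pair_incident[of p v] \<open>v \<notin> V0\<close> by blast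
    then show ?thesis by (intro degk)
  qed
  have a3: "card {e \<in> \<Union>Items. col e = c} = 2 * card {p \<in> Items. f p = c}" for c
    unfolding cls using fin dj c2 by (intro pairs_card) (auto simp: disjoint_def)
  have a4: "card {e \<in> \<Union>Items. v \<in> e \<and> col e = c} \<le> 1" if "\<forall>p\<in>Items. f p = c \<longrightarrow> matching_pair p" for v c
  proof -
    have "card {e \<in> p. v \<in> e} \<le> 1" if "p \<in> Items" "f p = c" for p
      using matching_pair_incident[of p v] that \<open>\<forall>p\<in>Items. f p = c \<longrightarrow> matching_pair p\<close> by blast
    then show ?thesis by (intro degk)
  qed
  have a5: "g \<inter> e = {}" if eg: "e \<in> \<Union>{p \<in> Items. f p = c}" "g \<in> \<Union>{p \<in> Items. f p = c}" "e \<subseteq> V0" "g \<noteq> e" for c e g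
  proof -
    obtain p q where pq: "p \<in> Items" "f p = c" "e \<in> p" "q \<in> Items" "f q = c" "g \<in> q" using eg by blast
    show ?thesis
    proof (cases "p = q")
      case True
      have "matching_pair p" using kinds[OF pq(1)] starV[of p e] pq(3) eg(3) by blast
      then show ?thesis using matm pq True eg(4) by blast
    next
      case False
      then have "\<Union>p \<inter> \<Union>q = {}" using sep[OF pq(1,4)] pq by simp
      then show ?thesis using pq(3,6) by blast
    qed
  qed
  have a6: "{e \<in> \<Union>{p \<in> Items. f p = c}. \<forall>g\<in>\<Union>{p \<in> Items. f p = c}. g \<noteq> e \<longrightarrow> g \<inter> e = {}} =
     \<Union>{p \<in> Items. f p = c \<and> matching_pair p}" for c
  proof
    show "{e \<in> \<Union>{p \<in> Items. f p = c}. \<forall>g\<in>\<Union>{p \<in> Items. f p = c}. g \<noteq> e \<longrightarrow> g \<inter> e = {}} \<subseteq>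
     \<Union>{p \<in> Items. f p = c \<and> matching_pair p}"
    proof
      fix e assume e: "e \<in> {e \<in> \<Union>{p \<in> Items. f p = c}. \<forall>g\<in>\<Union>{p \<in> Items. f p = c}. g \<noteq> e \<longrightarrow> g \<inter> e = {}}"
      then obtain p where p: "p \<in> Items" "f p = c" "e \<in> p" by blast
      have "\<not> star_pair V0 p"
      proof
        assume "star_pair V0 p"
        from starm[OF this p(3)] obtain g where g: "g \<in> p" "g \<noteq> e" "g \<inter> e \<noteq> {}"
          by (elim bexE conjE) (rule that)
        then have "g \<in> \<Union>{p \<in> Items. f p = c}" using p by blast
        then show False using e g by blast
      qed
      then show "e \<in> \<Union>{p \<in> Items. f p = c \<and> matching_pair p}" using kinds[OF p(1)] p by blast
    qed
    show "\<Union>{p \<in> Items. f p = c \<and> matching_pair p} \<subseteq>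
      {e \<in> \<Union>{p \<in> Items. f p = c}. \<forall>g\<in>\<Union>{p \<in> Items. f p = c}. g \<noteq> e \<longrightarrow> g \<inter> e = {}}"
    proof
      fix e assume "e \<in> \<Union>{p \<in> Items. f p = c \<and> matching_pair p}"
      then obtain p where p: "p \<in> Items" "f p = c" "matching_pair p" "e \<in> p" by blast
      have "g \<inter> e = {}" if g: "g \<in> \<Union>{p \<in> Items. f p = c}" "g \<noteq> e" for g
      proof -
        obtain q where q: "q \<in> Items" "f q = c" "g \<in> q" using g by blast
        show ?thesis
        proof (cases "q = p")
          case True
          then show ?thesis using matm[OF p(3,4)] q(3) g(2) by blast
        next
          case False
          then have "\<Union>q \<inter> \<Union>p = {}" using sep[OF q(1) p(1)] p q by simp
          then show ?thesis using q(3) p(4) by blast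
        qed
      qed
      then show "e \<in> {e \<in> \<Union>{p \<in> Items. f p = c}. \<forall>g\<in>\<Union>{p \<in> Items. f p = c}. g \<noteq> e \<longrightarrow> g \<inter> e = {}}"
        using p by blast
    qed
  qed
  have a7: "card {e \<in> \<Union>{p \<in> Items. f p = c}. \<forall>g\<in>\<Union>{p \<in> Items. f p = c}. g \<noteq> e \<longrightarrow> g \<inter> e = {}} =
     2 * card {p \<in> Items. f p = c \<and> matching_pair p}" for c
    unfolding a6 using fin dj c2 by (intro pairs_card) (auto simp: disjoint_def)
  show ?thesis
  proof (rule exI[of _ col], intro conjI)
    show "\<forall>p\<in>Items. \<forall>e\<in>p. col e = f p" using col by blast
    show "\<forall>v c. card {e \<in> \<Union>Items. v \<in> e \<and> col e = c} \<le> 2" by (intro allI a1)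
    show "\<forall>v c. v \<notin> V0 \<longrightarrow> card {e \<in> \<Union>Items. v \<in> e \<and> col e = c} \<le> 1"
      by (intro allI impI a2)
    show "\<forall>c. card {e \<in> \<Union>Items. col e = c} = 2 * card {p \<in> Items. f p = c}" by (intro allI a3)
    show "\<forall>c v. (\<forall>p\<in>Items. f p = c \<longrightarrow> matching_pair p) \<longrightarrow> card {e \<in> \<Union>Items. v \<in> e \<and> col e = c} \<le> 1"
      by (intro allI impI a4)
    show "\<forall>c. \<forall>e\<in>{e \<in> \<Union>Items. col e = c}. \<forall>g\<in>{e \<in> \<Union>Items. col e = c}. e \<subseteq> V0 \<longrightarrow> g \<noteq> e \<longrightarrow> g \<inter> e = {}"
      unfolding cls by (intro allI ballI impI a5)
    show "\<forall>c. card (isolated {e \<in> \<Union>Items. col e = c})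
       = 2 * card {p \<in> Items. f p = c \<and> matching_pair p}"
      unfolding cls isolated_def by (intro allI a7)
  qed
qed

lemma incident_items_card:
  assumes "disjoint P" "finite E" "\<Union>P \<subseteq> E"
  shows "card {q \<in> P. z \<in> \<Union>q} \<le> card {e \<in> E. z \<in> e}"
proof (rule disjoint_choice_card_le)
  show "disjoint {q \<in> P. z \<in> \<Union>q}" using assms(1) by (auto simp: disjoint_def)
  show "\<exists>e\<in>p. e \<in> {e \<in> E. z \<in> e}" if "p \<in> {q \<in> P. z \<in> \<Union>q}" for p using that assms(3) by blast
qed (use assms in simp)

context typed_bipartite
begin

text \<open>The properties of the colouring of \<open>cr\<close> that the extension to all edges and the count of \<open>AB\<close>-paths
  use. Colours \<open>(\<tau>, k)\<close> with \<open>k < t'\<close> are local; in the nonlocal ones every vertex has crossing degree at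
  most 1, so each \<open>v \<in> V\<^sub>0\<close> still needs an edge into its own side there.\<close>
definition crossing_scheme :: "nat \<Rightarrow> nat \<Rightarrow> nat \<Rightarrow> nat \<Rightarrow> ('a set \<Rightarrow> 't \<times> nat) \<Rightarrow> bool" where
  "crossing_scheme t t' l M col0 \<longleftrightarrow>
    (\<forall>e\<in>cr. fst (col0 e) \<in> Ty \<and> snd (col0 e) < t \<and> (snd (col0 e) < t' \<longrightarrow> fst (col0 e) = ty e)) \<and>
    (\<forall>v c. card {e \<in> cr. v \<in> e \<and> col0 e = c} \<le> 2) \<and>
    (\<forall>v c. v \<notin> V0 \<longrightarrow> card {e \<in> cr. v \<in> e \<and> col0 e = c} \<le> 1) \<and>
    (\<forall>v c. t' \<le> snd c \<longrightarrow> card {e \<in> cr. v \<in> e \<and> col0 e = c} \<le> 1) \<and>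
    (\<forall>c. card {e \<in> cr. col0 e = c} \<le> 2 * M) \<and>
    (\<forall>c\<in>Ty \<times> {..<l}. card {e \<in> cr. col0 e = c} = 2) \<and>
    (\<forall>c. \<forall>e\<in>{e \<in> cr. col0 e = c}. \<forall>g\<in>{e \<in> cr. col0 e = c}. e \<subseteq> V0 \<longrightarrow> g \<noteq> e \<longrightarrow> g \<inter> e = {}) \<and>
    (\<forall>c\<in>Ty \<times> {..<t}. even (card (isolated {e \<in> cr. col0 e = c})) \<and> isolated {e \<in> cr. col0 e = c} \<noteq> {}) \<and>
    (\<forall>\<tau>\<in>Ty. \<forall>v. 2 * card {e \<in> cr. ty e = \<tau> \<and> v \<in> e \<and> t' \<le> snd (col0 e)} \<le> 3 * l + 2)"

text \<open>Colours with \<open>k < l\<close> must keep only their seed, and nonlocal colours should contain no star pairs. So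
  the leftover pairs and star pairs use the local colours \<open>l \<le> k < t'\<close> of their own type. A leftover pair
  conflicts with few items, since its type has low degree. A star pair at \<open>v\<close> conflicts mainly with
  items at \<open>v\<close>: at most \<open>r\<close> matching pairs, and star pairs of two edges each. With \<open>a\<close> of the at most
  \<open>dm\<close> edges in matching pairs, these are at most \<open>a + (dm - a)/2 \<le> (dm + r)/2\<close> items.\<close>
lemma crossing_colouring:
  assumes adm: "admissible r lo (2 * (card Ty * t)) Q"
    and dich: "card (cr - \<Union>Q) = 2 * (card Ty * t) \<or>
      (\<forall>\<tau>\<in>Ty. card (rest Q \<tau>) \<le> lo + 1 \<or> (\<forall>p. star_pair V0 p \<longrightarrow> \<not> p \<subseteq> rest Q \<tau>))"
    and evcr: "even (card cr)"
    and num: "2 * r + 1 \<le> lo" "lo + s = 2 * t" "2 \<le> s" "card Ty * s \<le> l" "t' + l = t" "b + 1 \<le> l"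
    and lowA: "\<And>v. v \<notin> V0 \<Longrightarrow> card {e \<in> cr. v \<in> e} \<le> b"
    and lowV: "\<And>v. v \<in> V0 \<Longrightarrow> card {e \<in> cr. v \<in> e \<and> e \<subseteq> V0} \<le> b"
    and Ty0: "Ty \<noteq> {}"
    and dm: "\<And>\<tau> v. \<tau> \<in> Ty \<Longrightarrow> v \<in> V0 \<Longrightarrow> card {e \<in> cr. ty e = \<tau> \<and> v \<in> e} \<le> dm"
    and num2: "l < t'" "dm + r + 4 * b + 2 * fl + 2 \<le> 2 * (t' - l)" "4 * (b + 1) + fl < t' - l"
    and full: "card cr < M * Suc fl" "1 \<le> M"
  shows "\<exists>col0. crossing_scheme t t' l M col0"
proof -
  have pk: "star_packing Q" and degr: "\<And>\<tau> v. \<tau> \<in> Ty \<Longrightarrow> card {e \<in> rest Q \<tau>. v \<in> e} \<le> r"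
    using adm unfolding admissible_def by auto
  have Qst: "\<And>p. p \<in> Q \<Longrightarrow> star_pair V0 p" and Qd: "disjoint Q"
    and Qt: "\<And>p. p \<in> Q \<Longrightarrow> \<exists>\<tau>. p \<subseteq> {e \<in> cr. ty e = \<tau>}" using pk unfolding star_packing_def by auto
  have finQ: "finite Q" using packing_finite[OF pk] .
  have sc: "\<exists>LP SS NS. seed_system l t' b Q LP SS NS"
    by (rule seed_choice[OF adm dich evcr num _ _ Ty0]) (simp_all add: lowA lowV)
  obtain LP SS NS where PP: "pair_partition (cr - \<Union>Q) ((\<Union>\<tau>\<in>Ty. LP \<tau>) \<union> NS)"
    and mt: "\<forall>p\<in>(\<Union>\<tau>\<in>Ty. LP \<tau>) \<union> NS. matching_pair p"
    and SS: "\<forall>\<tau>\<in>Ty. SS \<tau> \<subseteq> LP \<tau> \<and> card (SS \<tau>) = t' \<and> \<Union>(LP \<tau>) \<subseteq> rest Q \<tau> \<and> SS \<tau> \<inter> NS = {}"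
    and cNS: "card NS = card Ty * l"
    and exlow: "\<forall>\<tau>\<in>Ty. \<forall>p\<in>LP \<tau> - SS \<tau> - NS. \<forall>v. card {e \<in> rest Q \<tau>. v \<in> e} \<le> b + 1"
    and NSlow: "\<forall>\<tau>\<in>Ty. \<forall>v. 2 * card {e \<in> rest Q \<tau>. v \<in> e \<and> e \<in> \<Union>NS} \<le> 3 * l + 2"
    using sc unfolding seed_system_def by (elim exE conjE) (rule that)
  define LA where "LA = (\<Union>\<tau>\<in>Ty. LP \<tau>)"
  define SA where "SA = (\<Union>\<tau>\<in>Ty. SS \<tau>)"
  define Sd where "Sd = SA \<union> NS"
  define Ex where "Ex = LA - SA - NS"
  define Items where "Items = LA \<union> NS \<union> Q"
  have PPd: "disjoint (LA \<union> NS)" and PPU: "\<Union>(LA \<union> NS) = cr - \<Union>Q"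
    using PP unfolding pair_partition_def LA_def by auto
  have finP: "finite (LA \<union> NS)" using pair_partition_card(1)[OF PP] fin_cr unfolding LA_def by simp
  have m: "matching_pair p" if "p \<in> LA \<union> NS" for p using mt that unfolding LA_def by blast
  have QP: "p \<inter> q = {}" if "p \<in> LA \<union> NS" "q \<in> Q" for p q using PPU that by blast
  have Id: "disjoint Items"
    unfolding disjoint_def
  proof (intro ballI impI)
    fix p q assume pq: "p \<in> Items" "q \<in> Items" "p \<noteq> q"
    show "p \<inter> q = {}"
      using pq QP[of p q] QP[of q p] PPd Qd unfolding Items_def disjoint_def
      by (metis Int_commute UnE)
  qed
  have IU: "\<Union>Items = cr" unfolding Items_def using PPU packing_sub[OF pk] by auto
  have finI: "finite Items" unfolding Items_def using finP finQ by simp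
  have Ik: "matching_pair p \<or> star_pair V0 p" if "p \<in> Items" for p using that m Qst unfolding Items_def by blast
  have Ic2: "card p = 2" if "p \<in> Items" for p using Ik[OF that] star_pair_card matching_pair_card by blast
  have Ine: "p \<noteq> {}" if "p \<in> Items" for p using Ic2[OF that] by auto
  have SALA: "SA \<subseteq> LA" unfolding SA_def LA_def using SS by blast
  have PPeq: "LA \<union> NS = Sd \<union> Ex" unfolding Sd_def Ex_def using SALA by blast
  have SdEx: "Sd \<inter> Ex = {}" unfolding Sd_def Ex_def by blast
  \<comment> \<open>Only used for items whose edges have the same type, where the choice of the edge does not matter.\<close>
  define tp where "tp p = ty (SOME e. e \<in> p)" for p
  have tpI: "tp p = \<tau>" if "p \<noteq> {}" "\<And>e. e \<in> p \<Longrightarrow> ty e = \<tau>" for p \<tau>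
    unfolding tp_def using that by (metis some_in_eq)
  have tpLP: "tp p = \<tau>" "\<And>e. e \<in> p \<Longrightarrow> ty e = \<tau>" "\<Union>p \<subseteq> \<Union>(rest Q \<tau>)" "p \<in> LA" if "p \<in> LP \<tau>" "\<tau> \<in> Ty" for p \<tau>
  proof -
    show "p \<in> LA" using that unfolding LA_def by blast
    then have "p \<in> Items" unfolding Items_def by blast
    have "p \<subseteq> rest Q \<tau>" using SS that by blast
    then show "\<Union>p \<subseteq> \<Union>(rest Q \<tau>)" "\<And>e. e \<in> p \<Longrightarrow> ty e = \<tau>" unfolding rest_def by auto
    then show "tp p = \<tau>" using tpI[OF Ine[OF \<open>p \<in> Items\<close>]] by blast
  qed
  have LAtp: "p \<in> LP (tp p)" "tp p \<in> Ty" if pLA: "p \<in> LA" for p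
  proof -
    obtain \<tau> where "\<tau> \<in> Ty" "p \<in> LP \<tau>" using pLA unfolding LA_def by blast
    then show "p \<in> LP (tp p)" "tp p \<in> Ty" using tpLP(1) by auto
  qed
  have Qtp: "ty e = tp p" "tp p \<in> Ty" if pQ: "p \<in> Q" "e \<in> p" for p e
  proof -
    obtain \<tau> where t: "p \<subseteq> {e \<in> cr. ty e = \<tau>}" using Qt[OF pQ(1)] by blast
    have "p \<noteq> {}" using pQ by blast
    then have "tp p = \<tau>" using tpI[of p \<tau>] t by blast
    moreover have "e \<in> cr" "ty e = \<tau>" using t pQ(2) by auto
    ultimately show "ty e = tp p" "tp p \<in> Ty" using ty_in[of e] by simp_all
  qed
  have LAty: "ty e = tp p" if "p \<in> LA" "e \<in> p" for p e
    using tpLP(2)[OF LAtp[OF that(1)] that(2)] .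
  have SSLP: "SS \<tau> \<subseteq> LP \<tau>" "card (SS \<tau>) = t'" if "\<tau> \<in> Ty" for \<tau> using SS that by auto
  have SAtp: "p \<in> SS (tp p)" "tp p \<in> Ty" if pSA: "p \<in> SA" for p
  proof -
    obtain \<tau> where t: "\<tau> \<in> Ty" "p \<in> SS \<tau>" using pSA unfolding SA_def by blast
    then have "p \<in> LP \<tau>" using SSLP by blast
    then have "tp p = \<tau>" using tpLP(1) t by blast
    then show "p \<in> SS (tp p)" "tp p \<in> Ty" using t by auto
  qed
  have "\<exists>g. bij_betw g (SS \<tau>) {..<t'}" if "\<tau> \<in> Ty" for \<tau>
  proof -
    have "SS \<tau> \<subseteq> LA \<union> NS" using SSLP(1)[OF that] that unfolding LA_def by blast
    then have "finite (SS \<tau>)" using finP finite_subset by blast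
    then show ?thesis using SSLP(2)[OF that] by (intro finite_same_card_bij) auto
  qed
  then obtain gS where gS: "\<And>\<tau>. \<tau> \<in> Ty \<Longrightarrow> bij_betw (gS \<tau>) (SS \<tau>) {..<t'}" by metis
  obtain gN where gN: "bij_betw gN NS (Ty \<times> {t'..<t})"
  proof -
    have "t - t' = l" using num(5) by linarith
    then have "card (Ty \<times> {t'..<t}) = card Ty * l" by (simp add: card_cartesian_product)
    then have "\<exists>g. bij_betw g NS (Ty \<times> {t'..<t})"
      using cNS finP fin_Ty by (intro finite_same_card_bij) auto
    then show thesis using that by blast
  qed
  \<comment> \<open>Local seeds get the local colours of their type bijectively, and nonlocal seeds get all the nonlocal
    colours bijectively, whatever the types of their edges.\<close>
  define f0 where "f0 p = (if p \<in> NS then gN p else (tp p, gS (tp p) p))" for p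
  have f0N: "fst (f0 p) \<in> Ty" "t' \<le> snd (f0 p)" "snd (f0 p) < t" if "p \<in> NS" for p
    using bij_betwE[OF gN] that unfolding f0_def by auto
  have SANS: "p \<notin> NS" if "p \<in> SA" for p using that SS unfolding SA_def by blast
  have f0S: "fst (f0 p) = tp p" "snd (f0 p) < t'" if "p \<in> SA" for p
    using bij_betwE[OF gS[OF SAtp(2)[OF that]]] SAtp(1)[OF that] SANS[OF that] unfolding f0_def by auto
  have f0inj: "p = q" if pq: "p \<in> Sd" "q \<in> Sd" "f0 p = f0 q" for p q
  proof -
    have "p \<in> NS \<longleftrightarrow> q \<in> NS" using f0N(2) f0S(2) pq unfolding Sd_def by (metis UnE not_le)
    then consider "p \<in> NS" "q \<in> NS" | "p \<in> SA" "q \<in> SA" "p \<notin> NS" "q \<notin> NS" using pq unfolding Sd_def by blast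
    then show ?thesis
    proof cases
      case 1
      then show ?thesis using gN pq(3) unfolding f0_def bij_betw_def inj_on_def by simp
    next
      case 2
      then have "tp p = tp q" "gS (tp p) p = gS (tp p) q" using pq(3) unfolding f0_def by auto
      then show ?thesis using gS[OF SAtp(2)[OF 2(1)]] SAtp(1)[OF 2(1)] SAtp(1)[OF 2(2)]
        unfolding bij_betw_def inj_on_def by simp
    qed
  qed
  have f0surj: "\<exists>p\<in>Sd. f0 p = (\<tau>, k)" if tk: "\<tau> \<in> Ty" "k < t" for \<tau> k
  proof (cases "k < t'")
    case True
    then obtain p where p: "p \<in> SS \<tau>" "gS \<tau> p = k" using gS[OF tk(1)] unfolding bij_betw_def by (metis imageE lessThan_iff)
    then have "p \<in> SA" unfolding SA_def using tk by blast
    moreover have "tp p = \<tau>" using tpLP(1) SSLP(1)[OF tk(1)] p tk by blast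
    ultimately show ?thesis using p SANS unfolding f0_def Sd_def by (intro bexI[of _ p]) auto
  next
    case False
    then have "(\<tau>, k) \<in> gN ` NS" using gN tk unfolding bij_betw_def by auto
    then show ?thesis unfolding f0_def Sd_def by auto
  qed
  define conf where "conf p q \<longleftrightarrow> \<Union>p \<inter> \<Union>q \<noteq> {}" for p q :: "'a set set"
  \<comment> \<open>The colours open to an item that is not a seed.\<close>
  define Al where "Al p = {tp p} \<times> {l..<t'}" for p
  have AlC: "card (Al p) = t' - l" "finite (Al p)" for p unfolding Al_def by (auto simp: card_cartesian_product)
  have itemsle: "card Items \<le> card cr"
    using Id fin_cr IU Ine by (intro disjoint_choice_card_le) blast+
  have finSd: "finite Sd" "finite Ex" using finP PPeq by (metis finite_Un)+
  have sum3: "card Sd + card Ex + card Q \<le> card cr"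
  proof -
    have "(Sd \<union> Ex) \<inter> Q = {}"
    proof (rule ccontr)
      assume "(Sd \<union> Ex) \<inter> Q \<noteq> {}"
      then obtain p where p: "p \<in> LA \<union> NS" "p \<in> Q" using PPeq by blast
      then have "p = {}" using QP[OF p] by blast
      then show False using p Ine unfolding Items_def by blast
    qed
    then have "card Items = card (Sd \<union> Ex) + card Q"
      unfolding Items_def PPeq using finSd finQ by (intro card_Un_disjoint) auto
    then show ?thesis using itemsle finSd SdEx by (simp add: card_Un_disjoint)
  qed
  have finr: "finite (rest Q \<tau>)" for \<tau> by (rule rest_finite)
  have LPdis: "disjoint (LP \<tau>)" "\<Union>(LP \<tau>) \<subseteq> rest Q \<tau>" "finite (LP \<tau>)" "LP \<tau> \<subseteq> LA" if "\<tau> \<in> Ty" for \<tau>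
  proof -
    show sub: "LP \<tau> \<subseteq> LA" unfolding LA_def using that by blast
    show "disjoint (LP \<tau>)" using PPd sub unfolding disjoint_def by blast
    show "\<Union>(LP \<tau>) \<subseteq> rest Q \<tau>" using SS that by blast
    have "finite LA" using finP by simp
    then show "finite (LP \<tau>)" by (rule finite_subset[OF sub])
  qed
  have room1: "card ({q \<in> Sd. conf q p \<and> f0 q \<in> Al p} \<union> {q \<in> Ex. conf q p \<and> Al q \<inter> Al p \<noteq> {}}) + fl < card (Al p)"
    if p: "p \<in> Ex" for p
  proof -
    let ?\<tau> = "tp p"
    have pLA: "p \<in> LA" using p unfolding Ex_def by blast
    have \<tau>: "?\<tau> \<in> Ty" "p \<in> LP ?\<tau>" using LAtp[OF pLA] by auto
    have "p \<notin> SS ?\<tau>" using p \<tau> unfolding Ex_def SA_def by blast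
    then have low: "card {e \<in> rest Q ?\<tau>. v \<in> e} \<le> b + 1" for v using exlow \<tau> p unfolding Ex_def by blast
    obtain e g where eg: "p = {e, g}" using m[of p] pLA unfolding matching_pair_def by blast
    have "e \<in> cr" "g \<in> cr" using IU pLA eg unfolding Items_def by blast+
    then obtain x y u w where xy: "e = {x, y}" "g = {u, w}" using bip by metis
    let ?C = "{q \<in> Sd. conf q p \<and> f0 q \<in> Al p} \<union> {q \<in> Ex. conf q p \<and> Al q \<inter> Al p \<noteq> {}}"
    have "?C \<subseteq> (\<Union>z\<in>{x, y, u, w}. {q \<in> LP ?\<tau>. z \<in> \<Union>q})"
    proof
      fix q assume q: "q \<in> ?C"
      have "q \<in> LP ?\<tau>"
      proof (cases "q \<in> Sd")
        case True
        then have "f0 q \<in> Al p" using q SdEx by blast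
        then have a: "fst (f0 q) = ?\<tau>" "snd (f0 q) < t'" unfolding Al_def by auto
        then have "q \<in> SA" using True f0N(2)[of q] unfolding Sd_def by auto
        then show ?thesis using f0S(1) SAtp SSLP(1) a(1) by (metis subsetD)
      next
        case False
        then have "q \<in> Ex" "Al q \<inter> Al p \<noteq> {}" using q by auto
        then have "q \<in> LA" "tp q = ?\<tau>" unfolding Ex_def Al_def by auto
        then show ?thesis using LAtp by metis
      qed
      moreover have "conf q p" using q by blast
      ultimately show "q \<in> (\<Union>z\<in>{x, y, u, w}. {q \<in> LP ?\<tau>. z \<in> \<Union>q})"
        unfolding conf_def eg xy by auto
    qed
    then have "card ?C \<le> card (\<Union>z\<in>{x, y, u, w}. {q \<in> LP ?\<tau>. z \<in> \<Union>q})"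
      using LPdis(3)[OF \<tau>(1)] by (intro card_mono) auto
    also have "\<dots> \<le> (\<Sum>z\<in>{x, y, u, w}. card {q \<in> LP ?\<tau>. z \<in> \<Union>q})" by (rule card_UN_le) simp
    also have "\<dots> \<le> (\<Sum>z\<in>{x, y, u, w}. b + 1)"
    proof (rule sum_mono)
      fix z
      show "card {q \<in> LP ?\<tau>. z \<in> \<Union>q} \<le> b + 1"
        using incident_items_card[OF LPdis(1)[OF \<tau>(1)] finr LPdis(2)[OF \<tau>(1)], of z] low[of z] by linarith
    qed
    also have "\<dots> \<le> 4 * (b + 1)"
    proof -
      have "card {x, y, u, w} \<le> 4" by (simp add: card_insert_if)
      then show ?thesis using mult_right_mono[of "card {x, y, u, w}" 4 "b + 1"] by simp
    qed
    finally show ?thesis using AlC num2(3) by simp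
  qed
  have symc: "conf q p" if "conf p q" for p q using that unfolding conf_def by auto
  have g1: "\<exists>f. (\<forall>p\<in>Sd. f p = f0 p) \<and> (\<forall>p\<in>Ex. f p \<in> Al p) \<and>
     (\<forall>p\<in>Sd \<union> Ex. \<forall>q\<in>Sd \<union> Ex. p \<noteq> q \<longrightarrow> conf p q \<longrightarrow> f p \<noteq> f q) \<and>
     (\<forall>c. card {p \<in> Sd \<union> Ex. f p = c} \<le> M)"
  proof (rule greedy_extend[where fl = fl])
    show "card {p \<in> Sd. f0 p = c} \<le> M" for c
    proof -
      have "card {p \<in> Sd. f0 p = c} \<le> 1"
        using f0inj finSd(1) by (auto simp: card_le_Suc0_iff_eq)
      then show ?thesis using full(2) by linarith
    qed
    show "card Sd + card Ex < M * Suc fl" using sum3 full(1) by linarith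
    show "f0 p \<noteq> f0 q" if "p \<in> Sd" "q \<in> Sd" "p \<noteq> q" for p q using f0inj that by blast
  qed (use finSd AlC SdEx symc room1 in auto)
  obtain f1 where f11: "\<forall>p\<in>Sd. f1 p = f0 p" and f12: "\<forall>p\<in>Ex. f1 p \<in> Al p"
    and f13: "\<forall>p\<in>Sd \<union> Ex. \<forall>q\<in>Sd \<union> Ex. p \<noteq> q \<longrightarrow> conf p q \<longrightarrow> f1 p \<noteq> f1 q"
    and f14: "\<forall>c. card {p \<in> Sd \<union> Ex. f1 p = c} \<le> M" using g1 by (elim exE conjE) (rule that)
  have room2: "card ({q \<in> Sd \<union> Ex. conf q p \<and> f1 q \<in> Al p} \<union> {q \<in> Q. conf q p \<and> Al q \<inter> Al p \<noteq> {}}) + fl < card (Al p)"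
    if p: "p \<in> Q" for p
  proof -
    let ?\<tau> = "tp p"
    obtain v x y where v: "v \<in> V0" and xy: "x \<notin> V0" "y \<notin> V0" "p = {{v, x}, {v, y}}"
      using Qst[OF p] unfolding star_pair_def by blast
    have \<tau>: "?\<tau> \<in> Ty" using Qtp(2)[OF p, of "{v, x}"] xy by simp
    define Q' where "Q' = {q \<in> Q. tp q = ?\<tau>}"
    let ?R = "LP ?\<tau> \<union> Q'"
    let ?C = "{q \<in> Sd \<union> Ex. conf q p \<and> f1 q \<in> Al p} \<union> {q \<in> Q. conf q p \<and> Al q \<inter> Al p \<noteq> {}}"
    have RI: "?R \<subseteq> Items" unfolding Q'_def Items_def using LPdis(4)[OF \<tau>] by blast
    have finR: "finite ?R" using RI finI finite_subset by blast
    have Rd: "disjoint ?R" using Id RI unfolding disjoint_def by blast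
    have RU: "\<Union>?R \<subseteq> cr" using RI IU by blast
    have sub: "?C \<subseteq> (\<Union>z\<in>{v, x, y}. {q \<in> ?R. z \<in> \<Union>q})"
    proof
      fix q assume q: "q \<in> ?C"
      have "q \<in> ?R"
      proof (cases "q \<in> Sd \<union> Ex")
        case True
        have "q \<notin> Q"
        proof
          assume "q \<in> Q"
          then have "q \<inter> q = {}" using QP True PPeq by blast
          then show False using Ine \<open>q \<in> Q\<close> unfolding Items_def by blast
        qed
        then have al: "f1 q \<in> Al p" using q by blast
        show ?thesis
        proof (cases "q \<in> Sd")
          case True
          then have "f0 q \<in> Al p" using al f11 by simp
          then have a: "fst (f0 q) = ?\<tau>" "snd (f0 q) < t'" unfolding Al_def by auto
          then have "q \<in> SA" using True f0N(2)[of q] unfolding Sd_def by auto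
          then show ?thesis using f0S(1) SAtp SSLP(1) a(1) by (metis subsetD UnI1)
        next
          case False
          then have qE: "q \<in> Ex" using True by blast
          then have "f1 q \<in> Al q" using f12 by blast
          then have "tp q = ?\<tau>" using al unfolding Al_def by auto
          moreover have "q \<in> LA" using qE unfolding Ex_def by blast
          ultimately show ?thesis using LAtp by (metis UnI1)
        qed
      next
        case False
        then have "q \<in> Q" "Al q \<inter> Al p \<noteq> {}" using q by auto
        then show ?thesis unfolding Q'_def Al_def by auto
      qed
      moreover have "conf q p" using q by blast
      ultimately show "q \<in> (\<Union>z\<in>{v, x, y}. {q \<in> ?R. z \<in> \<Union>q})"
        unfolding conf_def xy(3) by auto
    qed
    have "card ?C \<le> card (\<Union>z\<in>{v, x, y}. {q \<in> ?R. z \<in> \<Union>q})"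
      using sub finR by (intro card_mono) auto
    also have "\<dots> = card ({q \<in> ?R. v \<in> \<Union>q} \<union> ({q \<in> ?R. x \<in> \<Union>q} \<union> {q \<in> ?R. y \<in> \<Union>q}))"
      by (rule arg_cong[where f = card]) auto
    also have "\<dots> \<le> card {q \<in> ?R. v \<in> \<Union>q} + (card {q \<in> ?R. x \<in> \<Union>q} + card {q \<in> ?R. y \<in> \<Union>q})"
      by (meson add_left_mono card_Un_le order_trans)
    finally have c1: "card ?C \<le> card {q \<in> ?R. v \<in> \<Union>q} + (card {q \<in> ?R. x \<in> \<Union>q} + card {q \<in> ?R. y \<in> \<Union>q})" .
    have cx: "card {q \<in> ?R. z \<in> \<Union>q} \<le> b" if "z \<notin> V0" for z
      using incident_items_card[OF Rd fin_cr RU, of z] lowA[OF that] by linarith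
    let ?a = "card {e \<in> rest Q ?\<tau>. v \<in> e}"
    have s1: "card {q \<in> LP ?\<tau>. v \<in> \<Union>q} \<le> ?a"
      using incident_items_card[OF LPdis(1)[OF \<tau>] finr LPdis(2)[OF \<tau>]] .
    \<comment> \<open>Each star pair at \<open>v\<close> uses two of the edges of this type at \<open>v\<close>, and none of those counted by \<open>?a\<close>.\<close>
    have s2: "2 * card {q \<in> Q'. v \<in> \<Union>q} + ?a \<le> dm"
    proof -
      let ?D = "{q \<in> Q'. v \<in> \<Union>q}"
      have fD: "finite ?D" unfolding Q'_def using finQ by simp
      have "card (\<Union>?D) = 2 * card ?D"
        using fD Qd star_pair_card[OF Qst] unfolding Q'_def by (intro pairs_card) (auto simp: disjoint_def)
      moreover have "\<Union>?D \<subseteq> {e \<in> cr. ty e = ?\<tau> \<and> v \<in> e} - rest Q ?\<tau>"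
      proof
        fix e assume "e \<in> \<Union>?D"
        then obtain q where q: "q \<in> Q" "tp q = ?\<tau>" "e \<in> q" "v \<in> \<Union>q" unfolding Q'_def by blast
        have "v \<in> e" using Qst[OF q(1)] q(3,4) v unfolding star_pair_def by auto
        moreover have "e \<notin> rest Q ?\<tau>" using q unfolding rest_def by blast
        moreover have "e \<in> cr" using q packing_sub[OF pk] by blast
        ultimately show "e \<in> {e \<in> cr. ty e = ?\<tau> \<and> v \<in> e} - rest Q ?\<tau>" using Qtp(1)[OF q(1,3)] q(2) by simp
      qed
      then have "card (\<Union>?D) \<le> card ({e \<in> cr. ty e = ?\<tau> \<and> v \<in> e} - rest Q ?\<tau>)"
        using fin_cr by (intro card_mono) auto
      moreover have "card {e \<in> cr. ty e = ?\<tau> \<and> v \<in> e} =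
         card ({e \<in> cr. ty e = ?\<tau> \<and> v \<in> e} \<inter> rest Q ?\<tau>) + card ({e \<in> cr. ty e = ?\<tau> \<and> v \<in> e} - rest Q ?\<tau>)"
        using fin_cr by (intro card_Int_Diff) simp
      moreover have "{e \<in> cr. ty e = ?\<tau> \<and> v \<in> e} \<inter> rest Q ?\<tau> = {e \<in> rest Q ?\<tau>. v \<in> e}"
        unfolding rest_def by auto
      ultimately show ?thesis using dm[OF \<tau> v] by simp
    qed
    have "{q \<in> ?R. v \<in> \<Union>q} = {q \<in> LP ?\<tau>. v \<in> \<Union>q} \<union> {q \<in> Q'. v \<in> \<Union>q}" by blast
    then have "card {q \<in> ?R. v \<in> \<Union>q} \<le> card {q \<in> LP ?\<tau>. v \<in> \<Union>q} + card {q \<in> Q'. v \<in> \<Union>q}"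
      using card_Un_le by simp
    then show ?thesis using c1 cx[OF xy(1)] cx[OF xy(2)] s1 s2 degr[OF \<tau>, of v] AlC num2(2) by simp
  qed
  have g2: "\<exists>f. (\<forall>p\<in>Sd \<union> Ex. f p = f1 p) \<and> (\<forall>p\<in>Q. f p \<in> Al p) \<and>
     (\<forall>p\<in>(Sd \<union> Ex) \<union> Q. \<forall>q\<in>(Sd \<union> Ex) \<union> Q. p \<noteq> q \<longrightarrow> conf p q \<longrightarrow> f p \<noteq> f q) \<and>
     (\<forall>c. card {p \<in> (Sd \<union> Ex) \<union> Q. f p = c} \<le> M)"
  proof (rule greedy_extend[where fl = fl])
    show "(Sd \<union> Ex) \<inter> Q = {}"
    proof (rule ccontr)
      assume "(Sd \<union> Ex) \<inter> Q \<noteq> {}"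
      then obtain p where p: "p \<in> LA \<union> NS" "p \<in> Q" using PPeq by blast
      then have "p = {}" using QP[OF p] by blast
      then show False using p Ine unfolding Items_def by blast
    qed
    show "card (Sd \<union> Ex) + card Q < M * Suc fl"
      using sum3 full(1) card_Un_le[of Sd Ex] by linarith
    show "f1 p \<noteq> f1 q" if "p \<in> Sd \<union> Ex" "q \<in> Sd \<union> Ex" "p \<noteq> q" "conf p q" for p q using f13 that by blast
    show "card {p \<in> Sd \<union> Ex. f1 p = c} \<le> M" for c using f14 by blast
  qed (use finSd finQ AlC symc room2 in auto)
  obtain f where f1: "\<forall>p\<in>Sd \<union> Ex. f p = f1 p" and f2: "\<forall>p\<in>Q. f p \<in> Al p"
    and f3: "\<forall>p\<in>(Sd \<union> Ex) \<union> Q. \<forall>q\<in>(Sd \<union> Ex) \<union> Q. p \<noteq> q \<longrightarrow> conf p q \<longrightarrow> f p \<noteq> f q"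
    and f4: "\<forall>c. card {p \<in> (Sd \<union> Ex) \<union> Q. f p = c} \<le> M" using g2 by (elim exE conjE) (rule that)
  have Ieq: "Items = (Sd \<union> Ex) \<union> Q" unfolding Items_def PPeq ..
  have fSd: "f p = f0 p" if "p \<in> Sd" for p using f1 f11 that by simp
  have fEx: "f p \<in> Al p" if "p \<in> Ex" for p using f1 f12 that by simp
  have other: "p \<in> Sd \<or> (f p \<in> Al p \<and> tp p \<in> Ty \<and> (\<forall>e\<in>p. ty e = tp p))" if p: "p \<in> Items" for p
  proof -
    consider "p \<in> Sd" | "p \<in> Ex" | "p \<in> Q" using p unfolding Ieq by blast
    then show ?thesis
    proof cases
      case 2
      then have "p \<in> LA" unfolding Ex_def by blast
      then show ?thesis using fEx[OF 2] LAtp LAty by blast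
    next
      case 3
      have "p \<noteq> {}" using Ine[OF p] .
      then show ?thesis using f2 3 Qtp[OF 3] by blast
    qed simp
  qed
  have Itemcol: "fst (f p) \<in> Ty \<and> snd (f p) < t \<and> (snd (f p) < t' \<longrightarrow> (\<forall>e\<in>p. ty e = fst (f p))) \<and> (t' \<le> snd (f p) \<longrightarrow> p \<in> NS)"
    if p: "p \<in> Items" for p
  proof -
    consider "p \<in> NS" | "p \<in> SA" | "f p \<in> Al p" "tp p \<in> Ty" "\<forall>e\<in>p. ty e = tp p"
      using other[OF p] unfolding Sd_def by blast
    then show ?thesis
    proof cases
      case 1
      then have "f p = f0 p" using fSd unfolding Sd_def by simp
      then show ?thesis using f0N[OF 1] 1 by simp
    next
      case 2
      then have "f p = f0 p" using fSd unfolding Sd_def by simp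
      then show ?thesis using f0S[OF 2] SAtp(2)[OF 2] LAty SALA 2 num(5) by auto
    next
      case 3
      then show ?thesis using num(5) unfolding Al_def by auto
    qed
  qed
  have "\<exists>col. (\<forall>p\<in>Items. \<forall>e\<in>p. col e = f p) \<and>
    (\<forall>v c. card {e \<in> \<Union>Items. v \<in> e \<and> col e = c} \<le> 2) \<and>
    (\<forall>v c. v \<notin> V0 \<longrightarrow> card {e \<in> \<Union>Items. v \<in> e \<and> col e = c} \<le> 1) \<and>
    (\<forall>c. card {e \<in> \<Union>Items. col e = c} = 2 * card {p \<in> Items. f p = c}) \<and>
    (\<forall>c v. (\<forall>p\<in>Items. f p = c \<longrightarrow> matching_pair p) \<longrightarrow> card {e \<in> \<Union>Items. v \<in> e \<and> col e = c} \<le> 1) \<and>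
    (\<forall>c. \<forall>e\<in>{e \<in> \<Union>Items. col e = c}. \<forall>g\<in>{e \<in> \<Union>Items. col e = c}. e \<subseteq> V0 \<longrightarrow> g \<noteq> e \<longrightarrow> g \<inter> e = {}) \<and>
    (\<forall>c. card (isolated {e \<in> \<Union>Items. col e = c})
       = 2 * card {p \<in> Items. f p = c \<and> matching_pair p})"
  proof (rule item_classes[OF finI Id Ik])
    show "\<Union>p \<inter> \<Union>q = {}" if "p \<in> Items" "q \<in> Items" "p \<noteq> q" "f p = f q" for p q
      using f3 that unfolding Ieq conf_def by blast
  qed simp_all
  then obtain col where c0: "\<forall>p\<in>Items. \<forall>e\<in>p. col e = f p"
    and c1: "\<forall>v c. card {e \<in> cr. v \<in> e \<and> col e = c} \<le> 2"
    and c2: "\<forall>v c. v \<notin> V0 \<longrightarrow> card {e \<in> cr. v \<in> e \<and> col e = c} \<le> 1"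
    and c3: "\<forall>c. card {e \<in> cr. col e = c} = 2 * card {p \<in> Items. f p = c}"
    and c4: "\<forall>c v. (\<forall>p\<in>Items. f p = c \<longrightarrow> matching_pair p) \<longrightarrow> card {e \<in> cr. v \<in> e \<and> col e = c} \<le> 1"
    and c5: "\<forall>c. \<forall>e\<in>{e \<in> cr. col e = c}. \<forall>g\<in>{e \<in> cr. col e = c}. e \<subseteq> V0 \<longrightarrow> g \<noteq> e \<longrightarrow> g \<inter> e = {}"
    and c6: "\<forall>c. card (isolated {e \<in> cr. col e = c})
       = 2 * card {p \<in> Items. f p = c \<and> matching_pair p}"
    unfolding IU by (elim exE conjE) (rule that)
  have nz: "card Y \<noteq> 0 \<Longrightarrow> Y \<noteq> {}" for Y :: "'a set set" by auto
  have itemof: "\<exists>p\<in>Items. e \<in> p" if "e \<in> cr" for e using that IU by blast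
  have seedof: "\<exists>p\<in>Sd. f p = c" if "c \<in> Ty \<times> {..<t}" for c
    using f0surj[of "fst c" "snd c"] fSd that by force
  have LSd: "p \<in> LA \<union> NS" if "p \<in> Sd" for p using that PPeq by blast
  show ?thesis
    unfolding crossing_scheme_def
  proof (rule exI[of _ col], intro conjI)
    show "\<forall>e\<in>cr. fst (col e) \<in> Ty \<and> snd (col e) < t \<and> (snd (col e) < t' \<longrightarrow> fst (col e) = ty e)"
    proof
      fix e assume "e \<in> cr"
      then obtain p where p: "p \<in> Items" "e \<in> p" using itemof by blast
      then have "col e = f p" using c0 by blast
      then show "fst (col e) \<in> Ty \<and> snd (col e) < t \<and> (snd (col e) < t' \<longrightarrow> fst (col e) = ty e)"
        using Itemcol[OF p(1)] p(2) by auto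
    qed
    show "\<forall>v c. card {e \<in> cr. v \<in> e \<and> col e = c} \<le> 2" by (rule c1)
    show "\<forall>v c. v \<notin> V0 \<longrightarrow> card {e \<in> cr. v \<in> e \<and> col e = c} \<le> 1" by (rule c2)
    show "\<forall>v c. t' \<le> snd c \<longrightarrow> card {e \<in> cr. v \<in> e \<and> col e = c} \<le> 1"
    proof (intro allI impI)
      fix v c assume "t' \<le> snd (c :: 't \<times> nat)"
      then have "\<forall>p\<in>Items. f p = c \<longrightarrow> matching_pair p" using Itemcol m by blast
      then show "card {e \<in> cr. v \<in> e \<and> col e = c} \<le> 1" using c4 by blast
    qed
    show "\<forall>c. card {e \<in> cr. col e = c} \<le> 2 * M"
    proof
      fix c show "card {e \<in> cr. col e = c} \<le> 2 * M"
        using spec[OF c3, of c] spec[OF f4, of c] unfolding Ieq by simp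
    qed
    show "\<forall>c\<in>Ty \<times> {..<l}. card {e \<in> cr. col e = c} = 2"
    proof
      fix c assume c: "c \<in> Ty \<times> {..<l}"
      then have "c \<in> Ty \<times> {..<t}" using num(5) by auto
      then obtain p where p: "p \<in> Sd" "f p = c" using seedof by blast
      have "{p \<in> Items. f p = c} = {p}"
      proof
        show "{p} \<subseteq> {p \<in> Items. f p = c}" using p unfolding Ieq by blast
        show "{p \<in> Items. f p = c} \<subseteq> {p}"
        proof
          fix q assume q: "q \<in> {p \<in> Items. f p = c}"
          then have "f q \<notin> Al q" using c unfolding Al_def by auto
          then have "q \<in> Sd" using other q by blast
          then show "q \<in> {p}" using f0inj[of q p] fSd p q by simp
        qed
      qed
      then show "card {e \<in> cr. col e = c} = 2" using spec[OF c3, of c] by simp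
    qed
    show "\<forall>c. \<forall>e\<in>{e \<in> cr. col e = c}. \<forall>g\<in>{e \<in> cr. col e = c}. e \<subseteq> V0 \<longrightarrow> g \<noteq> e \<longrightarrow> g \<inter> e = {}"
      by (rule c5)
    show "\<forall>c\<in>Ty \<times> {..<t}. even (card (isolated {e \<in> cr. col e = c})) \<and> isolated {e \<in> cr. col e = c} \<noteq> {}"
    proof
      fix c assume cT: "c \<in> Ty \<times> {..<t}"
      let ?I = "isolated {e \<in> cr. col e = c}"
      obtain p where p: "p \<in> Sd" "f p = c" using seedof[OF cT] by (elim bexE) (rule that)
      then have "p \<in> {p \<in> Items. f p = c \<and> matching_pair p}" using m[OF LSd[OF p(1)]] unfolding Ieq by simp
      moreover have "finite {p \<in> Items. f p = c \<and> matching_pair p}" using finI by simp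
      ultimately have "card {p \<in> Items. f p = c \<and> matching_pair p} \<noteq> 0"
        by (simp only: card_eq_0_iff) blast
      then have "card ?I \<noteq> 0" using spec[OF c6, of c] by simp
      moreover have "even (card ?I)" using spec[OF c6, of c] by simp
      ultimately have "even (card ?I) \<and> ?I \<noteq> {}" by (intro conjI nz)
      then show "even (card ?I) \<and> ?I \<noteq> {}" .
    qed
    show "\<forall>\<tau>\<in>Ty. \<forall>v. 2 * card {e \<in> cr. ty e = \<tau> \<and> v \<in> e \<and> t' \<le> snd (col e)} \<le> 3 * l + 2"
    proof (intro ballI allI)
      fix \<tau> v assume \<tau>: "\<tau> \<in> Ty"
      have "{e \<in> cr. ty e = \<tau> \<and> v \<in> e \<and> t' \<le> snd (col e)} \<subseteq> {e \<in> rest Q \<tau>. v \<in> e \<and> e \<in> \<Union>NS}"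
      proof
        fix e assume e: "e \<in> {e \<in> cr. ty e = \<tau> \<and> v \<in> e \<and> t' \<le> snd (col e)}"
        then obtain p where p: "p \<in> Items" "e \<in> p" using itemof by blast
        then have "col e = f p" using c0 by blast
        then have "p \<in> NS" using Itemcol[OF p(1)] e by auto
        then have "e \<in> \<Union>NS" "e \<in> cr - \<Union>Q" using p(2) PPU by blast+
        then show "e \<in> {e \<in> rest Q \<tau>. v \<in> e \<and> e \<in> \<Union>NS}" using e unfolding rest_def by blast
      qed
      then have "card {e \<in> cr. ty e = \<tau> \<and> v \<in> e \<and> t' \<le> snd (col e)} \<le> card {e \<in> rest Q \<tau>. v \<in> e \<and> e \<in> \<Union>NS}"
        using finr by (intro card_mono) auto
      then show "2 * card {e \<in> cr. ty e = \<tau> \<and> v \<in> e \<and> t' \<le> snd (col e)} \<le> 3 * l + 2"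
        using NSlow \<tau> by (meson le_trans mult_le_mono2)
    qed
  qed
qed

section \<open>Existence of admissible packings\<close>

lemma packing_extend:
  assumes "star_packing Q" "star_pair V0 p" "p \<subseteq> rest Q \<tau>"
  shows "star_packing (insert p Q)" "p \<notin> Q"
proof -
  have pQ: "p \<inter> \<Union>Q = {}" using assms(3) unfolding rest_def by auto
  have "p \<subseteq> {e \<in> cr. ty e = \<tau>}" using assms(3) unfolding rest_def by auto
  moreover have "disjoint (insert p Q)" using assms(1) pQ unfolding star_packing_def by (auto simp: disjoint_def)
  ultimately show "star_packing (insert p Q)" using assms(1,2) unfolding star_packing_def by blast
  have "p \<noteq> {}" using star_pair_card[OF assms(2)] by auto
  then show "p \<notin> Q" using pQ by blast
qed

lemma packing_empty: "star_packing {}"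
  unfolding star_packing_def by (auto simp: disjoint_def)

lemma starless_packing:
  "\<exists>Q. star_packing Q \<and> (\<forall>\<tau> p. star_pair V0 p \<longrightarrow> \<not> p \<subseteq> rest Q \<tau>)"
proof -
  have "card Q < Suc (card cr)" if "star_packing Q" for Q
    using packing_card[OF that] card_mono[OF fin_cr packing_sub[OF that]] by linarith
  then have "\<exists>x. star_packing x \<and> (\<forall>y. star_packing y \<longrightarrow> card y \<le> card x)"
    using packing_empty by (intro ex_has_greatest_nat) auto
  then obtain Q where Q: "star_packing Q" and max: "\<And>Q'. star_packing Q' \<Longrightarrow> card Q' \<le> card Q" by blast
  have "\<not> p \<subseteq> rest Q \<tau>" if p: "star_pair V0 p" for \<tau> p
  proof
    assume "p \<subseteq> rest Q \<tau>"
    then have "star_packing (insert p Q)" "p \<notin> Q" using packing_extend[OF Q p] by auto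
    then show False using max[of "insert p Q"] packing_finite[OF Q] by simp
  qed
  then show ?thesis using Q by blast
qed

text \<open>Take a smallest packing that brings all degrees down to \<open>r\<close>. By minimality, every centre of a star pair
  still has degree at least \<open>r - 1\<close>, of which at least \<open>r - 1 - b\<close> edges leave \<open>V\<^sub>0\<close>; these are disjoint
  for different centres. Four centres therefore leave many edges. With a set \<open>W\<close> of at most three centres,
  the edges lost are among those at \<open>W\<close>, and the remaining edges at \<open>W\<close> are counted back.\<close>
lemma trimmed_packing:
  assumes lowA: "\<And>v. v \<notin> V0 \<Longrightarrow> card {e \<in> cr. v \<in> e} \<le> b"
    and lowV: "\<And>v. v \<in> V0 \<Longrightarrow> card {e \<in> cr. v \<in> e \<and> e \<subseteq> V0} \<le> b"
    and br: "b + 1 \<le> r"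
  shows "\<exists>Q. star_packing Q \<and> (\<forall>\<tau>\<in>Ty. \<forall>v. card {e \<in> rest Q \<tau>. v \<in> e} \<le> r) \<and>
    (\<forall>\<tau>\<in>Ty. 4 * (r - 1 - b) \<le> card (rest Q \<tau>) \<or>
      (\<exists>W \<subseteq> V0. finite W \<and> card W \<le> 3 \<and> (\<forall>w\<in>W. r < card {e \<in> cr. ty e = \<tau> \<and> w \<in> e}) \<and>
        card {e \<in> cr. ty e = \<tau>} + card W * (r - 1 - b)
          \<le> card (rest Q \<tau>) + (\<Sum>w\<in>W. card {e \<in> cr. ty e = \<tau> \<and> w \<in> e})))"
proof -
  define good where "good Q \<longleftrightarrow> star_packing Q \<and> (\<forall>\<tau>\<in>Ty. \<forall>v. card {e \<in> rest Q \<tau>. v \<in> e} \<le> r)" for Q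
  obtain Q0 where Q0: "star_packing Q0" "\<forall>\<tau> p. star_pair V0 p \<longrightarrow> \<not> p \<subseteq> rest Q0 \<tau>"
    using starless_packing by blast
  have "card {e \<in> rest Q0 \<tau>. v \<in> e} \<le> b + 1" for \<tau> v
    using rest_without_stars[OF _ lowA lowV] Q0(2) by blast
  then have "good Q0" unfolding good_def using Q0(1) br le_trans by blast
  then obtain Q where Q: "good Q" and min: "\<And>Q'. good Q' \<Longrightarrow> card Q \<le> card Q'"
    using ex_has_least_nat[of good Q0 card] by blast
  have pk: "star_packing Q" and degr: "\<And>\<tau> v. \<tau> \<in> Ty \<Longrightarrow> card {e \<in> rest Q \<tau>. v \<in> e} \<le> r"
    using Q unfolding good_def by auto
  have finQ: "finite Q" using packing_finite[OF pk] .
  \<comment> \<open>Without \<open>p\<close> the packing is no longer good, and the excess must be at the centre of \<open>p\<close>, because vertices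
    outside \<open>V\<^sub>0\<close> have low degree.\<close>
  have tight: "r \<le> card {e \<in> rest Q \<tau>. v \<in> e} + 1 \<and> r < card {e \<in> cr. ty e = \<tau> \<and> v \<in> e}"
    if p: "p \<in> Q" "v \<in> V0" "p = {{v, x}, {v, y}}" "x \<notin> V0" "y \<notin> V0" "x \<noteq> y" "p \<subseteq> {e \<in> cr. ty e = \<tau>}" for p v x y \<tau>
  proof -
    let ?Q = "Q - {p}"
    have pQ: "p \<inter> \<Union>?Q = {}" using pk p(1) unfolding star_packing_def disjoint_def by blast
    have pk': "star_packing ?Q" using pk unfolding star_packing_def by (auto simp: disjoint_def)
    have "card ?Q < card Q" using p(1) finQ by (intro psubset_card_mono) auto
    then have "\<not> good ?Q" using min[of ?Q] by linarith
    then obtain \<sigma> w where w: "\<sigma> \<in> Ty" "r < card {e \<in> rest ?Q \<sigma>. w \<in> e}"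
      unfolding good_def using pk' by (auto simp: not_le)
    have rs: "rest ?Q \<sigma> = rest Q \<sigma> \<union> (if \<sigma> = \<tau> then p else {})"
      using p(1,7) pQ unfolding rest_def by auto
    have ne: "{e \<in> rest ?Q \<sigma>. w \<in> e} \<noteq> {e \<in> rest Q \<sigma>. w \<in> e}" using w degr[OF w(1), of w] by (metis not_le)
    then have st: "\<sigma> = \<tau>" unfolding rs by (auto split: if_splits)
    have "\<exists>e\<in>p. w \<in> e" using ne unfolding rs unfolding st by auto
    then have wc: "w = v \<or> w = x \<or> w = y" unfolding p(3) by auto
    have "w \<in> V0"
    proof (rule ccontr)
      assume "w \<notin> V0"
      then have "card {e \<in> cr. w \<in> e} \<le> b" by (rule lowA)
      moreover have "card {e \<in> rest ?Q \<sigma>. w \<in> e} \<le> card {e \<in> cr. w \<in> e}"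
        using fin_cr rest_sub by (intro card_mono) auto
      ultimately show False using w(2) br by linarith
    qed
    then have wv: "w = v" using wc p(4,5) by blast
    have "{e \<in> rest ?Q \<tau>. v \<in> e} \<subseteq> {e \<in> rest Q \<tau>. v \<in> e} \<union> p" using rs st by auto
    then have "card {e \<in> rest ?Q \<tau>. v \<in> e} \<le> card ({e \<in> rest Q \<tau>. v \<in> e} \<union> p)"
      using rest_finite[of Q \<tau>] p(3) by (intro card_mono) auto
    also have "\<dots> \<le> card {e \<in> rest Q \<tau>. v \<in> e} + card p" by (rule card_Un_le)
    also have "card p \<le> 2" unfolding p(3) by (simp add: card_insert_if)
    finally have a: "r \<le> card {e \<in> rest Q \<tau>. v \<in> e} + 1" using w(2) unfolding st wv by linarith
    have "card {e \<in> rest ?Q \<tau>. v \<in> e} \<le> card {e \<in> cr. ty e = \<tau> \<and> v \<in> e}"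
      using fin_cr by (intro card_mono) (auto simp: rest_def)
    then show ?thesis using a w(2) unfolding st wv by linarith
  qed
  have "4 * (r - 1 - b) \<le> card (rest Q \<tau>) \<or>
      (\<exists>W \<subseteq> V0. finite W \<and> card W \<le> 3 \<and> (\<forall>w\<in>W. r < card {e \<in> cr. ty e = \<tau> \<and> w \<in> e}) \<and>
        card {e \<in> cr. ty e = \<tau>} + card W * (r - 1 - b)
          \<le> card (rest Q \<tau>) + (\<Sum>w\<in>W. card {e \<in> cr. ty e = \<tau> \<and> w \<in> e}))" if \<tau>: "\<tau> \<in> Ty" for \<tau>
  proof -
    \<comment> \<open>The centres of the star pairs of type \<open>\<tau>\<close>.\<close>
    define W where "W = {v \<in> V0. \<exists>p\<in>Q. \<exists>x y. p = {{v, x}, {v, y}} \<and> x \<notin> V0 \<and> y \<notin> V0 \<and> x \<noteq> y \<and> p \<subseteq> {e \<in> cr. ty e = \<tau>}}"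
    have W: "v \<in> V0" "r \<le> card {e \<in> rest Q \<tau>. v \<in> e} + 1" "r < card {e \<in> cr. ty e = \<tau> \<and> v \<in> e}" if v: "v \<in> W" for v
    proof -
      obtain p x y where p: "v \<in> V0" "p \<in> Q" "p = {{v, x}, {v, y}}" "x \<notin> V0" "y \<notin> V0" "x \<noteq> y" "p \<subseteq> {e \<in> cr. ty e = \<tau>}"
        using v unfolding W_def by blast
      show "v \<in> V0" by (rule p(1))
      show "r \<le> card {e \<in> rest Q \<tau>. v \<in> e} + 1" "r < card {e \<in> cr. ty e = \<tau> \<and> v \<in> e}"
        using tight[OF p(2,1,3-7)] by blast+
    qed
    have finW: "finite W"
    proof (rule finite_subset)
      show "W \<subseteq> \<Union>cr" unfolding W_def using packing_sub[OF pk] by blast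
      have "finite e" if "e \<in> cr" for e using bip[OF that] by auto
      then show "finite (\<Union>cr)" using fin_cr by (intro finite_Union)
    qed
    define Y where "Y v = {e \<in> rest Q \<tau>. v \<in> e \<and> \<not> e \<subseteq> V0}" for v
    have finY: "finite (Y v)" for v unfolding Y_def using rest_finite[of Q \<tau>] by simp
    have cY: "r - 1 - b \<le> card (Y v)" if v: "v \<in> W" for v
    proof -
      have "{e \<in> rest Q \<tau>. v \<in> e} \<subseteq> Y v \<union> {e \<in> cr. v \<in> e \<and> e \<subseteq> V0}" unfolding Y_def using rest_sub by auto
      then have "card {e \<in> rest Q \<tau>. v \<in> e} \<le> card (Y v \<union> {e \<in> cr. v \<in> e \<and> e \<subseteq> V0})"
        using finY fin_cr by (intro card_mono) auto
      also have "\<dots> \<le> card (Y v) + card {e \<in> cr. v \<in> e \<and> e \<subseteq> V0}" by (rule card_Un_le)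
      finally show ?thesis using W(2)[OF v] lowV[OF W(1)[OF v]] by linarith
    qed
    have Yd: "Y v \<inter> Y w = {}" if vw: "v \<in> V0" "w \<in> V0" "v \<noteq> w" for v w
    proof (rule ccontr)
      assume "Y v \<inter> Y w \<noteq> {}"
      then obtain e where e: "e \<in> Y v" "e \<in> Y w" by blast
      then have "e \<in> cr" unfolding Y_def using rest_sub by blast
      then obtain x y where "e = {x, y}" using bip by blast
      then show False using e vw unfolding Y_def by auto
    qed
    have sumY: "card X * (r - 1 - b) \<le> card (\<Union>v\<in>X. Y v)" if X: "X \<subseteq> W" for X
    proof -
      have fX: "finite X" using finite_subset[OF X finW] .
      have "card X * (r - 1 - b) = (\<Sum>v\<in>X. r - 1 - b)" by simp
      also have "\<dots> \<le> (\<Sum>v\<in>X. card (Y v))" using cY X by (intro sum_mono) blast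
      also have "\<dots> = card (\<Union>v\<in>X. Y v)"
        using fX finY Yd X W(1) by (intro card_UN_disjoint[symmetric]) blast+
      finally show ?thesis .
    qed
    show ?thesis
    proof (cases "4 \<le> card W")
      case True
      then obtain X where X: "X \<subseteq> W" "card X = 4" by (meson obtain_subset_with_card_n)
      have "card (\<Union>v\<in>X. Y v) \<le> card (rest Q \<tau>)"
        using rest_finite[of Q \<tau>] unfolding Y_def by (intro card_mono) auto
      then show ?thesis using sumY[OF X(1)] X(2) by simp
    next
      case False
      let ?N = "{e \<in> cr. ty e = \<tau> \<and> e \<inter> W = {}}"
      have Nrest: "?N \<subseteq> rest Q \<tau>"
      proof
        fix e assume e: "e \<in> ?N"
        have "e \<notin> \<Union>Q"
        proof
          assume "e \<in> \<Union>Q"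
          then obtain p where p: "p \<in> Q" "e \<in> p" by blast
          obtain \<sigma> where s: "p \<subseteq> {e \<in> cr. ty e = \<sigma>}" and st: "star_pair V0 p"
            using pk p(1) unfolding star_packing_def by blast
          have "\<sigma> = \<tau>" using s e p(2) by blast
          obtain v x y where v: "v \<in> V0" "x \<notin> V0" "y \<notin> V0" "x \<noteq> y" "p = {{v, x}, {v, y}}"
            using st unfolding star_pair_def by blast
          have "p \<subseteq> {e \<in> cr. ty e = \<tau>}" using s \<open>\<sigma> = \<tau>\<close> by simp
          then have "v \<in> W" unfolding W_def using v p(1) by blast
          moreover have "v \<in> e" using p(2) v(5) by blast
          ultimately show False using e by blast
        qed
        then show "e \<in> rest Q \<tau>" using e unfolding rest_def by blast
      qed
      have "?N \<inter> (\<Union>v\<in>W. Y v) = {}" unfolding Y_def by blast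
      then have "card ?N + card (\<Union>v\<in>W. Y v) = card (?N \<union> (\<Union>v\<in>W. Y v))"
        using fin_cr finW finY by (intro card_Un_disjoint[symmetric]) auto
      also have "\<dots> \<le> card (rest Q \<tau>)"
        using Nrest rest_finite[of Q \<tau>] unfolding Y_def by (intro card_mono) auto
      finally have c1: "card ?N + card W * (r - 1 - b) \<le> card (rest Q \<tau>)" using sumY[OF subset_refl] by linarith
      have "{e \<in> cr. ty e = \<tau>} \<subseteq> ?N \<union> (\<Union>w\<in>W. {e \<in> cr. ty e = \<tau> \<and> w \<in> e})" by blast
      then have "card {e \<in> cr. ty e = \<tau>} \<le> card (?N \<union> (\<Union>w\<in>W. {e \<in> cr. ty e = \<tau> \<and> w \<in> e}))"
        using fin_cr finW by (intro card_mono) auto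
      also have "\<dots> \<le> card ?N + card (\<Union>w\<in>W. {e \<in> cr. ty e = \<tau> \<and> w \<in> e})" by (rule card_Un_le)
      also have "card (\<Union>w\<in>W. {e \<in> cr. ty e = \<tau> \<and> w \<in> e}) \<le> (\<Sum>w\<in>W. card {e \<in> cr. ty e = \<tau> \<and> w \<in> e})"
        by (rule card_UN_le[OF finW])
      finally have "card {e \<in> cr. ty e = \<tau>} + card W * (r - 1 - b)
          \<le> card (rest Q \<tau>) + (\<Sum>w\<in>W. card {e \<in> cr. ty e = \<tau> \<and> w \<in> e})" using c1 by linarith
      moreover have "W \<subseteq> V0" "\<forall>w\<in>W. r < card {e \<in> cr. ty e = \<tau> \<and> w \<in> e}" using W by blast+
      moreover have "card W \<le> 3" using False by simp
      ultimately show ?thesis using finW by blast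
    qed
  qed
  then show ?thesis using pk degr by blast
qed

text \<open>The choice \<open>r = 3t/5\<close> satisfies \<open>56/100 * t < r\<close>, so that nothing need be trimmed if all crossing degrees
  are at most \<open>56/100 * NN\<close>, and \<open>4r > 2t\<close>, which settles the case of four centres in \<open>trimmed_packing\<close>.
  For at most three centres \<open>W\<close>, the second alternative of the last assumption says, once divided by \<open>kk\<close>, that
  replacing the edges at each centre by \<open>56/100 * t < r\<close> of them leaves at least \<open>205/100 * t\<close> edges of
  type \<open>\<tau>\<close>. The errors of the slicing are small multiples of \<open>z\<close> or \<open>t\<close>.\<close>
lemma admissible_exists:
  fixes t b r lo s :: nat and x z \<epsilon> kk NN :: real
  assumes lowA: "\<And>v. v \<notin> V0 \<Longrightarrow> card {e \<in> cr. v \<in> e} \<le> b"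
    and lowV: "\<And>v. v \<in> V0 \<Longrightarrow> card {e \<in> cr. v \<in> e \<and> e \<subseteq> V0} \<le> b"
    and kk: "kk = real (card Ty)" "0 < kk" and NN: "NN = kk * t"
    and up: "\<And>v \<tau>. v \<in> V0 \<Longrightarrow> \<tau> \<in> Ty \<Longrightarrow>
      real (card {e \<in> cr. ty e = \<tau> \<and> v \<in> e}) \<le> (real (card {e \<in> cr. v \<in> e}) + x) / kk + 1 + b"
    and low: "\<And>\<tau>. \<tau> \<in> Ty \<Longrightarrow> ((1 - \<epsilon>) * card cr - 3 * x) / kk - b - 1 \<le> real (card {e \<in> cr. ty e = \<tau>})"
    and half: "\<And>v. v \<in> V0 \<Longrightarrow> real (card {e \<in> cr. v \<in> e}) \<le> 101 / 100 * NN"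
    and par: "lo + s = 2 * t" "r = 3 * t div 5"
    and sm: "x / kk \<le> z / 1000" "real b + 2 \<le> z / 500" "1000 \<le> z" "\<epsilon> * t \<le> z / 1000" "z - 1 \<le> real s" "100 * z \<le> t"
      "0 \<le> \<epsilon>" "\<epsilon> \<le> 1" "0 \<le> x"
    and adm: "((\<forall>v\<in>V0. real (card {e \<in> cr. v \<in> e}) \<le> 56 / 100 * NN) \<and> 2 * NN \<le> card cr) \<or>
      (\<forall>W \<subseteq> V0. finite W \<longrightarrow> card W \<le> 3 \<longrightarrow>
         205 / 100 * NN + (\<Sum>w\<in>W. real (card {e \<in> cr. w \<in> e})) \<le> card cr + 56 / 100 * NN * card W)"
  shows "\<exists>Q. admissible r lo (2 * (card Ty * t)) Q"
proof -
  have rr: "3 / 5 * real t - 1 \<le> real r"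
  proof -
    have "3 * t < 5 * (r + 1)" unfolding par(2) by presburger
    then have "real (3 * t) < real (5 * (r + 1))" by (simp only: of_nat_less_iff)
    then show ?thesis by simp
  qed
  have br: "b + 1 \<le> r"
  proof -
    have "real b + 1 \<le> real r" using rr sm(2,3,6) by linarith
    then show ?thesis by linarith
  qed
  from adm show ?thesis
  proof
    assume I: "(\<forall>v\<in>V0. real (card {e \<in> cr. v \<in> e}) \<le> 56 / 100 * NN) \<and> 2 * NN \<le> card cr"
    have rest0: "rest {} \<tau> = {e \<in> cr. ty e = \<tau>}" for \<tau> unfolding rest_def by auto
    have "card {e \<in> rest {} \<tau>. v \<in> e} \<le> r" if \<tau>: "\<tau> \<in> Ty" for \<tau> v
    proof (cases "v \<in> V0")
      case False
      have "card {e \<in> rest {} \<tau>. v \<in> e} \<le> card {e \<in> cr. v \<in> e}"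
        using fin_cr rest_sub by (intro card_mono) auto
      then show ?thesis using lowA[OF False] br by linarith
    next
      case True
      have "(real (card {e \<in> cr. v \<in> e}) + x) / kk \<le> (56 / 100 * NN + x) / kk"
        using I True kk(2) by (intro divide_right_mono) auto
      also have "\<dots> = 56 / 100 * t + x / kk" unfolding NN using kk(2) by (simp add: field_simps)
      finally have "real (card {e \<in> cr. ty e = \<tau> \<and> v \<in> e}) \<le> 56 / 100 * t + x / kk + 1 + b"
        using up[OF True \<tau>] by linarith
      then have "real (card {e \<in> cr. ty e = \<tau> \<and> v \<in> e}) \<le> real r" using rr sm by linarith
      moreover have "{e \<in> rest {} \<tau>. v \<in> e} = {e \<in> cr. ty e = \<tau> \<and> v \<in> e}" unfolding rest0 by auto
      ultimately show ?thesis by simp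
    qed
    moreover have "lo \<le> card (rest {} \<tau>)" if \<tau>: "\<tau> \<in> Ty" for \<tau>
    proof -
      have "(1 - \<epsilon>) * (2 * NN) \<le> (1 - \<epsilon>) * card cr" using I sm(8) by (intro mult_left_mono) auto
      then have "((1 - \<epsilon>) * (2 * NN) - 3 * x) / kk \<le> ((1 - \<epsilon>) * card cr - 3 * x) / kk"
        using kk(2) by (intro divide_right_mono) auto
      moreover have "((1 - \<epsilon>) * (2 * NN) - 3 * x) / kk = 2 * t - 2 * (\<epsilon> * t) - 3 * (x / kk)"
        unfolding NN using kk(2) by (simp add: field_simps)
      ultimately have "2 * t - 2 * (\<epsilon> * t) - 3 * (x / kk) - b - 1 \<le> real (card {e \<in> cr. ty e = \<tau>})"
        using low[OF \<tau>] by linarith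
      then have "2 * real t - real s \<le> real (card {e \<in> cr. ty e = \<tau>})" using sm by linarith
      moreover have "real lo + real s = 2 * real t" using par(1) by linarith
      ultimately show ?thesis unfolding rest0 by linarith
    qed
    moreover have "2 * (card Ty * t) \<le> card (cr - \<Union>{})"
    proof -
      have "2 * (kk * t) \<le> card cr" using I NN by simp
      then have "real (2 * (card Ty * t)) \<le> real (card cr)" using kk(1) by simp
      then have "2 * (card Ty * t) \<le> card cr" by (simp only: of_nat_le_iff)
      then show ?thesis by simp
    qed
    ultimately have "admissible r lo (2 * (card Ty * t)) {}" unfolding admissible_def using packing_empty by blast
    then show ?thesis ..
  next
    assume II: "\<forall>W \<subseteq> V0. finite W \<longrightarrow> card W \<le> 3 \<longrightarrow>
         205 / 100 * NN + (\<Sum>w\<in>W. real (card {e \<in> cr. w \<in> e})) \<le> card cr + 56 / 100 * NN * card W"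
    obtain Q where pk: "star_packing Q" and deg: "\<forall>\<tau>\<in>Ty. \<forall>v. card {e \<in> rest Q \<tau>. v \<in> e} \<le> r"
      and big: "\<forall>\<tau>\<in>Ty. 4 * (r - 1 - b) \<le> card (rest Q \<tau>) \<or>
      (\<exists>W \<subseteq> V0. finite W \<and> card W \<le> 3 \<and> (\<forall>w\<in>W. r < card {e \<in> cr. ty e = \<tau> \<and> w \<in> e}) \<and>
        card {e \<in> cr. ty e = \<tau>} + card W * (r - 1 - b)
          \<le> card (rest Q \<tau>) + (\<Sum>w\<in>W. card {e \<in> cr. ty e = \<tau> \<and> w \<in> e}))"
    proof -
      have "\<exists>Q. star_packing Q \<and> (\<forall>\<tau>\<in>Ty. \<forall>v. card {e \<in> rest Q \<tau>. v \<in> e} \<le> r) \<and>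
    (\<forall>\<tau>\<in>Ty. 4 * (r - 1 - b) \<le> card (rest Q \<tau>) \<or>
      (\<exists>W \<subseteq> V0. finite W \<and> card W \<le> 3 \<and> (\<forall>w\<in>W. r < card {e \<in> cr. ty e = \<tau> \<and> w \<in> e}) \<and>
        card {e \<in> cr. ty e = \<tau>} + card W * (r - 1 - b)
          \<le> card (rest Q \<tau>) + (\<Sum>w\<in>W. card {e \<in> cr. ty e = \<tau> \<and> w \<in> e})))"
        by (rule trimmed_packing[OF _ _ br]) (simp_all add: lowA lowV)
      then show thesis by (elim exE conjE) (rule that)
    qed
    have rb: "real (r - 1 - b) = real r - 1 - real b" using br by (simp add: of_nat_diff)
    have NN0: "0 \<le> NN" unfolding NN using kk(2) by simp
    have r2t: "2 * t \<le> card (rest Q \<tau>)" if \<tau>: "\<tau> \<in> Ty" for \<tau>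
    proof -
      from big \<tau> consider "4 * (r - 1 - b) \<le> card (rest Q \<tau>)"
        | W where "W \<subseteq> V0" "finite W" "card W \<le> 3" "card {e \<in> cr. ty e = \<tau>} + card W * (r - 1 - b)
          \<le> card (rest Q \<tau>) + (\<Sum>w\<in>W. card {e \<in> cr. ty e = \<tau> \<and> w \<in> e})" by blast
      then show ?thesis
      proof cases
        case 1
        then have "real (4 * (r - 1 - b)) \<le> real (card (rest Q \<tau>))" by (simp only: of_nat_le_iff)
        then have "4 * (real r - 1 - real b) \<le> real (card (rest Q \<tau>))" unfolding rb[symmetric] by simp
        then have "2 * real t \<le> real (card (rest Q \<tau>))" using rr sm(2,3,6) by argo
        then show ?thesis by linarith
      next
        case 2
        \<comment> \<open>\<open>Y\<close> below bounds the number of crossing edges from below; the bound \<open>Y \<le> 6 * NN\<close> is used to control the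
          error \<open>\<epsilon> * Y\<close>.\<close>
        define Sd where "Sd = (\<Sum>w\<in>W. real (card {e \<in> cr. w \<in> e}))"
        define c where "c = real (card W)"
        have c3: "0 \<le> c" "c \<le> 3" unfolding c_def using 2(3) by auto
        have main: "real (card {e \<in> cr. ty e = \<tau>}) + c * (real r - 1 - real b) \<le> real (card (rest Q \<tau>)) +
           (\<Sum>w\<in>W. real (card {e \<in> cr. ty e = \<tau> \<and> w \<in> e}))"
        proof -
          have "real (card {e \<in> cr. ty e = \<tau>} + card W * (r - 1 - b))
             \<le> real (card (rest Q \<tau>) + (\<Sum>w\<in>W. card {e \<in> cr. ty e = \<tau> \<and> w \<in> e}))"
            using 2(4) by (simp only: of_nat_le_iff)
          then show ?thesis unfolding c_def rb[symmetric] by simp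
        qed
        have "(\<Sum>w\<in>W. real (card {e \<in> cr. ty e = \<tau> \<and> w \<in> e})) \<le> (\<Sum>w\<in>W. (real (card {e \<in> cr. w \<in> e}) + x) / kk + 1 + b)"
          using up \<tau> 2(1) by (intro sum_mono) blast
        also have "\<dots> = Sd / kk + c * (x / kk) + c * (1 + real b)"
          unfolding Sd_def c_def by (simp add: sum.distrib sum_divide_distrib add_divide_distrib algebra_simps)
        finally have sumd: "(\<Sum>w\<in>W. real (card {e \<in> cr. ty e = \<tau> \<and> w \<in> e})) \<le> Sd / kk + c * (x / kk) + c * (1 + real b)" .
        have "Sd \<le> (\<Sum>w\<in>W. 101 / 100 * NN)" unfolding Sd_def using half 2(1) by (intro sum_mono) blast
        also have "\<dots> = c * (101 / 100 * NN)" unfolding c_def by simp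
        also have "\<dots> \<le> 3 * (101 / 100 * NN)" using c3 NN0 by (intro mult_right_mono) auto
        finally have Sdle: "Sd \<le> 303 / 100 * NN" by simp
        have "205 / 100 * NN + Sd - 56 / 100 * NN * c \<le> card cr" using II 2(1-3) unfolding Sd_def c_def by (smt (verit))
        then obtain Y where Y: "Y = 205 / 100 * NN + Sd - 56 / 100 * NN * c" "Y \<le> card cr" by blast
        have Y6: "Y \<le> 6 * NN"
        proof -
          have "0 \<le> NN * c" using NN0 c3(1) by (rule mult_nonneg_nonneg)
          then show ?thesis unfolding Y(1) using Sdle NN0 by linarith
        qed
        have "(1 - \<epsilon>) * Y \<le> (1 - \<epsilon>) * card cr" using sm(8) Y(2) by (intro mult_left_mono) auto
        moreover have "Y - 6 * (\<epsilon> * NN) \<le> (1 - \<epsilon>) * Y"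
        proof -
          have "\<epsilon> * Y \<le> \<epsilon> * (6 * NN)" using Y6 sm(7) by (rule mult_left_mono)
          then show ?thesis by (simp add: left_diff_distrib)
        qed
        ultimately have "Y - 6 * (\<epsilon> * NN) - 3 * x \<le> (1 - \<epsilon>) * card cr - 3 * x" by argo
        then have "205 / 100 * NN + Sd - 56 / 100 * NN * c - 6 * (\<epsilon> * NN) - 3 * x \<le> (1 - \<epsilon>) * card cr - 3 * x"
          unfolding Y(1) .
        then have "(205 / 100 * NN + Sd - 56 / 100 * NN * c - 6 * (\<epsilon> * NN) - 3 * x) / kk \<le> ((1 - \<epsilon>) * card cr - 3 * x) / kk"
          using kk(2) by (intro divide_right_mono) auto
        moreover have "(205 / 100 * NN + Sd - 56 / 100 * NN * c - 6 * (\<epsilon> * NN) - 3 * x) / kk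
           = 205 / 100 * t + Sd / kk - 56 / 100 * (c * t) - 6 * (\<epsilon> * t) - 3 * (x / kk)"
          unfolding NN using kk(2) by (simp add: field_simps)
        ultimately have lowC: "205 / 100 * t + Sd / kk - 56 / 100 * (c * t) - 6 * (\<epsilon> * t) - 3 * (x / kk) - b - 1
           \<le> real (card {e \<in> cr. ty e = \<tau>})" using low[OF \<tau>] by linarith
        have cx: "c * (x / kk) \<le> 3 * (x / kk)" using c3 sm(9) kk(2) by (intro mult_right_mono) auto
        have cb: "c * (1 + real b) \<le> 3 * (1 + real b)" using c3 by (intro mult_right_mono) auto
        have "0 \<le> c * (real r - 1 - real b - 56 / 100 * t)"
        proof (rule mult_nonneg_nonneg[OF c3(1)])
          show "0 \<le> real r - 1 - real b - 56 / 100 * t" using rr sm by linarith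
        qed
        then have cr1: "56 / 100 * (c * t) \<le> c * (real r - 1 - real b)" by (simp add: algebra_simps)
        have "2 * real t \<le> real (card (rest Q \<tau>))"
          using main sumd lowC cx cb cr1 sm(1,2,3,4,6) by argo
        then show ?thesis by linarith
      qed
    qed
    have "2 * (card Ty * t) \<le> card (cr - \<Union>Q)"
    proof -
      have "(\<Sum>\<tau>\<in>Ty. 2 * t) \<le> (\<Sum>\<tau>\<in>Ty. card (rest Q \<tau>))" using r2t by (intro sum_mono) auto
      then show ?thesis unfolding rest_sum by simp
    qed
    moreover have "lo \<le> card (rest Q \<tau>)" if "\<tau> \<in> Ty" for \<tau> using r2t[OF that] par(1) by linarith
    ultimately have "admissible r lo (2 * (card Ty * t)) Q" unfolding admissible_def using pk deg by blast
    then show ?thesis ..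
  qed
qed

end

section \<open>Distributing the remaining edges at exceptional vertices\<close>

text \<open>For a fixed exceptional vertex, \<open>N\<close> is the set of its remaining neighbours, \<open>q c\<close> the number of edges
  that it still needs in colour \<open>c\<close>, and \<open>dest c\<close> the cluster prescribed by \<open>c\<close>, with \<open>None\<close> for nonlocal
  colours. Each colour is split into \<open>q c\<close> slots. The slots with destination \<open>i\<close> are matched into the part
  \<open>i\<close> of \<open>N\<close>; then the nonlocal slots are matched to all that is left, which has the right size by
  \<open>total\<close>. Both steps are matchings with slack.\<close>
lemma star_allocation:
  fixes N :: "'a set" and Col :: "'c set" and q :: "'c \<Rightarrow> nat"
    and dest :: "'c \<Rightarrow> 'i option" and part :: "'a \<Rightarrow> 'i" and bad :: "'a \<Rightarrow> 'c \<Rightarrow> bool"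
  assumes fin: "finite N" "finite Col"
    and q2: "\<And>c. c \<in> Col \<Longrightarrow> q c \<le> 2"
    and total: "(\<Sum>c\<in>Col. q c) = card N"
    and I: "\<And>c i. c \<in> Col \<Longrightarrow> dest c = Some i \<Longrightarrow> i \<in> I"
    and demand: "\<And>i. i \<in> I \<Longrightarrow> (\<Sum>c\<in>{c\<in>Col. dest c = Some i}. q c) \<le> card {a \<in> N. part a = i}"
    and large: "\<And>i. i \<in> I \<Longrightarrow> 3 * L < card {a \<in> N. part a = i}"
      "3 * L < (\<Sum>c\<in>{c\<in>Col. dest c = None}. q c)"
    and bad1: "\<And>c. c \<in> Col \<Longrightarrow> card {a \<in> N. bad a c} \<le> L"
    and bad2: "\<And>a. a \<in> N \<Longrightarrow> 2 * card {c \<in> Col. bad a c} \<le> L"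
  shows "\<exists>h. h ` N \<subseteq> Col \<and> (\<forall>c\<in>Col. card {a \<in> N. h a = c} = q c) \<and>
    (\<forall>a\<in>N. \<not> bad a (h a) \<and> (\<forall>i. dest (h a) = Some i \<longrightarrow> part a = i))"
proof -
  \<comment> \<open>The slots of the colours with destination \<open>d\<close>.\<close>
  define X where "X d = Sigma {c \<in> Col. dest c = d} (\<lambda>c. {..<q c})" for d
  have fX: "finite (X d)" for d unfolding X_def using fin by auto
  have cX: "card (X d) = (\<Sum>c\<in>{c\<in>Col. dest c = d}. q c)" for d
    unfolding X_def using fin by (subst card_SigmaI) auto
  have badX: "card {x \<in> X d. bad a (fst x)} \<le> L" if "a \<in> N" for a d
  proof -
    have "{x \<in> X d. bad a (fst x)} \<subseteq> {c \<in> Col. bad a c} \<times> {..<2}"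
      using q2 unfolding X_def by fastforce
    then have "card {x \<in> X d. bad a (fst x)} \<le> card ({c \<in> Col. bad a c} \<times> {..<2::nat})"
      using fin by (intro card_mono) auto
    then show ?thesis using bad2[OF that] by (simp add: card_cartesian_product)
  qed
  have badN: "card {a \<in> Y. bad a (fst x)} \<le> L" if "x \<in> X d" "Y \<subseteq> N" for x d Y
  proof -
    have "card {a \<in> Y. bad a (fst x)} \<le> card {a \<in> N. bad a (fst x)}"
      using that fin by (intro card_mono) auto
    then show ?thesis using bad1[of "fst x"] that unfolding X_def by fastforce
  qed
  have "\<exists>f. inj_on f (X (Some i)) \<and> f ` X (Some i) \<subseteq> {a \<in> N. part a = i} \<and> (\<forall>x\<in>X (Some i). \<not> bad (f x) (fst x))"
    if "i \<in> I" for i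
  proof (rule matching_with_slack[where p = L and q = L])
    show "card (X (Some i)) \<le> card {a \<in> N. part a = i}" using demand[OF that] cX by simp
    show "card {x \<in> X (Some i). bad y (fst x)} \<le> L" if "y \<in> {a \<in> N. part a = i}" for y
      using badX that by blast
    show "card {y \<in> {a \<in> N. part a = i}. bad y (fst x)} \<le> L" if "x \<in> X (Some i)" for x
      using badN[OF that, of "{a \<in> N. part a = i}"] by blast
    show "2 * L + L < card {a \<in> N. part a = i}" using large(1)[OF that] by simp
  qed (use fin fX in auto)
  then obtain f where f: "\<And>i. i \<in> I \<Longrightarrow> inj_on (f i) (X (Some i))"
     "\<And>i. i \<in> I \<Longrightarrow> f i ` X (Some i) \<subseteq> {a \<in> N. part a = i}"
     "\<And>i x. i \<in> I \<Longrightarrow> x \<in> X (Some i) \<Longrightarrow> \<not> bad (f i x) (fst x)"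
    by metis
  define Sl where "Sl = Sigma Col (\<lambda>c. {..<q c})"
  \<comment> \<open>All local slots; \<open>X None\<close> are the others.\<close>
  define XS where "XS = {x \<in> Sl. dest (fst x) \<noteq> None}"
  have SlX: "x \<in> X (dest (fst x))" "fst x \<in> Col" if "x \<in> Sl" for x using that unfolding Sl_def X_def by auto
  have fSl: "finite Sl" unfolding Sl_def using fin by auto
  have cSl: "card Sl = card N" unfolding Sl_def using fin total by (subst card_SigmaI) auto
  define F0 where "F0 x = f (the (dest (fst x))) x" for x
  have F0: "F0 x \<in> N" "dest (fst x) = Some (part (F0 x))" "\<not> bad (F0 x) (fst x)" if x: "x \<in> XS" for x
  proof -
    obtain i where i: "dest (fst x) = Some i" using x unfolding XS_def by auto
    have xS: "x \<in> Sl" using x unfolding XS_def by simp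
    have iI: "i \<in> I" using I[OF SlX(2)[OF xS] i] .
    have "x \<in> X (Some i)" using SlX(1)[OF xS] i by simp
    then show "F0 x \<in> N" "dest (fst x) = Some (part (F0 x))" "\<not> bad (F0 x) (fst x)"
      using f(2)[OF iI] f(3)[OF iI] i unfolding F0_def by auto
  qed
  have injF0: "inj_on F0 XS"
  proof (rule inj_onI)
    fix x y assume xy: "x \<in> XS" "y \<in> XS" "F0 x = F0 y"
    obtain i where i: "dest (fst x) = Some i" using xy unfolding XS_def by auto
    then have j: "dest (fst y) = Some i" using F0(2)[OF xy(1)] F0(2)[OF xy(2)] xy(3) by simp
    have xS: "x \<in> Sl" "y \<in> Sl" using xy unfolding XS_def by auto
    have iI: "i \<in> I" using I[OF SlX(2)[OF xS(1)] i] .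
    show "x = y" using f(1)[OF iI] SlX(1)[OF xS(1)] SlX(1)[OF xS(2)] i j xy(3) unfolding F0_def inj_on_def by simp
  qed
  \<comment> \<open>What the local slots leave over.\<close>
  define R where "R = N - F0 ` XS"
  have Sl_split: "Sl = XS \<union> X None" "XS \<inter> X None = {}" unfolding XS_def Sl_def X_def by auto
  have fXS: "finite XS" using fSl unfolding XS_def by simp
  have cR: "card R = card (X None)"
  proof -
    have "card R = card N - card XS"
      unfolding R_def using F0(1) fXS injF0 by (subst card_Diff_subset) (auto simp: card_image)
    moreover have "card Sl = card XS + card (X None)"
      using Sl_split fXS fX by (metis card_Un_disjoint)
    ultimately show ?thesis using cSl by simp
  qed
  obtain g where g: "inj_on g (X None)" "g ` X None \<subseteq> R" "\<forall>x\<in>X None. \<not> bad (g x) (fst x)"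
  proof -
    have "\<exists>g. inj_on g (X None) \<and> g ` X None \<subseteq> R \<and> (\<forall>x\<in>X None. \<not> bad (g x) (fst x))"
    proof (rule matching_with_slack[where p = L and q = L])
      show "2 * L + L < card R" using large(2) cR cX by simp
      show "card {x \<in> X None. bad y (fst x)} \<le> L" if "y \<in> R" for y
        using badX that unfolding R_def by blast
      show "card {y \<in> R. bad y (fst x)} \<le> L" if "x \<in> X None" for x
        using badN[OF that, of R] unfolding R_def by blast
    qed (use fin fX cR in \<open>auto simp: R_def\<close>)
    then show ?thesis using that by blast
  qed
  define F where "F x = (if x \<in> XS then F0 x else g x)" for x
  have gN: "g x \<in> N" "g x \<notin> F0 ` XS" if "x \<in> X None" for x using g(2) that unfolding R_def by auto
  have nXS: "x \<in> X None" if "x \<in> Sl" "x \<notin> XS" for x using Sl_split that by blast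
  have injF: "inj_on F Sl"
  proof (rule inj_onI)
    fix x y assume xy: "x \<in> Sl" "y \<in> Sl" "F x = F y"
    show "x = y"
    proof (cases "x \<in> XS"; cases "y \<in> XS")
      assume "x \<in> XS" "y \<in> XS"
      then show ?thesis using xy injF0 unfolding F_def inj_on_def by simp
    next
      assume "x \<notin> XS" "y \<notin> XS"
      then show ?thesis using xy nXS g(1) unfolding F_def inj_on_def by simp
    next
      assume "x \<in> XS" "y \<notin> XS"
      then show ?thesis using xy nXS[of y] gN(2)[of y] unfolding F_def by (metis imageI)
    next
      assume "x \<notin> XS" "y \<in> XS"
      then show ?thesis using xy nXS[of x] gN(2)[of x] unfolding F_def by (metis imageI)
    qed
  qed
  have FN: "F x \<in> N" if "x \<in> Sl" for x using F0(1) gN(1) nXS that unfolding F_def by auto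
  have FSl: "F ` Sl = N"
    using FN cSl fin(1) injF by (intro card_subset_eq) (auto simp: card_image)
  define h where "h a = fst (inv_into Sl F a)" for a
  have hF: "h (F x) = fst x" if "x \<in> Sl" for x unfolding h_def using injF that by simp
  have "h ` N \<subseteq> Col" using hF SlX(2) FSl by force
  moreover have "card {a \<in> N. h a = c} = q c" if "c \<in> Col" for c
  proof -
    have "{a \<in> N. h a = c} = F ` ({c} \<times> {..<q c})"
    proof
      show "{a \<in> N. h a = c} \<subseteq> F ` ({c} \<times> {..<q c})"
      proof
        fix a assume a: "a \<in> {a \<in> N. h a = c}"
        then obtain x where x: "x \<in> Sl" "a = F x" using FSl by auto
        then have "fst x = c" using hF a by auto
        then have "x \<in> {c} \<times> {..<q c}" using x(1) unfolding Sl_def by auto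
        then show "a \<in> F ` ({c} \<times> {..<q c})" using x(2) by blast
      qed
      have "{c} \<times> {..<q c} \<subseteq> Sl" unfolding Sl_def using that by auto
      then show "F ` ({c} \<times> {..<q c}) \<subseteq> {a \<in> N. h a = c}" using hF FN by auto
    qed
    moreover have "inj_on F ({c} \<times> {..<q c})"
      using injF by (rule inj_on_subset) (use that in \<open>auto simp: Sl_def\<close>)
    ultimately show ?thesis by (simp add: card_image)
  qed
  moreover have "\<not> bad a (h a) \<and> (\<forall>i. dest (h a) = Some i \<longrightarrow> part a = i)" if aN: "a \<in> N" for a
  proof -
    obtain x where x: "x \<in> Sl" "a = F x" using FSl aN by auto
    show ?thesis
    proof (cases "x \<in> XS")
      case True
      then show ?thesis using F0[OF True] hF[OF x(1)] x(2) unfolding F_def by simp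
    next
      case False
      then have "x \<in> X None" using nXS x by blast
      then show ?thesis using g(3) hF[OF x(1)] x(2) False unfolding F_def X_def by auto
    qed
  qed
  ultimately show ?thesis by blast
qed

text \<open>The vertices of \<open>V\<^sub>0\<close> are treated one after another. An edge \<open>va\<close> may not get a colour that already
  occurs at \<open>a\<close>. For each \<open>a\<close> these are at most \<open>b\<close> colours, and for each colour at most \<open>2M + 4 card V\<^sub>0\<close>
  vertices, since a colour has at most \<open>M\<close> crossing edges and two edges at each vertex treated so far.
  So \<open>star_allocation\<close> applies with \<open>L\<close> at every step.\<close>
lemma extend_colouring:
  fixes E cr :: "'a set set" and col0 :: "'a set \<Rightarrow> 'c" and Col :: "'c set"
    and dest :: "'a \<Rightarrow> 'c \<Rightarrow> 'i option" and part :: "'a \<Rightarrow> 'i"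
  assumes fin: "finite E" "finite Col" "finite V0" and crE: "cr \<subseteq> E"
    and E2: "\<And>e. e \<in> E \<Longrightarrow> card e = 2"
    and own: "\<And>e. e \<in> E - cr \<Longrightarrow> \<exists>v\<in>V0. \<exists>a. a \<notin> V0 \<and> e = {v, a}"
    and deg: "\<And>v. v \<in> V0 \<Longrightarrow> card {e \<in> E. v \<in> e} = 2 * card Col"
    and col0: "\<And>e. e \<in> cr \<Longrightarrow> col0 e \<in> Col"
    and col02: "\<And>v c. v \<in> V0 \<Longrightarrow> c \<in> Col \<Longrightarrow> card {e \<in> cr. v \<in> e \<and> col0 e = c} \<le> 2"
    and col01: "\<And>a c. a \<notin> V0 \<Longrightarrow> card {e \<in> cr. a \<in> e \<and> col0 e = c} \<le> 1"
    and size: "\<And>c. c \<in> Col \<Longrightarrow> card {e \<in> cr. col0 e = c} \<le> M"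
    and low: "\<And>a. a \<notin> V0 \<Longrightarrow> card {e \<in> E. a \<in> e} \<le> b"
    and I: "\<And>v c i. v \<in> V0 \<Longrightarrow> c \<in> Col \<Longrightarrow> dest v c = Some i \<Longrightarrow> i \<in> I"
    and demand: "\<And>v i. v \<in> V0 \<Longrightarrow> i \<in> I \<Longrightarrow>
        (\<Sum>c\<in>{c\<in>Col. dest v c = Some i}. 2 - card {e \<in> cr. v \<in> e \<and> col0 e = c})
          \<le> card {a. {v, a} \<in> E - cr \<and> part a = i}"
    and large: "\<And>v i. v \<in> V0 \<Longrightarrow> i \<in> I \<Longrightarrow> 3 * L < card {a. {v, a} \<in> E - cr \<and> part a = i}"
      "\<And>v. v \<in> V0 \<Longrightarrow> 3 * L < (\<Sum>c\<in>{c\<in>Col. dest v c = None}. 2 - card {e \<in> cr. v \<in> e \<and> col0 e = c})"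
    and L: "2 * M + 4 * card V0 \<le> L" "2 * b \<le> L"
  shows "\<exists>col. (\<forall>e\<in>E. col e \<in> Col) \<and> (\<forall>e\<in>cr. col e = col0 e) \<and>
     (\<forall>v\<in>V0. \<forall>c\<in>Col. card {e \<in> E. v \<in> e \<and> col e = c} = 2) \<and>
     (\<forall>a c. a \<notin> V0 \<longrightarrow> card {e \<in> E. a \<in> e \<and> col e = c} \<le> 1) \<and>
     (\<forall>v\<in>V0. \<forall>a i. {v, a} \<in> E - cr \<longrightarrow> dest v (col {v, a}) = Some i \<longrightarrow> part a = i)"
proof -
  \<comment> \<open>The edges that have a colour once the vertices in \<open>U\<close> are treated.\<close>
  define EU where "EU U = cr \<union> {e \<in> E. e \<inter> U \<noteq> {}}" for U
  have EUE: "EU U \<subseteq> E" for U unfolding EU_def using crE by auto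
  have fcr: "finite cr" using crE fin finite_subset by blast
  have only: "w = v" if "e \<in> E - cr" "v \<in> e" "w \<in> e" "v \<in> V0" "w \<in> V0" for e v w
    using own[OF that(1)] that(2-5) by auto
  have "\<exists>col. (\<forall>e\<in>EU U. col e \<in> Col) \<and> (\<forall>e\<in>cr. col e = col0 e) \<and>
     (\<forall>v\<in>U. \<forall>c\<in>Col. card {e \<in> E. v \<in> e \<and> col e = c} = 2) \<and>
     (\<forall>a c. a \<notin> V0 \<longrightarrow> card {e \<in> EU U. a \<in> e \<and> col e = c} \<le> 1) \<and>
     (\<forall>v\<in>U. \<forall>a i. {v, a} \<in> E - cr \<longrightarrow> dest v (col {v, a}) = Some i \<longrightarrow> part a = i)"
    if "U \<subseteq> V0" for U
    using finite_subset[OF that fin(3)] that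
  proof (induction U rule: finite_induct)
    case empty
    then show ?case using col0 col01 by (intro exI[of _ col0]) (auto simp: EU_def)
  next
    case (insert v U)
    have vV: "v \<in> V0" and UV: "U \<subseteq> V0" using insert.prems by auto
    obtain col where c1: "\<forall>e\<in>EU U. col e \<in> Col" and c2: "\<forall>e\<in>cr. col e = col0 e"
      and c3: "\<forall>v\<in>U. \<forall>c\<in>Col. card {e \<in> E. v \<in> e \<and> col e = c} = 2"
      and c4: "\<forall>a c. a \<notin> V0 \<longrightarrow> card {e \<in> EU U. a \<in> e \<and> col e = c} \<le> 1"
      and c5: "\<forall>v\<in>U. \<forall>a i. {v, a} \<in> E - cr \<longrightarrow> dest v (col {v, a}) = Some i \<longrightarrow> part a = i"
      using insert.IH UV by blast
    define N where "N = {a. {v, a} \<in> E - cr}"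
    define d where "d c = card {e \<in> cr. v \<in> e \<and> col0 e = c}" for c
    define q where "q c = 2 - d c" for c
    define bad where "bad a c \<longleftrightarrow> (\<exists>e\<in>EU U. a \<in> e \<and> col e = c)" for a c
    have N0: "a \<notin> V0" "a \<noteq> v" if "a \<in> N" for a
    proof -
      have e: "{v, a} \<in> E - cr" using that unfolding N_def by simp
      have "card {v, a} = 2" using E2 e by blast
      then show "a \<noteq> v" by auto
      then show "a \<notin> V0" using only[OF e, of v a] vV by auto
    qed
    have Nedges: "{e \<in> E - cr. v \<in> e} = (\<lambda>a. {v, a}) ` N"
    proof
      show "{e \<in> E - cr. v \<in> e} \<subseteq> (\<lambda>a. {v, a}) ` N"
      proof
        fix e assume e: "e \<in> {e \<in> E - cr. v \<in> e}"
        then obtain w a where "w \<in> V0" "a \<notin> V0" "e = {w, a}" using own by blast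
        then have "e = {v, a}" using e vV by auto
        then show "e \<in> (\<lambda>a. {v, a}) ` N" using e unfolding N_def by auto
      qed
    qed (auto simp: N_def)
    have injv: "inj_on (\<lambda>a. {v, a}) S" for S by (auto simp: inj_on_def doubleton_eq_iff)
    have fN: "finite N" using finite_imageD[OF _ injv[of N]] Nedges fin(1)
      by (metis (no_types, lifting) finite_Diff finite_subset mem_Collect_eq subsetI)
    have new: "{v, a} \<notin> EU U" if "a \<in> N" for a
    proof -
      have e: "{v, a} \<in> E - cr" using that unfolding N_def by simp
      have "{v, a} \<inter> U = {}" using N0(1)[OF that] insert.hyps(2) UV by auto
      then show ?thesis using e unfolding EU_def by auto
    qed
    have EU': "EU (insert v U) = EU U \<union> (\<lambda>a. {v, a}) ` N"
      using Nedges unfolding EU_def by blast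
    have d2: "d c \<le> 2" if "c \<in> Col" for c using col02[OF vV that] unfolding d_def .
    have sumd: "(\<Sum>c\<in>Col. d c) = card {e \<in> cr. v \<in> e}"
    proof -
      have "card (\<Union>c\<in>Col. {e \<in> cr. v \<in> e \<and> col0 e = c}) = (\<Sum>c\<in>Col. d c)"
        unfolding d_def using fin fcr by (intro card_UN_disjoint) auto
      moreover have "(\<Union>c\<in>Col. {e \<in> cr. v \<in> e \<and> col0 e = c}) = {e \<in> cr. v \<in> e}" using col0 by auto
      ultimately show ?thesis by simp
    qed
    have sumq: "(\<Sum>c\<in>Col. q c) = card N"
    proof -
      have "(\<Sum>c\<in>Col. q c) + (\<Sum>c\<in>Col. d c) = (\<Sum>c\<in>Col. 2)"
        unfolding sum.distrib[symmetric] q_def using d2 by (intro sum.cong) auto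
      moreover have "card {e \<in> E. v \<in> e} = card {e \<in> cr. v \<in> e} + card {e \<in> E - cr. v \<in> e}"
        using fin(1) fcr crE by (subst card_Un_disjoint[symmetric]) (auto intro: arg_cong[where f = card])
      moreover have "card {e \<in> E - cr. v \<in> e} = card N" unfolding Nedges using injv by (rule card_image)
      ultimately show ?thesis using deg[OF vV] sumd by simp
    qed
    have Npart: "{a \<in> N. part a = i} = {a. {v, a} \<in> E - cr \<and> part a = i}" for i unfolding N_def by auto
    have bad1: "card {a \<in> N. bad a c} \<le> L" if c: "c \<in> Col" for c
    proof -
      let ?F = "{e \<in> EU U. col e = c}"
      have "?F \<subseteq> {e \<in> cr. col0 e = c} \<union> (\<Union>w\<in>U. {e \<in> E. w \<in> e \<and> col e = c})"
        using c2 unfolding EU_def by auto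
      then have "card ?F \<le> card ({e \<in> cr. col0 e = c} \<union> (\<Union>w\<in>U. {e \<in> E. w \<in> e \<and> col e = c}))"
        using fcr fin insert.hyps(1) by (intro card_mono) auto
      also have "\<dots> \<le> card {e \<in> cr. col0 e = c} + card (\<Union>w\<in>U. {e \<in> E. w \<in> e \<and> col e = c})"
        by (rule card_Un_le)
      also have "card (\<Union>w\<in>U. {e \<in> E. w \<in> e \<and> col e = c}) \<le> (\<Sum>w\<in>U. card {e \<in> E. w \<in> e \<and> col e = c})"
        using insert.hyps(1) by (rule card_UN_le)
      also have "\<dots> = 2 * card U" using c3 c by simp
      also have "card U \<le> card V0" using UV fin(3) by (rule card_mono[rotated])
      finally have F: "card ?F \<le> M + 2 * card V0" using size[OF c] by simp
      have fF: "finite ?F" using finite_subset[OF EUE fin(1)] by simp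
      have fe: "finite e" if "e \<in> E" for e using E2[OF that] by (simp add: card_ge_0_finite)
      have fU: "finite (\<Union>e\<in>?F. e)" using fF fe EUE by (intro finite_UN_I) blast+
      have "{a \<in> N. bad a c} \<subseteq> (\<Union>e\<in>?F. e)" unfolding bad_def by auto
      then have "card {a \<in> N. bad a c} \<le> card (\<Union>e\<in>?F. e)"
        using fU by (intro card_mono)
      also have "\<dots> \<le> (\<Sum>e\<in>?F. card e)" using fF by (rule card_UN_le)
      also have "\<dots> = (\<Sum>e\<in>?F. 2)" using E2 EUE by (intro sum.cong) auto
      also have "\<dots> \<le> 2 * M + 4 * card V0" using F by simp
      finally show ?thesis using L(1) by simp
    qed
    have bad2: "2 * card {c \<in> Col. bad a c} \<le> L" if "a \<in> N" for a
    proof -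
      have "{c \<in> Col. bad a c} \<subseteq> col ` {e \<in> E. a \<in> e}" using EUE unfolding bad_def by auto
      then have "card {c \<in> Col. bad a c} \<le> card (col ` {e \<in> E. a \<in> e})"
        using fin by (intro card_mono) auto
      also have "\<dots> \<le> card {e \<in> E. a \<in> e}" using fin by (intro card_image_le) auto
      also have "\<dots> \<le> b" using low N0(1)[OF that] by blast
      finally show ?thesis using L(2) by simp
    qed
    obtain h where h1: "h ` N \<subseteq> Col" and h2: "\<forall>c\<in>Col. card {a \<in> N. h a = c} = q c"
      and h3: "\<forall>a\<in>N. \<not> bad a (h a) \<and> (\<forall>i. dest v (h a) = Some i \<longrightarrow> part a = i)"
    proof -
      have "\<exists>h. h ` N \<subseteq> Col \<and> (\<forall>c\<in>Col. card {a \<in> N. h a = c} = q c) \<and>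
        (\<forall>a\<in>N. \<not> bad a (h a) \<and> (\<forall>i. dest v (h a) = Some i \<longrightarrow> part a = i))"
      proof (rule star_allocation[where L = L and I = I])
        show "(\<Sum>c\<in>{c\<in>Col. dest v c = Some i}. q c) \<le> card {a \<in> N. part a = i}" if "i \<in> I" for i
          using demand[OF vV that] unfolding q_def d_def Npart .
        show "3 * L < card {a \<in> N. part a = i}" if "i \<in> I" for i
          using large(1)[OF vV that] unfolding Npart .
        show "3 * L < (\<Sum>c\<in>{c\<in>Col. dest v c = None}. q c)"
          using large(2)[OF vV] unfolding q_def d_def .
      qed (use fN fin sumq I vV bad1 bad2 in \<open>auto simp: q_def\<close>)
      then show ?thesis using that by blast
    qed
    define col' where "col' e = (if v \<in> e \<and> e \<in> E - cr then h (the_elem (e - {v})) else col e)" for e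
    have col'N: "col' {v, a} = h a" if "a \<in> N" for a
    proof -
      have "{v, a} - {v} = {a}" using N0[OF that] by auto
      then show ?thesis using that unfolding col'_def N_def by auto
    qed
    have col'O: "col' e = col e" if "v \<notin> e \<or> e \<in> cr \<or> e \<in> EU U" for e
    proof -
      have "\<not> (v \<in> e \<and> e \<in> E - cr)"
      proof
        assume ve: "v \<in> e \<and> e \<in> E - cr"
        then have "e \<in> (\<lambda>a. {v, a}) ` N" using Nedges by blast
        then have "e \<notin> EU U" using new by auto
        then show False using that ve by auto
      qed
      then show ?thesis unfolding col'_def by auto
    qed
    have "\<forall>e\<in>EU (insert v U). col' e \<in> Col"
      using EU' col'N col'O c1 h1 by auto
    moreover have "\<forall>e\<in>cr. col' e = col0 e" using col'O c2 by auto
    moreover have "\<forall>w\<in>insert v U. \<forall>c\<in>Col. card {e \<in> E. w \<in> e \<and> col' e = c} = 2"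
    proof (intro ballI)
      fix w c assume w: "w \<in> insert v U" and c: "c \<in> Col"
      show "card {e \<in> E. w \<in> e \<and> col' e = c} = 2"
      proof (cases "w = v")
        case True
        have "{e \<in> E. v \<in> e \<and> col' e = c} = {e \<in> cr. v \<in> e \<and> col0 e = c} \<union> {e \<in> E - cr. v \<in> e \<and> col' e = c}"
          using crE col'O c2 by auto
        moreover have "{e \<in> E - cr. v \<in> e \<and> col' e = c} = (\<lambda>a. {v, a}) ` {a \<in> N. h a = c}"
        proof -
          have "{e \<in> E - cr. v \<in> e \<and> col' e = c} = {e \<in> (\<lambda>a. {v, a}) ` N. col' e = c}"
            using Nedges by auto
          then show ?thesis using col'N by auto
        qed
        moreover have "card ({e \<in> cr. v \<in> e \<and> col0 e = c} \<union> {e \<in> E - cr. v \<in> e \<and> col' e = c}) =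
           card {e \<in> cr. v \<in> e \<and> col0 e = c} + card {e \<in> E - cr. v \<in> e \<and> col' e = c}"
          using fcr fin by (intro card_Un_disjoint) auto
        moreover have "card ((\<lambda>a. {v, a}) ` {a \<in> N. h a = c}) = q c"
          using card_image[OF injv] h2 c by simp
        ultimately show ?thesis using True d2[OF c] unfolding d_def q_def by simp
      next
        case False
        then have wU: "w \<in> U" using w by simp
        then have "v \<notin> e" if "e \<in> E - cr" "w \<in> e" for e
          using only[OF that(1), of w v] that vV UV False by auto
        then have "{e \<in> E. w \<in> e \<and> col' e = c} = {e \<in> E. w \<in> e \<and> col e = c}"
          using col'O by (metis Diff_iff)
        then show ?thesis using c3 wU c by simp
      qed
    qed
    moreover have "\<forall>a c. a \<notin> V0 \<longrightarrow> card {e \<in> EU (insert v U). a \<in> e \<and> col' e = c} \<le> 1"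
    proof (intro allI impI)
      fix a c assume a: "a \<notin> V0"
      have "a \<noteq> v" using a vV by auto
      have eq: "{e \<in> EU (insert v U). a \<in> e \<and> col' e = c} =
         {e \<in> EU U. a \<in> e \<and> col e = c} \<union> (\<lambda>a. {v, a}) ` {b \<in> N. a = b \<and> h b = c}"
      proof -
        have "{e \<in> EU U. a \<in> e \<and> col' e = c} = {e \<in> EU U. a \<in> e \<and> col e = c}" using col'O by auto
        moreover have "{e \<in> (\<lambda>a. {v, a}) ` N. a \<in> e \<and> col' e = c} = (\<lambda>a. {v, a}) ` {b \<in> N. a = b \<and> h b = c}"
          using col'N \<open>a \<noteq> v\<close> by auto
        ultimately show ?thesis unfolding EU' by blast
      qed
      show "card {e \<in> EU (insert v U). a \<in> e \<and> col' e = c} \<le> 1"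
      proof (cases "a \<in> N \<and> h a = c")
        case True
        then have s1: "{e \<in> EU U. a \<in> e \<and> col e = c} = {}" using h3 unfolding bad_def by auto
        have s2: "{b \<in> N. a = b \<and> h b = c} = {a}" using True by auto
        show ?thesis unfolding eq s1 s2 by simp
      next
        case False
        then have s2: "{b \<in> N. a = b \<and> h b = c} = {}" by auto
        show ?thesis unfolding eq s2 using c4 a by simp
      qed
    qed
    moreover have "\<forall>w\<in>insert v U. \<forall>a i. {w, a} \<in> E - cr \<longrightarrow> dest w (col' {w, a}) = Some i \<longrightarrow> part a = i"
    proof (intro ballI allI impI)
      fix w a i assume w: "w \<in> insert v U" and e: "{w, a} \<in> E - cr" and ds: "dest w (col' {w, a}) = Some i"
      show "part a = i"
      proof (cases "w = v")
        case True
        then have "a \<in> N" using e unfolding N_def by simp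
        then show ?thesis using ds h3 col'N True by auto
      next
        case False
        then have wU: "w \<in> U" using w by simp
        then have "{w, a} \<in> EU U" using e unfolding EU_def by auto
        then show ?thesis using col'O c5 wU e ds by metis
      qed
    qed
    ultimately show ?case by blast
  qed
  from this[OF subset_refl] obtain col where col: "(\<forall>e\<in>EU V0. col e \<in> Col) \<and> (\<forall>e\<in>cr. col e = col0 e) \<and>
     (\<forall>v\<in>V0. \<forall>c\<in>Col. card {e \<in> E. v \<in> e \<and> col e = c} = 2) \<and>
     (\<forall>a c. a \<notin> V0 \<longrightarrow> card {e \<in> EU V0. a \<in> e \<and> col e = c} \<le> 1) \<and>
     (\<forall>v\<in>V0. \<forall>a i. {v, a} \<in> E - cr \<longrightarrow> dest v (col {v, a}) = Some i \<longrightarrow> part a = i)" by blast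
  have "EU V0 = E"
  proof
    show "E \<subseteq> EU V0" using own unfolding EU_def by auto
  qed (rule EUE)
  then show ?thesis using col by auto
qed

section \<open>Slicing the crossing edges into types\<close>

lemma deg_in_card_star: "deg_in G v X = card ((\<lambda>y. {v, y}) ` (nbrs G v \<inter> X))"
  unfolding deg_in_def by (rule card_image[symmetric]) (auto simp: inj_on_def doubleton_eq_iff)

lemma e_between_sum:
  assumes "finite X" "finite (edges G)" "X \<inter> Y = {}"
  shows "e_between G X Y = (\<Sum>x\<in>X. deg_in G x Y)"
proof -
  let ?S = "\<lambda>v. (\<lambda>y. {v, y}) ` (nbrs G v \<inter> Y)"
  have eq: "edges_between G X Y = (\<Union>x\<in>X. ?S x)"
    unfolding edges_between_def nbrs_def by auto
  have fin: "finite (?S x)" for x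
    by (rule finite_subset[OF _ assms(2)]) (auto simp: nbrs_def)
  have "card (\<Union>x\<in>X. ?S x) = (\<Sum>x\<in>X. card (?S x))"
  proof (rule card_UN_disjoint[OF assms(1)])
    show "\<forall>x\<in>X. \<forall>z\<in>X. x \<noteq> z \<longrightarrow> ?S x \<inter> ?S z = {}"
      using assms(3) by (auto simp: doubleton_eq_iff)
  qed (use fin in blast)
  then show ?thesis unfolding e_between_def eq deg_in_card_star .
qed

text \<open>Apart from crossing edges, all edges of \<open>G\<close> join an exceptional vertex to the core of its side; this is
  what \<open>G\<^sup>\<diamond>\<close> looks like after the removal of \<open>G[A]\<close>, \<open>G[B]\<close> and \<open>G\<^sub>0\<close>.\<close>
locale partitioned_graph =
  fixes A B :: "nat \<Rightarrow> 'a set" and K :: nat and G :: "'a ugraph"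
  assumes K1: "1 \<le> K"
    and dA: "disjoint_family_on A {0..K}" and dB: "disjoint_family_on B {0..K}"
    and AB: "side K A \<inter> side K B = {}"
    and simple: "simple_graph G"
    and finV0: "finite (A 0 \<union> B 0)"
    and kinds: "\<And>e. e \<in> edges G \<Longrightarrow> (\<exists>x\<in>side K A. \<exists>y\<in>side K B. e = {x, y}) \<or>
       (\<exists>v\<in>A 0. \<exists>a\<in>core K A. e = {v, a}) \<or> (\<exists>v\<in>B 0. \<exists>b\<in>core K B. e = {v, b})"
begin

abbreviation "V0 \<equiv> A 0 \<union> B 0"
abbreviation "cr \<equiv> edges_between G (side K A) (side K B)"
abbreviation "Ty \<equiv> {1..K} \<times> {1..K}"

text \<open>For \<open>v\<close> in \<open>V\<^sub>0\<close>, the cluster with index \<open>j\<close> on the side opposite to \<open>v\<close>; \<open>opp_index v \<tau>\<close> is the index of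
  the cluster that type \<open>\<tau>\<close> prescribes there.\<close>
definition opp :: "'a \<Rightarrow> nat \<Rightarrow> 'a set" where
  "opp v j = (if v \<in> A 0 then B j else A j)"

definition opp_index :: "'a \<Rightarrow> nat \<times> nat \<Rightarrow> nat" where
  "opp_index v \<tau> = (if v \<in> A 0 then snd \<tau> else fst \<tau>)"

text \<open>The types whose local colours may contain \<open>e\<close>: all types for an edge inside \<open>V\<^sub>0\<close>, \<open>K\<close> types for an edge
  between \<open>V\<^sub>0\<close> and a cluster, and one type for an edge between two clusters.\<close>
definition permitted :: "'a set \<Rightarrow> (nat \<times> nat) set" where
  "permitted e = {\<tau> \<in> Ty. e \<subseteq> V0 \<union> A (fst \<tau>) \<union> B (snd \<tau>)}"

lemma sideE: "x \<in> side K X \<longleftrightarrow> x \<in> X 0 \<or> (\<exists>i\<in>{1..K}. x \<in> X i)"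
  unfolding side_def core_def by auto

lemma A_unique: "x \<in> A i \<Longrightarrow> x \<in> A j \<Longrightarrow> i \<le> K \<Longrightarrow> j \<le> K \<Longrightarrow> i = j"
  using dA unfolding disjoint_family_on_def by (metis IntI atLeastAtMost_iff empty_iff zero_le)

lemma B_unique: "x \<in> B i \<Longrightarrow> x \<in> B j \<Longrightarrow> i \<le> K \<Longrightarrow> j \<le> K \<Longrightarrow> i = j"
  using dB unfolding disjoint_family_on_def by (metis IntI atLeastAtMost_iff empty_iff zero_le)

lemma A_side: "x \<in> A i \<Longrightarrow> i \<le> K \<Longrightarrow> x \<in> side K A"
  unfolding sideE by (cases "i = 0") auto

lemma B_side: "x \<in> B i \<Longrightarrow> i \<le> K \<Longrightarrow> x \<in> side K B"
  unfolding sideE by (cases "i = 0") auto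

lemma A_not_B: "x \<in> A i \<Longrightarrow> i \<le> K \<Longrightarrow> j \<le> K \<Longrightarrow> x \<notin> B j"
  using A_side B_side AB by blast

lemma finE: "finite (edges G)"
proof -
  have "edges G \<subseteq> Pow (verts G)" "finite (verts G)" using simple unfolding simple_graph_def by auto
  then show ?thesis using finite_subset by blast
qed

lemma fin_cr: "finite cr"
  unfolding edges_between_def using finE by simp

lemma core_not_V0: "x \<in> A i \<or> x \<in> B i \<Longrightarrow> i \<in> {1..K} \<Longrightarrow> x \<notin> V0"
  using A_unique[of x i 0] B_unique[of x i 0] A_not_B[of x i 0] A_not_B[of x 0 i] by auto

lemma opp_not_V0: "x \<in> opp v j \<Longrightarrow> j \<in> {1..K} \<Longrightarrow> x \<notin> V0"
  using core_not_V0 unfolding opp_def by (auto split: if_splits)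

lemma cr_bip: "e \<in> cr \<Longrightarrow> \<exists>x y. e = {x, y} \<and> x \<in> side K A \<and> y \<notin> side K A"
  using AB unfolding edges_between_def by blast

lemma crI: assumes "v \<in> V0" "{v, y} \<in> edges G" "y \<in> opp v j" "j \<le> K" shows "{v, y} \<in> cr"
proof (cases "v \<in> A 0")
  case True
  then have "v \<in> side K A" "y \<in> side K B" using assms A_side B_side unfolding opp_def by auto
  then show ?thesis using assms(2) unfolding edges_between_def by blast
next
  case False
  then have "v \<in> side K B" "y \<in> side K A" using assms A_side B_side unfolding opp_def by auto
  moreover have "{v, y} = {y, v}" by (rule insert_commute)
  ultimately show ?thesis using assms(2) unfolding edges_between_def by blast
qed

lemma cr_at:
  assumes "v \<in> V0" "e \<in> cr" "v \<in> e"
  shows "\<exists>y. e = {v, y} \<and> y \<in> nbrs G v \<and> (y \<in> V0 \<or> (\<exists>j\<in>{1..K}. y \<in> opp v j))"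
proof -
  obtain x y where xy: "e = {x, y}" "x \<in> side K A" "y \<in> side K B" "e \<in> edges G"
    using assms(2) unfolding edges_between_def by blast
  show ?thesis
  proof (cases "v \<in> A 0")
    case True
    then have "v = x" using assms(3) xy A_side[of v 0] AB by blast
    moreover have "y \<in> V0 \<or> (\<exists>j\<in>{1..K}. y \<in> opp v j)" using xy(3) True unfolding sideE opp_def by auto
    ultimately show ?thesis using xy unfolding nbrs_def by blast
  next
    case False
    then have "v = y" using assms(1,3) xy B_side[of v 0] AB by blast
    moreover have "x \<in> V0 \<or> (\<exists>j\<in>{1..K}. x \<in> opp v j)" using xy(2) False unfolding sideE opp_def by auto
    moreover have "e = {y, x}" using xy(1) by auto
    ultimately show ?thesis using xy(4) unfolding nbrs_def by blast
  qed
qed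

lemma permitted_pair: "a \<in> {1..K} \<Longrightarrow> b \<in> {1..K} \<Longrightarrow>
    (a, b) \<in> permitted {x, y} \<longleftrightarrow> x \<in> V0 \<union> A a \<union> B b \<and> y \<in> V0 \<union> A a \<union> B b"
  unfolding permitted_def by simp

lemma permitted_Ty: "permitted e \<subseteq> Ty"
  unfolding permitted_def by blast

lemma core_A_mem:
  assumes "y \<in> A j" "j \<in> {1..K}" "a \<in> {1..K}" "b \<in> {1..K}"
  shows "y \<in> V0 \<union> A a \<union> B b \<longleftrightarrow> a = j"
  using core_not_V0[of y j] A_not_B[of y j b] A_unique[of y a j] assms by auto

lemma core_B_mem:
  assumes "y \<in> B j" "j \<in> {1..K}" "a \<in> {1..K}" "b \<in> {1..K}"
  shows "y \<in> V0 \<union> A a \<union> B b \<longleftrightarrow> b = j"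
  using core_not_V0[of y j] A_not_B[of y a j] B_unique[of y b j] assms by auto

lemma permitted_star:
  assumes "v \<in> V0" "y \<in> opp v j" "j \<in> {1..K}"
  shows "permitted {v, y} = {\<tau> \<in> Ty. opp_index v \<tau> = j}"
proof (rule set_eqI)
  fix \<sigma> :: "nat \<times> nat"
  obtain a b where ab: "\<sigma> = (a, b)" by (cases \<sigma>)
  show "\<sigma> \<in> permitted {v, y} \<longleftrightarrow> \<sigma> \<in> {\<tau> \<in> Ty. opp_index v \<tau> = j}"
  proof (cases "a \<in> {1..K} \<and> b \<in> {1..K}")
    case True
    then have "y \<in> V0 \<union> A a \<union> B b \<longleftrightarrow> opp_index v (a, b) = j"
      using assms core_A_mem[of y j a b] core_B_mem[of y j a b] unfolding opp_def opp_index_def by (auto split: if_splits)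
    then show ?thesis using True permitted_pair[of a b v y] assms(1) unfolding ab by blast
  next
    case False
    then show ?thesis using permitted_Ty[of "{v, y}"] unfolding ab by blast
  qed
qed

lemma permitted_AB:
  assumes "x \<in> A i" "y \<in> B j" "i \<in> {1..K}" "j \<in> {1..K}"
  shows "permitted {x, y} = {(i, j)}"
proof (rule set_eqI)
  fix \<sigma> :: "nat \<times> nat"
  obtain a b where ab: "\<sigma> = (a, b)" by (cases \<sigma>)
  show "\<sigma> \<in> permitted {x, y} \<longleftrightarrow> \<sigma> \<in> {(i, j)}"
  proof (cases "a \<in> {1..K} \<and> b \<in> {1..K}")
    case True
    then show ?thesis
      using permitted_pair[of a b x y] core_A_mem[OF assms(1,3), of a b] core_B_mem[OF assms(2,4), of a b]
      unfolding ab by blast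
  next
    case False
    then show ?thesis using permitted_Ty[of "{x, y}"] assms(3,4) unfolding ab by blast
  qed
qed

lemma permitted_V0: "e \<subseteq> V0 \<Longrightarrow> permitted e = Ty"
  unfolding permitted_def by auto

lemma cr_cases:
  assumes "e \<in> cr"
  obtains (inner) "e \<subseteq> V0"
    | (star) v y j where "v \<in> V0" "j \<in> {1..K}" "y \<in> opp v j" "e = {v, y}" "y \<in> nbrs G v"
    | (outer) x y i j where "x \<in> A i" "y \<in> B j" "i \<in> {1..K}" "j \<in> {1..K}" "e = {x, y}"
proof (cases "e \<inter> V0 = {}")
  case True
  obtain x y where xy: "e = {x, y}" "x \<in> side K A" "y \<in> side K B"
    using assms unfolding edges_between_def by blast
  then show thesis using outer True unfolding sideE by blast
next
  case False
  then obtain v where v: "v \<in> e" "v \<in> V0" by blast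
  then show thesis using cr_at[OF v(2) assms v(1)] inner star by blast
qed

text \<open>The edges from \<open>v\<close> to one opposite cluster form one kind, described by the exceptional end and the set
  of permitted types.\<close>
lemma star_edges:
  assumes "v \<in> V0" "j \<in> {1..K}"
  shows "(\<lambda>y. {v, y}) ` (nbrs G v \<inter> opp v j) =
    {e \<in> cr. (if e \<subseteq> V0 then {} else e \<inter> V0, permitted e) = ({v}, {\<tau> \<in> Ty. opp_index v \<tau> = j})}"
proof
  show "(\<lambda>y. {v, y}) ` (nbrs G v \<inter> opp v j) \<subseteq>
    {e \<in> cr. (if e \<subseteq> V0 then {} else e \<inter> V0, permitted e) = ({v}, {\<tau> \<in> Ty. opp_index v \<tau> = j})}"
  proof
    fix e assume "e \<in> (\<lambda>y. {v, y}) ` (nbrs G v \<inter> opp v j)"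
    then obtain y where y: "e = {v, y}" "y \<in> nbrs G v" "y \<in> opp v j" by blast
    then have "e \<in> cr" using crI[OF assms(1), of y j] assms(2) unfolding nbrs_def by auto
    moreover have "y \<notin> V0" using opp_not_V0 y assms by blast
    ultimately show "e \<in> {e \<in> cr. (if e \<subseteq> V0 then {} else e \<inter> V0, permitted e) = ({v}, {\<tau> \<in> Ty. opp_index v \<tau> = j})}"
      using permitted_star[OF assms(1) y(3) assms(2)] y(1) assms(1) by auto
  qed
  show "{e \<in> cr. (if e \<subseteq> V0 then {} else e \<inter> V0, permitted e) = ({v}, {\<tau> \<in> Ty. opp_index v \<tau> = j})}
    \<subseteq> (\<lambda>y. {v, y}) ` (nbrs G v \<inter> opp v j)"
  proof
    fix e assume e: "e \<in> {e \<in> cr. (if e \<subseteq> V0 then {} else e \<inter> V0, permitted e) = ({v}, {\<tau> \<in> Ty. opp_index v \<tau> = j})}"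
    then have e1: "e \<in> cr" "\<not> e \<subseteq> V0" "e \<inter> V0 = {v}" "permitted e = {\<tau> \<in> Ty. opp_index v \<tau> = j}"
      by (auto split: if_splits)
    then have "v \<in> e" by blast
    then obtain y where y: "e = {v, y}" "y \<in> nbrs G v" "y \<in> V0 \<or> (\<exists>j\<in>{1..K}. y \<in> opp v j)"
      using cr_at[OF assms(1) e1(1)] by blast
    then obtain j' where j': "j' \<in> {1..K}" "y \<in> opp v j'" using e1(2) assms(1) by blast
    have "permitted e = {\<tau> \<in> Ty. opp_index v \<tau> = j'}" using permitted_star[OF assms(1) j'(2,1)] y(1) by simp
    moreover have "(j, j) \<in> permitted e" unfolding e1(4) opp_index_def using assms(2) by simp
    ultimately have "opp_index v (j, j) = j'" by blast
    then have "j' = j" unfolding opp_index_def by (simp split: if_splits)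
    then show "e \<in> (\<lambda>y. {v, y}) ` (nbrs G v \<inter> opp v j)" using y j' by blast
  qed
qed

lemma card_opp_index: "j \<in> {1..K} \<Longrightarrow> card {\<tau> \<in> Ty. opp_index v \<tau> = j} = K"
proof -
  assume j: "j \<in> {1..K}"
  have "{\<tau> \<in> Ty. opp_index v \<tau> = j} = (if v \<in> A 0 then {1..K} \<times> {j} else {j} \<times> {1..K})"
    using j unfolding opp_index_def by auto
  then show ?thesis by (simp add: card_cartesian_product)
qed

text \<open>Each star from an exceptional vertex to an opposite cluster is distributed evenly over its \<open>K\<close> permitted
  types, and the edges inside \<open>V\<^sub>0\<close> are distributed evenly over all types. Edges inside \<open>V\<^sub>0\<close> at \<open>v\<close> number
  at most \<open>card V0\<close>, which enters as an error term, and rounding costs 1 per star.\<close>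
lemma type_assignment:
  "\<exists>ty. (\<forall>e\<in>cr. ty e \<in> permitted e) \<and>
    (\<forall>v\<in>V0. \<forall>\<tau>\<in>Ty.
       real (deg_in G v (opp v (opp_index v \<tau>))) / K - 1 \<le> card {e \<in> cr. ty e = \<tau> \<and> v \<in> e} \<and>
       card {e \<in> cr. ty e = \<tau> \<and> v \<in> e} \<le> real (deg_in G v (opp v (opp_index v \<tau>))) / K + 1 + card V0) \<and>
    (\<forall>\<tau>\<in>Ty. real (e_between G (A (fst \<tau>)) (B (snd \<tau>))) + real (e_between G (A 0) (B (snd \<tau>))) / K
         + real (e_between G (B 0) (A (fst \<tau>))) / K + real (card {e \<in> cr. e \<subseteq> V0}) / real K ^ 2
         - real (card V0) - 1 \<le> card {e \<in> cr. ty e = \<tau>})"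
proof -
  \<comment> \<open>The second component is the list of permitted types. For \<open>K = 1\<close> the kind of the edges inside
    \<open>V\<^sub>0\<close> also contains the edges between the cores, hence the case distinction at the end.\<close>
  define \<kappa> where "\<kappa> e = (if e \<subseteq> V0 then {} else e \<inter> V0, permitted e)" for e
  have finTy: "finite Ty" by simp
  have ne: "permitted e \<noteq> {}" if "e \<in> cr" for e
    using that
  proof (cases rule: cr_cases)
    case inner
    then show ?thesis using permitted_V0 K1 by auto
  next
    case (star v y j)
    have "(j, j) \<in> {\<tau> \<in> Ty. opp_index v \<tau> = j}" using star unfolding opp_index_def by auto
    then show ?thesis using permitted_star[OF star(1,3,2)] star(4) by blast
  next
    case (outer x y i j)
    then show ?thesis using permitted_AB by simp
  qed
  have "finite (snd (\<kappa> e)) \<and> snd (\<kappa> e) \<noteq> {}" if "e \<in> cr" for e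
    using ne[OF that] finTy unfolding \<kappa>_def permitted_def by (auto intro: finite_subset)
  from equitable_list_map[where Perm = snd and \<kappa> = \<kappa>, OF fin_cr this] obtain ty where ty: "\<forall>e\<in>cr. ty e \<in> snd (\<kappa> e)" and
    bal: "\<forall>k\<in>\<kappa> ` cr. \<forall>\<tau>\<in>snd k.
       real (card {e \<in> cr. \<kappa> e = k}) / real (card (snd k)) - 1 \<le> real (card {e \<in> cr. \<kappa> e = k \<and> ty e = \<tau>})
     \<and> real (card {e \<in> cr. \<kappa> e = k \<and> ty e = \<tau>}) \<le> real (card {e \<in> cr. \<kappa> e = k}) / real (card (snd k)) + 1"
    by blast
  have ty_permitted: "ty e \<in> permitted e" if "e \<in> cr" for e using ty that unfolding \<kappa>_def by simp
  have balk: "real (card {e \<in> cr. \<kappa> e = k}) / real (card (snd k)) - 1 \<le> real (card {e \<in> cr. \<kappa> e = k \<and> ty e = \<tau>})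
     \<and> real (card {e \<in> cr. \<kappa> e = k \<and> ty e = \<tau>}) \<le> real (card {e \<in> cr. \<kappa> e = k}) / real (card (snd k)) + 1"
    if "\<tau> \<in> snd k" for k \<tau>
  proof (cases "k \<in> \<kappa> ` cr")
    case True
    then show ?thesis using bal that by blast
  next
    case False
    then have "{e \<in> cr. \<kappa> e = k} = {}" "{e \<in> cr. \<kappa> e = k \<and> ty e = \<tau>} = {}" by blast+
    then show ?thesis by (simp only: card.empty) simp
  qed
  define S where "S v j = (\<lambda>y. {v, y}) ` (nbrs G v \<inter> opp v j)" for v j
  have S\<kappa>: "S v j = {e \<in> cr. \<kappa> e = ({v}, {\<tau> \<in> Ty. opp_index v \<tau> = j})}" if "v \<in> V0" "j \<in> {1..K}" for v j
    unfolding S_def \<kappa>_def by (rule star_edges[OF that])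
  have opp_indexTy: "opp_index v \<tau> \<in> {1..K}" if "\<tau> \<in> Ty" for v \<tau> using that unfolding opp_index_def by auto
  have starbal: "real (deg_in G v (opp v (opp_index v \<tau>))) / K - 1 \<le> card {e \<in> S v (opp_index v \<tau>). ty e = \<tau>} \<and>
     card {e \<in> S v (opp_index v \<tau>). ty e = \<tau>} \<le> real (deg_in G v (opp v (opp_index v \<tau>))) / K + 1"
    if v: "v \<in> V0" and \<tau>: "\<tau> \<in> Ty" for v \<tau>
  proof -
    let ?j = "opp_index v \<tau>"
    let ?k = "({v}, {\<sigma> \<in> Ty. opp_index v \<sigma> = ?j})"
    have j: "?j \<in> {1..K}" using opp_indexTy[OF \<tau>] .
    have "\<tau> \<in> snd ?k" using \<tau> by simp
    note b = balk[OF this]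
    have e1: "{e \<in> cr. \<kappa> e = ?k} = S v ?j" using S\<kappa>[OF v j] by simp
    have e2: "{e \<in> cr. \<kappa> e = ?k \<and> ty e = \<tau>} = {e \<in> S v ?j. ty e = \<tau>}" unfolding S\<kappa>[OF v j] by blast
    have c: "card (snd ?k) = K" using card_opp_index[OF j] by simp
    have d: "card (S v ?j) = deg_in G v (opp v ?j)" unfolding S_def deg_in_card_star ..
    show ?thesis using b unfolding e1 e2 c d by simp
  qed
  have finS: "finite (S v j)" for v j
    unfolding S_def by (rule finite_subset[OF _ finE]) (auto simp: nbrs_def)
  have at_v: "{e \<in> cr. ty e = \<tau> \<and> v \<in> e} = {e \<in> S v (opp_index v \<tau>). ty e = \<tau>} \<union> {e \<in> cr. ty e = \<tau> \<and> v \<in> e \<and> e \<subseteq> V0}"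
    if v: "v \<in> V0" and \<tau>: "\<tau> \<in> Ty" for v \<tau>
  proof
    have sub: "e \<in> cr \<and> v \<in> e" if "e \<in> S v (opp_index v \<tau>)" for e
      using that unfolding S\<kappa>[OF v opp_indexTy[OF \<tau>]] \<kappa>_def by (auto split: if_splits)
    then show "{e \<in> S v (opp_index v \<tau>). ty e = \<tau>} \<union> {e \<in> cr. ty e = \<tau> \<and> v \<in> e \<and> e \<subseteq> V0} \<subseteq> {e \<in> cr. ty e = \<tau> \<and> v \<in> e}"
      by blast
    show "{e \<in> cr. ty e = \<tau> \<and> v \<in> e} \<subseteq> {e \<in> S v (opp_index v \<tau>). ty e = \<tau>} \<union> {e \<in> cr. ty e = \<tau> \<and> v \<in> e \<and> e \<subseteq> V0}"
    proof
      fix e assume e: "e \<in> {e \<in> cr. ty e = \<tau> \<and> v \<in> e}"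
      then obtain y where y: "e = {v, y}" "y \<in> nbrs G v" "y \<in> V0 \<or> (\<exists>j\<in>{1..K}. y \<in> opp v j)"
        using cr_at[OF v] by blast
      show "e \<in> {e \<in> S v (opp_index v \<tau>). ty e = \<tau>} \<union> {e \<in> cr. ty e = \<tau> \<and> v \<in> e \<and> e \<subseteq> V0}"
      proof (cases "y \<in> V0")
        case True
        then show ?thesis using e y(1) v by blast
      next
        case False
        then obtain j where j: "j \<in> {1..K}" "y \<in> opp v j" using y(3) by blast
        have "ty e \<in> {\<sigma> \<in> Ty. opp_index v \<sigma> = j}" using ty_permitted[of e] e permitted_star[OF v j(2,1)] y(1) by auto
        then have "j = opp_index v \<tau>" using e by auto
        then have "e \<in> S v (opp_index v \<tau>)" unfolding S_def using y j by blast
        then show ?thesis using e by blast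
      qed
    qed
  qed
  have inner_le: "card {e \<in> cr. ty e = \<tau> \<and> v \<in> e \<and> e \<subseteq> V0} \<le> card V0" if v: "v \<in> V0" for v \<tau>
  proof -
    have "{e \<in> cr. ty e = \<tau> \<and> v \<in> e \<and> e \<subseteq> V0} \<subseteq> (\<lambda>y. {v, y}) ` V0"
      using cr_at[OF v] by blast
    then have "card {e \<in> cr. ty e = \<tau> \<and> v \<in> e \<and> e \<subseteq> V0} \<le> card ((\<lambda>y. {v, y}) ` V0)"
      using finV0 by (intro card_mono) auto
    also have "\<dots> \<le> card V0" using finV0 by (rule card_image_le)
    finally show ?thesis .
  qed
  show ?thesis
  proof (rule exI[of _ ty], intro conjI ballI)
    show "ty e \<in> permitted e" if "e \<in> cr" for e using ty_permitted[OF that] .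
    show "real (deg_in G v (opp v (opp_index v \<tau>))) / K - 1 \<le> card {e \<in> cr. ty e = \<tau> \<and> v \<in> e}"
      if v: "v \<in> V0" and \<tau>: "\<tau> \<in> Ty" for v \<tau>
    proof -
      have "card {e \<in> S v (opp_index v \<tau>). ty e = \<tau>} \<le> card {e \<in> cr. ty e = \<tau> \<and> v \<in> e}"
        unfolding at_v[OF that] using fin_cr finS by (intro card_mono) auto
      then show ?thesis using starbal[OF that] by linarith
    qed
    show "card {e \<in> cr. ty e = \<tau> \<and> v \<in> e} \<le> real (deg_in G v (opp v (opp_index v \<tau>))) / K + 1 + card V0"
      if v: "v \<in> V0" and \<tau>: "\<tau> \<in> Ty" for v \<tau>
    proof -
      have "card {e \<in> cr. ty e = \<tau> \<and> v \<in> e} \<le> card {e \<in> S v (opp_index v \<tau>). ty e = \<tau>} + card {e \<in> cr. ty e = \<tau> \<and> v \<in> e \<and> e \<subseteq> V0}"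
        unfolding at_v[OF that] by (rule card_Un_le)
      then have "real (card {e \<in> cr. ty e = \<tau> \<and> v \<in> e}) \<le> real (card {e \<in> S v (opp_index v \<tau>). ty e = \<tau>}) + real (card V0)"
        using inner_le[OF v, of \<tau>] by linarith
      then show ?thesis using starbal[OF that] by linarith
    qed
    fix \<tau> assume \<tau>: "\<tau> \<in> Ty"
    define i j where "i = fst \<tau>" and "j = snd \<tau>"
    have ij: "i \<in> {1..K}" "j \<in> {1..K}" using \<tau> unfolding i_def j_def by auto
    \<comment> \<open>The edges of type \<open>\<tau>\<close> split into those without, with one and with two exceptional ends.\<close>
    let ?E1 = "edges_between G (A i) (B j)"
    let ?E2 = "\<Union>v\<in>V0. {e \<in> S v (opp_index v \<tau>). ty e = \<tau>}"
    let ?E3 = "{e \<in> cr. e \<subseteq> V0 \<and> ty e = \<tau>}"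
    have E1cr: "?E1 \<subseteq> cr" using A_side B_side ij unfolding edges_between_def by fastforce
    have E1: "ty e = \<tau> \<and> e \<inter> V0 = {}" if eE: "e \<in> ?E1" for e
    proof -
      obtain x y where xy: "x \<in> A i" "y \<in> B j" "e = {x, y}" using eE unfolding edges_between_def by blast
      have "ty e \<in> {(i, j)}" using ty_permitted[of e] E1cr eE permitted_AB[OF xy(1,2) ij] xy(3) by auto
      moreover have "x \<notin> V0" "y \<notin> V0" using core_not_V0 xy ij by blast+
      ultimately show ?thesis using xy(3) unfolding i_def j_def by auto
    qed
    have Sform: "e \<in> cr \<and> e \<inter> V0 = {v} \<and> \<not> e \<subseteq> V0" if "e \<in> S v (opp_index v \<tau>)" "v \<in> V0" for e v
      using that(1) unfolding S\<kappa>[OF that(2) opp_indexTy[OF \<tau>]] \<kappa>_def by (auto split: if_splits)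
    have dj12: "?E1 \<inter> ?E2 = {}" using E1 Sform by blast
    have dj3: "(?E1 \<union> ?E2) \<inter> ?E3 = {}"
    proof -
      have "\<not> e \<subseteq> V0" if "e \<in> ?E1" for e
      proof -
        have "e \<noteq> {}" using that unfolding edges_between_def by blast
        then show ?thesis using E1[OF that] by blast
      qed
      then show ?thesis using Sform by blast
    qed
    have fins: "finite ?E1" "finite ?E2" "finite ?E3"
      using E1cr fin_cr finite_subset finV0 finS by auto
    have sub: "?E1 \<union> ?E2 \<union> ?E3 \<subseteq> {e \<in> cr. ty e = \<tau>}" using E1 E1cr Sform by blast
    have "card ?E1 + card ?E2 + card ?E3 = card (?E1 \<union> ?E2 \<union> ?E3)"
      using fins dj12 dj3 by (simp add: card_Un_disjoint)
    also have "\<dots> \<le> card {e \<in> cr. ty e = \<tau>}" using sub fin_cr by (intro card_mono) auto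
    finally have tot: "real (card ?E1) + real (card ?E2) + real (card ?E3) \<le> real (card {e \<in> cr. ty e = \<tau>})"
      by linarith
    have c2: "real (card ?E2) = (\<Sum>v\<in>V0. real (card {e \<in> S v (opp_index v \<tau>). ty e = \<tau>}))"
    proof -
      have "{e \<in> S v (opp_index v \<tau>). ty e = \<tau>} \<inter> {e \<in> S w (opp_index w \<tau>). ty e = \<tau>} = {}" if "v \<in> V0" "w \<in> V0" "v \<noteq> w" for v w
        using Sform[OF _ that(1)] Sform[OF _ that(2)] that(3) by blast
      then have "card ?E2 = (\<Sum>v\<in>V0. card {e \<in> S v (opp_index v \<tau>). ty e = \<tau>})"
        using finV0 finS by (intro card_UN_disjoint) auto
      then show ?thesis by simp
    qed
    have "(\<Sum>v\<in>V0. real (deg_in G v (opp v (opp_index v \<tau>))) / K - 1) \<le> (\<Sum>v\<in>V0. real (card {e \<in> S v (opp_index v \<tau>). ty e = \<tau>}))"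
      using starbal \<tau> by (intro sum_mono) blast
    moreover have "(\<Sum>v\<in>V0. real (deg_in G v (opp v (opp_index v \<tau>))) / K - 1)
       = (\<Sum>v\<in>V0. real (deg_in G v (opp v (opp_index v \<tau>)))) / K - card V0"
      by (simp add: sum_subtractf sum_divide_distrib)
    moreover have "(\<Sum>v\<in>V0. real (deg_in G v (opp v (opp_index v \<tau>)))) =
       real (e_between G (A 0) (B j)) + real (e_between G (B 0) (A i))"
    proof -
      have d0: "A 0 \<inter> B 0 = {}" using A_not_B[of _ 0 0] by auto
      have "(\<Sum>v\<in>V0. real (deg_in G v (opp v (opp_index v \<tau>)))) =
        (\<Sum>v\<in>A 0. real (deg_in G v (opp v (opp_index v \<tau>)))) + (\<Sum>v\<in>B 0. real (deg_in G v (opp v (opp_index v \<tau>))))"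
        using finV0 d0 by (intro sum.union_disjoint) auto
      also have "(\<Sum>v\<in>A 0. real (deg_in G v (opp v (opp_index v \<tau>)))) = (\<Sum>v\<in>A 0. real (deg_in G v (B j)))"
        unfolding opp_def opp_index_def j_def by simp
      also have "(\<Sum>v\<in>B 0. real (deg_in G v (opp v (opp_index v \<tau>)))) = (\<Sum>v\<in>B 0. real (deg_in G v (A i)))"
        using d0 unfolding opp_def opp_index_def i_def by (intro sum.cong) auto
      moreover have "A 0 \<inter> B j = {}" "B 0 \<inter> A i = {}" using A_not_B[of _ 0 j] A_not_B[of _ i 0] ij by auto
      ultimately show ?thesis
        using e_between_sum[OF _ finE, of "A 0" "B j"] e_between_sum[OF _ finE, of "B 0" "A i"] finV0 by simp
    qed
    ultimately have b2: "real (e_between G (A 0) (B j)) / K + real (e_between G (B 0) (A i)) / K - card V0 \<le> real (card ?E2)"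
      unfolding c2 by (simp add: add_divide_distrib)
    have b3: "real (card {e \<in> cr. e \<subseteq> V0}) / real K ^ 2 - 1 \<le> real (card ?E3)"
    proof -
      let ?k = "({}, Ty) :: 'a set \<times> (nat \<times> nat) set"
      have in0: "{e \<in> cr. e \<subseteq> V0} \<subseteq> {e \<in> cr. \<kappa> e = ?k}" unfolding \<kappa>_def using permitted_V0 by auto
      have sub0: "{e \<in> cr. \<kappa> e = ?k} \<subseteq> {e \<in> cr. e \<subseteq> V0} \<union> {e \<in> cr. e \<inter> V0 = {} \<and> permitted e = Ty}"
        unfolding \<kappa>_def by (auto split: if_splits)
      show ?thesis
      proof (cases "K = 1")
        case True
        have "{e \<in> cr. e \<subseteq> V0} = ?E3"
        proof -
          have "ty e = \<tau>" if "e \<in> cr" for e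
          proof -
            have "ty e \<in> Ty" using ty_permitted[OF that] unfolding permitted_def by simp
            then show ?thesis using \<tau> True by auto
          qed
          then show ?thesis by blast
        qed
        then show ?thesis using True by simp
      next
        case False
        have "{e \<in> cr. e \<inter> V0 = {} \<and> permitted e = Ty} = {}"
        proof -
          have "permitted e \<noteq> Ty" if e: "e \<in> cr" "e \<inter> V0 = {}" for e
          proof -
            obtain x y where xy: "e = {x, y}" "x \<in> side K A" "y \<in> side K B"
              using e(1) unfolding edges_between_def by blast
            then obtain a b where ab: "x \<in> A a" "y \<in> B b" "a \<in> {1..K}" "b \<in> {1..K}"
              using e(2) unfolding sideE by blast
            have "permitted e = {(a, b)}" using permitted_AB[OF ab] xy by simp
            moreover have "(1, 1) \<in> Ty" "(1, K) \<in> Ty" "(1, K) \<noteq> (1::nat, 1::nat)" using K1 False by auto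
            ultimately show ?thesis by (metis singletonD)
          qed
          then show ?thesis by blast
        qed
        then have eq: "{e \<in> cr. \<kappa> e = ?k} = {e \<in> cr. e \<subseteq> V0}" using in0 sub0 by blast
        have eq2: "{e \<in> cr. \<kappa> e = ?k \<and> ty e = \<tau>} = ?E3" using eq by blast
        have "card (snd ?k) = K ^ 2" by (simp add: card_cartesian_product power2_eq_square)
        moreover have "\<tau> \<in> snd ?k" using \<tau> by simp
        ultimately show ?thesis using balk[of \<tau> ?k] unfolding eq eq2 by simp
      qed
    qed
    show "real (e_between G (A (fst \<tau>)) (B (snd \<tau>))) + real (e_between G (A 0) (B (snd \<tau>))) / K
         + real (e_between G (B 0) (A (fst \<tau>))) / K + real (card {e \<in> cr. e \<subseteq> V0}) / real K ^ 2
         - real (card V0) - 1 \<le> card {e \<in> cr. ty e = \<tau>}"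
      using tot b2 b3 unfolding i_def[symmetric] j_def[symmetric] e_between_def by linarith
  qed
qed

definition opp_core :: "'a \<Rightarrow> 'a set" where
  "opp_core v = (if v \<in> A 0 then core K B else core K A)"

lemma opp_core_Union: "opp_core v = (\<Union>j\<in>{1..K}. opp v j)"
  unfolding opp_core_def opp_def core_def by auto

lemma cr_degree_split:
  assumes v: "v \<in> V0"
  shows "deg_in G v (opp_core v) \<le> card {e \<in> cr. v \<in> e}"
    and "card {e \<in> cr. v \<in> e} \<le> deg_in G v (opp_core v) + card V0"
proof -
  have sub: "(\<lambda>y. {v, y}) ` (nbrs G v \<inter> opp_core v) \<subseteq> {e \<in> cr. v \<in> e}"
    using crI[OF v] unfolding opp_core_Union nbrs_def by fastforce
  then show "deg_in G v (opp_core v) \<le> card {e \<in> cr. v \<in> e}"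
    unfolding deg_in_card_star using fin_cr by (intro card_mono) auto
  have "{e \<in> cr. v \<in> e} \<subseteq> (\<lambda>y. {v, y}) ` (nbrs G v \<inter> opp_core v) \<union> (\<lambda>y. {v, y}) ` V0"
  proof
    fix e assume "e \<in> {e \<in> cr. v \<in> e}"
    then obtain y where "e = {v, y}" "y \<in> nbrs G v" "y \<in> V0 \<or> (\<exists>j\<in>{1..K}. y \<in> opp v j)"
      using cr_at[OF v] by blast
    then show "e \<in> (\<lambda>y. {v, y}) ` (nbrs G v \<inter> opp_core v) \<union> (\<lambda>y. {v, y}) ` V0"
      unfolding opp_core_Union by blast
  qed
  moreover have "finite ((\<lambda>y. {v, y}) ` (nbrs G v \<inter> opp_core v))"
    by (rule finite_subset[OF _ finE]) (auto simp: nbrs_def)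
  ultimately have "card {e \<in> cr. v \<in> e} \<le> card ((\<lambda>y. {v, y}) ` (nbrs G v \<inter> opp_core v) \<union> (\<lambda>y. {v, y}) ` V0)"
    using finV0 by (intro card_mono) auto
  also have "\<dots> \<le> deg_in G v (opp_core v) + card ((\<lambda>y. {v, y}) ` V0)"
    unfolding deg_in_card_star by (rule card_Un_le)
  also have "card ((\<lambda>y. {v, y}) ` V0) \<le> card V0" using finV0 by (rule card_image_le)
  finally show "card {e \<in> cr. v \<in> e} \<le> deg_in G v (opp_core v) + card V0" by simp
qed

lemma cr_inner_degree:
  assumes v: "v \<in> V0"
  shows "card {e \<in> cr. v \<in> e \<and> e \<subseteq> V0} \<le> card V0"
proof -
  have "{e \<in> cr. v \<in> e \<and> e \<subseteq> V0} \<subseteq> (\<lambda>y. {v, y}) ` V0" using cr_at[OF v] by blast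
  then have "card {e \<in> cr. v \<in> e \<and> e \<subseteq> V0} \<le> card ((\<lambda>y. {v, y}) ` V0)"
    using finV0 by (intro card_mono) auto
  also have "\<dots> \<le> card V0" using finV0 by (rule card_image_le)
  finally show ?thesis .
qed

lemma cr_total: "card cr \<le> e_between G (core K A) (core K B) + e_between G (A 0) (core K B)
    + e_between G (B 0) (core K A) + card {e \<in> cr. e \<subseteq> V0}"
proof -
  let ?E1 = "edges_between G (core K A) (core K B)" and ?E2 = "edges_between G (A 0) (core K B)"
    and ?E3 = "edges_between G (B 0) (core K A)" and ?E4 = "{e \<in> cr. e \<subseteq> V0}"
  have fin: "finite (edges_between G X Y)" for X Y unfolding edges_between_def using finE by simp
  have "cr \<subseteq> ?E1 \<union> ?E2 \<union> ?E3 \<union> ?E4"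
  proof
    fix e assume e: "e \<in> cr"
    then obtain x y where xy: "e \<in> edges G" "e = {x, y}" "x \<in> A 0 \<union> core K A" "y \<in> B 0 \<union> core K B"
      unfolding edges_between_def side_def by blast
    have "e = {y, x}" using xy(2) by auto
    then show "e \<in> ?E1 \<union> ?E2 \<union> ?E3 \<union> ?E4" using xy e unfolding edges_between_def by blast
  qed
  then have "card cr \<le> card (?E1 \<union> ?E2 \<union> ?E3 \<union> ?E4)" using fin fin_cr by (intro card_mono) auto
  also have "\<dots> \<le> card ?E1 + card ?E2 + card ?E3 + card ?E4"
    by (meson add_le_mono1 card_Un_le order_trans)
  finally show ?thesis unfolding e_between_def .
qed

text \<open>By the scheme conditions, each cluster receives a \<open>1/K\<close> proportion of the degrees and edge numbers, and
  \<open>type_assignment\<close> turns this into a \<open>1/K\<^sup>2\<close> proportion for each type.\<close>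
lemma slicing:
  assumes E4: "ESch4 \<epsilon> K A B G" and E5: "ESch5 \<epsilon> K A B G"
    and vG: "V0 \<subseteq> verts G" and n: "n = card (verts G)" and b: "card V0 \<le> b" and \<epsilon>: "0 < \<epsilon>"
  shows "\<exists>ty. (\<forall>e\<in>cr. ty e \<in> permitted e) \<and>
    (\<forall>v\<in>V0. \<forall>\<tau>\<in>Ty.
       real (card {e \<in> cr. ty e = \<tau> \<and> v \<in> e}) \<le> (real (card {e \<in> cr. v \<in> e}) + \<epsilon> * n) / real K ^ 2 + 1 + b \<and>
       (real (card {e \<in> cr. v \<in> e}) - b - \<epsilon> * n) / real K ^ 2 - 1 \<le> real (card {e \<in> cr. ty e = \<tau> \<and> v \<in> e})) \<and>
    (\<forall>\<tau>\<in>Ty. ((1 - \<epsilon>) * card cr - 3 * \<epsilon> * n) / real K ^ 2 - b - 1 \<le> real (card {e \<in> cr. ty e = \<tau>}))"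
proof -
  obtain ty where ty1: "\<forall>e\<in>cr. ty e \<in> permitted e"
    and ty2: "\<forall>v\<in>V0. \<forall>\<tau>\<in>Ty.
       real (deg_in G v (opp v (opp_index v \<tau>))) / K - 1 \<le> card {e \<in> cr. ty e = \<tau> \<and> v \<in> e} \<and>
       card {e \<in> cr. ty e = \<tau> \<and> v \<in> e} \<le> real (deg_in G v (opp v (opp_index v \<tau>))) / K + 1 + card V0"
    and ty3: "\<forall>\<tau>\<in>Ty. real (e_between G (A (fst \<tau>)) (B (snd \<tau>))) + real (e_between G (A 0) (B (snd \<tau>))) / K
         + real (e_between G (B 0) (A (fst \<tau>))) / K + real (card {e \<in> cr. e \<subseteq> V0}) / real K ^ 2
         - real (card V0) - 1 \<le> card {e \<in> cr. ty e = \<tau>}"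
    using type_assignment by (elim exE conjE) (rule that)
  have Kpos: "0 < real K" using K1 by simp
  have opp4: "(real (deg_in G v (opp_core v)) - \<epsilon> * n) / K \<le> real (deg_in G v (opp v j)) \<and>
     real (deg_in G v (opp v j)) \<le> (real (deg_in G v (opp_core v)) + \<epsilon> * n) / K"
    if "v \<in> V0" "j \<in> {1..K}" for v j
  proof -
    have v: "v \<in> verts G" using that(1) vG by blast
    have "eq_pm_div (deg_in G v (A j)) (deg_in G v (core K A)) (\<epsilon> * card (verts G)) K \<and>
     eq_pm_div (deg_in G v (B j)) (deg_in G v (core K B)) (\<epsilon> * card (verts G)) K"
      using E4 v that(2) unfolding ESch4_def by blast
    then show ?thesis unfolding eq_pm_div_def opp_core_def opp_def n by simp
  qed
  have sq: "x / K / K = x / real K ^ 2" for x :: real by (simp add: power2_eq_square)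
  show ?thesis
  proof (rule exI[of _ ty], intro conjI ballI)
    show "ty e \<in> permitted e" if "e \<in> cr" for e using ty1 that by blast
    fix v \<tau> assume v: "v \<in> V0" and \<tau>: "\<tau> \<in> Ty"
    have j: "opp_index v \<tau> \<in> {1..K}" using \<tau> unfolding opp_index_def by auto
    note o = opp4[OF v j]
    have t2: "real (deg_in G v (opp v (opp_index v \<tau>))) / K - 1 \<le> card {e \<in> cr. ty e = \<tau> \<and> v \<in> e}"
       "card {e \<in> cr. ty e = \<tau> \<and> v \<in> e} \<le> real (deg_in G v (opp v (opp_index v \<tau>))) / K + 1 + card V0"
      using ty2 v \<tau> by blast+
    show "real (card {e \<in> cr. ty e = \<tau> \<and> v \<in> e}) \<le> (real (card {e \<in> cr. v \<in> e}) + \<epsilon> * n) / real K ^ 2 + 1 + b"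
    proof -
      have "real (deg_in G v (opp v (opp_index v \<tau>))) \<le> (real (card {e \<in> cr. v \<in> e}) + \<epsilon> * n) / K"
        using o cr_degree_split(1)[OF v] Kpos by (smt (verit) divide_right_mono of_nat_mono)
      then have "real (deg_in G v (opp v (opp_index v \<tau>))) / K \<le> (real (card {e \<in> cr. v \<in> e}) + \<epsilon> * n) / K / K"
        using Kpos by (intro divide_right_mono) auto
      then show ?thesis using t2(2) b unfolding sq by linarith
    qed
    show "(real (card {e \<in> cr. v \<in> e}) - b - \<epsilon> * n) / real K ^ 2 - 1 \<le> real (card {e \<in> cr. ty e = \<tau> \<and> v \<in> e})"
    proof -
      have "real (card {e \<in> cr. v \<in> e}) - b - \<epsilon> * n \<le> real (deg_in G v (opp_core v)) - \<epsilon> * n"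
        using cr_degree_split(2)[OF v] b by linarith
      then have "(real (card {e \<in> cr. v \<in> e}) - b - \<epsilon> * n) / K \<le> (real (deg_in G v (opp_core v)) - \<epsilon> * n) / K"
        using Kpos by (intro divide_right_mono) auto
      then have "(real (card {e \<in> cr. v \<in> e}) - b - \<epsilon> * n) / K \<le> real (deg_in G v (opp v (opp_index v \<tau>)))"
        using o by linarith
      then have "(real (card {e \<in> cr. v \<in> e}) - b - \<epsilon> * n) / K / K \<le> real (deg_in G v (opp v (opp_index v \<tau>))) / K"
        using Kpos by (intro divide_right_mono) auto
      then show ?thesis using t2(1) unfolding sq by linarith
    qed
  next
    fix \<tau> assume \<tau>: "\<tau> \<in> Ty"
    define i j where "i = fst \<tau>" and "j = snd \<tau>"
    have ij: "i \<in> {1..K}" "j \<in> {1..K}" using \<tau> unfolding i_def j_def by auto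
    have e5: "eq_pm_div (e_between G (B 0) (A i)) (e_between G (B 0) (core K A))
          (\<epsilon> * max (real (e_between G (B 0) (core K A))) (real (card (verts G)))) (real K)"
      "eq_pm_div (e_between G (A 0) (B j)) (e_between G (A 0) (core K B))
          (\<epsilon> * max (real (e_between G (A 0) (core K B))) (real (card (verts G)))) (real K)"
      "eq_pm_div (e_between G (A i) (B j)) (e_between G (core K A) (core K B))
          (\<epsilon> * max (real (e_between G (core K A) (core K B))) (real (card (verts G)))) (real K ^ 2)"
    proof -
      have "\<forall>i\<in>{1..K}. \<forall>j\<in>{1..K}.
        eq_pm_div (e_between G (B 0) (A i)) (e_between G (B 0) (core K A))
          (\<epsilon> * max (real (e_between G (B 0) (core K A))) (real (card (verts G)))) (real K) \<and>
        eq_pm_div (e_between G (A 0) (B j)) (e_between G (A 0) (core K B))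
          (\<epsilon> * max (real (e_between G (A 0) (core K B))) (real (card (verts G)))) (real K) \<and>
        eq_pm_div (e_between G (A i) (B j)) (e_between G (core K A) (core K B))
          (\<epsilon> * max (real (e_between G (core K A) (core K B))) (real (card (verts G)))) (real K ^ 2)"
        using E5 unfolding ESch5_def Let_def by blast
      then show "eq_pm_div (e_between G (B 0) (A i)) (e_between G (B 0) (core K A))
          (\<epsilon> * max (real (e_between G (B 0) (core K A))) (real (card (verts G)))) (real K)"
      "eq_pm_div (e_between G (A 0) (B j)) (e_between G (A 0) (core K B))
          (\<epsilon> * max (real (e_between G (A 0) (core K B))) (real (card (verts G)))) (real K)"
      "eq_pm_div (e_between G (A i) (B j)) (e_between G (core K A) (core K B))
          (\<epsilon> * max (real (e_between G (core K A) (core K B))) (real (card (verts G)))) (real K ^ 2)"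
        using ij by blast+
    qed
    have lowpm: "(x - \<epsilon> * x - \<epsilon> * n) / k \<le> a" if "eq_pm_div a x (\<epsilon> * max x (real (card (verts G)))) k" "0 < k" "0 \<le> x" for a x k :: real
    proof -
      have "max x (real n) \<le> x + n" using that(3) by simp
      then have "\<epsilon> * max x (real n) \<le> \<epsilon> * (x + n)" using \<epsilon> by (intro mult_left_mono) auto
      then have "x - \<epsilon> * x - \<epsilon> * n \<le> x - \<epsilon> * max x (real n)" by (simp add: distrib_left)
      then have "(x - \<epsilon> * x - \<epsilon> * n) / k \<le> (x - \<epsilon> * max x (real n)) / k" using that(2) by (intro divide_right_mono) auto
      then show ?thesis using that(1) unfolding eq_pm_div_def n by linarith
    qed
    let ?x1 = "real (e_between G (core K A) (core K B))" and ?x2 = "real (e_between G (A 0) (core K B))"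
      and ?x3 = "real (e_between G (B 0) (core K A))" and ?x4 = "real (card {e \<in> cr. e \<subseteq> V0})"
    have K2: "0 < real K ^ 2" using Kpos by simp
    have l1: "(?x1 - \<epsilon> * ?x1 - \<epsilon> * n) / real K ^ 2 \<le> real (e_between G (A i) (B j))"
      by (rule lowpm[OF e5(3) K2]) simp
    have l2: "(?x2 - \<epsilon> * ?x2 - \<epsilon> * n) / real K ^ 2 \<le> real (e_between G (A 0) (B j)) / K"
    proof -
      have "(?x2 - \<epsilon> * ?x2 - \<epsilon> * n) / K \<le> real (e_between G (A 0) (B j))"
        by (rule lowpm[OF e5(2) Kpos]) simp
      then have "(?x2 - \<epsilon> * ?x2 - \<epsilon> * n) / K / K \<le> real (e_between G (A 0) (B j)) / K"
        using Kpos by (intro divide_right_mono) auto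
      then show ?thesis unfolding sq .
    qed
    have l3: "(?x3 - \<epsilon> * ?x3 - \<epsilon> * n) / real K ^ 2 \<le> real (e_between G (B 0) (A i)) / K"
    proof -
      have "(?x3 - \<epsilon> * ?x3 - \<epsilon> * n) / K \<le> real (e_between G (B 0) (A i))"
        by (rule lowpm[OF e5(1) Kpos]) simp
      then have "(?x3 - \<epsilon> * ?x3 - \<epsilon> * n) / K / K \<le> real (e_between G (B 0) (A i)) / K"
        using Kpos by (intro divide_right_mono) auto
      then show ?thesis unfolding sq .
    qed
    have l4: "(?x4 - \<epsilon> * ?x4) / real K ^ 2 \<le> ?x4 / real K ^ 2"
      using K2 \<epsilon> by (intro divide_right_mono) auto
    have ye: "card {e \<in> cr. ty e = \<tau>} \<ge> real (e_between G (A i) (B j)) + real (e_between G (A 0) (B j)) / K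
         + real (e_between G (B 0) (A i)) / K + ?x4 / real K ^ 2 - real (card V0) - 1"
      using ty3 \<tau> unfolding i_def j_def by blast
    show "((1 - \<epsilon>) * card cr - 3 * \<epsilon> * n) / real K ^ 2 - b - 1 \<le> real (card {e \<in> cr. ty e = \<tau>})"
    proof (cases "\<epsilon> \<le> 1")
      case True
      have "real (card cr) \<le> ?x1 + ?x2 + ?x3 + ?x4" using cr_total by linarith
      then have "(1 - \<epsilon>) * card cr \<le> (1 - \<epsilon>) * (?x1 + ?x2 + ?x3 + ?x4)" using True by (intro mult_left_mono) auto
      then have "(1 - \<epsilon>) * card cr - 3 * \<epsilon> * n \<le> (?x1 - \<epsilon> * ?x1 - \<epsilon> * n) + (?x2 - \<epsilon> * ?x2 - \<epsilon> * n)
          + (?x3 - \<epsilon> * ?x3 - \<epsilon> * n) + (?x4 - \<epsilon> * ?x4)"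
        by (simp add: algebra_simps)
      then have "((1 - \<epsilon>) * card cr - 3 * \<epsilon> * n) / real K ^ 2 \<le> ((?x1 - \<epsilon> * ?x1 - \<epsilon> * n) + (?x2 - \<epsilon> * ?x2 - \<epsilon> * n)
          + (?x3 - \<epsilon> * ?x3 - \<epsilon> * n) + (?x4 - \<epsilon> * ?x4)) / real K ^ 2"
        using K2 by (intro divide_right_mono) auto
      then show ?thesis using l1 l2 l3 l4 ye b unfolding add_divide_distrib by linarith
    next
      case False
      then have "(1 - \<epsilon>) * card cr \<le> 0" by (simp add: mult_nonpos_nonneg)
      then have "(1 - \<epsilon>) * card cr - 3 * \<epsilon> * n \<le> 0"
        using \<epsilon> by (smt (verit) mult_nonneg_nonneg of_nat_0_le_iff)
      then have "((1 - \<epsilon>) * card cr - 3 * \<epsilon> * n) / real K ^ 2 \<le> 0" using K2 by (simp add: divide_nonpos_pos)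
      then show ?thesis by (smt (verit) of_nat_0_le_iff)
    qed
  qed
qed

end

section \<open>Extending the colouring to all edges\<close>

lemma fibre_sum:
  assumes "finite X" "finite Z"
  shows "(\<Sum>c\<in>Z. card {e \<in> X. f e = c}) = card {e \<in> X. f e \<in> Z}"
proof -
  have "card (\<Union>c\<in>Z. {e \<in> X. f e = c}) = (\<Sum>c\<in>Z. card {e \<in> X. f e = c})"
    using assms by (intro card_UN_disjoint) auto
  moreover have "(\<Union>c\<in>Z. {e \<in> X. f e = c}) = {e \<in> X. f e \<in> Z}" by auto
  ultimately show ?thesis by simp
qed

context partitioned_graph
begin

text \<open>The clusters on the side of \<open>v\<close>, to which the edges at \<open>v\<close> that are not crossing go.\<close>
definition own :: "'a \<Rightarrow> nat \<Rightarrow> 'a set" where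
  "own v j = (if v \<in> A 0 then A j else B j)"

definition own_core :: "'a \<Rightarrow> 'a set" where
  "own_core v = (if v \<in> A 0 then core K A else core K B)"

definition own_index :: "'a \<Rightarrow> nat \<times> nat \<Rightarrow> nat" where
  "own_index v \<tau> = (if v \<in> A 0 then fst \<tau> else snd \<tau>)"

definition part :: "'a \<Rightarrow> nat" where
  "part a = (SOME i. i \<in> {1..K} \<and> a \<in> A i \<union> B i)"

lemma part_eq: assumes "a \<in> A i \<union> B i" "i \<in> {1..K}" shows "part a = i"
  unfolding part_def
proof (rule some_equality)
  show "i \<in> {1..K} \<and> a \<in> A i \<union> B i" using assms by blast
  fix j assume "j \<in> {1..K} \<and> a \<in> A j \<union> B j"
  then show "j = i" using assms A_unique[of a i j] B_unique[of a i j] A_not_B[of a i j] A_not_B[of a j i] by auto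
qed

lemma own_core_Union: "own_core v = (\<Union>j\<in>{1..K}. own v j)"
  unfolding own_core_def own_def core_def by auto

lemma own_edge_core:
  assumes "v \<in> V0" "{v, a} \<in> edges G - cr"
  shows "a \<in> own_core v"
proof -
  have coreV: "x \<notin> V0" if "x \<in> core K A \<or> x \<in> core K B" for x
    using that core_not_V0 unfolding core_def by blast
  have d0: "A 0 \<inter> B 0 = {}" using A_not_B[of _ 0 0] by auto
  from kinds[of "{v, a}"] assms(2) consider
      x y where "x \<in> side K A" "y \<in> side K B" "{v, a} = {x, y}"
    | w x where "w \<in> A 0" "x \<in> core K A" "{v, a} = {w, x}"
    | w x where "w \<in> B 0" "x \<in> core K B" "{v, a} = {w, x}" by blast
  then show ?thesis
  proof cases
    case 1
    then show ?thesis using assms(2) unfolding edges_between_def by blast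
  next
    case 2
    then have "v = w" "a = x" using coreV[of x] assms(1) by (auto simp: doubleton_eq_iff)
    then show ?thesis using 2 unfolding own_core_def by simp
  next
    case 3
    then have "v = w" "a = x" using coreV[of x] assms(1) by (auto simp: doubleton_eq_iff)
    then show ?thesis using 3 d0 unfolding own_core_def by auto
  qed
qed

lemma own_edge:
  assumes "v \<in> V0" "{v, y} \<in> edges G" "y \<in> own v j" "j \<in> {1..K}"
  shows "{v, y} \<in> edges G - cr"
proof -
  have "{v, y} \<notin> cr"
  proof
    assume "{v, y} \<in> cr"
    then obtain x w where "{v, y} = {x, w}" "x \<in> side K A" "w \<in> side K B" unfolding edges_between_def by blast
    then have "(v \<in> side K A \<and> y \<in> side K B) \<or> (v \<in> side K B \<and> y \<in> side K A)" by (auto simp: doubleton_eq_iff)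
    moreover have "(v \<in> side K A \<and> y \<in> side K A) \<or> (v \<in> side K B \<and> y \<in> side K B)"
      using assms A_side[of v 0] B_side[of v 0] A_side[of y j] B_side[of y j] unfolding own_def by (auto split: if_splits)
    ultimately show False using AB by blast
  qed
  then show ?thesis using assms(2) by blast
qed

lemma noncrossing_edge:
  assumes "e \<in> edges G - cr"
  shows "\<exists>v\<in>V0. \<exists>a. a \<notin> V0 \<and> e = {v, a}"
proof -
  have coreV: "x \<notin> V0" if "x \<in> core K A \<or> x \<in> core K B" for x
    using that core_not_V0 unfolding core_def by blast
  from kinds[of e] assms have "(\<exists>v\<in>A 0. \<exists>a\<in>core K A. e = {v, a}) \<or> (\<exists>v\<in>B 0. \<exists>b\<in>core K B. e = {v, b})"
    unfolding edges_between_def by blast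
  then show ?thesis using coreV by blast
qed

lemma edge_card: "e \<in> edges G \<Longrightarrow> card e = 2"
  using simple unfolding simple_graph_def by blast

lemma card_Ty: "card Ty = K ^ 2"
  by (simp add: card_cartesian_product power2_eq_square)

lemma card_own_index: "i \<in> {1..K} \<Longrightarrow> card {\<tau> \<in> Ty. own_index v \<tau> = i} = K"
proof -
  assume j: "i \<in> {1..K}"
  have "{\<tau> \<in> Ty. own_index v \<tau> = i} = (if v \<in> A 0 then {i} \<times> {1..K} else {1..K} \<times> {i})"
    using j unfolding own_index_def by auto
  then show ?thesis by (simp add: card_cartesian_product)
qed

text \<open>The hypotheses of \<open>HES_of_colour_class\<close> for every colour class, together with the locality of the colours
  with index below \<open>t - l\<close> and the number of crossing edges for those with index below \<open>l\<close>.\<close>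
definition HES_colouring :: "nat \<Rightarrow> nat \<Rightarrow> real \<Rightarrow> ('a set \<Rightarrow> (nat \<times> nat) \<times> nat) \<Rightarrow> bool" where
  "HES_colouring t l q col \<longleftrightarrow> (\<forall>e\<in>edges G. col e \<in> Ty \<times> {..<t}) \<and>
    (\<forall>v\<in>V0. \<forall>c\<in>Ty \<times> {..<t}. card {e \<in> edges G. v \<in> e \<and> col e = c} = 2) \<and>
    (\<forall>a c. a \<notin> V0 \<longrightarrow> card {e \<in> edges G. a \<in> e \<and> col e = c} \<le> 1) \<and>
    (\<forall>e\<in>edges G. snd (col e) < t - l \<longrightarrow> e \<subseteq> V0 \<union> A (fst (fst (col e))) \<union> B (snd (fst (col e)))) \<and>
    (\<forall>c. real (card {e \<in> cr. col e = c}) \<le> q) \<and>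
    (\<forall>c\<in>Ty \<times> {..<l}. card {e \<in> cr. col e = c} = 2) \<and>
    (\<forall>c. \<forall>e\<in>{e \<in> cr. col e = c}. \<forall>g\<in>{e \<in> cr. col e = c}. e \<subseteq> V0 \<longrightarrow> g \<noteq> e \<longrightarrow> g \<inter> e = {}) \<and>
    (\<forall>c\<in>Ty \<times> {..<t}. even (card (isolated {e \<in> cr. col e = c})) \<and> isolated {e \<in> cr. col e = c} \<noteq> {})"

text \<open>The crossing edges are coloured by \<open>crossing_colouring\<close> for a maximal admissible packing, and the rest by
  \<open>extend_colouring\<close>. What remains to be compared at \<open>v \<in> V\<^sub>0\<close> is the demand and the supply for each
  own cluster \<open>i\<close>. The supply is about \<open>(2N - d)/K\<close> where \<open>d\<close> is the crossing degree of \<open>v\<close>. The demand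
  is that of the \<open>K(t - l)\<close> local colours with this destination, about \<open>2K(t - l) - (d/K - 3Kl/2)\<close>, because at
  most \<open>3l/2 + 1\<close> crossing edges of each type at \<open>v\<close> have nonlocal colours. With \<open>N = K\<^sup>2t\<close> the supply
  exceeds the demand by about \<open>Kl/2\<close>, which outweighs the errors.\<close>
lemma edge_colouring:
  fixes t l b n :: nat and \<epsilon> q z :: real
  assumes E4: "ESch4 \<epsilon> K A B G" and E5: "ESch5 \<epsilon> K A B G"
    and vG: "V0 \<subseteq> verts G" and n: "n = card (verts G)" and \<epsilon>: "0 < \<epsilon>" "\<epsilon> \<le> 1"
    and b: "card V0 \<le> b"
    and lowc: "\<And>a. a \<notin> V0 \<Longrightarrow> card {e \<in> cr. a \<in> e} \<le> b"
    and deg: "\<And>v. v \<in> V0 \<Longrightarrow> card {e \<in> edges G. v \<in> e} = 2 * (K ^ 2 * t)"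
    and half: "\<And>v. v \<in> V0 \<Longrightarrow> real (card {e \<in> cr. v \<in> e}) \<le> 101 / 100 * (real K ^ 2 * t)"
    and size: "real (card cr) \<le> q ^ 2" and ev: "even (card cr)"
    and adm: "((\<forall>v\<in>V0. real (card {e \<in> cr. v \<in> e}) \<le> 56 / 100 * (real K ^ 2 * t)) \<and> 2 * (real K ^ 2 * t) \<le> card cr) \<or>
      (\<forall>W \<subseteq> V0. finite W \<longrightarrow> card W \<le> 3 \<longrightarrow>
         205 / 100 * (real K ^ 2 * t) + (\<Sum>w\<in>W. real (card {e \<in> cr. w \<in> e})) \<le> card cr + 56 / 100 * (real K ^ 2 * t) * card W)"
    and z: "z = l / real K ^ 2"
    and sm: "4 \<le> q" "q \<le> z / 1000" "\<epsilon> * n / real K ^ 2 \<le> z / 1000" "real b \<le> q + 1" "100 * real l \<le> t" "\<epsilon> * t \<le> z / 1000"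
  shows "\<exists>col. HES_colouring t l q col"
proof -
  have Kp: "1 \<le> real K" using K1 by simp
  then have K2: "1 \<le> real K ^ 2" by simp
  have zl: "z \<le> l"
  proof -
    have "real l / real K ^ 2 \<le> real l / 1" using K2 K1 by (intro divide_left_mono) auto
    then show ?thesis unfolding z by simp
  qed
  have z4: "4000 \<le> z" using sm(1,2) by linarith
  have b500: "real b + 2 \<le> z / 500" using sm(1,2,4) by linarith
  obtain ty where ty1: "\<forall>e\<in>cr. ty e \<in> permitted e"
    and ty2: "\<forall>v\<in>V0. \<forall>\<tau>\<in>Ty.
       real (card {e \<in> cr. ty e = \<tau> \<and> v \<in> e}) \<le> (real (card {e \<in> cr. v \<in> e}) + \<epsilon> * n) / real K ^ 2 + 1 + b \<and>
       (real (card {e \<in> cr. v \<in> e}) - b - \<epsilon> * n) / real K ^ 2 - 1 \<le> real (card {e \<in> cr. ty e = \<tau> \<and> v \<in> e})"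
    and ty3: "\<forall>\<tau>\<in>Ty. ((1 - \<epsilon>) * card cr - 3 * \<epsilon> * n) / real K ^ 2 - b - 1 \<le> real (card {e \<in> cr. ty e = \<tau>})"
    using slicing[OF E4 E5 vG n b \<epsilon>(1)] by (elim exE conjE) (rule that)
  interpret tb: typed_bipartite cr "side K A" V0 Ty ty
  proof
    show "finite cr" by (rule fin_cr)
    show "finite Ty" by simp
    show "\<exists>x y. e = {x, y} \<and> x \<in> side K A \<and> y \<notin> side K A" if "e \<in> cr" for e using cr_bip[OF that] .
    show "ty e \<in> Ty" if "e \<in> cr" for e using ty1 that permitted_Ty by blast
  qed
  \<comment> \<open>\<open>s\<close> is the largest deficit per type such that the deficits of all types together are at most \<open>l\<close>;
    it still exceeds the errors of the slicing, which are small compared with \<open>z = l / K\<^sup>2\<close>. \<open>M\<close> is half the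
    number \<open>q\<close> of crossing edges allowed in a colour, and \<open>fl\<close> is such that \<open>M * (fl + 1)\<close> exceeds
    the bound \<open>q\<^sup>2\<close> on the number of crossing edges. \<open>dm\<close> bounds the crossing degrees per type, which are at most about \<open>t\<close>.\<close>
  define s where "s = l div K ^ 2"
  define r where "r = 3 * t div 5"
  define lo where "lo = 2 * t - s"
  define t' where "t' = t - l"
  define fl where "fl = nat \<lceil>4 * q\<rceil>"
  define M where "M = nat \<lfloor>q / 2\<rfloor>"
  define dm where "dm = t + t div 20"
  have sK: "K ^ 2 * s \<le> l" unfolding s_def by simp
  have s_ge: "z - 1 \<le> real s"
  proof -
    have "l < K ^ 2 * (s + 1)" unfolding s_def using K1 by (metis Suc_eq_plus1 dividend_less_times_div mult_Suc_right add.commute zero_less_power less_le_trans zero_less_one)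
    then have "real l < real (K ^ 2 * (s + 1))" by (simp only: of_nat_less_iff)
    then have "real l < real K ^ 2 * (real s + 1)" by (simp add: distrib_left)
    then have "z < real s + 1" unfolding z using K2 by (simp add: divide_less_eq mult.commute)
    then show ?thesis by simp
  qed
  have s_le: "s \<le> l" unfolding s_def by simp
  have lt: "100 * l \<le> t"
  proof -
    have "real (100 * l) \<le> real t" using sm(5) by simp
    then show ?thesis by (simp only: of_nat_le_iff)
  qed
  have par: "lo + s = 2 * t" unfolding lo_def using s_le lt by linarith
  have fl_r: "4 * q \<le> real fl" "real fl \<le> 4 * q + 1" unfolding fl_def using sm(1) by linarith+
  have M_r: "real M \<le> q / 2" "q / 2 - 1 \<le> real M" "1 \<le> M" unfolding M_def using sm(1) by linarith+
  have r_le: "real r \<le> 3 / 5 * t" unfolding r_def by linarith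
  have dm_r: "real dm \<le> 21 / 20 * t" "21 / 20 * t - 1 \<le> real dm" unfolding dm_def by linarith+
  have t'_r: "real t' = real t - real l" unfolding t'_def using lt by (simp add: of_nat_diff)
  have lowV: "card {e \<in> cr. v \<in> e \<and> e \<subseteq> V0} \<le> b" if "v \<in> V0" for v using cr_inner_degree[OF that] b by linarith
  have zt: "100 * z \<le> t" using zl sm(5) by linarith
  have kkTy: "real K ^ 2 = real (card Ty)" unfolding card_Ty by simp
  have Kn0: "0 < real K ^ 2" using K2 by linarith
  have x0: "0 \<le> \<epsilon> * n" using \<epsilon> by simp
  have "\<exists>Q. tb.admissible r lo (2 * (card Ty * t)) Q"
  proof (rule tb.admissible_exists[where kk = "real K ^ 2" and NN = "real K ^ 2 * t" and x = "\<epsilon> * n" and z = z and \<epsilon> = \<epsilon> and b = b and s = s])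
    show "((1 - \<epsilon>) * real (card cr) - 3 * (\<epsilon> * n)) / real K ^ 2 - real b - 1 \<le> real (card {e \<in> cr. ty e = \<tau>})" if "\<tau> \<in> Ty" for \<tau>
      using bspec[OF ty3 that] by (simp only: mult.assoc)
    show "real (card {e \<in> cr. ty e = \<tau> \<and> v \<in> e}) \<le> (real (card {e \<in> cr. v \<in> e}) + \<epsilon> * n) / real K ^ 2 + 1 + real b"
      if "v \<in> V0" "\<tau> \<in> Ty" for v \<tau> using ty2 that by blast
    show "1000 \<le> z" using z4 by linarith
  qed (use lowc lowV kkTy Kn0 half par r_def sm b500 s_ge zt \<epsilon> x0 adm in \<open>simp_all\<close>)
  then obtain Q0 where Q0: "tb.admissible r lo (2 * (card Ty * t)) Q0" by blast
  have evt: "even (2 * (card Ty * t))" by simp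
  obtain Q where Q: "tb.admissible r lo (2 * (card Ty * t)) Q"
    and dich: "card (cr - \<Union>Q) = 2 * (card Ty * t) \<or>
     (\<forall>\<tau>\<in>Ty. card (tb.rest Q \<tau>) \<le> lo + 1 \<or> (\<forall>p. star_pair V0 p \<longrightarrow> \<not> p \<subseteq> tb.rest Q \<tau>))"
    using tb.maximal_admissible[OF Q0 ev evt] by blast
  have "\<exists>col0. tb.crossing_scheme t t' l M col0"
  proof (rule tb.crossing_colouring[OF Q dich ev])
    have r1: "real lo + real s = 2 * real t" using par by linarith
    show "2 * r + 1 \<le> lo"
    proof -
      have "real (2 * r + 1) \<le> real lo" using r_le r1 s_le lt zt z4 by linarith
      then show ?thesis by (simp only: of_nat_le_iff)
    qed
    show "lo + s = 2 * t" by (rule par)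
    show "2 \<le> s" using s_ge z4 by linarith
    show "card Ty * s \<le> l" unfolding card_Ty by (rule sK)
    show "t' + l = t" unfolding t'_def using lt by simp
    show "b + 1 \<le> l"
    proof -
      have "real (b + 1) \<le> real l" using b500 zl z4 by simp
      then show ?thesis by (simp only: of_nat_le_iff)
    qed
    show "Ty \<noteq> {}" using K1 by auto
    show "card {e \<in> cr. ty e = \<tau> \<and> v \<in> e} \<le> dm" if \<tau>: "\<tau> \<in> Ty" and v: "v \<in> V0" for \<tau> v
    proof -
      have "(real (card {e \<in> cr. v \<in> e}) + \<epsilon> * n) / real K ^ 2 \<le> (101 / 100 * (real K ^ 2 * t) + \<epsilon> * n) / real K ^ 2"
        using half[OF v] Kn0 by (intro divide_right_mono) auto
      also have "\<dots> = 101 / 100 * t + \<epsilon> * n / real K ^ 2" using Kn0 K1 by (simp add: field_simps)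
      finally have le: "(real (card {e \<in> cr. v \<in> e}) + \<epsilon> * n) / real K ^ 2 \<le> 101 / 100 * t + \<epsilon> * n / real K ^ 2" .
      have "real (card {e \<in> cr. ty e = \<tau> \<and> v \<in> e}) \<le> (real (card {e \<in> cr. v \<in> e}) + \<epsilon> * n) / real K ^ 2 + 1 + b"
        using ty2 v \<tau> by blast
      then have "real (card {e \<in> cr. ty e = \<tau> \<and> v \<in> e}) \<le> 101 / 100 * t + \<epsilon> * n / real K ^ 2 + 1 + b"
        using le by argo
      then have "real (card {e \<in> cr. ty e = \<tau> \<and> v \<in> e}) \<le> real dm" using dm_r(2) sm(3) b500 zt z4 by linarith
      then show ?thesis by simp
    qed
    show "l < t'"
    proof -
      have "real l < real t'" using t'_r sm(5) zl z4 by linarith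
      then show ?thesis by simp
    qed
    then have tl: "real (t' - l) = real t - 2 * real l" using t'_r by (simp add: of_nat_diff)
    \<comment> \<open>This is where \<open>21/20 + 3/5 < 2\<close> is used.\<close>
    show "dm + r + 4 * b + 2 * fl + 2 \<le> 2 * (t' - l)"
    proof -
      have "real (dm + r + 4 * b + 2 * fl + 2) \<le> 2 * (real t - 2 * real l)"
        using dm_r(1) r_le b500 fl_r(2) sm(2,5) zt z4 by simp
      then have "real (dm + r + 4 * b + 2 * fl + 2) \<le> real (2 * (t' - l))" using tl by simp
      then show ?thesis by (simp only: of_nat_le_iff)
    qed
    show "4 * (b + 1) + fl < t' - l"
    proof -
      have "real (4 * (b + 1) + fl) < real t - 2 * real l"
        using b500 fl_r(2) sm(2,5) zt z4 by simp
      then have "real (4 * (b + 1) + fl) < real (t' - l)" using tl by simp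
      then show ?thesis by (simp only: of_nat_less_iff)
    qed
    show "card cr < M * Suc fl"
    proof -
      have "(q / 2 - 1) * (4 * q + 1) \<le> real M * real (Suc fl)"
        using M_r fl_r sm(1) by (intro mult_mono) auto
      moreover have "q ^ 2 < (q / 2 - 1) * (4 * q + 1)"
      proof -
        have "0 < (q - 4) * q + (q / 2 - 1)"
          using sm(1) by (intro add_nonneg_pos) auto
        then show ?thesis by (simp add: algebra_simps power2_eq_square)
      qed
      ultimately have "real (card cr) < real M * real (Suc fl)" using size by argo
      then have "real (card cr) < real (M * Suc fl)" by (simp only: of_nat_mult)
      then show ?thesis by (simp only: of_nat_less_iff)
    qed
    show "1 \<le> M" by (rule M_r)
  qed (use lowc lowV in simp_all)
  then obtain col0 where c1: "\<forall>e\<in>cr. fst (col0 e) \<in> Ty \<and> snd (col0 e) < t \<and> (snd (col0 e) < t' \<longrightarrow> fst (col0 e) = ty e)"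
    and c2: "\<forall>v c. card {e \<in> cr. v \<in> e \<and> col0 e = c} \<le> 2"
    and c3: "\<forall>v c. v \<notin> V0 \<longrightarrow> card {e \<in> cr. v \<in> e \<and> col0 e = c} \<le> 1"
    and c4: "\<forall>v c. t' \<le> snd c \<longrightarrow> card {e \<in> cr. v \<in> e \<and> col0 e = c} \<le> 1"
    and c5: "\<forall>c. card {e \<in> cr. col0 e = c} \<le> 2 * M"
    and c6: "\<forall>c\<in>Ty \<times> {..<l}. card {e \<in> cr. col0 e = c} = 2"
    and c7: "\<forall>c. \<forall>e\<in>{e \<in> cr. col0 e = c}. \<forall>g\<in>{e \<in> cr. col0 e = c}. e \<subseteq> V0 \<longrightarrow> g \<noteq> e \<longrightarrow> g \<inter> e = {}"
    and c8: "\<forall>c\<in>Ty \<times> {..<t}. even (card (isolated {e \<in> cr. col0 e = c})) \<and> isolated {e \<in> cr. col0 e = c} \<noteq> {}"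
    and c9: "\<forall>\<tau>\<in>Ty. \<forall>v. 2 * card {e \<in> cr. ty e = \<tau> \<and> v \<in> e \<and> t' \<le> snd (col0 e)} \<le> 3 * l + 2"
    unfolding tb.crossing_scheme_def by (elim exE conjE) (rule that)
  define Col where "Col = Ty \<times> {..<t}"
  \<comment> \<open>A local colour sends the edges at \<open>v\<close> to the cluster of its type on the side of \<open>v\<close>.\<close>
  define dest where "dest v c = (if snd c < t' then Some (own_index v (fst c)) else None)" for v and c :: "(nat \<times> nat) \<times> nat"
  define L where "L = 4 * M + 4 * b"
  have finCol: "finite Col" unfolding Col_def by simp
  have L_r: "3 * real L \<le> z / 10"
  proof -
    have "real L = 4 * real M + 4 * real b" unfolding L_def by simp
    then show ?thesis using M_r(1) b500 sm(2) z4 by linarith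
  qed
  have own_deg: "(2 * (real K ^ 2 * t) - real (card {e \<in> cr. v \<in> e}) - \<epsilon> * n) / K
     \<le> real (card {a. {v, a} \<in> edges G - cr \<and> part a = i})" if v: "v \<in> V0" and i: "i \<in> {1..K}" for v i
  proof -
    have "nbrs G v \<inter> own v i \<subseteq> {a. {v, a} \<in> edges G - cr \<and> part a = i}"
      using own_edge[OF v _ _ i] part_eq[OF _ i] unfolding nbrs_def own_def by (auto split: if_splits)
    moreover have "finite {a. {v, a} \<in> edges G - cr \<and> part a = i}"
    proof (rule finite_subset)
      show "{a. {v, a} \<in> edges G - cr \<and> part a = i} \<subseteq> verts G" using simple unfolding simple_graph_def by blast
      show "finite (verts G)" using simple unfolding simple_graph_def by blast
    qed
    ultimately have c: "deg_in G v (own v i) \<le> card {a. {v, a} \<in> edges G - cr \<and> part a = i}"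
      unfolding deg_in_def by (intro card_mono)
    have "{e \<in> edges G. v \<in> e} \<subseteq> {e \<in> cr. v \<in> e} \<union> (\<lambda>y. {v, y}) ` (nbrs G v \<inter> own_core v)"
    proof
      fix e assume e: "e \<in> {e \<in> edges G. v \<in> e}"
      show "e \<in> {e \<in> cr. v \<in> e} \<union> (\<lambda>y. {v, y}) ` (nbrs G v \<inter> own_core v)"
      proof (cases "e \<in> cr")
        case False
        then obtain w a where w: "w \<in> V0" "a \<notin> V0" "e = {w, a}" using noncrossing_edge[of e] e by blast
        then have "e = {v, a}" using e v by auto
        moreover have "a \<in> own_core v" using own_edge_core[OF v, of a] calculation e False by blast
        ultimately show ?thesis using e unfolding nbrs_def by blast
      qed (use e in simp)
    qed
    moreover have "finite ((\<lambda>y. {v, y}) ` (nbrs G v \<inter> own_core v))"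
      by (rule finite_subset[OF _ finE]) (auto simp: nbrs_def)
    ultimately have "card {e \<in> edges G. v \<in> e} \<le> card ({e \<in> cr. v \<in> e} \<union> (\<lambda>y. {v, y}) ` (nbrs G v \<inter> own_core v))"
      using fin_cr by (intro card_mono) auto
    also have "\<dots> \<le> card {e \<in> cr. v \<in> e} + deg_in G v (own_core v)"
      unfolding deg_in_card_star by (rule card_Un_le)
    finally have "2 * (K ^ 2 * t) \<le> card {e \<in> cr. v \<in> e} + deg_in G v (own_core v)" using deg[OF v] by simp
    then have "real (2 * (K ^ 2 * t)) \<le> real (card {e \<in> cr. v \<in> e} + deg_in G v (own_core v))" by (simp only: of_nat_le_iff)
    then have oc: "2 * (real K ^ 2 * t) - real (card {e \<in> cr. v \<in> e}) - \<epsilon> * n \<le> real (deg_in G v (own_core v)) - \<epsilon> * n" by simp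
    have "(real (deg_in G v (own_core v)) - \<epsilon> * n) / K \<le> real (deg_in G v (own v i))"
    proof -
      have "v \<in> verts G" using v vG by blast
      then have "eq_pm_div (deg_in G v (A i)) (deg_in G v (core K A)) (\<epsilon> * card (verts G)) K \<and>
       eq_pm_div (deg_in G v (B i)) (deg_in G v (core K B)) (\<epsilon> * card (verts G)) K"
        using E4 i unfolding ESch4_def by blast
      then show ?thesis unfolding eq_pm_div_def own_core_def own_def n by simp
    qed
    moreover have "(2 * (real K ^ 2 * t) - real (card {e \<in> cr. v \<in> e}) - \<epsilon> * n) / K \<le> (real (deg_in G v (own_core v)) - \<epsilon> * n) / K"
      using oc Kp by (intro divide_right_mono) auto
    ultimately show ?thesis using c by linarith
  qed
  have ext: "\<exists>col. (\<forall>e\<in>edges G. col e \<in> Col) \<and> (\<forall>e\<in>cr. col e = col0 e) \<and>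
     (\<forall>v\<in>V0. \<forall>c\<in>Col. card {e \<in> edges G. v \<in> e \<and> col e = c} = 2) \<and>
     (\<forall>a c. a \<notin> V0 \<longrightarrow> card {e \<in> edges G. a \<in> e \<and> col e = c} \<le> 1) \<and>
     (\<forall>v\<in>V0. \<forall>a i. {v, a} \<in> edges G - cr \<longrightarrow> dest v (col {v, a}) = Some i \<longrightarrow> part a = i)"
  proof (rule extend_colouring[where L = L and M = "2 * M" and b = "2 * b" and I = "{1..K}"])
    show "finite (edges G)" "finite Col" "finite V0" using finE finCol finV0 by auto
    show "cr \<subseteq> edges G" unfolding edges_between_def by auto
    show "card e = 2" if "e \<in> edges G" for e using edge_card[OF that] .
    show "\<exists>v\<in>V0. \<exists>a. a \<notin> V0 \<and> e = {v, a}" if "e \<in> edges G - cr" for e using noncrossing_edge[OF that] .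
    show "card {e \<in> edges G. v \<in> e} = 2 * card Col" if "v \<in> V0" for v
      using deg[OF that] unfolding Col_def card_cartesian_product[of Ty] card_Ty by simp
    show "col0 e \<in> Col" if "e \<in> cr" for e using c1 that unfolding Col_def by (metis lessThan_iff mem_Times_iff)
    show "card {e \<in> cr. v \<in> e \<and> col0 e = c} \<le> 2" for v c using c2 by blast
    show "card {e \<in> cr. a \<in> e \<and> col0 e = c} \<le> 1" if "a \<notin> V0" for a c using c3 that by blast
    show "card {e \<in> cr. col0 e = c} \<le> 2 * M" for c using c5 by blast
    show "card {e \<in> edges G. a \<in> e} \<le> 2 * b" if a: "a \<notin> V0" for a
    proof -
      have "{e \<in> edges G. a \<in> e} \<subseteq> {e \<in> cr. a \<in> e} \<union> (\<lambda>v. {v, a}) ` V0"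
      proof
        fix e assume e: "e \<in> {e \<in> edges G. a \<in> e}"
        show "e \<in> {e \<in> cr. a \<in> e} \<union> (\<lambda>v. {v, a}) ` V0"
        proof (cases "e \<in> cr")
          case False
          then obtain w c where "w \<in> V0" "c \<notin> V0" "e = {w, c}" using noncrossing_edge[of e] e by blast
          then show ?thesis using e a by auto
        qed (use e in simp)
      qed
      then have "card {e \<in> edges G. a \<in> e} \<le> card ({e \<in> cr. a \<in> e} \<union> (\<lambda>v. {v, a}) ` V0)"
        using fin_cr finV0 by (intro card_mono) auto
      also have "\<dots> \<le> card {e \<in> cr. a \<in> e} + card ((\<lambda>v. {v, a}) ` V0)" by (rule card_Un_le)
      also have "card ((\<lambda>v. {v, a}) ` V0) \<le> card V0" using finV0 by (rule card_image_le)
      finally show ?thesis using lowc[OF a] b by linarith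
    qed
    show "i \<in> {1..K}" if "c \<in> Col" "dest v c = Some i" for v c i
      using that unfolding Col_def dest_def own_index_def by (auto split: if_splits)
    show "2 * (2 * M) + 4 * card V0 \<le> L" "2 * (2 * b) \<le> L" unfolding L_def using b by auto
    show "3 * L < card {a. {v, a} \<in> edges G - cr \<and> part a = i}" if v: "v \<in> V0" and i: "i \<in> {1..K}" for v i
    proof -
      have "99 / 100 * t - \<epsilon> * n / real K ^ 2 = 1 * (99 / 100 * t - \<epsilon> * n / real K ^ 2)" by simp
      also have "\<dots> \<le> K * (99 / 100 * t - \<epsilon> * n / real K ^ 2)"
      proof (rule mult_right_mono[OF Kp])
        show "0 \<le> 99 / 100 * t - \<epsilon> * n / real K ^ 2" using sm(3) zt z4 by argo
      qed
      also have "\<dots> = (99 / 100 * (real K ^ 2 * t) - \<epsilon> * n) / K"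
        using K1 by (simp add: field_simps power2_eq_square)
      also have "\<dots> \<le> (2 * (real K ^ 2 * t) - real (card {e \<in> cr. v \<in> e}) - \<epsilon> * n) / K"
      proof (rule divide_right_mono)
        show "99 / 100 * (real K ^ 2 * t) - \<epsilon> * n \<le> 2 * (real K ^ 2 * t) - real (card {e \<in> cr. v \<in> e}) - \<epsilon> * n"
          using half[OF v] by argo
      qed (use Kp in simp)
      also have "\<dots> \<le> real (card {a. {v, a} \<in> edges G - cr \<and> part a = i})" by (rule own_deg[OF v i])
      finally have "99 / 100 * t - \<epsilon> * n / real K ^ 2 \<le> real (card {a. {v, a} \<in> edges G - cr \<and> part a = i})" .
      then have "3 * real L < real (card {a. {v, a} \<in> edges G - cr \<and> part a = i})"
        using L_r sm(3) zt z4 by linarith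
      then show ?thesis by linarith
    qed
    show "3 * L < (\<Sum>c\<in>{c \<in> Col. dest v c = None}. 2 - card {e \<in> cr. v \<in> e \<and> col0 e = c})" if "v \<in> V0" for v
    proof -
      have eq: "{c \<in> Col. dest v c = None} = Ty \<times> {t'..<t}" unfolding Col_def dest_def by (auto split: if_splits)
      have "(\<Sum>c\<in>Ty \<times> {t'..<t}. 1) \<le> (\<Sum>c\<in>Ty \<times> {t'..<t}. 2 - card {e \<in> cr. v \<in> e \<and> col0 e = c})"
      proof (rule sum_mono)
        fix c assume "c \<in> Ty \<times> {t'..<t}"
        then have "card {e \<in> cr. v \<in> e \<and> col0 e = c} \<le> 1" using c4 by auto
        then show "1 \<le> 2 - card {e \<in> cr. v \<in> e \<and> col0 e = c}" by linarith
      qed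
      moreover have "(\<Sum>c\<in>Ty \<times> {t'..<t}. 1) = K ^ 2 * l"
      proof -
        have "t - t' = l" unfolding t'_def using lt by simp
        then show ?thesis using card_Ty by (simp add: card_cartesian_product)
      qed
      moreover have "1 * l \<le> K ^ 2 * l" using K1 by (intro mult_right_mono) auto
      moreover have "3 * L < l"
      proof -
        have "3 * real L < real l" using L_r zl z4 by linarith
        then show ?thesis by linarith
      qed
      ultimately show ?thesis unfolding eq by linarith
    qed
    show "(\<Sum>c\<in>{c \<in> Col. dest v c = Some i}. 2 - card {e \<in> cr. v \<in> e \<and> col0 e = c})
       \<le> card {a. {v, a} \<in> edges G - cr \<and> part a = i}" if v: "v \<in> V0" and i: "i \<in> {1..K}" for v i
    proof -
      define P where "P = {\<tau> \<in> Ty. own_index v \<tau> = i}"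
      define Z where "Z = P \<times> {..<t'}"
      have finP: "finite P" unfolding P_def by simp
      have finZ: "finite Z" unfolding Z_def using finP by simp
      have eq: "{c \<in> Col. dest v c = Some i} = Z"
        unfolding Col_def dest_def Z_def P_def t'_def by (auto split: if_splits)
      have cP: "card P = K" unfolding P_def by (rule card_own_index[OF i])
      have cZ: "card Z = K * t'" unfolding Z_def by (simp add: card_cartesian_product cP)
      have fX: "finite {e \<in> cr. v \<in> e}" "finite {e \<in> cr. v \<in> e \<and> snd (col0 e) < t'}" using fin_cr by auto
      have "(\<Sum>c\<in>Z. card {e \<in> cr. v \<in> e \<and> col0 e = c}) = card {e \<in> cr. v \<in> e \<and> col0 e \<in> Z}"
        using fibre_sum[OF fX(1) finZ, of col0] by (simp add: conj_assoc)
      also have "{e \<in> cr. v \<in> e \<and> col0 e \<in> Z} = {e \<in> {e \<in> cr. v \<in> e \<and> snd (col0 e) < t'}. ty e \<in> P}"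
        using c1 unfolding Z_def by (auto simp: mem_Times_iff)
      also have "card \<dots> = (\<Sum>\<tau>\<in>P. card {e \<in> {e \<in> cr. v \<in> e \<and> snd (col0 e) < t'}. ty e = \<tau>})"
        using fibre_sum[OF fX(2) finP, of ty] by simp
      finally have sZ: "(\<Sum>c\<in>Z. card {e \<in> cr. v \<in> e \<and> col0 e = c})
          = (\<Sum>\<tau>\<in>P. card {e \<in> {e \<in> cr. v \<in> e \<and> snd (col0 e) < t'}. ty e = \<tau>})" .
      let ?d = "real (card {e \<in> cr. v \<in> e})"
      \<comment> \<open>A lower bound for the number of edges at \<open>v\<close> of one type that have a local colour.\<close>
      let ?m = "(?d - b - \<epsilon> * n) / real K ^ 2 - 1 - (3 * real l + 2) / 2"
      have each: "?m \<le> real (card {e \<in> {e \<in> cr. v \<in> e \<and> snd (col0 e) < t'}. ty e = \<tau>})" if \<tau>: "\<tau> \<in> P" for \<tau>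
      proof -
        have \<tau>T: "\<tau> \<in> Ty" using \<tau> unfolding P_def by blast
        have "{e \<in> cr. ty e = \<tau> \<and> v \<in> e} \<subseteq> {e \<in> {e \<in> cr. v \<in> e \<and> snd (col0 e) < t'}. ty e = \<tau>}
            \<union> {e \<in> cr. ty e = \<tau> \<and> v \<in> e \<and> t' \<le> snd (col0 e)}" by auto
        then have "card {e \<in> cr. ty e = \<tau> \<and> v \<in> e} \<le> card ({e \<in> {e \<in> cr. v \<in> e \<and> snd (col0 e) < t'}. ty e = \<tau>}
            \<union> {e \<in> cr. ty e = \<tau> \<and> v \<in> e \<and> t' \<le> snd (col0 e)})" using fin_cr by (intro card_mono) auto
        also have "\<dots> \<le> card {e \<in> {e \<in> cr. v \<in> e \<and> snd (col0 e) < t'}. ty e = \<tau>}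
            + card {e \<in> cr. ty e = \<tau> \<and> v \<in> e \<and> t' \<le> snd (col0 e)}" by (rule card_Un_le)
        finally have a: "real (card {e \<in> cr. ty e = \<tau> \<and> v \<in> e}) \<le> real (card {e \<in> {e \<in> cr. v \<in> e \<and> snd (col0 e) < t'}. ty e = \<tau>})
            + real (card {e \<in> cr. ty e = \<tau> \<and> v \<in> e \<and> t' \<le> snd (col0 e)})" by linarith
        have "2 * card {e \<in> cr. ty e = \<tau> \<and> v \<in> e \<and> t' \<le> snd (col0 e)} \<le> 3 * l + 2" using c9 \<tau>T by blast
        then have "2 * real (card {e \<in> cr. ty e = \<tau> \<and> v \<in> e \<and> t' \<le> snd (col0 e)}) \<le> 3 * real l + 2" by linarith
        moreover have "(?d - b - \<epsilon> * n) / real K ^ 2 - 1 \<le> real (card {e \<in> cr. ty e = \<tau> \<and> v \<in> e})" using ty2 v \<tau>T by blast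
        ultimately show ?thesis using a by argo
      qed
      have "K * ?m = (\<Sum>\<tau>\<in>P. ?m)" using cP by simp
      also have "\<dots> \<le> (\<Sum>\<tau>\<in>P. real (card {e \<in> {e \<in> cr. v \<in> e \<and> snd (col0 e) < t'}. ty e = \<tau>}))"
        using each by (rule sum_mono)
      also have "\<dots> = real (\<Sum>c\<in>Z. card {e \<in> cr. v \<in> e \<and> col0 e = c})" unfolding sZ by simp
      finally have low: "K * ?m \<le> real (\<Sum>c\<in>Z. card {e \<in> cr. v \<in> e \<and> col0 e = c})" .
      have "(\<Sum>c\<in>Z. 2 - card {e \<in> cr. v \<in> e \<and> col0 e = c}) + (\<Sum>c\<in>Z. card {e \<in> cr. v \<in> e \<and> col0 e = c}) = (\<Sum>c\<in>Z. 2)"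
        unfolding sum.distrib[symmetric] using c2 by (intro sum.cong) auto
      then have "(\<Sum>c\<in>Z. 2 - card {e \<in> cr. v \<in> e \<and> col0 e = c}) + (\<Sum>c\<in>Z. card {e \<in> cr. v \<in> e \<and> col0 e = c}) = 2 * (K * t')"
        using cZ by simp
      then have "real (\<Sum>c\<in>Z. 2 - card {e \<in> cr. v \<in> e \<and> col0 e = c}) + real (\<Sum>c\<in>Z. card {e \<in> cr. v \<in> e \<and> col0 e = c}) = 2 * (K * real t')"
        unfolding of_nat_add[symmetric] by (simp only: of_nat_mult of_nat_numeral)
      note total = this
      have kd: "real K * (2 * (real t - real l) - y) = 2 * (K * real t') - real K * y" for y
        unfolding t'_r by (simp add: algebra_simps)
      have lhs: "real (\<Sum>c\<in>Z. 2 - card {e \<in> cr. v \<in> e \<and> col0 e = c}) \<le> K * (2 * (real t - real l) - ?m)"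
        unfolding kd using total low by argo
      \<comment> \<open>The left-hand side contains \<open>- 2l + 3l/2\<close>; the gain \<open>l/2\<close> absorbs the error terms.\<close>
      have "2 * (real t - real l) - ?m \<le> 2 * real t - ?d / real K ^ 2 - \<epsilon> * n / real K ^ 2"
      proof -
        have "b / real K ^ 2 \<le> b / 1" using K2 K1 by (intro divide_left_mono) auto
        moreover have "(?d - b - \<epsilon> * n) / real K ^ 2 = ?d / real K ^ 2 - b / real K ^ 2 - \<epsilon> * n / real K ^ 2"
          by (simp add: diff_divide_distrib)
        ultimately show ?thesis using sm(3) b500 zl z4 by argo
      qed
      then have "K * (2 * (real t - real l) - ?m) \<le> K * (2 * real t - ?d / real K ^ 2 - \<epsilon> * n / real K ^ 2)"
        using Kp by (intro mult_left_mono) auto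
      also have "\<dots> = (2 * (real K ^ 2 * t) - ?d - \<epsilon> * n) / K"
        using K1 by (simp add: field_simps power2_eq_square)
      finally have chain: "K * (2 * (real t - real l) - ?m) \<le> (2 * (real K ^ 2 * t) - ?d - \<epsilon> * n) / K" .
      have "real (\<Sum>c\<in>Z. 2 - card {e \<in> cr. v \<in> e \<and> col0 e = c}) \<le> real (card {a. {v, a} \<in> edges G - cr \<and> part a = i})"
        by (rule order_trans[OF lhs order_trans[OF chain own_deg[OF v i]]])
      then show ?thesis unfolding eq by (simp only: of_nat_le_iff)
    qed
  qed
  obtain col where e1: "\<forall>e\<in>edges G. col e \<in> Col" and e2: "\<forall>e\<in>cr. col e = col0 e"
    and e3: "\<forall>v\<in>V0. \<forall>c\<in>Col. card {e \<in> edges G. v \<in> e \<and> col e = c} = 2"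
    and e4: "\<forall>a c. a \<notin> V0 \<longrightarrow> card {e \<in> edges G. a \<in> e \<and> col e = c} \<le> 1"
    and e5: "\<forall>v\<in>V0. \<forall>a i. {v, a} \<in> edges G - cr \<longrightarrow> dest v (col {v, a}) = Some i \<longrightarrow> part a = i"
    using ext by (elim exE conjE) (rule that)
  have ceq: "{e \<in> cr. col e = c} = {e \<in> cr. col0 e = c}" for c using e2 by auto
  show ?thesis
    unfolding HES_colouring_def
  proof (rule exI[of _ col], intro conjI)
    show "\<forall>e\<in>edges G. col e \<in> Ty \<times> {..<t}" using e1 unfolding Col_def .
    show "\<forall>v\<in>V0. \<forall>c\<in>Ty \<times> {..<t}. card {e \<in> edges G. v \<in> e \<and> col e = c} = 2" using e3 unfolding Col_def .
    show "\<forall>a c. a \<notin> V0 \<longrightarrow> card {e \<in> edges G. a \<in> e \<and> col e = c} \<le> 1" by (rule e4)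
    show "\<forall>e\<in>edges G. snd (col e) < t - l \<longrightarrow> e \<subseteq> V0 \<union> A (fst (fst (col e))) \<union> B (snd (fst (col e)))"
    proof (intro ballI impI)
      fix e assume e: "e \<in> edges G" "snd (col e) < t - l"
      show "e \<subseteq> V0 \<union> A (fst (fst (col e))) \<union> B (snd (fst (col e)))"
      proof (cases "e \<in> cr")
        case True
        then have "fst (col e) = ty e" using c1 e2 e(2) unfolding t'_def by simp
        then show ?thesis using ty1 True unfolding permitted_def by auto
      next
        case False
        then obtain v a where v: "v \<in> V0" "a \<notin> V0" "e = {v, a}" using noncrossing_edge[of e] e(1) by blast
        have "a \<in> own_core v" using own_edge_core[OF v(1), of a] v(3) e(1) False by blast
        then obtain j where j: "j \<in> {1..K}" "a \<in> own v j" unfolding own_core_Union by blast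
        have "part a = j" using part_eq[OF _ j(1), of a] j(2) unfolding own_def by (auto split: if_splits)
        moreover have "dest v (col e) = Some (own_index v (fst (col e)))" using e(2) unfolding dest_def t'_def by simp
        ultimately have "own_index v (fst (col e)) = j" using e5 v e(1) False by auto
        then have "a \<in> A (fst (fst (col e))) \<union> B (snd (fst (col e)))"
          using j(2) unfolding own_def own_index_def by (auto split: if_splits)
        then show ?thesis using v by auto
      qed
    qed
    show "\<forall>c. real (card {e \<in> cr. col e = c}) \<le> q"
    proof
      fix c
      have "card {e \<in> cr. col e = c} \<le> 2 * M" using c5 unfolding ceq by blast
      then show "real (card {e \<in> cr. col e = c}) \<le> q" using M_r(1) by linarith
    qed
    show "\<forall>c\<in>Ty \<times> {..<l}. card {e \<in> cr. col e = c} = 2" using c6 unfolding ceq .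
    show "\<forall>c. \<forall>e\<in>{e \<in> cr. col e = c}. \<forall>g\<in>{e \<in> cr. col e = c}. e \<subseteq> V0 \<longrightarrow> g \<noteq> e \<longrightarrow> g \<inter> e = {}"
      using c7 unfolding ceq .
    show "\<forall>c\<in>Ty \<times> {..<t}. even (card (isolated {e \<in> cr. col e = c})) \<and> isolated {e \<in> cr. col e = c} \<noteq> {}" using c8 unfolding ceq .
  qed
qed

end

section \<open>Colour classes as Hamilton exceptional systems\<close>

lemma deg_eq_card_incident:
  assumes "\<And>e. e \<in> edges G \<Longrightarrow> card e = 2"
  shows "deg G v = card {e \<in> edges G. v \<in> e}"
proof -
  have "(\<lambda>u. {v, u}) ` nbrs G v = {e \<in> edges G. v \<in> e}"
  proof
    show "{e \<in> edges G. v \<in> e} \<subseteq> (\<lambda>u. {v, u}) ` nbrs G v"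
    proof
      fix e assume e: "e \<in> {e \<in> edges G. v \<in> e}"
      then obtain x y where "e = {x, y}" using assms by (metis (no_types, lifting) card_2_iff mem_Collect_eq)
      then obtain u where "e = {v, u}" using e by auto
      then show "e \<in> (\<lambda>u. {v, u}) ` nbrs G v" using e unfolding nbrs_def by auto
    qed
  qed (auto simp: nbrs_def)
  moreover have "inj_on (\<lambda>u. {v, u}) (nbrs G v)" by (auto simp: inj_on_def doubleton_eq_iff)
  ultimately show ?thesis unfolding deg_def by (metis card_image)
qed

lemma path_graph_edges_simps:
  "edges (path_graph [x]) = {}"
  "edges (path_graph (x # y # zs)) = insert {x, y} (edges (path_graph (y # zs)))"
  "verts (path_graph zs) = set zs"
proof -
  show "edges (path_graph (x # y # zs)) = insert {x, y} (edges (path_graph (y # zs)))"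
  proof (rule set_eqI)
    fix e
    have "e \<in> edges (path_graph (x # y # zs)) \<longleftrightarrow> (\<exists>i<Suc (length zs). e = {(x # y # zs) ! i, (x # y # zs) ! Suc i})"
      unfolding path_graph_def by auto
    also have "\<dots> \<longleftrightarrow> e = {x, y} \<or> (\<exists>i<length zs. e = {(y # zs) ! i, (y # zs) ! Suc i})"
      by (subst Ex_less_Suc2) simp
    also have "\<dots> \<longleftrightarrow> e \<in> insert {x, y} (edges (path_graph (y # zs)))"
      unfolding path_graph_def by auto
    finally show "e \<in> edges (path_graph (x # y # zs)) \<longleftrightarrow> e \<in> insert {x, y} (edges (path_graph (y # zs)))" .
  qed
qed (auto simp: path_graph_def)

lemma ugraph_eqI: "verts G = verts H \<Longrightarrow> edges G = edges H \<Longrightarrow> G = (H :: 'a ugraph)"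
  by (cases G; cases H) simp

lemma two_incident:
  assumes "\<And>e. e \<in> J \<Longrightarrow> card e = 2" "card {e \<in> J. v \<in> e} = 2"
  obtains x y where "{e \<in> J. v \<in> e} = {{v, x}, {v, y}}" "x \<noteq> y" "x \<noteq> v" "y \<noteq> v"
proof -
  obtain e f where ef: "{e \<in> J. v \<in> e} = {e, f}" "e \<noteq> f" using assms(2) by (metis card_2_iff)
  then have "e \<in> J" "v \<in> e" "f \<in> J" "v \<in> f" by auto
  have other: "\<exists>x. g = {v, x} \<and> x \<noteq> v" if "g \<in> J" "v \<in> g" for g
  proof -
    obtain a b where "g = {a, b}" "a \<noteq> b" using assms(1)[OF \<open>g \<in> J\<close>] by (metis card_2_iff)
    then show ?thesis using \<open>v \<in> g\<close> by auto
  qed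
  obtain x y where "e = {v, x}" "x \<noteq> v" "f = {v, y}" "y \<noteq> v"
    using other[OF \<open>e \<in> J\<close> \<open>v \<in> e\<close>] other[OF \<open>f \<in> J\<close> \<open>v \<in> f\<close>] by blast
  then show thesis using that ef by auto
qed

lemma two_incident':
  assumes "\<And>e. e \<in> J \<Longrightarrow> card e = 2" "card {e \<in> J. v \<in> e} = 2" "{v, x} \<in> J"
  obtains y where "{e \<in> J. v \<in> e} = {{v, x}, {v, y}}" "x \<noteq> y" "x \<noteq> v" "y \<noteq> v"
proof -
  obtain y z where yz: "{e \<in> J. v \<in> e} = {{v, y}, {v, z}}" "y \<noteq> z" "y \<noteq> v" "z \<noteq> v"
    using two_incident[OF assms(1,2)] by blast
  have "{v, x} \<in> {e \<in> J. v \<in> e}" using assms(3) by simp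
  then have "x = y \<or> x = z" unfolding yz using yz by (auto simp: doubleton_eq_iff)
  then show thesis
  proof
    assume "x = y" then show thesis using that[of z] yz by blast
  next
    assume "x = z" then show thesis using that[of y] yz by (simp add: insert_commute)
  qed
qed

text \<open>Let \<open>X\<close> be the set of crossing edges in \<open>J\<close>. The components of \<open>J\<close> are grown from kernels: an edge inside
  \<open>V\<^sub>0\<close>, an exceptional vertex without such an edge, or an edge without exceptional ends. Since crossing
  edges inside \<open>V\<^sub>0\<close> are isolated in \<open>X\<close>, adding all incident edges to a kernel gives a path with at most four
  vertices whose ends have degree 1. From an exceptional end of an isolated crossing edge, the path
  goes on to the core of the same side, so it joins \<open>A\<close> to \<open>B\<close>. The other kernels are exceptional
  vertices \<open>v\<close> with two crossing or two own edges, whose paths \<open>xvy\<close> start and end on the same side.\<close>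
lemma HES_of_colour_class:
  fixes A A0 B B0 :: "'a set" and J :: "'a set set"
  assumes disj: "A \<inter> A0 = {}" "B \<inter> B0 = {}" "(A0 \<union> A) \<inter> (B0 \<union> B) = {}"
    and finJ: "finite J"
    and kinds: "\<And>e. e \<in> J \<Longrightarrow> (\<exists>x\<in>A0 \<union> A. \<exists>y\<in>B0 \<union> B. e = {x, y}) \<or>
       (\<exists>v\<in>A0. \<exists>a\<in>A. e = {v, a}) \<or> (\<exists>v\<in>B0. \<exists>b\<in>B. e = {v, b})"
    and deg2: "\<And>v. v \<in> A0 \<union> B0 \<Longrightarrow> card {e \<in> J. v \<in> e} = 2"
    and deg1: "\<And>a. a \<notin> A0 \<union> B0 \<Longrightarrow> card {e \<in> J. a \<in> e} \<le> 1"
    and X: "X = {e \<in> J. e \<inter> (A0 \<union> A) \<noteq> {} \<and> e \<inter> (B0 \<union> B) \<noteq> {}}"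
    and inner: "\<And>e f. e \<in> X \<Longrightarrow> f \<in> X \<Longrightarrow> e \<subseteq> A0 \<union> B0 \<Longrightarrow> f \<noteq> e \<Longrightarrow> f \<inter> e = {}"
    and Iso0: "Iso = isolated X"
    and num: "even (card Iso)" "Iso \<noteq> {}" "real (card Iso) \<le> sqrt \<epsilon>0 * real (card (A \<union> A0 \<union> B \<union> B0))"
  shows "HES \<epsilon>0 A A0 B B0 \<lparr>verts = \<Union>J, edges = J\<rparr>"
proof -
  note Iso = Iso0[unfolded isolated_def]
  let ?V0 = "A0 \<union> B0" and ?G = "\<lparr>verts = \<Union>J, edges = J\<rparr>"
  have J2: "card e = 2" if eJ: "e \<in> J" for e
  proof -
    obtain x y where "e = {x, y}" "x \<noteq> y" using kinds[OF eJ] disj by blast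
    then show ?thesis by simp
  qed
  have fJe: "finite e" if "e \<in> J" for e using J2[OF that] by (simp add: card_ge_0_finite)
  have finU: "finite (\<Union>J)" using finJ fJe by (intro finite_Union)
  have JV: "e \<subseteq> A \<union> A0 \<union> B \<union> B0" if "e \<in> J" for e using kinds[OF that] by auto
  have uniq: "e = f" if "e \<in> J" "f \<in> J" "a \<in> e" "a \<in> f" "a \<notin> ?V0" for e f a
  proof (rule ccontr)
    assume "e \<noteq> f"
    then have "card {e, f} = 2" by simp
    moreover have "card {e, f} \<le> card {e \<in> J. a \<in> e}" using that finJ by (intro card_mono) auto
    ultimately show False using deg1[OF that(5)] by simp
  qed
  have V0V0: "e \<in> X" if "e \<in> J" "e \<subseteq> ?V0" for e
    using kinds[OF that(1)] that disj unfolding X by auto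
  have XJ: "X \<subseteq> J" unfolding X by auto
  have crossX: "\<exists>x\<in>A0 \<union> A. \<exists>y\<in>B0 \<union> B. e = {x, y}" if eX: "e \<in> X" for e
  proof -
    have e: "e \<in> J" "\<not> e \<subseteq> A0 \<union> A" "\<not> e \<subseteq> B0 \<union> B" using eX disj(3) unfolding X by blast+
    from kinds[OF e(1)] show ?thesis
    proof (elim disjE)
      assume "\<exists>v\<in>A0. \<exists>a\<in>A. e = {v, a}"
      then show ?thesis using e(2) by blast
    next
      assume "\<exists>v\<in>B0. \<exists>b\<in>B. e = {v, b}"
      then show ?thesis using e(3) by blast
    qed
  qed
  have nonX: "(x \<in> A0 \<longrightarrow> y \<in> A) \<and> (x \<in> B0 \<longrightarrow> y \<in> B)" if "{x, y} \<in> J" "{x, y} \<notin> X" "x \<in> ?V0" for x y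
    using kinds[OF that(1)] that disj unfolding X by (auto simp: doubleton_eq_iff)
  \<comment> \<open>The component grown from \<open>k\<close>, where \<open>k\<close> is an edge or a singleton.\<close>
  define Cm where "Cm k = {g \<in> J. g \<inter> k \<noteq> {}}" for k
  define Pk where "Pk k = \<lparr>verts = \<Union>(Cm k), edges = Cm k\<rparr>" for k
  have Cm_Un: "Cm {x, y} = {e \<in> J. x \<in> e} \<union> {e \<in> J. y \<in> e}" "Cm {x} = {e \<in> J. x \<in> e}" for x y
    unfolding Cm_def by auto
  have Pk_path: "Pk k = path_graph xs" if Cmk: "Cm k = edges (path_graph xs)" and len: "length xs \<ge> 2" for k xs
  proof (rule ugraph_eqI)
    have "\<Union>(edges (path_graph xs)) = set xs" if "length xs \<ge> 2" for xs :: "'a list"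
      using that
    proof (induction xs rule: induct_list012)
      case (3 x y zs)
      then show ?case by (cases zs) (auto simp: path_graph_edges_simps)
    qed auto
    then show "verts (Pk k) = verts (path_graph xs)"
      using Cmk len unfolding Pk_def by (simp add: path_graph_edges_simps)
  qed (use Cmk in \<open>simp add: Pk_def\<close>)
  have end1: "{e \<in> J. a \<in> e} = {e}" if "e \<in> J" "a \<in> e" "a \<notin> ?V0" for a e
    using uniq that by blast

  \<comment> \<open>The three sorts of kernels. \<open>K1\<close> and \<open>K2\<close> say that an edge touching a kernel has no exceptional end
    outside it, and that different kernels are disjoint, whence different components are disjoint.\<close>
  define Ker where "Ker = {e \<in> J. e \<subseteq> ?V0} \<union> {{v} | v. v \<in> ?V0 \<and> (\<forall>e\<in>J. v \<in> e \<longrightarrow> \<not> e \<subseteq> ?V0)}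
     \<union> {e \<in> J. e \<inter> ?V0 = {}}"
  have K1: "g \<inter> ?V0 \<subseteq> k \<and> (g \<inter> ?V0 = {} \<longrightarrow> g = k)" if k: "k \<in> Ker" and g: "g \<in> J" "g \<inter> k \<noteq> {}" for k g
  proof -
    from k consider "k \<in> J" "k \<subseteq> ?V0" | v where "k = {v}" "v \<in> ?V0" "\<forall>e\<in>J. v \<in> e \<longrightarrow> \<not> e \<subseteq> ?V0"
      | "k \<in> J" "k \<inter> ?V0 = {}" unfolding Ker_def by blast
    then show ?thesis
    proof cases
      case 1
      show ?thesis
      proof (cases "g = k")
        case True
        then show ?thesis using 1 g by auto
      next
        case False
        have "\<not> g \<subseteq> ?V0" using inner[OF V0V0[OF 1] V0V0[OF g(1)] 1(2) False] g(2) by blast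
        moreover obtain x y where "g = {x, y}" using J2[OF g(1)] by (metis card_2_iff)
        ultimately show ?thesis using g(2) 1(2) by auto
      qed
    next
      case 2
      have vg: "v \<in> g" using g(2) 2(1) by blast
      obtain z where z: "g = {v, z}" using J2[OF g(1)] vg by (metis card_2_iff empty_iff insertE insert_commute)
      have "z \<notin> ?V0" using 2(2,3) g(1) vg z by blast
      then show ?thesis using 2(1,2) z by blast
    next
      case 3
      then obtain z where "z \<in> g" "z \<in> k" "z \<notin> ?V0" using g by blast
      then have "g = k" using uniq[OF g(1) 3(1)] by blast
      then show ?thesis using 3 by auto
    qed
  qed
  have K2: "k = k'" if "k \<in> Ker" "k' \<in> Ker" "k \<inter> k' \<noteq> {}" for k k'
  proof (cases "k \<in> J")
    case True
    have a: "k \<inter> ?V0 \<subseteq> k' \<and> (k \<inter> ?V0 = {} \<longrightarrow> k = k')" using K1[OF that(2) True] that(3) by blast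
    show ?thesis
    proof (cases "k' \<in> J")
      case True
      then show ?thesis using K1[OF that(1) True] that a \<open>k \<in> J\<close> unfolding Ker_def by blast
    next
      case False
      then show ?thesis using that a True unfolding Ker_def by auto
    qed
  next
    case False
    then show ?thesis using K1[OF that(1), of k'] that unfolding Ker_def by auto
  qed
  have comp_disj: "verts (Pk k) \<inter> verts (Pk k') = {}" if kk: "k \<in> Ker" "k' \<in> Ker" "k \<noteq> k'" for k k'
  proof (rule ccontr)
    assume "verts (Pk k) \<inter> verts (Pk k') \<noteq> {}"
    then obtain g g' z where g: "g \<in> J" "g \<inter> k \<noteq> {}" "g' \<in> J" "g' \<inter> k' \<noteq> {}" "z \<in> g" "z \<in> g'"
      unfolding Pk_def Cm_def by auto
    show False
    proof (cases "z \<in> ?V0")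
      case True
      then have "z \<in> k \<inter> k'" using K1[OF kk(1) g(1,2)] K1[OF kk(2) g(3,4)] g by blast
      then show False using K2 kk by blast
    next
      case False
      then have "g = g'" using uniq g by blast
      then show False using K1[OF kk(1) g(1,2)] K1[OF kk(2) g(3,4)] K2[OF kk(1,2)] kk(3) by blast
    qed
  qed
  have star_end: "\<exists>a. {e \<in> J. u \<in> e} = {{u, w}, {u, a}} \<and> a \<noteq> w \<and> a \<noteq> u \<and> {u, a} \<notin> X"
    if uwX: "{u, w} \<in> X" and uV: "u \<in> ?V0" and iso: "\<forall>f\<in>X. f \<noteq> {u, w} \<longrightarrow> f \<inter> {u, w} = {}" for u w
  proof -
    have uw: "{u, w} \<in> J" using uwX XJ by auto
    obtain a where a: "{e \<in> J. u \<in> e} = {{u, w}, {u, a}}" "w \<noteq> a" "w \<noteq> u" "a \<noteq> u"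
      using two_incident'[OF J2 deg2[OF uV] uw] by blast
    have "{u, a} \<noteq> {u, w}" using a(2-4) by (auto simp: doubleton_eq_iff)
    then have "{u, a} \<notin> X" using bspec[OF iso, of "{u, a}"] by auto
    then show ?thesis using a(1) a(2)[symmetric] a(4) by blast
  qed
  have comp_path: "is_path (Pk k)" if k: "k \<in> Ker" for k
  proof -
    from k consider "k \<in> J" "k \<subseteq> ?V0" | v where "k = {v}" "v \<in> ?V0" "\<forall>e\<in>J. v \<in> e \<longrightarrow> \<not> e \<subseteq> ?V0"
      | "k \<in> J" "k \<inter> ?V0 = {}" unfolding Ker_def by blast
    then show ?thesis
    proof cases
      case 1
      have kX: "k \<in> X" using V0V0 1 by blast
      obtain u w where uw: "k = {u, w}" "u \<in> A0 \<union> A" "w \<in> B0 \<union> B"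
        using crossX[OF kX] by blast
      have uw0: "u \<in> A0" "w \<in> B0" "u \<in> ?V0" "w \<in> ?V0" using 1(2) uw disj by blast+
      have iso: "\<forall>f\<in>X. f \<noteq> {u, w} \<longrightarrow> f \<inter> {u, w} = {}" using inner[OF kX _ 1(2)] uw by blast
      obtain a where a: "{e \<in> J. u \<in> e} = {{u, w}, {u, a}}" "a \<noteq> w" "a \<noteq> u" "{u, a} \<notin> X"
        using star_end[OF _ uw0(3) iso] kX uw by blast
      obtain b where b: "{e \<in> J. w \<in> e} = {{w, u}, {w, b}}" "b \<noteq> u" "b \<noteq> w" "{w, b} \<notin> X"
      proof -
        have "{w, u} \<in> X" using kX uw(1) by (simp add: insert_commute)
        moreover have "\<forall>f\<in>X. f \<noteq> {w, u} \<longrightarrow> f \<inter> {w, u} = {}"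
          using iso unfolding insert_commute[of w u] .
        ultimately show thesis using star_end[OF _ uw0(4)] that by blast
      qed
      have ab: "{u, a} \<in> J" "{w, b} \<in> J" using a(1) b(1) by blast+
      have aA: "a \<in> A" using nonX[OF ab(1) a(4) uw0(3)] uw0(1) by blast
      have bB: "b \<in> B" using nonX[OF ab(2) b(4) uw0(4)] uw0(2) by blast
      have "a \<noteq> b" using aA bB disj by auto
      have "Pk k = path_graph [a, u, w, b]"
      proof (rule Pk_path)
        show "Cm k = edges (path_graph [a, u, w, b])"
          unfolding uw(1) Cm_Un a(1) b(1) path_graph_edges_simps by (auto simp: insert_commute)
      qed simp
      moreover have "distinct [a, u, w, b]" using a(2,3) b(2,3) \<open>a \<noteq> b\<close> uw0(1,2) disj by auto
      ultimately show ?thesis unfolding is_path_def by blast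
    next
      case 2
      obtain x y where xy: "{e \<in> J. v \<in> e} = {{v, x}, {v, y}}" "x \<noteq> y" "x \<noteq> v" "y \<noteq> v"
        using two_incident[OF J2 deg2[OF 2(2)]] by blast
      have "Pk k = path_graph [x, v, y]"
      proof (rule Pk_path)
        show "Cm k = edges (path_graph [x, v, y])"
          unfolding 2(1) Cm_Un xy(1) path_graph_edges_simps by (auto simp: insert_commute)
      qed simp
      moreover have "distinct [x, v, y]" using xy(2-4) by auto
      ultimately show ?thesis unfolding is_path_def by blast
    next
      case 3
      obtain x y where xy: "k = {x, y}" "x \<noteq> y" using J2[OF 3(1)] by (metis card_2_iff)
      have st: "{e \<in> J. x \<in> e} = {k}" "{e \<in> J. y \<in> e} = {k}"
        using end1[OF 3(1), of x] end1[OF 3(1), of y] xy(1) 3(2) by blast+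
      have "Pk k = path_graph [x, y]"
      proof (rule Pk_path)
        have "Cm k = Cm {x, y}" using xy(1) by simp
        then show "Cm k = edges (path_graph [x, y])"
          unfolding Cm_Un st path_graph_edges_simps using xy(1) by simp
      qed simp
      moreover have "distinct [x, y]" using xy by auto
      ultimately show ?thesis unfolding is_path_def by blast
    qed
  qed
  have cover: "\<exists>k\<in>Ker. e \<in> Cm k" if "e \<in> J" for e
  proof (cases "e \<inter> ?V0 = {}")
    case True
    then have "e \<in> Ker" using that unfolding Ker_def by auto
    moreover have "e \<in> Cm e" using that J2[OF that] unfolding Cm_def by auto
    ultimately show ?thesis by blast
  next
    case False
    then obtain v where v: "v \<in> e" "v \<in> ?V0" by blast
    show ?thesis
    proof (cases "\<exists>f\<in>J. v \<in> f \<and> f \<subseteq> ?V0")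
      case True
      then obtain f where f: "f \<in> J" "v \<in> f" "f \<subseteq> ?V0" by blast
      then have "f \<in> Ker" unfolding Ker_def by auto
      moreover have "e \<in> Cm f" using that f v unfolding Cm_def by auto
      ultimately show ?thesis by blast
    next
      case False
      then have "{v} \<in> Ker" using v unfolding Ker_def by auto
      moreover have "e \<in> Cm {v}" using that v unfolding Cm_def by auto
      ultimately show ?thesis by blast
    qed
  qed
  have UJ: "J = (\<Union>k\<in>Ker. Cm k)" using cover unfolding Cm_def by blast
  have finKer: "finite Ker"
  proof -
    have "k \<subseteq> \<Union>J" if "k \<in> Ker" for k
    proof -
      have "v \<in> \<Union>J" if "v \<in> ?V0" for v
        using deg2[OF that] by (metis (no_types, lifting) UnionI card.empty empty_Collect_eq zero_neq_numeral)
      then show ?thesis using that unfolding Ker_def by auto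
    qed
    then have "Ker \<subseteq> Pow (\<Union>J)" by auto
    then show ?thesis using finite_subset finU by blast
  qed
  have ps: "path_system ?G"
    unfolding path_system_def
  proof (intro exI[of _ "Pk ` Ker"] conjI)
    show "disjoint_family_on verts (Pk ` Ker)"
      unfolding disjoint_family_on_def using comp_disj by blast
    show "\<forall>P\<in>Pk ` Ker. is_path P" using comp_path by blast
    have "(\<Union>P\<in>Pk ` Ker. edges P) = J" using UJ unfolding Pk_def by simp
    then show "edges ?G = (\<Union>P\<in>Pk ` Ker. edges P)" by simp
    have "(\<Union>P\<in>Pk ` Ker. verts P) = \<Union>(\<Union>k\<in>Ker. Cm k)" unfolding Pk_def by auto
    then show "verts ?G = (\<Union>P\<in>Pk ` Ker. verts P)" using UJ by simp
  qed (use finKer in simp)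

  \<comment> \<open>At an end \<open>x\<close> of an isolated crossing edge, the component stops or continues by one edge to the
    core of the same side. Formulated for both sides at once: \<open>(S, S0)\<close> is \<open>(A, A0)\<close> or \<open>(B, B0)\<close>.\<close>
  have endA: "\<exists>as. (\<forall>z\<in>set as. z \<in> S) \<and> distinct as \<and> hd (as @ [x]) \<in> S \<and> x \<notin> set as
      \<and> {f \<in> J. x \<in> f} = insert e (edges (path_graph (as @ [x])))"
    if e: "e \<in> Iso" "e = {x, y}" and S: "x \<in> S \<or> x \<in> S0" "(S = A \<and> S0 = A0) \<or> (S = B \<and> S0 = B0)" for e x y S S0
  proof (cases "x \<in> S0")
    case True
    then have xV: "x \<in> ?V0" using S by auto
    have eX: "{x, y} \<in> X" "\<forall>f\<in>X. f \<noteq> {x, y} \<longrightarrow> f \<inter> {x, y} = {}" using e unfolding Iso by auto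
    obtain a where a: "{f \<in> J. x \<in> f} = {{x, y}, {x, a}}" "a \<noteq> y" "a \<noteq> x" "{x, a} \<notin> X"
      using star_end[OF eX(1) xV eX(2)] by blast
    have xa: "{x, a} \<in> J" using a(1) by blast
    have aS: "a \<in> S" using nonX[OF xa a(4) xV] True S(2) disj by blast
    have "insert e (edges (path_graph ([a] @ [x]))) = {{x, y}, {x, a}}"
      unfolding e(2) append.simps path_graph_edges_simps by (simp add: insert_commute)
    then show ?thesis using a(1,3) aS by (intro exI[of _ "[a]"]) simp
  next
    case False
    then have xS: "x \<in> S" "x \<notin> ?V0" using S disj by auto
    have "e \<in> J" using e XJ unfolding Iso by auto
    then have "{f \<in> J. x \<in> f} = {e}" using end1 xS(2) e(2) by blast
    then show ?thesis using xS(1) by (intro exI[of _ "[]"]) (simp add: path_graph_edges_simps)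
  qed
  have path_app: "edges (path_graph (xs @ [x] @ y # ys)) =
     edges (path_graph (xs @ [x])) \<union> {{x, y}} \<union> edges (path_graph (y # ys))" for xs x y and ys :: "'a list"
  proof (induction xs)
    case Nil
    then show ?case by (simp add: path_graph_edges_simps)
  next
    case (Cons z xs)
    then show ?case by (cases xs) (auto simp: path_graph_edges_simps)
  qed
  have AB1: "Pk e \<in> AB_paths A B ?G" if e: "e \<in> Iso" for e
  proof -
    have eJ: "e \<in> J" using e XJ unfolding Iso by auto
    have "e \<in> X" using e unfolding Iso by simp
    then obtain x y where xy: "e = {x, y}" "x \<in> A0 \<union> A" "y \<in> B0 \<union> B"
      using crossX by blast
    obtain as where as: "\<forall>z\<in>set as. z \<in> A" "distinct as" "hd (as @ [x]) \<in> A" "x \<notin> set as"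
        "{f \<in> J. x \<in> f} = insert e (edges (path_graph (as @ [x])))"
      using endA[OF e xy(1), of A A0] xy by auto
    have yx: "e = {y, x}" using xy by auto
    obtain bs where bs: "\<forall>z\<in>set bs. z \<in> B" "distinct bs" "hd (bs @ [y]) \<in> B" "y \<notin> set bs"
        "{f \<in> J. y \<in> f} = insert e (edges (path_graph (bs @ [y])))"
      using endA[OF e yx, of B B0] xy by auto
    have rev: "edges (path_graph (bs @ [y])) = edges (path_graph (y # rev bs))"
    proof -
      have gen: "edges (path_graph (rev zs)) = edges (path_graph zs)" for zs :: "'a list"
      proof (induction zs rule: induct_list012)
        case (3 u v zs)
        have "edges (path_graph (rev (u # v # zs))) = edges (path_graph (rev zs @ [v] @ [u]))" by simp
        also have "\<dots> = edges (path_graph (rev zs @ [v])) \<union> {{v, u}}"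
          using path_app[of "rev zs" v u "[]"] by (simp add: path_graph_edges_simps)
        also have "\<dots> = edges (path_graph (u # v # zs))"
          using 3 by (auto simp: path_graph_edges_simps insert_commute)
        finally show ?case .
      qed auto
      show ?thesis using gen[of "bs @ [y]"] by simp
    qed
    let ?xs = "as @ [x] @ y # rev bs"
    have "Cm e = Cm {x, y}" using xy(1) by simp
    also have "\<dots> = edges (path_graph ?xs)"
      unfolding path_app rev[symmetric] Cm_Un(1)[of x y] as(5) bs(5) xy(1) by auto
    finally have P: "Pk e = path_graph ?xs" by (intro Pk_path) auto
    have "x \<noteq> y" "x \<notin> set bs" "y \<notin> set as" "set as \<inter> set bs = {}"
      using as(1) bs(1) xy(2,3) disj by blast+
    then have "distinct ?xs" using as(2,4) bs(2,4) by auto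
    moreover have "hd ?xs \<in> A" using as(3) by (cases as) auto
    moreover have "last ?xs \<in> B" using bs(3) by (cases bs) (auto simp: last_rev)
    moreover have "subgraph (Pk e) ?G"
    proof -
      have CJ: "Cm e \<subseteq> J" unfolding Cm_def by auto
      then have "\<Union>(Cm e) \<subseteq> \<Union>J" by auto
      moreover from this have "finite (\<Union>(Cm e))" using finU finite_subset by blast
      ultimately show ?thesis using CJ J2 unfolding subgraph_def Pk_def simple_graph_def by auto
    qed
    ultimately show ?thesis unfolding AB_paths_def using P by blast
  qed
  \<comment> \<open>Inner vertices of a path have degree 2 and so lie in \<open>V\<^sub>0\<close>. Three consecutive ones would give two
    adjacent crossing edges inside \<open>V\<^sub>0\<close>. So an \<open>AB\<close>-path has at most four vertices, and it is the component
    of its crossing edge.\<close>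
  have AB2: "\<exists>e\<in>Iso. P = Pk e" if P: "P \<in> AB_paths A B ?G" for P
  proof -
    obtain xs where xs: "xs \<noteq> []" "distinct xs" "P = path_graph xs" "hd xs \<in> A" "last xs \<in> B"
      and sub: "edges (path_graph xs) \<subseteq> J" using P unfolding AB_paths_def subgraph_def by auto
    have mid: "v \<in> ?V0 \<and> {e \<in> J. v \<in> e} = {{x, v}, {v, y}}" if "{x, v} \<in> J" "{v, y} \<in> J" "x \<noteq> y" for x v y
    proof -
      have "{x, v} \<noteq> {v, y}" using that by (auto simp: doubleton_eq_iff)
      then have V: "v \<in> ?V0" using uniq[OF that(1,2), of v] by auto
      have "{{x, v}, {v, y}} \<subseteq> {e \<in> J. v \<in> e}" using that by auto
      moreover have "card {{x, v}, {v, y}} = 2" using \<open>{x, v} \<noteq> {v, y}\<close> by simp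
      ultimately have "{{x, v}, {v, y}} = {e \<in> J. v \<in> e}"
        using deg2[OF V] finJ by (intro card_subset_eq) auto
      then show ?thesis using V by simp
    qed
    have core: "x \<notin> ?V0" if "x \<in> A \<or> x \<in> B" for x using that disj by auto
    from xs(1) consider a where "xs = [a]" | a b where "xs = [a, b]" | a v b where "xs = [a, v, b]"
      | a u w b where "xs = [a, u, w, b]" | x0 x1 x2 x3 x4 zs where "xs = x0 # x1 # x2 # x3 # x4 # zs"
      by (metis neq_Nil_conv)
    then show ?thesis
    proof cases
      case 1
      then show ?thesis using xs disj by auto
    next
      case 2
      let ?e = "{a, b}"
      have e: "?e \<in> J" "a \<in> A" "b \<in> B" using 2 sub xs by (auto simp: path_graph_edges_simps)
      have ea: "{e \<in> J. a \<in> e} = {?e}" "{e \<in> J. b \<in> e} = {?e}" using end1[OF e(1)] core e(2,3) by simp_all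
      have "?e \<in> X" using e unfolding X by auto
      then have "?e \<in> Iso" using ea XJ unfolding Iso by blast
      moreover have "Pk ?e = path_graph [a, b]"
        by (rule Pk_path, unfold Cm_Un ea path_graph_edges_simps) (auto simp: insert_commute)
      ultimately show ?thesis using 2 xs(3) by metis
    next
      case 3
      have e: "{a, v} \<in> J" "{v, b} \<in> J" "a \<in> A" "b \<in> B" "a \<noteq> b"
        using 3 sub xs by (auto simp: path_graph_edges_simps)
      have v: "v \<in> ?V0" "{e \<in> J. v \<in> e} = {{a, v}, {v, b}}" using mid[OF e(1,2,5)] by blast+
      have ea: "{e \<in> J. a \<in> e} = {{a, v}}" "{e \<in> J. b \<in> e} = {{v, b}}"
        using end1[OF e(1), of a] end1[OF e(2), of b] core e(3,4) by simp_all
      show ?thesis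
      proof (cases "v \<in> A0")
        case True
        have n: "{a, v} \<notin> X" using True e disj unfolding X by auto
        have "{v, b} \<in> X" using True e unfolding X by auto
        moreover have "f = {v, b}" if "f \<in> X" "f \<inter> {v, b} \<noteq> {}" for f
        proof -
          have "f \<in> {e \<in> J. v \<in> e} \<union> {e \<in> J. b \<in> e}" using that XJ by auto
          then show ?thesis unfolding v(2) ea(2) using n that(1) by auto
        qed
        ultimately have "{v, b} \<in> Iso" unfolding Iso by blast
        moreover have "Pk {v, b} = path_graph [a, v, b]"
          by (rule Pk_path, unfold Cm_Un v(2) ea path_graph_edges_simps) (auto simp: insert_commute)
        ultimately show ?thesis using 3 xs(3) by metis
      next
        case False
        then have vB: "v \<in> B0" using v by auto
        have n: "{v, b} \<notin> X" using vB e disj unfolding X by auto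
        have "{a, v} \<in> X" using vB e unfolding X by auto
        moreover have "f = {a, v}" if "f \<in> X" "f \<inter> {a, v} \<noteq> {}" for f
        proof -
          have "f \<in> {e \<in> J. v \<in> e} \<union> {e \<in> J. a \<in> e}" using that XJ by auto
          then show ?thesis unfolding v(2) ea(1) using n that(1) by auto
        qed
        ultimately have "{a, v} \<in> Iso" unfolding Iso by blast
        moreover have "Pk {a, v} = path_graph [a, v, b]"
          by (rule Pk_path, unfold Cm_Un v(2) ea path_graph_edges_simps) (auto simp: insert_commute)
        ultimately show ?thesis using 3 xs(3) by metis
      qed
    next
      case 4
      have e: "{a, u} \<in> J" "{u, w} \<in> J" "{w, b} \<in> J" "a \<noteq> w" "u \<noteq> b"
        using 4 sub xs by (auto simp: path_graph_edges_simps)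
      have u: "u \<in> ?V0" "{e \<in> J. u \<in> e} = {{a, u}, {u, w}}" using mid[OF e(1,2,4)] by blast+
      have w: "w \<in> ?V0" "{e \<in> J. w \<in> e} = {{u, w}, {w, b}}" using mid[OF e(2,3,5)] by blast+
      have X': "{u, w} \<in> X" using V0V0[OF e(2)] u w by auto
      have "{u, w} \<in> Iso" using inner[OF X'] X' u(1) w(1) unfolding Iso by blast
      moreover have "Pk {u, w} = path_graph [a, u, w, b]"
        by (rule Pk_path, unfold Cm_Un u(2) w(2) path_graph_edges_simps) (auto simp: insert_commute)
      ultimately show ?thesis using 4 xs(3) by metis
    next
      case 5
      have e: "{x0, x1} \<in> J" "{x1, x2} \<in> J" "{x2, x3} \<in> J" "{x3, x4} \<in> J"
        and d: "x0 \<noteq> x2" "x1 \<noteq> x3" "x2 \<noteq> x4"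
        using 5 sub xs by (auto simp: path_graph_edges_simps)
      have "x1 \<in> ?V0" "x2 \<in> ?V0" "x3 \<in> ?V0" using mid[OF e(1,2) d(1)] mid[OF e(2,3) d(2)] mid[OF e(3,4) d(3)] by blast+
      then have "{x1, x2} \<in> X" "{x2, x3} \<in> X" "{x1, x2} \<subseteq> ?V0" using V0V0 e by auto
      moreover have "{x2, x3} \<noteq> {x1, x2}" using d by (auto simp: doubleton_eq_iff)
      ultimately show ?thesis using inner[of "{x1, x2}" "{x2, x3}"] by auto
    qed
  qed
  have inj: "inj_on Pk Iso"
  proof (rule inj_onI)
    fix e f assume ef: "e \<in> Iso" "f \<in> Iso" "Pk e = Pk f"
    have "f \<in> J" using ef XJ unfolding Iso by auto
    then have "f \<in> Cm f" using J2[of f] unfolding Cm_def by auto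
    then have "f \<in> Cm e" using ef(3) unfolding Pk_def by simp
    then have "f \<inter> e \<noteq> {}" unfolding Cm_def by auto
    then show "e = f" using ef unfolding Iso by blast
  qed
  have "AB_paths A B ?G = Pk ` Iso" using AB1 AB2 by blast
  then have cAB: "card (AB_paths A B ?G) = card Iso" using inj by (simp add: card_image)
  have finIso: "finite Iso" using finJ unfolding Iso X by simp
  have dG: "deg ?G v = card {e \<in> J. v \<in> e}" for v using deg_eq_card_incident[of ?G v] J2 by simp
  have "exceptional_cover A A0 B B0 ?G"
    unfolding exceptional_cover_def
  proof (intro conjI)
    show "path_system ?G" by (rule ps)
    show "A0 \<union> B0 \<subseteq> verts ?G"
    proof
      fix v assume "v \<in> A0 \<union> B0"
      then have "card {e \<in> J. v \<in> e} \<noteq> 0" using deg2 by simp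
      then have "{e \<in> J. v \<in> e} \<noteq> {}" by (metis card.empty)
      then show "v \<in> verts ?G" by auto
    qed
    show "verts ?G \<subseteq> A \<union> A0 \<union> B \<union> B0" using JV by auto
    have "edges_within ?G A = {}" "edges_within ?G B = {}"
      using kinds disj unfolding edges_within_def by fastforce+
    then show "e_within ?G A = 0" "e_within ?G B = 0" unfolding e_within_def by simp_all
  qed (use dG deg2 deg1 in auto)
  then show ?thesis
    unfolding HES_def cAB using num finIso by (auto simp: card_gt_0_iff)
qed

section \<open>The family of Hamilton exceptional systems\<close>

context partitioned_graph
begin

lemma HES_family:
  fixes col :: "'a set \<Rightarrow> (nat \<times> nat) \<times> nat"
  assumes col: "HES_colouring t l (sqrt \<epsilon>0 * card (verts G)) col"
    and vs: "verts G = side K A \<union> side K B" and lt: "l \<le> t - l"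
  shows "\<exists>\<J>. finite \<J> \<and> card \<J> = K ^ 2 * t \<and>
     (\<forall>J\<in>\<J>. subgraph J G \<and> HES \<epsilon>0 (core K A) (A 0) (core K B) (B 0) J) \<and>
     disjoint_family_on edges \<J> \<and> (\<Union>J\<in>\<J>. edges J) = edges G \<and>
     (\<forall>i\<in>{1..K}. \<forall>i'\<in>{1..K}. \<exists>S \<subseteq> {J \<in> \<J>. local_HES \<epsilon>0 K A B i i' J}. card S = t - l \<and>
        (\<exists>T \<subseteq> S. card T = l \<and> (\<forall>J\<in>T. e_between J (side K A) (side K B) = 2)))"
proof -
  note cs = col[unfolded HES_colouring_def]
  note c1 = cs[THEN conjunct1] and c2 = cs[THEN conjunct2, THEN conjunct1]
    and cs3 = cs[THEN conjunct2, THEN conjunct2]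
  note c3 = cs3[THEN conjunct1] and c4 = cs3[THEN conjunct2, THEN conjunct1]
    and cs5 = cs3[THEN conjunct2, THEN conjunct2]
  note c5 = cs5[THEN conjunct1] and c6 = cs5[THEN conjunct2, THEN conjunct1]
    and cs7 = cs5[THEN conjunct2, THEN conjunct2]
  note c7 = cs7[THEN conjunct1] and c8 = cs7[THEN conjunct2]
  define E where "E c = {e \<in> edges G. col e = c}" for c
  define J where "J c = \<lparr>verts = \<Union>(E c), edges = E c\<rparr>" for c
  define Col where "Col = Ty \<times> {..<t}"
  have eJ: "edges (J c) = E c" "verts (J c) = \<Union>(E c)" for c unfolding J_def by simp_all
  have EG: "E c \<subseteq> edges G" for c unfolding E_def by auto
  have finEc: "finite (E c)" for c using EG finE finite_subset by blast
  have crE: "cr \<subseteq> edges G" unfolding edges_between_def by auto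
  have Fc: "edges_between (J c) (side K A) (side K B) = {e \<in> cr. col e = c}" for c
    unfolding edges_between_def eJ E_def by auto
  have sA: "A 0 \<union> core K A = side K A" "B 0 \<union> core K B = side K B" unfolding side_def by auto
  have coreV: "x \<notin> V0" if "x \<in> core K A \<or> x \<in> core K B" for x
    using that core_not_V0 unfolding core_def by blast
  have Eun: "core K A \<union> A 0 \<union> core K B \<union> B 0 = verts G" unfolding vs side_def by auto
  have vG: "\<Union>(E c) \<subseteq> verts G" for c using EG simple unfolding simple_graph_def by blast
  have finV: "finite (verts G)" using simple unfolding simple_graph_def by simp
  have nonempty: "{e \<in> cr. col e = c} \<noteq> {}" if "c \<in> Col" for c
  proof -
    let ?I = "isolated {e \<in> cr. col e = c}"
    have "?I \<noteq> {}" using bspec[OF c8, of c] that unfolding Col_def by blast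
    then show ?thesis unfolding isolated_def by blast
  qed
  have sub: "subgraph (J c) G" for c
  proof -
    have "finite (\<Union>(E c))" using vG finV finite_subset by blast
    then show ?thesis unfolding subgraph_def simple_graph_def eJ using vG EG edge_card by blast
  qed
  have hes: "HES \<epsilon>0 (core K A) (A 0) (core K B) (B 0) (J c)" if c: "c \<in> Col" for c
    unfolding J_def
  proof (rule HES_of_colour_class)
    let ?I = "isolated {e \<in> cr. col e = c}"
    show "core K A \<inter> A 0 = {}" "core K B \<inter> B 0 = {}" using coreV by blast+
    show "(A 0 \<union> core K A) \<inter> (B 0 \<union> core K B) = {}" unfolding sA by (rule AB)
    show "finite (E c)" by (rule finEc)
    show "(\<exists>x\<in>A 0 \<union> core K A. \<exists>y\<in>B 0 \<union> core K B. e = {x, y}) \<or>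
      (\<exists>v\<in>A 0. \<exists>a\<in>core K A. e = {v, a}) \<or> (\<exists>v\<in>B 0. \<exists>b\<in>core K B. e = {v, b})" if "e \<in> E c" for e
      unfolding sA using kinds[of e] that EG by blast
    show "card {e \<in> E c. v \<in> e} = 2" if "v \<in> A 0 \<union> B 0" for v
    proof -
      have eq: "{e \<in> E c. v \<in> e} = {e \<in> edges G. v \<in> e \<and> col e = c}" unfolding E_def by auto
      show ?thesis unfolding eq using c2 that c unfolding Col_def by blast
    qed
    show "card {e \<in> E c. a \<in> e} \<le> 1" if "a \<notin> A 0 \<union> B 0" for a
    proof -
      have eq: "{e \<in> E c. a \<in> e} = {e \<in> edges G. a \<in> e \<and> col e = c}" unfolding E_def by auto
      show ?thesis unfolding eq using c3 that by blast
    qed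
    show "{e \<in> cr. col e = c} = {e \<in> E c. e \<inter> (A 0 \<union> core K A) \<noteq> {} \<and> e \<inter> (B 0 \<union> core K B) \<noteq> {}}"
    proof -
      have "e \<in> cr \<longleftrightarrow> e \<inter> side K A \<noteq> {} \<and> e \<inter> side K B \<noteq> {}" if e: "e \<in> edges G" for e
      proof
        assume "e \<in> cr"
        then show "e \<inter> side K A \<noteq> {} \<and> e \<inter> side K B \<noteq> {}" unfolding edges_between_def by auto
      next
        assume "e \<inter> side K A \<noteq> {} \<and> e \<inter> side K B \<noteq> {}"
        then obtain x y where xy: "x \<in> e" "y \<in> e" "x \<in> side K A" "y \<in> side K B" by blast
        then have "x \<noteq> y" using AB by blast
        moreover obtain u w where "e = {u, w}" using edge_card[OF e] by (metis card_2_iff)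
        ultimately have "e = {x, y}" using xy by auto
        then show "e \<in> cr" using xy e unfolding edges_between_def by blast
      qed
      then show ?thesis unfolding sA E_def using crE by blast
    qed
    show "f \<inter> e = {}" if "e \<in> {e \<in> cr. col e = c}" "f \<in> {e \<in> cr. col e = c}" "e \<subseteq> A 0 \<union> B 0" "f \<noteq> e" for e f
      using spec[OF c7, of c] that by blast
    show "?I = ?I" ..
    have c8': "even (card ?I) \<and> ?I \<noteq> {}" using bspec[OF c8, of c] c unfolding Col_def by blast
    show "even (card ?I)" using c8' by (rule conjunct1)
    show "?I \<noteq> {}" using c8' by (rule conjunct2)
    have "card ?I \<le> card {e \<in> cr. col e = c}"
      using fin_cr by (intro card_mono) (auto simp: isolated_def)
    then show "real (card ?I) \<le> sqrt \<epsilon>0 * real (card (core K A \<union> A 0 \<union> core K B \<union> B 0))"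
      unfolding Eun using spec[OF c5, of c] by linarith
  qed
  have Edisj: "E c \<inter> E d = {}" if "c \<noteq> d" for c d using that unfolding E_def by auto
  \<comment> \<open>Colour classes are not empty, so different colours give different graphs.\<close>
  have injJ: "inj_on J Col"
  proof (rule inj_onI)
    fix c d assume cd: "c \<in> Col" "d \<in> Col" "J c = J d"
    then have "E c = E d" using eJ by metis
    moreover have "E c \<noteq> {}" using nonempty[OF cd(1)] crE unfolding E_def by blast
    ultimately show "c = d" using Edisj[of c d] by blast
  qed
  have cCol: "card Col = K ^ 2 * t" unfolding Col_def card_cartesian_product[of Ty] card_Ty by simp
  have finCol: "finite Col" unfolding Col_def by simp
  show ?thesis
  proof (rule exI[of _ "J ` Col"], intro conjI ballI)
    show "finite (J ` Col)" using finCol by simp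
    show "card (J ` Col) = K ^ 2 * t" using injJ cCol by (simp add: card_image)
    show "subgraph H G" if "H \<in> J ` Col" for H using that sub by blast
    show "HES \<epsilon>0 (core K A) (A 0) (core K B) (B 0) H" if "H \<in> J ` Col" for H using that hes by blast
    show "disjoint_family_on edges (J ` Col)"
      unfolding disjoint_family_on_def
    proof (intro ballI impI)
      fix H H' assume h: "H \<in> J ` Col" "H' \<in> J ` Col" "H \<noteq> H'"
      then obtain c d where "H = J c" "H' = J d" "c \<noteq> d" by blast
      then show "edges H \<inter> edges H' = {}" using Edisj eJ by simp
    qed
    show "(\<Union>H\<in>J ` Col. edges H) = edges G"
    proof -
      have "(\<Union>H\<in>J ` Col. edges H) = (\<Union>c\<in>Col. E c)" using eJ by simp
      also have "\<dots> = edges G" using c1 unfolding E_def Col_def by blast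
      finally show ?thesis .
    qed
    fix i i' assume i: "i \<in> {1..K}" "i' \<in> {1..K}"
    let ?S = "J ` ({(i, i')} \<times> {..<t - l})" and ?T = "J ` ({(i, i')} \<times> {..<l})"
    have sS: "{(i, i')} \<times> {..<t - l} \<subseteq> Col" "{(i, i')} \<times> {..<l} \<subseteq> Col" using i lt unfolding Col_def by auto
    show "\<exists>S \<subseteq> {H \<in> J ` Col. local_HES \<epsilon>0 K A B i i' H}. card S = t - l \<and>
        (\<exists>T \<subseteq> S. card T = l \<and> (\<forall>H\<in>T. e_between H (side K A) (side K B) = 2))"
    proof (rule exI[of _ ?S], intro conjI)
      show "?S \<subseteq> {H \<in> J ` Col. local_HES \<epsilon>0 K A B i i' H}"
      proof
        fix H assume "H \<in> ?S"
        then obtain k where k: "H = J ((i, i'), k)" "k < t - l" by auto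
        have cC: "((i, i'), k) \<in> Col" using sS(1) k(2) by blast
        have "verts H \<subseteq> A 0 \<union> B 0 \<union> A i \<union> B i'"
          unfolding k(1) eJ
        proof (rule Union_least)
          fix e assume "e \<in> E ((i, i'), k)"
          then have e: "e \<in> edges G" "col e = ((i, i'), k)" unfolding E_def by auto
          show "e \<subseteq> A 0 \<union> B 0 \<union> A i \<union> B i'" using bspec[OF c4 e(1)] e(2) k(2) by simp
        qed
        then show "H \<in> {H \<in> J ` Col. local_HES \<epsilon>0 K A B i i' H}"
          using cC hes[OF cC] k(1) unfolding local_HES_def by blast
      qed
      show "card ?S = t - l"
        using card_image[OF inj_on_subset[OF injJ sS(1)]] by (simp add: card_cartesian_product)
      show "\<exists>T \<subseteq> ?S. card T = l \<and> (\<forall>H\<in>T. e_between H (side K A) (side K B) = 2)"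
      proof (rule exI[of _ ?T], intro conjI)
      show "?T \<subseteq> ?S" using lt by (intro image_mono) auto
      show "card ?T = l"
        using card_image[OF inj_on_subset[OF injJ sS(2)]] by (simp add: card_cartesian_product)
      show "\<forall>H\<in>?T. e_between H (side K A) (side K B) = 2"
      proof
        fix H assume "H \<in> ?T"
        then obtain k where k: "H = J ((i, i'), k)" "k < l" by auto
        have "((i, i'), k) \<in> Ty \<times> {..<l}" using i k(2) by auto
        then show "e_between H (side K A) (side K B) = 2" unfolding e_between_def k(1) Fc using c6 by blast
      qed
      qed
    qed
  qed
qed

section \<open>Counting at vertices of large crossing degree\<close>

text \<open>Compare \<open>cr\<close> with a set \<open>F\<close> of edges in which the vertices of \<open>W\<close> have degree at most \<open>m\<close>. Away from \<open>W\<close>, apart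
  from the few edges in \<open>X\<close>, \<open>F\<close> is contained in \<open>cr\<close>. So replacing the edges of \<open>cr\<close> at \<open>W\<close> by \<open>m\<close> edges for
  each vertex still leaves about \<open>card F\<close> edges. The term \<open>b\<close> accounts for edges between two vertices of \<open>W\<close>,
  which are counted twice in the sum of the degrees.\<close>
lemma heavy_vertex_count:
  fixes m p :: real
  assumes F: "finite F" "F - cr \<subseteq> X" "finite X" "real (card X) \<le> p"
    and W: "W \<subseteq> V0" "finite W" and m: "\<And>w. w \<in> W \<Longrightarrow> real (card {e \<in> F. w \<in> e}) \<le> m"
    and b: "card V0 \<le> b"
  shows "real (card F) + (\<Sum>w\<in>W. real (card {e \<in> cr. w \<in> e})) \<le> card cr + p + card W * (m + b)"
proof -
  let ?N = "{e \<in> cr. e \<inter> W = {}}" and ?M = "{e \<in> cr. e \<inter> W \<noteq> {}}"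
  have "F \<subseteq> ?N \<union> X \<union> (\<Union>w\<in>W. {e \<in> F. w \<in> e})" using F(2) by blast
  then have "card F \<le> card (?N \<union> X \<union> (\<Union>w\<in>W. {e \<in> F. w \<in> e}))"
    using F(1,3) W(2) fin_cr by (intro card_mono) auto
  also have "\<dots> \<le> card ?N + card X + card (\<Union>w\<in>W. {e \<in> F. w \<in> e})"
    by (meson add_le_mono1 card_Un_le order_trans)
  also have "card (\<Union>w\<in>W. {e \<in> F. w \<in> e}) \<le> (\<Sum>w\<in>W. card {e \<in> F. w \<in> e})" using W(2) by (rule card_UN_le)
  finally have a: "real (card F) \<le> real (card ?N) + real (card X) + (\<Sum>w\<in>W. real (card {e \<in> F. w \<in> e}))"
    by (simp flip: of_nat_sum of_nat_add)
  have "(\<Sum>w\<in>W. real (card {e \<in> F. w \<in> e})) \<le> (\<Sum>w\<in>W. m)" using m by (rule sum_mono)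
  then have a1: "(\<Sum>w\<in>W. real (card {e \<in> F. w \<in> e})) \<le> card W * m" by simp
  let ?Y = "\<lambda>w. {e \<in> cr. w \<in> e \<and> \<not> e \<subseteq> V0}"
  have Yd: "?Y v \<inter> ?Y w = {}" if "v \<in> W" "w \<in> W" "v \<noteq> w" for v w
  proof (rule ccontr)
    assume "?Y v \<inter> ?Y w \<noteq> {}"
    then obtain e where e: "e \<in> cr" "v \<in> e" "w \<in> e" "\<not> e \<subseteq> V0" by blast
    then obtain x y where "e = {x, y}" using cr_bip by blast
    then show False using e that W(1) by auto
  qed
  have "(\<Sum>w\<in>W. card (?Y w)) = card (\<Union>w\<in>W. ?Y w)"
    using W(2) fin_cr Yd by (intro card_UN_disjoint[symmetric]) auto
  also have "\<dots> \<le> card ?M" using fin_cr by (intro card_mono) auto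
  finally have y1: "(\<Sum>w\<in>W. real (card (?Y w))) \<le> real (card ?M)" by (simp flip: of_nat_sum)
  have "(\<Sum>w\<in>W. real (card {e \<in> cr. w \<in> e})) \<le> (\<Sum>w\<in>W. real (card (?Y w)) + b)"
  proof (rule sum_mono)
    fix w assume w: "w \<in> W"
    have "{e \<in> cr. w \<in> e} = ?Y w \<union> {e \<in> cr. w \<in> e \<and> e \<subseteq> V0}" by blast
    then have "card {e \<in> cr. w \<in> e} \<le> card (?Y w) + card {e \<in> cr. w \<in> e \<and> e \<subseteq> V0}" by (simp add: card_Un_le)
    then show "real (card {e \<in> cr. w \<in> e}) \<le> real (card (?Y w)) + b" using cr_inner_degree[of w] w W(1) b by force
  qed
  also have "\<dots> = (\<Sum>w\<in>W. real (card (?Y w))) + card W * b" by (simp add: sum.distrib)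
  finally have d: "(\<Sum>w\<in>W. real (card {e \<in> cr. w \<in> e})) \<le> real (card ?M) + card W * b" using y1 by linarith
  have "cr = ?N \<union> ?M" by blast
  moreover have "?N \<inter> ?M = {}" by blast
  ultimately have "card cr = card ?N + card ?M" using fin_cr card_Un_disjoint[of ?N ?M] by simp
  then show ?thesis using a a1 d F(4) by (simp add: distrib_left)
qed

end

section \<open>Constants and the theorem\<close>

lemma max_deg_ge: "finite (verts H) \<Longrightarrow> v \<in> verts H \<Longrightarrow> deg H v \<le> max_deg H"
  unfolding max_deg_def by (intro Max_ge) auto

lemma hierarchy_fun_power:
  assumes "0 < c" "c \<le> 1"
  shows "hierarchy_fun (\<lambda>x. c * x ^ k)"
  unfolding hierarchy_fun_def
proof (intro conjI)
  show "mono_on {0<..1} (\<lambda>x. c * x ^ k)"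
    by (intro mono_onI mult_left_mono power_mono) (use assms in auto)
  show "(\<lambda>x. c * x ^ k) ` {0<..1} \<subseteq> {0<..1}"
  proof
    fix y assume "y \<in> (\<lambda>x. c * x ^ k) ` {0<..1}"
    then obtain x where x: "0 < x" "x \<le> 1" "y = c * x ^ k" by auto
    have "x ^ k \<le> 1" using x by (simp add: power_le_one)
    then have "c * x ^ k \<le> 1 * 1" using assms x by (intro mult_mono) auto
    then show "y \<in> {0<..1}" using x assms by simp
  qed
qed

text \<open>\<open>\<epsilon>\<close> has to be small compared with \<open>\<lambda>/K\<^sup>2\<close>, but it is bounded in terms of \<open>\<lambda>\<close> and of \<open>1/K\<close>
  separately. The two bounds are combined by their geometric mean, which is why the exponents 2 and 8 are twice
  those of \<open>\<lambda>/K\<^sup>4\<close>. The quantity \<open>q\<close> is the number of crossing edges allowed in each colour class.\<close>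
lemma constant_bounds:
  fixes n K :: nat and \<epsilon>0 \<epsilon> lam :: real
  assumes n: "0 < 1 / real n" "1 / real n \<le> 1 * \<epsilon>0 ^ 2"
    and e0: "0 < \<epsilon>0" "\<epsilon>0 \<le> 1 * \<epsilon> ^ 4"
    and e: "0 < \<epsilon>" "\<epsilon> \<le> 1 / 1000000 * lam ^ 2" "\<epsilon> \<le> 1 / 1000000 * (1 / real K) ^ 8"
    and lam: "0 < lam" "lam \<le> 1 / 1000" and K: "0 < 1 / real K"
  defines "q \<equiv> sqrt \<epsilon>0 * n"
  shows "\<epsilon> \<le> lam / (1000 * real K ^ 2)" "\<epsilon> \<le> 1" "4 \<le> q" "q \<le> \<epsilon> * n / real K ^ 2" "\<epsilon>0 * n \<le> q" "q ^ 2 = \<epsilon>0 * real n ^ 2"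
proof -
  define x where "x = 1 / real K"
  have Kp: "1 \<le> real K" using K by (cases K) auto
  have x: "0 < x" "x \<le> 1" unfolding x_def using K Kp by (auto simp: field_simps)
  have np: "0 < real n" using n by simp
  have "\<epsilon> * \<epsilon> \<le> (1 / 1000000 * lam ^ 2) * (1 / 1000000 * x ^ 8)"
    using e unfolding x_def by (intro mult_mono) auto
  also have "\<dots> = (lam * x ^ 4 / 1000000) ^ 2"
    by (simp add: power_mult_distrib power_divide flip: power_mult)
  finally have "\<epsilon> ^ 2 \<le> (lam * x ^ 4 / 1000000) ^ 2" by (simp add: power2_eq_square)
  then have el: "\<epsilon> \<le> lam * x ^ 4 / 1000000" 
    by (rule power2_le_imp_le) (use lam x in simp)
  have x42: "x ^ 4 \<le> x ^ 2" using x by (intro power_decreasing) auto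
  have x21: "x ^ 2 \<le> 1" using x by (simp add: power_le_one)
  have "lam * x ^ 4 \<le> lam * x ^ 2" using x42 lam by (intro mult_left_mono) auto
  then have "\<epsilon> \<le> lam * x ^ 2 / 1000" 
  proof -
    have "0 \<le> lam * x ^ 2" using lam x by simp
    then show ?thesis using el \<open>lam * x ^ 4 \<le> lam * x ^ 2\<close> by linarith
  qed
  then show "\<epsilon> \<le> lam / (1000 * real K ^ 2)" unfolding x_def by (simp add: field_simps)
  have "lam * x ^ 4 \<le> 1 * 1" using lam x x42 x21 by (intro mult_mono) auto
  then have e6: "\<epsilon> \<le> 1 / 1000000" using el by linarith
  then show e1: "\<epsilon> \<le> 1" by linarith
  have "sqrt \<epsilon>0 \<le> sqrt (\<epsilon> ^ 4)" using e0 by simp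
  also have "\<epsilon> ^ 4 = (\<epsilon> ^ 2) ^ 2" by simp
  also have "sqrt ((\<epsilon> ^ 2) ^ 2) = \<epsilon> ^ 2" by (rule real_sqrt_unique) auto
  finally have se: "sqrt \<epsilon>0 \<le> \<epsilon> ^ 2" .
  have ex: "\<epsilon> \<le> x ^ 2"
  proof -
    have "lam * x ^ 4 \<le> 1 * x ^ 2" using lam x x42 by (intro mult_mono) auto
    moreover have "0 \<le> lam * x ^ 4" using lam x by simp
    ultimately show ?thesis using el by linarith
  qed
  have "q \<le> \<epsilon> ^ 2 * n" unfolding q_def using se np by (intro mult_right_mono) auto
  also have "\<dots> = \<epsilon> * (\<epsilon> * n)" by (simp add: power2_eq_square)
  also have "\<dots> \<le> x ^ 2 * (\<epsilon> * n)" using ex e np by (intro mult_right_mono) auto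
  also have "\<dots> = \<epsilon> * n / real K ^ 2" unfolding x_def by (simp add: field_simps)
  finally show "q \<le> \<epsilon> * n / real K ^ 2" .
  have e04: "\<epsilon>0 \<le> 1 / 4"
  proof -
    have "\<epsilon> ^ 4 \<le> \<epsilon> ^ 1" using e e1 by (intro power_decreasing) auto
    then show ?thesis using e0 e6 by simp
  qed
  have "\<epsilon>0 * \<epsilon>0 \<le> 1 * \<epsilon>0" using e04 e0 by (intro mult_right_mono) auto
  then have ss: "\<epsilon>0 \<le> sqrt \<epsilon>0" by (intro real_le_rsqrt) (simp add: power2_eq_square)
  then show en: "\<epsilon>0 * n \<le> q" unfolding q_def using np by (intro mult_right_mono) auto
  have "1 \<le> \<epsilon>0 ^ 2 * n" using n np by (simp add: field_simps)
  then have "1 \<le> \<epsilon>0 * (\<epsilon>0 * n)" by (simp add: power2_eq_square mult.assoc)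
  also have "\<dots> \<le> 1 / 4 * (\<epsilon>0 * n)" using e04 e0 np by (intro mult_right_mono) auto
  finally show "4 \<le> q" using en by linarith
  show "q ^ 2 = \<epsilon>0 * real n ^ 2" unfolding q_def using e0 by (simp add: power_mult_distrib)
qed

theorem lemma4p2:
  "\<exists>cphi clam cK. \<exists>flam fK feps feps0.
     cphi \<in> {0<..1} \<and> clam \<in> {0<..1} \<and> cK \<in> {0<..1} \<and>
     hierarchy_fun flam \<and> hierarchy_fun fK \<and> hierarchy_fun feps \<and> hierarchy_fun feps0 \<and>
     (\<forall>(n::nat) (D::nat) (K::nat) (m::nat) (\<epsilon>0::real) (\<epsilon>::real) (lam::real) (\<phi>::real)
        (G :: 'a ugraph) (G0 :: 'a ugraph) (A :: nat \<Rightarrow> 'a set) (B :: nat \<Rightarrow> 'a set) (Gd :: 'a ugraph).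
        0 < 1 / real n \<and> 1 / real n \<le> feps0 \<epsilon>0 \<and>
        0 < \<epsilon>0 \<and> \<epsilon>0 \<le> feps \<epsilon> \<and>
        0 < \<epsilon> \<and> \<epsilon> \<le> flam lam \<and> \<epsilon> \<le> fK (1 / real K) \<and>
        0 < lam \<and> lam \<le> clam \<and> 0 < 1 / real K \<and> 1 / real K \<le> cK \<and>
        real D \<ge> real n / 3 \<and>
        0 \<le> \<phi> \<and> \<phi> \<le> cphi \<and>
        lam * real n / real K ^ 2 \<in> \<nat> \<and>
        (real D - \<phi> * real n) / (2 * real K ^ 2) \<in> \<nat> \<and>
        \<comment> \<open>(i)\<close>
        simple_graph G \<and> card (verts G) = n \<and> regular D G \<and>
        \<comment> \<open>(ii)\<close>
        Km_partition K m \<epsilon>0 A B (verts G) \<and>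
        D \<le> e_between G (side K A) (side K B) \<and>
        real (e_between G (side K A) (side K B)) \<le> \<epsilon>0 * real n ^ 2 \<and>
        real (max_deg (bip_subgraph G (side K A) (side K B))) \<le> real D / 2 \<and>
        \<not> critical D (side K A) (side K B) G \<and>
        \<comment> \<open>(iii)\<close>
        subgraph G0 G \<and>
        subgraph (graph_sum (induced G (A 0)) (induced G (B 0))) G0 \<and>
        real (e_between G0 (side K A) (side K B)) \<le> \<phi> * real n \<and>
        (\<forall>v\<in>A 0 \<union> B 0. real (deg G0 v) = \<phi> * real n) \<and>
        \<comment> \<open>(iv)\<close>
        Gd = graph_minus (graph_minus (graph_minus G (induced G (core K A)))
               (induced G (core K B))) G0 \<and>
        even (e_between Gd (side K A) (side K B)) \<and>
        exceptional_scheme K m \<epsilon>0 \<epsilon> A B Gd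
      \<longrightarrow>
        (\<exists>\<J> :: 'a ugraph set.
           finite \<J> \<and> real (card \<J>) = (real D - \<phi> * real n) / 2 \<and>
           (\<forall>J\<in>\<J>. subgraph J Gd \<and> HES \<epsilon>0 (core K A) (A 0) (core K B) (B 0) J) \<and>
           disjoint_family_on edges \<J> \<and>
           \<comment> \<open>(a)\<close>
           (\<Union>J\<in>\<J>. edges J) = edges Gd \<and>
           \<comment> \<open>(b)\<close>
           (\<forall>i\<in>{1..K}. \<forall>i'\<in>{1..K}.
              \<exists>S \<subseteq> {J \<in> \<J>. local_HES \<epsilon>0 K A B i i' J}.
                real (card S) = (real D - (\<phi> + 2 * lam) * real n) / (2 * real K ^ 2) \<and>
                (\<exists>T \<subseteq> S. real (card T) = lam * real n / real K ^ 2 \<and>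
                   (\<forall>J\<in>T. e_between J (side K A) (side K B) = 2)))))"
proof (rule exI[of _ "1 / 1000"], rule exI[of _ "1 / 1000"], rule exI[of _ 1],
    rule exI[of _ "\<lambda>x. 1 / 1000000 * x ^ 2"], rule exI[of _ "\<lambda>x. 1 / 1000000 * x ^ 8"],
    rule exI[of _ "\<lambda>x. 1 * x ^ 4"], rule exI[of _ "\<lambda>x. 1 * x ^ 2"],
    intro conjI allI impI, goal_cases)
  \<comment> \<open>The constant functions are powers, and the goals before this one are their ranges and monotonicity.\<close>
  case (8 n D K m \<epsilon>0 \<epsilon> lam \<phi> G G0 A B Gd)
  then have hn: "0 < 1 / real n" "1 / real n \<le> 1 * \<epsilon>0 ^ 2"
    and he0: "0 < \<epsilon>0" "\<epsilon>0 \<le> 1 * \<epsilon> ^ 4"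
    and he: "0 < \<epsilon>" "\<epsilon> \<le> 1 / 1000000 * lam ^ 2" "\<epsilon> \<le> 1 / 1000000 * (1 / real K) ^ 8"
    and hlam: "0 < lam" "lam \<le> 1 / 1000" and hK: "0 < 1 / real K"
    and hD: "real n / 3 \<le> real D" and hphi: "0 \<le> \<phi>" "\<phi> \<le> 1 / 1000"
    and hl: "lam * real n / real K ^ 2 \<in> \<nat>" and ht: "(real D - \<phi> * real n) / (2 * real K ^ 2) \<in> \<nat>"
    and sG: "simple_graph G" and cV: "card (verts G) = n" and reg: "regular D G"
    and part: "Km_partition K m \<epsilon>0 A B (verts G)"
    and eD: "D \<le> e_between G (side K A) (side K B)"
    and eU: "real (e_between G (side K A) (side K B)) \<le> \<epsilon>0 * real n ^ 2"
    and mdeg: "real (max_deg (bip_subgraph G (side K A) (side K B))) \<le> real D / 2"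
    and crit: "\<not> critical D (side K A) (side K B) G"
    and G0G: "subgraph G0 G" and G0in: "subgraph (graph_sum (induced G (A 0)) (induced G (B 0))) G0"
    and eG0: "real (e_between G0 (side K A) (side K B)) \<le> \<phi> * real n"
    and dG0: "\<forall>v\<in>A 0 \<union> B 0. real (deg G0 v) = \<phi> * real n"
    and Gd: "Gd = graph_minus (graph_minus (graph_minus G (induced G (core K A))) (induced G (core K B))) G0"
    and ev: "even (e_between Gd (side K A) (side K B))"
    and ES: "exceptional_scheme K m \<epsilon>0 \<epsilon> A B Gd"
    by blast+
  obtain l :: nat where l: "lam * real n / real K ^ 2 = real l" using hl unfolding Nats_def by auto
  obtain t :: nat where t: "(real D - \<phi> * real n) / (2 * real K ^ 2) = real t" using ht unfolding Nats_def by auto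
  define q where "q = sqrt \<epsilon>0 * n"
  note cb = constant_bounds[OF hn he0 he hlam hK, folded q_def]
  let ?A' = "side K A" and ?B' = "side K B" and ?V0 = "A 0 \<union> B 0"
  have K1: "1 \<le> K" using hK by simp
  then have Kp: "1 \<le> real K" by simp
  then have K2: "1 \<le> real K ^ 2" by simp
  have np: "0 < real n" using hn by simp

  have vGd: "verts Gd = verts G" unfolding Gd graph_minus_def by simp
  have eGd: "edges Gd = edges G - edges_within G (core K A) - edges_within G (core K B) - edges G0"
    unfolding Gd graph_minus_def induced_def by simp
  have finVG: "finite (verts G)" and G2: "\<And>e. e \<in> edges G \<Longrightarrow> e \<subseteq> verts G \<and> card e = 2"
    using sG unfolding simple_graph_def by auto
  have sGd: "simple_graph Gd" using finVG G2 unfolding simple_graph_def vGd eGd by blast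
  have dA: "disjoint_family_on A {0..K}" and dB: "disjoint_family_on B {0..K}"
    and AB: "?A' \<inter> ?B' = {}" and Vu: "?A' \<union> ?B' = verts G"
    and cV0: "real (card ?V0) \<le> \<epsilon>0 * real (card (verts G))" using part unfolding Km_partition_def by auto
  have V0V: "?V0 \<subseteq> verts G" using Vu unfolding side_def by blast
  have finV0: "finite ?V0" using V0V finVG finite_subset by blast
  have inG0: "edges_within G (A 0) \<subseteq> edges G0" "edges_within G (B 0) \<subseteq> edges G0"
    using G0in unfolding subgraph_def graph_sum_def induced_def by auto
  have G0E: "edges G0 \<subseteq> edges G" and sG0: "simple_graph G0" using G0G unfolding subgraph_def by auto
  \<comment> \<open>Edges inside \<open>A\<close>, \<open>B\<close>, \<open>A\<^sub>0\<close> and \<open>B\<^sub>0\<close> have been removed.\<close>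
  have kinds: "(\<exists>x\<in>?A'. \<exists>y\<in>?B'. e = {x, y}) \<or> (\<exists>v\<in>A 0. \<exists>a\<in>core K A. e = {v, a}) \<or> (\<exists>v\<in>B 0. \<exists>b\<in>core K B. e = {v, b})"
    if e: "e \<in> edges Gd" for e
  proof -
    have eG: "e \<in> edges G" and n1: "\<not> e \<subseteq> core K A" "\<not> e \<subseteq> core K B" "\<not> e \<subseteq> A 0" "\<not> e \<subseteq> B 0"
      using e inG0 unfolding eGd edges_within_def by blast+
    obtain x y where xy: "e = {x, y}" using G2[OF eG] by (metis card_2_iff)
    have "x \<in> ?A' \<union> ?B'" "y \<in> ?A' \<union> ?B'" using G2[OF eG] xy Vu by auto
    then consider "x \<in> ?A'" "y \<in> ?B'" | "x \<in> ?B'" "y \<in> ?A'" | "x \<in> ?A'" "y \<in> ?A'" | "x \<in> ?B'" "y \<in> ?B'"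
      by blast
    then show ?thesis
    proof cases
      case 1
      then show ?thesis using xy by blast
    next
      case 2
      moreover have "e = {y, x}" using xy by auto
      ultimately show ?thesis by blast
    next
      case 3
      then have "(x \<in> A 0 \<and> y \<in> core K A) \<or> (y \<in> A 0 \<and> x \<in> core K A)"
        using n1 xy unfolding side_def by blast
      moreover have "e = {y, x}" using xy by auto
      ultimately show ?thesis using xy by blast
    next
      case 4
      then have "(x \<in> B 0 \<and> y \<in> core K B) \<or> (y \<in> B 0 \<and> x \<in> core K B)"
        using n1 xy unfolding side_def by blast
      moreover have "e = {y, x}" using xy by auto
      ultimately show ?thesis using xy by blast
    qed
  qed
  interpret pg: partitioned_graph A B K Gd
    by unfold_locales (use K1 dA dB AB sGd finV0 kinds in blast)+
  let ?cr = "edges_between Gd ?A' ?B'"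
  have cr_eq: "?cr = edges_between G ?A' ?B' - edges_between G0 ?A' ?B'"
  proof -
    have "\<not> e \<subseteq> core K A \<and> \<not> e \<subseteq> core K B" if "\<exists>x\<in>?A'. \<exists>y\<in>?B'. e = {x, y}" for e
      using that AB unfolding side_def by blast
    then show ?thesis unfolding edges_between_def eGd edges_within_def using G0E by blast
  qed
  have finGE: "finite (edges G)"
  proof -
    have "edges G \<subseteq> Pow (verts G)" using G2 by auto
    then show ?thesis using finVG finite_subset by blast
  qed
  have finb: "finite (edges_between H X Y)" if "edges H \<subseteq> edges G" for H X Y
    using finite_subset[OF that finGE] unfolding edges_between_def by simp
  have crle: "card ?cr \<le> e_between G ?A' ?B'"
    unfolding e_between_def cr_eq using finb[of G] by (intro card_mono) auto
  have crge: "e_between G ?A' ?B' \<le> card ?cr + e_between G0 ?A' ?B'"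
  proof -
    have "edges_between G ?A' ?B' \<subseteq> ?cr \<union> edges_between G0 ?A' ?B'" unfolding cr_eq by blast
    then have "card (edges_between G ?A' ?B') \<le> card (?cr \<union> edges_between G0 ?A' ?B')"
      using pg.fin_cr finb[OF G0E] by (intro card_mono) auto
    also have "\<dots> \<le> card ?cr + card (edges_between G0 ?A' ?B')" by (rule card_Un_le)
    finally show ?thesis unfolding e_between_def .
  qed

  define N where "N = real K ^ 2 * t"
  \<comment> \<open>\<open>N\<close> is the number of colours; \<open>D \<ge> n/3\<close> makes it a constant fraction of \<open>n\<close>, so that \<open>\<phi>n\<close> and \<open>\<lambda>n\<close>
    are small compared with it.\<close>
  have N: "2 * N = real D - \<phi> * n"
    using t K1 unfolding N_def by (simp add: field_simps)
  have DleN: "real D \<le> n"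
  proof -
    have "verts G \<noteq> {}" using cV np by auto
    then obtain v where v: "v \<in> verts G" by blast
    have "nbrs G v \<subseteq> verts G" using G2 unfolding nbrs_def by auto
    then have "deg G v \<le> n" unfolding deg_def using card_mono[OF finVG] cV by blast
    then show ?thesis using reg v unfolding regular_def by simp
  qed
  have phin: "0 \<le> \<phi> * n" "\<phi> * n \<le> n / 1000"
    using hphi np mult_right_mono[OF hphi(2), of "real n"] by auto
  define u where "u = n / real K ^ 2"
  have un: "u \<le> n" "0 < u"
  proof -
    have "n / real K ^ 2 \<le> n / 1" using K2 K1 by (intro divide_left_mono) auto
    then show "u \<le> n" unfolding u_def by simp
    show "0 < u" unfolding u_def using np K1 by simp
  qed
  have tu: "33 / 200 * u \<le> t" "t \<le> u"
  proof -
    have "33 / 200 * n \<le> N" "N \<le> n" using N hD phin DleN by linarith+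
    then have "33 / 200 * n / real K ^ 2 \<le> N / real K ^ 2" "N / real K ^ 2 \<le> n / real K ^ 2"
      using K1 by (intro divide_right_mono; simp)+
    moreover have "N / real K ^ 2 = t" unfolding N_def using K1 by simp
    ultimately show "33 / 200 * u \<le> t" "t \<le> u" unfolding u_def by simp_all
  qed
  have lu: "real l = lam * u" using l unfolding u_def by simp
  have lu2: "real l \<le> u / 1000" unfolding lu using hlam un mult_right_mono[OF hlam(2), of u] by simp
  define z where "z = real l / real K ^ 2"
  have eu: "\<epsilon> * u \<le> z / 1000"
  proof -
    have "\<epsilon> * u \<le> lam / (1000 * real K ^ 2) * u" using cb(1) un by (intro mult_right_mono) auto
    also have "\<dots> = z / 1000" unfolding z_def lu by simp
    finally show ?thesis .
  qed
  have enu: "\<epsilon> * n / real K ^ 2 = \<epsilon> * u" unfolding u_def by simp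
  have qz: "q \<le> z / 1000" using cb(4) eu unfolding enu by linarith
  have et: "\<epsilon> * t \<le> z / 1000"
  proof -
    have "\<epsilon> * t \<le> \<epsilon> * u" using tu he by (intro mult_left_mono) auto
    then show ?thesis using eu by linarith
  qed
  have zl: "z \<le> l"
  proof -
    have "real l / real K ^ 2 \<le> real l / 1" using K2 K1 by (intro divide_left_mono) auto
    then show ?thesis unfolding z_def by simp
  qed
  have lt100: "100 * real l \<le> t" using lu2 tu un by linarith
  define b where "b = nat \<lceil>\<epsilon>0 * n\<rceil>"
  have b_ge: "\<epsilon>0 * n \<le> real b" unfolding b_def by linarith
  have b_le: "real b \<le> q + 1"
  proof -
    have "0 \<le> \<epsilon>0 * n" using he0 by simp
    then have "real b \<le> \<epsilon>0 * n + 1" unfolding b_def by linarith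
    then show ?thesis using cb(5) by linarith
  qed
  have V0b: "card ?V0 \<le> b" using cV0 b_ge cV by simp
  have bn: "real b \<le> n / 1000" using b_le qz zl lu2 un cb(3) by linarith

  have cr_deg: "card {e \<in> ?cr. v \<in> e} \<le> deg (bip_subgraph G ?A' ?B') v" for v
  proof -
    have "deg (bip_subgraph G ?A' ?B') v = card {e \<in> edges (bip_subgraph G ?A' ?B'). v \<in> e}"
      by (rule deg_eq_card_incident) (use G2 in \<open>auto simp: bip_subgraph_def edges_between_def\<close>)
    moreover have "card {e \<in> ?cr. v \<in> e} \<le> card {e \<in> edges (bip_subgraph G ?A' ?B'). v \<in> e}"
      using finb[of G] unfolding cr_eq bip_subgraph_def by (intro card_mono) auto
    ultimately show ?thesis by simp
  qed
  have bipV: "verts (bip_subgraph G ?A' ?B') = verts G" unfolding bip_subgraph_def using Vu by auto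
  have maxd: "card {e \<in> ?cr. v \<in> e} \<le> max_deg (bip_subgraph G ?A' ?B')" if "v \<in> ?V0" for v
  proof -
    have "deg (bip_subgraph G ?A' ?B') v \<le> max_deg (bip_subgraph G ?A' ?B')"
      by (rule max_deg_ge; unfold bipV) (use finVG that V0V in auto)
    then show ?thesis using cr_deg[of v] by linarith
  qed
  have half: "real (card {e \<in> ?cr. v \<in> e}) \<le> 101 / 100 * (real K ^ 2 * t)" if "v \<in> ?V0" for v
  proof -
    have "real (card {e \<in> ?cr. v \<in> e}) \<le> real D / 2" using maxd[OF that] mdeg by linarith
    moreover have "real D / 2 \<le> 101 / 100 * N" using N hD phin by linarith
    ultimately show ?thesis unfolding N_def by linarith
  qed
  have deg: "card {e \<in> edges Gd. v \<in> e} = 2 * (K ^ 2 * t)" if v: "v \<in> ?V0" for v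
  proof -
    have core: "v \<notin> core K A" "v \<notin> core K B" using pg.core_not_V0[of v] v unfolding core_def by blast+
    have eq: "{e \<in> edges Gd. v \<in> e} = {e \<in> edges G. v \<in> e} - {e \<in> edges G0. v \<in> e}"
      unfolding eGd edges_within_def using core by blast
    have dG: "card {e \<in> edges G. v \<in> e} = D"
    proof -
      have "v \<in> verts G" using v V0V by blast
      then have "deg G v = D" using reg unfolding regular_def by blast
      then show ?thesis using deg_eq_card_incident[of G v] G2 by simp
    qed
    have d0: "real (card {e \<in> edges G0. v \<in> e}) = \<phi> * n"
    proof -
      have "deg G0 v = card {e \<in> edges G0. v \<in> e}"
        by (rule deg_eq_card_incident) (use sG0 in \<open>auto simp: simple_graph_def\<close>)
      then show ?thesis using dG0 v by metis
    qed
    have sub: "{e \<in> edges G0. v \<in> e} \<subseteq> {e \<in> edges G. v \<in> e}" using G0E by blast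
    have "card {e \<in> edges Gd. v \<in> e} = D - card {e \<in> edges G0. v \<in> e}"
      unfolding eq dG[symmetric] using sub finGE finite_subset[OF sub] by (intro card_Diff_subset) auto
    moreover have "card {e \<in> edges G0. v \<in> e} \<le> D"
      unfolding dG[symmetric] using sub finGE by (intro card_mono) auto
    ultimately have "real (card {e \<in> edges Gd. v \<in> e}) = D - \<phi> * n" using d0 by (simp add: of_nat_diff)
    also have "\<dots> = real (2 * (K ^ 2 * t))" using N unfolding N_def by simp
    finally show ?thesis by (simp only: of_nat_eq_iff)
  qed
  have E3: "ESch3 \<epsilon>0 K A B Gd" and E4: "ESch4 \<epsilon> K A B Gd" and E5: "ESch5 \<epsilon> K A B Gd"
    using ES unfolding exceptional_scheme_def by auto
  have lowc: "card {e \<in> ?cr. a \<in> e} \<le> b" if a: "a \<notin> ?V0" for a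
  proof -
    have star: "card {e \<in> ?cr. a \<in> e} \<le> deg_in Gd a X"
      if X: "\<And>e. e \<in> ?cr \<Longrightarrow> a \<in> e \<Longrightarrow> \<exists>y\<in>X. e = {a, y}" for X
    proof -
      have "{e \<in> ?cr. a \<in> e} \<subseteq> (\<lambda>y. {a, y}) ` (nbrs Gd a \<inter> X)"
      proof
        fix e assume "e \<in> {e \<in> ?cr. a \<in> e}"
        then have e: "e \<in> ?cr" "a \<in> e" by auto
        obtain y where y: "y \<in> X" "e = {a, y}" using X[OF e] by blast
        moreover have "e \<in> edges Gd" using e(1) unfolding edges_between_def by simp
        ultimately show "e \<in> (\<lambda>y. {a, y}) ` (nbrs Gd a \<inter> X)" unfolding nbrs_def by auto
      qed
      moreover have "finite ((\<lambda>y. {a, y}) ` (nbrs Gd a \<inter> X))"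
        by (rule finite_subset[OF _ pg.finE]) (auto simp: nbrs_def)
      ultimately show ?thesis unfolding deg_in_card_star by (rule card_mono[rotated])
    qed
    have e0b: "real d < \<epsilon>0 * real (card (verts Gd)) \<Longrightarrow> d \<le> b" for d
      using b_ge cV vGd by simp
    consider "a \<in> core K A" | "a \<in> core K B" | "a \<notin> ?A' \<union> ?B'" using a unfolding side_def by blast
    then show ?thesis
    proof cases
      case 1
      then have nB: "a \<notin> ?B'" using AB unfolding side_def by blast
      have "card {e \<in> ?cr. a \<in> e} \<le> deg_in Gd a ?B'"
      proof (rule star)
        fix e assume e: "e \<in> ?cr" "a \<in> e"
        then obtain x y where "y \<in> ?B'" "e = {x, y}" unfolding edges_between_def by blast
        then show "\<exists>y\<in>?B'. e = {a, y}" using e(2) nB by auto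
      qed
      moreover have "real (deg_in Gd a ?B') < \<epsilon>0 * real (card (verts Gd))" using E3 1 unfolding ESch3_def by blast
      ultimately show ?thesis using e0b le_trans by blast
    next
      case 2
      then have nA: "a \<notin> ?A'" using AB unfolding side_def by blast
      have "card {e \<in> ?cr. a \<in> e} \<le> deg_in Gd a ?A'"
      proof (rule star)
        fix e assume e: "e \<in> ?cr" "a \<in> e"
        then obtain x y where "x \<in> ?A'" "e = {x, y}" unfolding edges_between_def by blast
        then show "\<exists>y\<in>?A'. e = {a, y}" using e(2) nA by auto
      qed
      moreover have "real (deg_in Gd a ?A') < \<epsilon>0 * real (card (verts Gd))" using E3 2 unfolding ESch3_def by blast
      ultimately show ?thesis using e0b le_trans by blast
    next
      case 3
      then have "{e \<in> ?cr. a \<in> e} = {}" unfolding edges_between_def by blast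
      then show ?thesis by (simp only: card.empty le0)
    qed
  qed
  have size: "real (card ?cr) \<le> q ^ 2" using crle eU unfolding cb(6) by linarith
  have cr2N: "2 * N \<le> card ?cr" using crge eD eG0 N by linarith

  \<comment> \<open>If some crossing degree exceeds \<open>56/100 * N\<close>, which is slightly more than \<open>11D/40\<close>, then the first condition
    in the definition of critical holds. As \<open>G\<close> is not critical, the second one fails: there is a subgraph \<open>H\<close>
    of \<open>G[A', B']\<close> with maximum degree at most \<open>11D/40\<close> and more than \<open>41D/40\<close> edges, which is at least
    \<open>205/100 * N + \<phi>n\<close>. At most \<open>\<phi>n\<close> of them are lost to \<open>G\<^sub>0\<close>.\<close>
  have adm: "((\<forall>v\<in>?V0. real (card {e \<in> ?cr. v \<in> e}) \<le> 56 / 100 * (real K ^ 2 * t)) \<and> 2 * (real K ^ 2 * t) \<le> card ?cr) \<or>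
      (\<forall>W \<subseteq> ?V0. finite W \<longrightarrow> card W \<le> 3 \<longrightarrow>
         205 / 100 * (real K ^ 2 * t) + (\<Sum>w\<in>W. real (card {e \<in> ?cr. w \<in> e})) \<le> card ?cr + 56 / 100 * (real K ^ 2 * t) * card W)"
  proof (cases "\<forall>v\<in>?V0. real (card {e \<in> ?cr. v \<in> e}) \<le> 56 / 100 * N")
    case True
    then show ?thesis using cr2N unfolding N_def by blast
  next
    case False
    then obtain v where v: "v \<in> ?V0" "56 / 100 * N < real (card {e \<in> ?cr. v \<in> e})" by force
    have N56: "11 * real D / 40 + n / 1000 \<le> 56 / 100 * N" using N hD phin by linarith
    have "11 * real D / 40 \<le> real (max_deg (bip_subgraph G ?A' ?B'))" using maxd[OF v(1)] v(2) N56 np by linarith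
    then obtain H where H: "subgraph H (bip_subgraph G ?A' ?B')" "real (max_deg H) \<le> 11 * real D / 40"
      and Hbig: "41 * real D / 40 < real (num_edges H)"
      using crit unfolding critical_def by (auto simp: not_le)
    have sH: "simple_graph H" and HE: "edges H \<subseteq> edges_between G ?A' ?B'"
      using H(1) unfolding subgraph_def bip_subgraph_def by auto
    have finH: "finite (edges H)" using HE finb[of G] finite_subset by blast
    have Hd: "real (card {e \<in> edges H. w \<in> e}) \<le> 11 * real D / 40" for w
    proof (cases "w \<in> verts H")
      case True
      have "deg H w = card {e \<in> edges H. w \<in> e}"
        by (rule deg_eq_card_incident) (use sH in \<open>auto simp: simple_graph_def\<close>)
      moreover have "deg H w \<le> max_deg H" using True sH unfolding simple_graph_def by (intro max_deg_ge) auto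
      ultimately show ?thesis using H(2) by linarith
    next
      case False
      then have "{e \<in> edges H. w \<in> e} = {}" using sH unfolding simple_graph_def by blast
      then show ?thesis by (simp only: card.empty)
    qed
    have sub: "edges H - ?cr \<subseteq> edges_between G0 ?A' ?B'" using HE unfolding cr_eq by blast
    have X: "real (card (edges_between G0 ?A' ?B')) \<le> \<phi> * n" using eG0 unfolding e_between_def .
    have "205 / 100 * N + (\<Sum>w\<in>W. real (card {e \<in> ?cr. w \<in> e})) \<le> card ?cr + 56 / 100 * N * card W"
      if W: "W \<subseteq> ?V0" "finite W" for W
    proof -
      have "real (card (edges H)) + (\<Sum>w\<in>W. real (card {e \<in> ?cr. w \<in> e})) \<le> card ?cr + \<phi> * n + card W * (11 * real D / 40 + b)"
        by (rule pg.heavy_vertex_count[OF finH sub finb[OF G0E] X W Hd V0b])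
      moreover have "card W * (11 * real D / 40 + b) \<le> card W * (56 / 100 * N)"
        using N56 bn by (intro mult_left_mono) auto
      moreover have "205 / 100 * N \<le> 41 * real D / 40 - \<phi> * n" using N phin by linarith
      ultimately show ?thesis using Hbig unfolding num_edges_def by (simp add: mult.commute)
    qed
    then show ?thesis unfolding N_def by blast
  qed
  have evcr: "even (card ?cr)" using ev unfolding e_between_def .
  have ecol: "\<exists>col. pg.HES_colouring t l q col"
  proof (rule pg.edge_colouring[OF E4 E5])
    show "?V0 \<subseteq> verts Gd" using V0V vGd by simp
    show "n = card (verts Gd)" using cV vGd by simp
    show "0 < \<epsilon>" "\<epsilon> \<le> 1" by (rule he, rule cb)
    show "card ?V0 \<le> b" by (rule V0b)
    show "z = real l / real K ^ 2" by (rule z_def)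
    show "\<epsilon> * real n / real K ^ 2 \<le> z / 1000" using eu unfolding enu .
    show "card {e \<in> ?cr. a \<in> e} \<le> b" if "a \<notin> ?V0" for a by (rule lowc[OF that])
    show "card {e \<in> edges Gd. v \<in> e} = 2 * (K ^ 2 * t)" if "v \<in> ?V0" for v by (rule deg[OF that])
    show "real (card {e \<in> ?cr. v \<in> e}) \<le> 101 / 100 * (real K ^ 2 * t)" if "v \<in> ?V0" for v by (rule half[OF that])
  qed (fact size evcr adm cb(3) qz b_le lt100 et)+
  then obtain col where "pg.HES_colouring t l q col" by blast
  then have col: "pg.HES_colouring t l (sqrt \<epsilon>0 * card (verts Gd)) col" unfolding q_def vGd cV .
  have vs: "verts Gd = ?A' \<union> ?B'" using Vu vGd by simp
  have ltl: "l \<le> t - l"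
  proof -
    have "2 * real l \<le> real t" using lt100 by linarith
    then have "2 * l \<le> t" by linarith
    then show ?thesis by simp
  qed
  obtain \<J> where J: "finite \<J>" "card \<J> = K ^ 2 * t"
     "\<forall>J\<in>\<J>. subgraph J Gd \<and> HES \<epsilon>0 (core K A) (A 0) (core K B) (B 0) J"
     "disjoint_family_on edges \<J>" "(\<Union>J\<in>\<J>. edges J) = edges Gd"
     "\<forall>i\<in>{1..K}. \<forall>i'\<in>{1..K}. \<exists>S \<subseteq> {J \<in> \<J>. local_HES \<epsilon>0 K A B i i' J}. card S = t - l \<and>
        (\<exists>T \<subseteq> S. card T = l \<and> (\<forall>J\<in>T. e_between J (side K A) (side K B) = 2))"
    using pg.HES_family[OF col vs ltl] by (elim exE conjE) (rule that)
  have cJ: "real (card \<J>) = (real D - \<phi> * real n) / 2" using J(2) N unfolding N_def by simp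
  have cS: "real (t - l) = (real D - (\<phi> + 2 * lam) * real n) / (2 * real K ^ 2)"
  proof -
    have "real (t - l) = real t - real l" using ltl by (simp add: of_nat_diff)
    also have "\<dots> = (real D - \<phi> * real n) / (2 * real K ^ 2) - lam * real n / real K ^ 2" using t l by simp
    also have "\<dots> = (real D - (\<phi> + 2 * lam) * real n) / (2 * real K ^ 2)" using K1 by (simp add: field_simps)
    finally show ?thesis .
  qed
  show ?case
  proof (rule exI[of _ \<J>], intro conjI)
    show "\<forall>i\<in>{1..K}. \<forall>i'\<in>{1..K}. \<exists>S \<subseteq> {J \<in> \<J>. local_HES \<epsilon>0 K A B i i' J}.
                real (card S) = (real D - (\<phi> + 2 * lam) * real n) / (2 * real K ^ 2) \<and>
                (\<exists>T \<subseteq> S. real (card T) = lam * real n / real K ^ 2 \<and>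
                   (\<forall>J\<in>T. e_between J (side K A) (side K B) = 2))"
      unfolding cS[symmetric] l of_nat_eq_iff by (rule J(6))
  qed (fact J(1) cJ J(3,4,5))+
qed (use hierarchy_fun_power[of "1 / 1000000" 2] hierarchy_fun_power[of "1 / 1000000" 8]
    hierarchy_fun_power[of 1 4] hierarchy_fun_power[of 1 2] in simp_all)

end
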